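(* By taking isomorphism classes of a DF monoidal category $M:(\mathbb{P}\mathrm{b}\,\mathcal{C})^{\mathrm{op}}\to\mathbb{C}\mathrm{at}$, one gets a DF monoid $|M|:(\mathbb{P}\mathrm{b}\,\mathcal{C})^{\mathrm{op}}\to\mathbb{S}\mathrm{q}\,\mathbf{Set}$. Namely, $|M|I=|MI|$ for every object $I$ of $\mathcal{C}$, and $|M|_hf=|f^*|$ and $|M|_vf=|f_!|$ for every arrow $f$ of $\mathcal{C}$.
   Context: $\mathcal{C}$ is an extensive category with pullbacks. Extensive means that $\mathcal{C}$ has finite sums and, for every commutative diagram consisting of two adjacent squares whose bottom row is a sum diagram $J\to J+L\leftarrow L$, the top row is a sum diagram if and only if both squares are pullbacks. For a category $\mathcal{A}$, $|\mathcal{A}|$ is the set of isomorphism classes of its objects, and for a functor $F$, $|F|$ is the induced mapping. Double categories. A (pseudo) double category $\mathbb{A}$ has a category $A_0$ of objects and horizontal arrows, a category $A_1$ of vertical arrows and cells, source and target functors $s,t:A_1\to A_0$, and a vertical composition defined up to isomorphism. A functor of double categories means a lax double functor, with horizontal component $F_h:A_0\to B_0$ and vertical component $F_v:A_1\to B_1$. It is normal if vertical identities are strictly preserved, and it preserves products if both $F_h$ and $F_v$ do. $\mathbb{A}^{\mathrm{op}}$ is the horizontal opposite ($A_0$ and $A_1$ are replaced by their opposites, $s,t$ are not exchanged). $\mathbb{P}\mathrm{b}\,\mathcal{C}$ is the double category whose horizontal and vertical arrows are the arrows of $\mathcal{C}$ and whose cells are the pullback squares in $\mathcal{C}$. $\mathbb{S}\mathrm{q}\,\mathcal{S}$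 is the double category of commutative squares in a category $\mathcal{S}$. $\mathbb{C}\mathrm{at}$ has categories as objects, functors as horizontal arrows, and as vertical arrows profunctors $\Phi:\mathcal{A}\to\mathcal{B}$, meaning functors $\mathcal{A}^{\mathrm{op}}\times\mathcal{B}\to\mathbf{Set}$. Its cells from $\Phi:\mathcal{A}\to\mathcal{B}$ to $\Psi:\mathcal{A}'\to\mathcal{B}'$ over functors $F:\mathcal{A}\to\mathcal{A}'$, $G:\mathcal{B}\to\mathcal{B}'$ are the natural transformations $\Phi\to\Psi(F-,G-)$. A DF monoid on $\mathcal{C}$ in a category $\mathcal{S}$ with products is a product-preserving functor $(\mathbb{P}\mathrm{b}\,\mathcal{C})^{\mathrm{op}}\to\mathbb{S}\mathrm{q}\,\mathcal{S}$ (preservation of all products, not only finite ones, is required). A DF operad on $\mathcal{C}$ is a product-preserving normal functor $M:(\mathbb{P}\mathrm{b}\,\mathcal{C})^{\mathrm{op}}\to\mathbb{C}\mathrm{at}$. For $f:I\to J$ in $\mathcal{C}$, write $f^*=M_hf:MJ\to MI$ and $\Phi_f=M_vf:MI\to MJ$ (a profunctor). A DF monoidal category is a DF operad $M$ satisfying the following two conditions: (1) the profunctors $\Phi_f$ are representable: for any $f:I\to J$ in $\mathcal{C}$ there is a functor $f_!:MI\to MJ$ such that $\Phi_f(X,Y)\cong MJ(f_!X,Y)$ (an isomorphism of profunctors); (2) the Beck–Chevalley condition holds: for any pullback square in $\mathcal{C}$ with sides $k:I\to L$, $g:L\to K$, $f:I\to J$, $l:J\to K$, $gk=lf$, the square formed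 by $k^*:ML\to MI$, $f_!:MI\to MJ$, $g_!:ML\to MK$, $l^*:MK\to MJ$ commutes up to isomorphism, i.e. $f_!\,k^*\cong l^*\,g_!$.
   Formalization: The lax comparison cells from the composite of Φ_f and Φ_g to Φ_{gf} are additionally assumed invertible; without this the claim fails, e.g. for finite sets with MI = (N,≤)^I and f_! the fibrewise sum plus 1 on fibres of size ≥ 2, where |(gf)_!| ≠ |g_!||f_!|. *)

theory Defs
  imports "HOL-Library.FuncSet" "HOL-Library.Infinite_Typeclass"
begin

section \<open>Categories and functors\<close>

text \<open>\<open>Cmp C g f\<close> is the composite of \<open>f\<close> followed by \<open>g\<close>.\<close>

record ('o, 'a) cat =
  Obj :: "'o set"
  Arr :: "'a set"
  Dom :: "'a \<Rightarrow> 'o"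
  Cod :: "'a \<Rightarrow> 'o"
  Ide :: "'o \<Rightarrow> 'a"
  Cmp :: "'a \<Rightarrow> 'a \<Rightarrow> 'a"

definition Hom :: "('o, 'a) cat \<Rightarrow> 'o \<Rightarrow> 'o \<Rightarrow> 'a set" where
  "Hom C a b = {f \<in> Arr C. Dom C f = a \<and> Cod C f = b}"

locale category =
  fixes C :: "('o, 'a) cat"
  assumes Dom_Obj: "f \<in> Arr C \<Longrightarrow> Dom C f \<in> Obj C"
    and Cod_Obj: "f \<in> Arr C \<Longrightarrow> Cod C f \<in> Obj C"
    and Ide_Hom: "a \<in> Obj C \<Longrightarrow> Ide C a \<in> Hom C a a"
    and Cmp_Hom: "f \<in> Hom C a b \<Longrightarrow> g \<in> Hom C b c \<Longrightarrow> Cmp C g f \<in> Hom C a c"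
    and Cmp_Ide_right: "f \<in> Hom C a b \<Longrightarrow> Cmp C f (Ide C a) = f"
    and Cmp_Ide_left: "f \<in> Hom C a b \<Longrightarrow> Cmp C (Ide C b) f = f"
    and Cmp_assoc: "f \<in> Hom C a b \<Longrightarrow> g \<in> Hom C b c \<Longrightarrow> h \<in> Hom C c d \<Longrightarrow>
      Cmp C h (Cmp C g f) = Cmp C (Cmp C h g) f"

definition inverse_arrows :: "('o, 'a) cat \<Rightarrow> 'a \<Rightarrow> 'a \<Rightarrow> bool" where
  "inverse_arrows C f g \<longleftrightarrow> f \<in> Arr C \<and> g \<in> Hom C (Cod C f) (Dom C f) \<and>
     Cmp C g f = Ide C (Dom C f) \<and> Cmp C f g = Ide C (Cod C f)"

definition is_iso :: "('o, 'a) cat \<Rightarrow> 'a \<Rightarrow> bool" where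
  "is_iso C f \<longleftrightarrow> (\<exists>g. inverse_arrows C f g)"

definition inverse_arrow :: "('o, 'a) cat \<Rightarrow> 'a \<Rightarrow> 'a" where
  "inverse_arrow C f = (THE g. inverse_arrows C f g)"

definition isomorphic :: "('o, 'a) cat \<Rightarrow> 'o \<Rightarrow> 'o \<Rightarrow> bool" where
  "isomorphic C a b \<longleftrightarrow> (\<exists>f \<in> Hom C a b. is_iso C f)"

definition op_cat :: "('o, 'a) cat \<Rightarrow> ('o, 'a) cat" where
  "op_cat C = \<lparr>Obj = Obj C, Arr = Arr C, Dom = Cod C, Cod = Dom C, Ide = Ide C,
     Cmp = (\<lambda>g f. Cmp C f g)\<rparr>"

definition prod_cat :: "('o, 'a) cat \<Rightarrow> ('p, 'b) cat \<Rightarrow> ('o \<times> 'p, 'a \<times> 'b) cat" where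
  "prod_cat A B = \<lparr>Obj = Obj A \<times> Obj B, Arr = Arr A \<times> Arr B,
     Dom = map_prod (Dom A) (Dom B), Cod = map_prod (Cod A) (Cod B),
     Ide = map_prod (Ide A) (Ide B),
     Cmp = (\<lambda>(g, g') (f, f'). (Cmp A g f, Cmp B g' f'))\<rparr>"

record ('o, 'a, 'p, 'b) ftor =
  fdom :: "('o, 'a) cat"
  fcod :: "('p, 'b) cat"
  fob :: "'o \<Rightarrow> 'p"
  far :: "'a \<Rightarrow> 'b"

locale cat_functor =
  fixes F :: "('o, 'a, 'p, 'b) ftor"
  assumes fdom_category: "category (fdom F)"
    and fcod_category: "category (fcod F)"
    and fob_funcset: "fob F \<in> Obj (fdom F) \<rightarrow>\<^sub>E Obj (fcod F)"
    and far_extensional: "far F \<in> extensional (Arr (fdom F))"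
    and far_Hom: "f \<in> Hom (fdom F) a b \<Longrightarrow> far F f \<in> Hom (fcod F) (fob F a) (fob F b)"
    and far_Ide: "a \<in> Obj (fdom F) \<Longrightarrow> far F (Ide (fdom F) a) = Ide (fcod F) (fob F a)"
    and far_Cmp: "f \<in> Hom (fdom F) a b \<Longrightarrow> g \<in> Hom (fdom F) b c \<Longrightarrow>
      far F (Cmp (fdom F) g f) = Cmp (fcod F) (far F g) (far F f)"

definition fid :: "('o, 'a) cat \<Rightarrow> ('o, 'a, 'o, 'a) ftor" where
  "fid C = \<lparr>fdom = C, fcod = C, fob = (\<lambda>a\<in>Obj C. a), far = (\<lambda>f\<in>Arr C. f)\<rparr>"

definition fcmp ::
  "('p, 'b, 'q, 'c) ftor \<Rightarrow> ('o, 'a, 'p, 'b) ftor \<Rightarrow> ('o, 'a, 'q, 'c) ftor" where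
  "fcmp G F = \<lparr>fdom = fdom F, fcod = fcod G,
     fob = (\<lambda>a\<in>Obj (fdom F). fob G (fob F a)), far = (\<lambda>f\<in>Arr (fdom F). far G (far F f))\<rparr>"

definition fop :: "('o, 'a, 'p, 'b) ftor \<Rightarrow> ('o, 'a, 'p, 'b) ftor" where
  "fop F = \<lparr>fdom = op_cat (fdom F), fcod = op_cat (fcod F), fob = fob F, far = far F\<rparr>"

definition fprod ::
  "('o, 'a, 'p, 'b) ftor \<Rightarrow> ('o', 'a', 'p', 'b') ftor \<Rightarrow>
     ('o \<times> 'o', 'a \<times> 'a', 'p \<times> 'p', 'b \<times> 'b') ftor" where
  "fprod F G = \<lparr>fdom = prod_cat (fdom F) (fdom G), fcod = prod_cat (fcod F) (fcod G),
     fob = (\<lambda>(a, b) \<in> Obj (fdom F) \<times> Obj (fdom G). (fob F a, fob G b)),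
     far = (\<lambda>(f, g) \<in> Arr (fdom F) \<times> Arr (fdom G). (far F f, far G g))\<rparr>"

definition nat_trans ::
  "('o, 'a, 'p, 'b) ftor \<Rightarrow> ('o, 'a, 'p, 'b) ftor \<Rightarrow> ('o \<Rightarrow> 'b) \<Rightarrow> bool" where
  "nat_trans F G \<tau> \<longleftrightarrow> cat_functor F \<and> cat_functor G \<and> fdom G = fdom F \<and> fcod G = fcod F \<and>
     \<tau> \<in> extensional (Obj (fdom F)) \<and>
     (\<forall>a \<in> Obj (fdom F). \<tau> a \<in> Hom (fcod F) (fob F a) (fob G a)) \<and>
     (\<forall>a b. \<forall>f \<in> Hom (fdom F) a b.
        Cmp (fcod F) (\<tau> b) (far F f) = Cmp (fcod F) (far G f) (\<tau> a))"

definition naturally_isomorphic ::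
  "('o, 'a, 'p, 'b) ftor \<Rightarrow> ('o, 'a, 'p, 'b) ftor \<Rightarrow> bool" where
  "naturally_isomorphic F G \<longleftrightarrow>
     (\<exists>\<tau>. nat_trans F G \<tau> \<and> (\<forall>a \<in> Obj (fdom F). is_iso (fcod F) (\<tau> a)))"

definition is_product ::
  "('o, 'a) cat \<Rightarrow> 'i set \<Rightarrow> ('i \<Rightarrow> 'o) \<Rightarrow> 'o \<Rightarrow> ('i \<Rightarrow> 'a) \<Rightarrow> bool" where
  "is_product C I X P \<pi> \<longleftrightarrow> P \<in> Obj C \<and> (\<forall>i\<in>I. X i \<in> Obj C \<and> \<pi> i \<in> Hom C P (X i)) \<and>
     (\<forall>Q \<in> Obj C. \<forall>q. (\<forall>i\<in>I. q i \<in> Hom C Q (X i)) \<longrightarrow>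
        (\<exists>!u. u \<in> Hom C Q P \<and> (\<forall>i\<in>I. Cmp C (\<pi> i) u = q i)))"

definition is_sum ::
  "('o, 'a) cat \<Rightarrow> 'i set \<Rightarrow> ('i \<Rightarrow> 'o) \<Rightarrow> 'o \<Rightarrow> ('i \<Rightarrow> 'a) \<Rightarrow> bool" where
  "is_sum C I X S \<iota> \<longleftrightarrow> is_product (op_cat C) I X S \<iota>"

text \<open>HOL cannot quantify over all index types inside a definition, so the families considered are
  those indexed by subsets of \<open>'i\<close>. With \<open>'i\<close> a type variable, families of every size are covered.\<close>

definition preserves_products :: "'i itself \<Rightarrow> ('o, 'a, 'p, 'b) ftor \<Rightarrow> bool" where
  "preserves_products TYPE('i) F \<longleftrightarrow> (\<forall>(I :: 'i set) X P \<pi>. is_product (fdom F) I X P \<pi> \<longrightarrow>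
     is_product (fcod F) I (\<lambda>i. fob F (X i)) (fob F P) (\<lambda>i. far F (\<pi> i)))"


section \<open>Squares, pullbacks, extensive categories\<close>

text \<open>A square is read as going horizontally from its left side to its right side.\<close>

record 'a square =
  Left :: 'a
  Right :: 'a
  Top :: 'a
  Bottom :: 'a

definition commutative_square :: "('o, 'a) cat \<Rightarrow> 'a square \<Rightarrow> bool" where
  "commutative_square C q \<longleftrightarrow>
     Left q \<in> Arr C \<and> Right q \<in> Arr C \<and>
     Top q \<in> Hom C (Dom C (Left q)) (Dom C (Right q)) \<and>
     Bottom q \<in> Hom C (Cod C (Left q)) (Cod C (Right q)) \<and>
     Cmp C (Right q) (Top q) = Cmp C (Bottom q) (Left q)"

definition pullback_square :: "('o, 'a) cat \<Rightarrow> 'a square \<Rightarrow> bool" where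
  "pullback_square C q \<longleftrightarrow> commutative_square C q \<and>
     (\<forall>W \<in> Obj C. \<forall>x \<in> Hom C W (Dom C (Right q)). \<forall>y \<in> Hom C W (Cod C (Left q)).
        Cmp C (Right q) x = Cmp C (Bottom q) y \<longrightarrow>
        (\<exists>!u. u \<in> Hom C W (Dom C (Left q)) \<and> Cmp C (Top q) u = x \<and> Cmp C (Left q) u = y))"

definition has_pullbacks :: "('o, 'a) cat \<Rightarrow> bool" where
  "has_pullbacks C \<longleftrightarrow> (\<forall>g \<in> Arr C. \<forall>l \<in> Arr C. Cod C g = Cod C l \<longrightarrow>
     (\<exists>f k. pullback_square C \<lparr>Left = f, Right = g, Top = k, Bottom = l\<rparr>))"

definition has_finite_sums :: "('o, 'a) cat \<Rightarrow> bool" where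
  "has_finite_sums C \<longleftrightarrow> (\<forall>(I :: nat set) X. finite I \<longrightarrow> (\<forall>i\<in>I. X i \<in> Obj C) \<longrightarrow>
     (\<exists>S \<iota>. is_sum C I X S \<iota>))"

definition sum_diagram :: "('o, 'a) cat \<Rightarrow> 'a \<Rightarrow> 'a \<Rightarrow> bool" where
  "sum_diagram C i j \<longleftrightarrow>
     is_sum C UNIV (\<lambda>b. Dom C (if b then i else j)) (Cod C i) (\<lambda>b. if b then i else j)"

definition extensive :: "('o, 'a) cat \<Rightarrow> bool" where
  "extensive C \<longleftrightarrow> category C \<and> has_finite_sums C \<and>
     (\<forall>i j i' j' f g h.
        sum_diagram C i j \<longrightarrow>
        commutative_square C \<lparr>Left = f, Right = h, Top = i', Bottom = i\<rparr> \<longrightarrow>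
        commutative_square C \<lparr>Left = g, Right = h, Top = j', Bottom = j\<rparr> \<longrightarrow>
        (sum_diagram C i' j' \<longleftrightarrow>
           pullback_square C \<lparr>Left = f, Right = h, Top = i', Bottom = i\<rparr> \<and>
           pullback_square C \<lparr>Left = g, Right = h, Top = j', Bottom = j\<rparr>))"


section \<open>Pseudo double categories and lax double functors\<close>

text \<open>\<open>Hc\<close> is the category of objects and horizontal arrows, \<open>Vc\<close> the category of vertical
  arrows and cells (composed horizontally). \<open>Vcmp\<close> is applied to pairs \<open>(w, v)\<close> with \<open>v\<close> coming
  first, i.e. the target of \<open>v\<close> is the source of \<open>w\<close>.\<close>

record ('o, 'h, 'v, 'c) dbl =
  Hc :: "('o, 'h) cat"
  Vc :: "('v, 'c) cat"
  Src :: "('v, 'c, 'o, 'h) ftor"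
  Tgt :: "('v, 'c, 'o, 'h) ftor"
  Uni :: "('o, 'h, 'v, 'c) ftor"
  Vcmp :: "('v \<times> 'v, 'c \<times> 'c, 'v, 'c) ftor"
  Asc :: "'v \<Rightarrow> 'v \<Rightarrow> 'v \<Rightarrow> 'c"
  Lun :: "'v \<Rightarrow> 'c"
  Run :: "'v \<Rightarrow> 'c"

definition composable_pairs ::
  "('v, 'c, 'o, 'h) ftor \<Rightarrow> ('v, 'c, 'o, 'h) ftor \<Rightarrow> ('v \<times> 'v, 'c \<times> 'c) cat" where
  "composable_pairs s t = (prod_cat (fdom s) (fdom s))
     \<lparr>Obj := {(w, v). w \<in> Obj (fdom s) \<and> v \<in> Obj (fdom s) \<and> fob s w = fob t v},
      Arr := {(\<beta>, \<alpha>). \<beta> \<in> Arr (fdom s) \<and> \<alpha> \<in> Arr (fdom s) \<and> far s \<beta> = far t \<alpha>}\<rparr>"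

abbreviation vcmp :: "('o, 'h, 'v, 'c) dbl \<Rightarrow> 'v \<Rightarrow> 'v \<Rightarrow> 'v" where
  "vcmp D w v \<equiv> fob (Vcmp D) (w, v)"

abbreviation vcmp2 :: "('o, 'h, 'v, 'c) dbl \<Rightarrow> 'c \<Rightarrow> 'c \<Rightarrow> 'c" where
  "vcmp2 D \<beta> \<alpha> \<equiv> far (Vcmp D) (\<beta>, \<alpha>)"

definition composable :: "('o, 'h, 'v, 'c) dbl \<Rightarrow> 'v \<Rightarrow> 'v \<Rightarrow> bool" where
  "composable D w v \<longleftrightarrow> w \<in> Obj (Vc D) \<and> v \<in> Obj (Vc D) \<and> fob (Src D) w = fob (Tgt D) v"

definition composable2 :: "('o, 'h, 'v, 'c) dbl \<Rightarrow> 'c \<Rightarrow> 'c \<Rightarrow> bool" where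
  "composable2 D \<beta> \<alpha> \<longleftrightarrow> \<beta> \<in> Arr (Vc D) \<and> \<alpha> \<in> Arr (Vc D) \<and> far (Src D) \<beta> = far (Tgt D) \<alpha>"

definition globular :: "('o, 'h, 'v, 'c) dbl \<Rightarrow> 'v \<Rightarrow> 'v \<Rightarrow> 'c \<Rightarrow> bool" where
  "globular D v w \<alpha> \<longleftrightarrow> \<alpha> \<in> Hom (Vc D) v w \<and>
     far (Src D) \<alpha> = Ide (Hc D) (fob (Src D) v) \<and>
     far (Tgt D) \<alpha> = Ide (Hc D) (fob (Tgt D) v)"

locale double_category =
  fixes D :: "('o, 'h, 'v, 'c) dbl"
  assumes Src_functor: "cat_functor (Src D)" "fdom (Src D) = Vc D" "fcod (Src D) = Hc D"
    and Tgt_functor: "cat_functor (Tgt D)" "fdom (Tgt D) = Vc D" "fcod (Tgt D) = Hc D"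
    and Uni_functor: "cat_functor (Uni D)" "fdom (Uni D) = Hc D" "fcod (Uni D) = Vc D"
    and Vcmp_functor: "cat_functor (Vcmp D)" "fdom (Vcmp D) = composable_pairs (Src D) (Tgt D)"
      "fcod (Vcmp D) = Vc D"
    and Src_Uni: "fcmp (Src D) (Uni D) = fid (Hc D)"
    and Tgt_Uni: "fcmp (Tgt D) (Uni D) = fid (Hc D)"
    and Src_vcmp: "composable D w v \<Longrightarrow> fob (Src D) (vcmp D w v) = fob (Src D) v"
    and Tgt_vcmp: "composable D w v \<Longrightarrow> fob (Tgt D) (vcmp D w v) = fob (Tgt D) w"
    and Src_vcmp2: "composable2 D \<beta> \<alpha> \<Longrightarrow> far (Src D) (vcmp2 D \<beta> \<alpha>) = far (Src D) \<alpha>"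
    and Tgt_vcmp2: "composable2 D \<beta> \<alpha> \<Longrightarrow> far (Tgt D) (vcmp2 D \<beta> \<alpha>) = far (Tgt D) \<beta>"
    and Asc_globular: "composable D w v \<Longrightarrow> composable D v u \<Longrightarrow>
      globular D (vcmp D (vcmp D w v) u) (vcmp D w (vcmp D v u)) (Asc D w v u)"
    and Asc_iso: "composable D w v \<Longrightarrow> composable D v u \<Longrightarrow> is_iso (Vc D) (Asc D w v u)"
    and Asc_natural: "composable2 D \<gamma> \<beta> \<Longrightarrow> composable2 D \<beta> \<alpha> \<Longrightarrow>
      \<gamma> \<in> Hom (Vc D) w w' \<Longrightarrow> \<beta> \<in> Hom (Vc D) v v' \<Longrightarrow> \<alpha> \<in> Hom (Vc D) u u' \<Longrightarrow>
      Cmp (Vc D) (Asc D w' v' u') (vcmp2 D (vcmp2 D \<gamma> \<beta>) \<alpha>) =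
      Cmp (Vc D) (vcmp2 D \<gamma> (vcmp2 D \<beta> \<alpha>)) (Asc D w v u)"
    and Lun_globular: "v \<in> Obj (Vc D) \<Longrightarrow>
      globular D (vcmp D (fob (Uni D) (fob (Tgt D) v)) v) v (Lun D v)"
    and Lun_iso: "v \<in> Obj (Vc D) \<Longrightarrow> is_iso (Vc D) (Lun D v)"
    and Lun_natural: "\<alpha> \<in> Hom (Vc D) v v' \<Longrightarrow>
      Cmp (Vc D) (Lun D v') (vcmp2 D (far (Uni D) (far (Tgt D) \<alpha>)) \<alpha>) = Cmp (Vc D) \<alpha> (Lun D v)"
    and Run_globular: "v \<in> Obj (Vc D) \<Longrightarrow>
      globular D (vcmp D v (fob (Uni D) (fob (Src D) v))) v (Run D v)"
    and Run_iso: "v \<in> Obj (Vc D) \<Longrightarrow> is_iso (Vc D) (Run D v)"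
    and Run_natural: "\<alpha> \<in> Hom (Vc D) v v' \<Longrightarrow>
      Cmp (Vc D) (Run D v') (vcmp2 D \<alpha> (far (Uni D) (far (Src D) \<alpha>))) = Cmp (Vc D) \<alpha> (Run D v)"
    and pentagon: "composable D x w \<Longrightarrow> composable D w v \<Longrightarrow> composable D v u \<Longrightarrow>
      Cmp (Vc D) (Asc D x w (vcmp D v u)) (Asc D (vcmp D x w) v u) =
      Cmp (Vc D) (vcmp2 D (Ide (Vc D) x) (Asc D w v u))
        (Cmp (Vc D) (Asc D x (vcmp D w v) u) (vcmp2 D (Asc D x w v) (Ide (Vc D) u)))"
    and triangle: "composable D w v \<Longrightarrow>
      Cmp (Vc D) (vcmp2 D (Ide (Vc D) w) (Lun D v)) (Asc D w (fob (Uni D) (fob (Src D) w)) v) =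
      vcmp2 D (Run D w) (Ide (Vc D) v)"

definition op_dbl :: "('o, 'h, 'v, 'c) dbl \<Rightarrow> ('o, 'h, 'v, 'c) dbl" where
  "op_dbl D = \<lparr>Hc = op_cat (Hc D), Vc = op_cat (Vc D), Src = fop (Src D), Tgt = fop (Tgt D),
     Uni = fop (Uni D), Vcmp = fop (Vcmp D),
     Asc = (\<lambda>w v u. inverse_arrow (Vc D) (Asc D w v u)),
     Lun = (\<lambda>v. inverse_arrow (Vc D) (Lun D v)),
     Run = (\<lambda>v. inverse_arrow (Vc D) (Run D v))\<rparr>"

text \<open>\<open>lcmp M w v\<close> is the comparison cell from \<open>Mw \<odot> Mv\<close> to \<open>M(w \<odot> v)\<close>, and \<open>luni M a\<close> the
  comparison cell from the vertical identity of \<open>Ma\<close> to the image of that of \<open>a\<close>.\<close>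

record ('o, 'h, 'v, 'c, 'o2, 'h2, 'v2, 'c2) lax =
  hfun :: "('o, 'h, 'o2, 'h2) ftor"
  vfun :: "('v, 'c, 'v2, 'c2) ftor"
  lcmp :: "'v \<Rightarrow> 'v \<Rightarrow> 'c2"
  luni :: "'o \<Rightarrow> 'c2"

locale lax_double_functor = D: double_category D + E: double_category E
  for D :: "('o, 'h, 'v, 'c) dbl" and E :: "('o2, 'h2, 'v2, 'c2) dbl" +
  fixes M :: "('o, 'h, 'v, 'c, 'o2, 'h2, 'v2, 'c2) lax"
  assumes hfun_functor: "cat_functor (hfun M)" "fdom (hfun M) = Hc D" "fcod (hfun M) = Hc E"
    and vfun_functor: "cat_functor (vfun M)" "fdom (vfun M) = Vc D" "fcod (vfun M) = Vc E"
    and Src_vfun: "fcmp (Src E) (vfun M) = fcmp (hfun M) (Src D)"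
    and Tgt_vfun: "fcmp (Tgt E) (vfun M) = fcmp (hfun M) (Tgt D)"
    and lcmp_globular: "composable D w v \<Longrightarrow>
      globular E (vcmp E (fob (vfun M) w) (fob (vfun M) v)) (fob (vfun M) (vcmp D w v)) (lcmp M w v)"
    and lcmp_natural: "composable2 D \<beta> \<alpha> \<Longrightarrow> \<beta> \<in> Hom (Vc D) w w' \<Longrightarrow> \<alpha> \<in> Hom (Vc D) v v' \<Longrightarrow>
      Cmp (Vc E) (lcmp M w' v') (vcmp2 E (far (vfun M) \<beta>) (far (vfun M) \<alpha>)) =
      Cmp (Vc E) (far (vfun M) (vcmp2 D \<beta> \<alpha>)) (lcmp M w v)"
    and luni_globular: "a \<in> Obj (Hc D) \<Longrightarrow>
      globular E (fob (Uni E) (fob (hfun M) a)) (fob (vfun M) (fob (Uni D) a)) (luni M a)"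
    and luni_natural: "h \<in> Hom (Hc D) a b \<Longrightarrow>
      Cmp (Vc E) (luni M b) (far (Uni E) (far (hfun M) h)) =
      Cmp (Vc E) (far (vfun M) (far (Uni D) h)) (luni M a)"
    and lax_assoc: "composable D w v \<Longrightarrow> composable D v u \<Longrightarrow>
      Cmp (Vc E) (far (vfun M) (Asc D w v u))
        (Cmp (Vc E) (lcmp M (vcmp D w v) u)
          (vcmp2 E (lcmp M w v) (Ide (Vc E) (fob (vfun M) u)))) =
      Cmp (Vc E) (lcmp M w (vcmp D v u))
        (Cmp (Vc E) (vcmp2 E (Ide (Vc E) (fob (vfun M) w)) (lcmp M v u))
          (Asc E (fob (vfun M) w) (fob (vfun M) v) (fob (vfun M) u)))"
    and lax_left_unit: "v \<in> Obj (Vc D) \<Longrightarrow>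
      Cmp (Vc E) (far (vfun M) (Lun D v))
        (Cmp (Vc E) (lcmp M (fob (Uni D) (fob (Tgt D) v)) v)
          (vcmp2 E (luni M (fob (Tgt D) v)) (Ide (Vc E) (fob (vfun M) v)))) =
      Lun E (fob (vfun M) v)"
    and lax_right_unit: "v \<in> Obj (Vc D) \<Longrightarrow>
      Cmp (Vc E) (far (vfun M) (Run D v))
        (Cmp (Vc E) (lcmp M v (fob (Uni D) (fob (Src D) v)))
          (vcmp2 E (Ide (Vc E) (fob (vfun M) v)) (luni M (fob (Src D) v)))) =
      Run E (fob (vfun M) v)"

definition normal_lax ::
  "('o, 'h, 'v, 'c) dbl \<Rightarrow> ('o2, 'h2, 'v2, 'c2) dbl \<Rightarrow>
     ('o, 'h, 'v, 'c, 'o2, 'h2, 'v2, 'c2) lax \<Rightarrow> bool" where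
  "normal_lax D E M \<longleftrightarrow> (\<forall>a \<in> Obj (Hc D).
     fob (vfun M) (fob (Uni D) a) = fob (Uni E) (fob (hfun M) a) \<and>
     luni M a = Ide (Vc E) (fob (Uni E) (fob (hfun M) a)))"

text \<open>If the profunctors \<open>M(v)\<close> of a lax double functor into categories and profunctors are
  represented by functors \<open>v\<^sub>!\<close>, the comparison cells only give natural transformations from
  \<open>(w \<odot> v)\<^sub>!\<close> to the composite of \<open>v\<^sub>!\<close> and \<open>w\<^sub>!\<close>; invertible comparison cells make these isomorphisms.\<close>

definition invertible_comparisons ::
  "('o, 'h, 'v, 'c) dbl \<Rightarrow> ('o2, 'h2, 'v2, 'c2) dbl \<Rightarrow>
     ('o, 'h, 'v, 'c, 'o2, 'h2, 'v2, 'c2) lax \<Rightarrow> bool" where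
  "invertible_comparisons D E M \<longleftrightarrow>
     (\<forall>w v. composable D w v \<longrightarrow> is_iso (Vc E) (lcmp M w v))"

definition product_preserving ::
  "'i itself \<Rightarrow> ('o, 'h, 'v, 'c, 'o2, 'h2, 'v2, 'c2) lax \<Rightarrow> bool" where
  "product_preserving I M \<longleftrightarrow> preserves_products I (hfun M) \<and> preserves_products I (vfun M)"


section \<open>The double categories of squares\<close>

definition square_cat :: "('o, 'a) cat \<Rightarrow> ('a square \<Rightarrow> bool) \<Rightarrow> ('a, 'a square) cat" where
  "square_cat C Q = \<lparr>Obj = Arr C, Arr = {q. Q q}, Dom = Left, Cod = Right,
     Ide = (\<lambda>f. \<lparr>Left = f, Right = f, Top = Ide C (Dom C f), Bottom = Ide C (Cod C f)\<rparr>),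
     Cmp = (\<lambda>q p. \<lparr>Left = Left p, Right = Right q,
       Top = Cmp C (Top q) (Top p), Bottom = Cmp C (Bottom q) (Bottom p)\<rparr>)\<rparr>"

definition square_dbl ::
  "('o, 'a) cat \<Rightarrow> ('a square \<Rightarrow> bool) \<Rightarrow> ('o, 'a, 'a, 'a square) dbl" where
  "square_dbl C Q = (let
     V = square_cat C Q;
     s = \<lparr>fdom = V, fcod = C, fob = (\<lambda>f\<in>Obj V. Dom C f), far = (\<lambda>q\<in>Arr V. Top q)\<rparr>;
     t = \<lparr>fdom = V, fcod = C, fob = (\<lambda>f\<in>Obj V. Cod C f), far = (\<lambda>q\<in>Arr V. Bottom q)\<rparr>;
     P = composable_pairs s t
   in \<lparr>Hc = C, Vc = V, Src = s, Tgt = t,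
     Uni = \<lparr>fdom = C, fcod = V, fob = (\<lambda>a\<in>Obj C. Ide C a),
       far = (\<lambda>h\<in>Arr C. \<lparr>Left = Ide C (Dom C h), Right = Ide C (Cod C h), Top = h, Bottom = h\<rparr>)\<rparr>,
     Vcmp = \<lparr>fdom = P, fcod = V, fob = (\<lambda>(g, f)\<in>Obj P. Cmp C g f),
       far = (\<lambda>(q, p)\<in>Arr P. \<lparr>Left = Cmp C (Left q) (Left p), Right = Cmp C (Right q) (Right p),
         Top = Top p, Bottom = Bottom q\<rparr>)\<rparr>,
     Asc = (\<lambda>h g f. Ide V (Cmp C h (Cmp C g f))),
     Lun = Ide V, Run = Ide V\<rparr>)"

definition Sq :: "('o, 'a) cat \<Rightarrow> ('o, 'a, 'a, 'a square) dbl" where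
  "Sq S = square_dbl S (commutative_square S)"

definition Pb :: "('o, 'a) cat \<Rightarrow> ('o, 'a, 'a, 'a square) dbl" where
  "Pb C = square_dbl C (pullback_square C)"


section \<open>Sets\<close>

record 'u sarr =
  sdom :: "'u set"
  scod :: "'u set"
  smap :: "'u \<Rightarrow> 'u"

definition set_cat :: "('u set, 'u sarr) cat" where
  "set_cat = \<lparr>Obj = UNIV, Arr = {f. smap f \<in> sdom f \<rightarrow>\<^sub>E scod f}, Dom = sdom, Cod = scod,
     Ide = (\<lambda>X. \<lparr>sdom = X, scod = X, smap = (\<lambda>x\<in>X. x)\<rparr>),
     Cmp = (\<lambda>g f. \<lparr>sdom = sdom f, scod = scod g, smap = (\<lambda>x\<in>sdom f. smap g (smap f x))\<rparr>)\<rparr>"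


section \<open>The double category of categories and profunctors\<close>

text \<open>Small categories and small sets are those carried by subsets of a fixed but arbitrary infinite
  type \<open>'u\<close>. Infinity is what keeps coends of such sets, which are quotients of sets of triples,
  within \<open>'u\<close>. Universal properties are not affected by the bound on test objects: products of
  categories and of profunctors are detected by finite ones.\<close>

definition cat_cat :: "(('u, 'u) cat, ('u, 'u, 'u, 'u) ftor) cat" where
  "cat_cat = \<lparr>Obj = {A. category A}, Arr = {F. cat_functor F}, Dom = fdom, Cod = fcod,
     Ide = fid, Cmp = fcmp\<rparr>"

record 'u prof =
  psrc :: "('u, 'u) cat"
  ptgt :: "('u, 'u) cat"
  pfun :: "('u \<times> 'u, 'u \<times> 'u, 'u set, 'u sarr) ftor"

definition profunctor :: "'u prof \<Rightarrow> bool" where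
  "profunctor \<Phi> \<longleftrightarrow> category (psrc \<Phi>) \<and> category (ptgt \<Phi>) \<and> cat_functor (pfun \<Phi>) \<and>
     fdom (pfun \<Phi>) = prod_cat (op_cat (psrc \<Phi>)) (ptgt \<Phi>) \<and> fcod (pfun \<Phi>) = set_cat"

record 'u pcell =
  cdom :: "'u prof"
  ccod :: "'u prof"
  csrc :: "('u, 'u, 'u, 'u) ftor"
  ctgt :: "('u, 'u, 'u, 'u) ftor"
  cnat :: "'u \<times> 'u \<Rightarrow> 'u sarr"

definition profunctor_cell :: "'u pcell \<Rightarrow> bool" where
  "profunctor_cell \<tau> \<longleftrightarrow> profunctor (cdom \<tau>) \<and> profunctor (ccod \<tau>) \<and>
     cat_functor (csrc \<tau>) \<and> fdom (csrc \<tau>) = psrc (cdom \<tau>) \<and> fcod (csrc \<tau>) = psrc (ccod \<tau>) \<and>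
     cat_functor (ctgt \<tau>) \<and> fdom (ctgt \<tau>) = ptgt (cdom \<tau>) \<and> fcod (ctgt \<tau>) = ptgt (ccod \<tau>) \<and>
     nat_trans (pfun (cdom \<tau>)) (fcmp (pfun (ccod \<tau>)) (fprod (fop (csrc \<tau>)) (ctgt \<tau>))) (cnat \<tau>)"

definition prof_cat :: "('u prof, 'u pcell) cat" where
  "prof_cat = \<lparr>Obj = {\<Phi>. profunctor \<Phi>}, Arr = {\<tau>. profunctor_cell \<tau>}, Dom = cdom, Cod = ccod,
     Ide = (\<lambda>\<Phi>. \<lparr>cdom = \<Phi>, ccod = \<Phi>, csrc = fid (psrc \<Phi>), ctgt = fid (ptgt \<Phi>),
       cnat = (\<lambda>p\<in>Obj (fdom (pfun \<Phi>)). Ide set_cat (fob (pfun \<Phi>) p))\<rparr>),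
     Cmp = (\<lambda>\<sigma> \<tau>. \<lparr>cdom = cdom \<tau>, ccod = ccod \<sigma>,
       csrc = fcmp (csrc \<sigma>) (csrc \<tau>), ctgt = fcmp (ctgt \<sigma>) (ctgt \<tau>),
       cnat = (\<lambda>(a, b)\<in>Obj (fdom (pfun (cdom \<tau>))).
         Cmp set_cat (cnat \<sigma> (fob (csrc \<tau>) a, fob (ctgt \<tau>) b)) (cnat \<tau> (a, b)))\<rparr>)\<rparr>"

definition hom_ftor :: "('u, 'u) cat \<Rightarrow> ('u \<times> 'u, 'u \<times> 'u, 'u set, 'u sarr) ftor" where
  "hom_ftor A = \<lparr>fdom = prod_cat (op_cat A) A, fcod = set_cat,
     fob = (\<lambda>(a, b)\<in>Obj A \<times> Obj A. Hom A a b),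
     far = (\<lambda>(\<alpha>, \<beta>)\<in>Arr A \<times> Arr A.
       \<lparr>sdom = Hom A (Cod A \<alpha>) (Dom A \<beta>), scod = Hom A (Dom A \<alpha>) (Cod A \<beta>),
        smap = (\<lambda>h\<in>Hom A (Cod A \<alpha>) (Dom A \<beta>). Cmp A \<beta> (Cmp A h \<alpha>))\<rparr>)\<rparr>"

definition hom_prof :: "('u, 'u) cat \<Rightarrow> 'u prof" where
  "hom_prof A = \<lparr>psrc = A, ptgt = A, pfun = hom_ftor A\<rparr>"

text \<open>The composite of \<open>\<Phi> : A \<rightarrow> B\<close> and \<open>\<Psi> : B \<rightarrow> C\<close> is the coend over \<open>b\<close> of
  \<open>\<Phi>(a, b) \<times> \<Psi>(b, c)\<close>, a quotient of the set of triples \<open>(b, x, y)\<close>. The class of a triple is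
  represented in \<open>'u\<close> by the code \<open>tensor \<Phi> \<Psi> a c (b, x, y)\<close> of a chosen member.\<close>

definition coend_triples :: "'u prof \<Rightarrow> 'u prof \<Rightarrow> 'u \<Rightarrow> 'u \<Rightarrow> ('u \<times> 'u \<times> 'u) set" where
  "coend_triples \<Phi> \<Psi> a c = {(b, x, y). b \<in> Obj (ptgt \<Phi>) \<and>
     x \<in> fob (pfun \<Phi>) (a, b) \<and> y \<in> fob (pfun \<Psi>) (b, c)}"

definition coend_rel ::
  "'u prof \<Rightarrow> 'u prof \<Rightarrow> 'u \<Rightarrow> 'u \<Rightarrow> (('u \<times> 'u \<times> 'u) \<times> ('u \<times> 'u \<times> 'u)) set" where
  "coend_rel \<Phi> \<Psi> a c =
     {((b, x, smap (far (pfun \<Psi>) (\<beta>, Ide (ptgt \<Psi>) c)) y),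
       (b', smap (far (pfun \<Phi>) (Ide (psrc \<Phi>) a, \<beta>)) x, y)) | b b' \<beta> x y.
      \<beta> \<in> Hom (ptgt \<Phi>) b b' \<and> x \<in> fob (pfun \<Phi>) (a, b) \<and> y \<in> fob (pfun \<Psi>) (b', c)}"

definition coend_eq ::
  "'u prof \<Rightarrow> 'u prof \<Rightarrow> 'u \<Rightarrow> 'u \<Rightarrow> (('u \<times> 'u \<times> 'u) \<times> ('u \<times> 'u \<times> 'u)) set" where
  "coend_eq \<Phi> \<Psi> a c = (coend_rel \<Phi> \<Psi> a c \<union> (coend_rel \<Phi> \<Psi> a c)\<inverse>)\<^sup>*"

definition code3 :: "'u::infinite \<times> 'u \<times> 'u \<Rightarrow> 'u" where
  "code3 = (SOME e. inj e)"

definition decode3 :: "'u::infinite \<Rightarrow> 'u \<times> 'u \<times> 'u" where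
  "decode3 = inv code3"

definition tensor ::
  "'u::infinite prof \<Rightarrow> 'u prof \<Rightarrow> 'u \<Rightarrow> 'u \<Rightarrow> 'u \<times> 'u \<times> 'u \<Rightarrow> 'u" where
  "tensor \<Phi> \<Psi> a c p = code3 (SOME p'. (p, p') \<in> coend_eq \<Phi> \<Psi> a c)"

definition prof_comp :: "'u::infinite prof \<Rightarrow> 'u prof \<Rightarrow> 'u prof" where
  "prof_comp \<Psi> \<Phi> = (let
     ob = (\<lambda>(a, c). tensor \<Phi> \<Psi> a c ` coend_triples \<Phi> \<Psi> a c);
     A = psrc \<Phi>; C = ptgt \<Psi>; P = prod_cat (op_cat A) C
   in \<lparr>psrc = A, ptgt = C, pfun = \<lparr>fdom = P, fcod = set_cat, fob = restrict ob (Obj P),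
     far = (\<lambda>(\<alpha>, \<gamma>)\<in>Arr P.
       \<lparr>sdom = ob (Cod A \<alpha>, Dom C \<gamma>), scod = ob (Dom A \<alpha>, Cod C \<gamma>),
        smap = (\<lambda>z\<in>ob (Cod A \<alpha>, Dom C \<gamma>). case decode3 z of (b, x, y) \<Rightarrow>
          tensor \<Phi> \<Psi> (Dom A \<alpha>) (Cod C \<gamma>)
            (b, smap (far (pfun \<Phi>) (\<alpha>, Ide (ptgt \<Phi>) b)) x,
                smap (far (pfun \<Psi>) (Ide (ptgt \<Phi>) b, \<gamma>)) y))\<rparr>)\<rparr>\<rparr>)"

definition cell_comp :: "'u::infinite pcell \<Rightarrow> 'u pcell \<Rightarrow> 'u pcell" where
  "cell_comp \<sigma> \<tau> = (let
     \<Phi> = prof_comp (cdom \<sigma>) (cdom \<tau>); \<Phi>' = prof_comp (ccod \<sigma>) (ccod \<tau>);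
     F = csrc \<tau>; G = ctgt \<tau>; H = ctgt \<sigma>
   in \<lparr>cdom = \<Phi>, ccod = \<Phi>', csrc = F, ctgt = H,
     cnat = (\<lambda>(a, c)\<in>Obj (fdom (pfun \<Phi>)).
       \<lparr>sdom = fob (pfun \<Phi>) (a, c), scod = fob (pfun \<Phi>') (fob F a, fob H c),
        smap = (\<lambda>z\<in>fob (pfun \<Phi>) (a, c). case decode3 z of (b, x, y) \<Rightarrow>
          tensor (ccod \<tau>) (ccod \<sigma>) (fob F a) (fob H c)
            (fob G b, smap (cnat \<tau> (a, b)) x, smap (cnat \<sigma> (b, c)) y))\<rparr>)\<rparr>)"

text \<open>The globular cell from \<open>\<Phi>\<close> to \<open>\<Psi>\<close> with the given components.\<close>

definition globular_cell :: "'u prof \<Rightarrow> 'u prof \<Rightarrow> ('u \<Rightarrow> 'u \<Rightarrow> 'u \<Rightarrow> 'u) \<Rightarrow> 'u pcell" where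
  "globular_cell \<Phi> \<Psi> k = \<lparr>cdom = \<Phi>, ccod = \<Psi>, csrc = fid (psrc \<Phi>), ctgt = fid (ptgt \<Phi>),
     cnat = (\<lambda>(a, c)\<in>Obj (fdom (pfun \<Phi>)).
       \<lparr>sdom = fob (pfun \<Phi>) (a, c), scod = fob (pfun \<Psi>) (a, c),
        smap = (\<lambda>z\<in>fob (pfun \<Phi>) (a, c). k a c z)\<rparr>)\<rparr>"

definition hom_cell :: "('u, 'u, 'u, 'u) ftor \<Rightarrow> 'u pcell" where
  "hom_cell F = \<lparr>cdom = hom_prof (fdom F), ccod = hom_prof (fcod F), csrc = F, ctgt = F,
     cnat = (\<lambda>(a, b)\<in>Obj (fdom F) \<times> Obj (fdom F).
       \<lparr>sdom = Hom (fdom F) a b, scod = Hom (fcod F) (fob F a) (fob F b),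
        smap = (\<lambda>h\<in>Hom (fdom F) a b. far F h)\<rparr>)\<rparr>"

definition asc_map :: "'u::infinite prof \<Rightarrow> 'u prof \<Rightarrow> 'u prof \<Rightarrow> 'u \<Rightarrow> 'u \<Rightarrow> 'u \<Rightarrow> 'u" where
  "asc_map X \<Psi> \<Phi> a d z = (case decode3 z of (b, x, w) \<Rightarrow> case decode3 w of (c, y, v) \<Rightarrow>
     tensor (prof_comp \<Psi> \<Phi>) X a d (c, tensor \<Phi> \<Psi> a c (b, x, y), v))"

definition lun_map :: "'u::infinite prof \<Rightarrow> 'u \<Rightarrow> 'u \<Rightarrow> 'u \<Rightarrow> 'u" where
  "lun_map \<Phi> a b z = (case decode3 z of (b', x, \<beta>) \<Rightarrow>
     smap (far (pfun \<Phi>) (Ide (psrc \<Phi>) a, \<beta>)) x)"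

definition run_map :: "'u::infinite prof \<Rightarrow> 'u \<Rightarrow> 'u \<Rightarrow> 'u \<Rightarrow> 'u" where
  "run_map \<Phi> a b z = (case decode3 z of (a', \<alpha>, x) \<Rightarrow>
     smap (far (pfun \<Phi>) (\<alpha>, Ide (ptgt \<Phi>) b)) x)"

definition Cat :: "(('u::infinite, 'u) cat, ('u, 'u, 'u, 'u) ftor, 'u prof, 'u pcell) dbl" where
  "Cat = (let
     s = \<lparr>fdom = prof_cat, fcod = cat_cat,
       fob = (\<lambda>\<Phi>\<in>Obj prof_cat. psrc \<Phi>), far = (\<lambda>\<tau>\<in>Arr prof_cat. csrc \<tau>)\<rparr>;
     t = \<lparr>fdom = prof_cat, fcod = cat_cat,
       fob = (\<lambda>\<Phi>\<in>Obj prof_cat. ptgt \<Phi>), far = (\<lambda>\<tau>\<in>Arr prof_cat. ctgt \<tau>)\<rparr>;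
     P = composable_pairs s t
   in \<lparr>Hc = cat_cat, Vc = prof_cat, Src = s, Tgt = t,
     Uni = \<lparr>fdom = cat_cat, fcod = prof_cat, fob = (\<lambda>A\<in>Obj cat_cat. hom_prof A),
       far = (\<lambda>F\<in>Arr cat_cat. hom_cell F)\<rparr>,
     Vcmp = \<lparr>fdom = P, fcod = prof_cat, fob = (\<lambda>(\<Psi>, \<Phi>)\<in>Obj P. prof_comp \<Psi> \<Phi>),
       far = (\<lambda>(\<sigma>, \<tau>)\<in>Arr P. cell_comp \<sigma> \<tau>)\<rparr>,
     Asc = (\<lambda>X \<Psi> \<Phi>. globular_cell (prof_comp (prof_comp X \<Psi>) \<Phi>) (prof_comp X (prof_comp \<Psi> \<Phi>))
       (asc_map X \<Psi> \<Phi>)),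
     Lun = (\<lambda>\<Phi>. globular_cell (prof_comp (hom_prof (ptgt \<Phi>)) \<Phi>) \<Phi> (lun_map \<Phi>)),
     Run = (\<lambda>\<Phi>. globular_cell (prof_comp \<Phi> (hom_prof (psrc \<Phi>))) \<Phi> (run_map \<Phi>))\<rparr>)"


section \<open>DF monoids, DF operads, DF monoidal categories\<close>

type_synonym ('o, 'a, 's, 'b) sq_lax = "('o, 'a, 'a, 'a square, 's, 'b, 'b, 'b square) lax"

type_synonym ('o, 'a, 'u) cat_lax =
  "('o, 'a, 'a, 'a square, ('u, 'u) cat, ('u, 'u, 'u, 'u) ftor, 'u prof, 'u pcell) lax"

definition DF_monoid ::
  "'i itself \<Rightarrow> ('o, 'a) cat \<Rightarrow> ('s, 'b) cat \<Rightarrow> ('o, 'a, 's, 'b) sq_lax \<Rightarrow> bool" where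
  "DF_monoid I C S N \<longleftrightarrow>
     lax_double_functor (op_dbl (Pb C)) (Sq S) N \<and> product_preserving I N"

definition DF_operad ::
  "'i itself \<Rightarrow> ('o, 'a) cat \<Rightarrow> ('o, 'a, 'u::infinite) cat_lax \<Rightarrow> bool" where
  "DF_operad I C M \<longleftrightarrow> lax_double_functor (op_dbl (Pb C)) Cat M \<and>
     normal_lax (op_dbl (Pb C)) Cat M \<and> product_preserving I M"

text \<open>The functor \<open>(X, Y) \<mapsto> MJ(F X, Y)\<close>.\<close>

definition represented_ftor ::
  "('u, 'u, 'u, 'u) ftor \<Rightarrow> ('u \<times> 'u, 'u \<times> 'u, 'u set, 'u sarr) ftor" where
  "represented_ftor F = fcmp (hom_ftor (fcod F)) (fprod (fop F) (fid (fcod F)))"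

definition represents :: "('u, 'u, 'u, 'u) ftor \<Rightarrow> 'u prof \<Rightarrow> bool" where
  "represents F \<Phi> \<longleftrightarrow> cat_functor F \<and> fdom F = psrc \<Phi> \<and> fcod F = ptgt \<Phi> \<and>
     naturally_isomorphic (pfun \<Phi>) (represented_ftor F)"

definition DF_monoidal_category ::
  "'i itself \<Rightarrow> ('o, 'a) cat \<Rightarrow> ('o, 'a, 'u::infinite) cat_lax \<Rightarrow> bool" where
  "DF_monoidal_category I C M \<longleftrightarrow> DF_operad I C M \<and>
     (\<forall>f \<in> Arr C. \<exists>F. represents F (fob (vfun M) f)) \<and>
     (\<forall>f g k l F G. pullback_square C \<lparr>Left = f, Right = g, Top = k, Bottom = l\<rparr> \<longrightarrow>
        represents F (fob (vfun M) f) \<longrightarrow> represents G (fob (vfun M) g) \<longrightarrow>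
        naturally_isomorphic (fcmp F (far (hfun M) k)) (fcmp (far (hfun M) l) G))"


section \<open>Isomorphism classes\<close>

definition iso_class :: "('o, 'a) cat \<Rightarrow> 'o \<Rightarrow> 'o set" where
  "iso_class A x = {y \<in> Obj A. isomorphic A x y}"

definition iso_classes :: "('o, 'a) cat \<Rightarrow> 'o set set" where
  "iso_classes A = iso_class A ` Obj A"

definition iso_classes_map :: "('u, 'u, 'u, 'u) ftor \<Rightarrow> 'u set sarr" where
  "iso_classes_map F = \<lparr>sdom = iso_classes (fdom F), scod = iso_classes (fcod F),
     smap = (\<lambda>c\<in>iso_classes (fdom F). \<Union>x\<in>c. iso_class (fcod F) (fob F x))\<rparr>"


section \<open>The double categories above satisfy the axioms\<close>

lemma HomI: "f \<in> Arr C \<Longrightarrow> Dom C f = a \<Longrightarrow> Cod C f = b \<Longrightarrow> f \<in> Hom C a b"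
  by (simp add: Hom_def)

lemma HomD: assumes "f \<in> Hom C a b" shows "f \<in> Arr C" "Dom C f = a" "Cod C f = b"
  using assms by (auto simp: Hom_def)

lemma (in category) Hom_Obj: assumes "f \<in> Hom C a b" shows "a \<in> Obj C" "b \<in> Obj C"
  using assms Dom_Obj Cod_Obj by (auto simp: Hom_def)

lemma op_cat_simps [simp]:
  "Obj (op_cat C) = Obj C" "Arr (op_cat C) = Arr C" "Dom (op_cat C) = Cod C" "Cod (op_cat C) = Dom C"
  "Ide (op_cat C) = Ide C" "Cmp (op_cat C) g f = Cmp C f g" "Hom (op_cat C) a b = Hom C b a"
  by (auto simp: op_cat_def Hom_def)

lemma op_op_cat [simp]: "op_cat (op_cat C) = C"
  by (simp add: op_cat_def)

lemma prod_cat_simps [simp]: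
  "Obj (prod_cat A B) = Obj A \<times> Obj B" "Arr (prod_cat A B) = Arr A \<times> Arr B"
  "Dom (prod_cat A B) (f, f') = (Dom A f, Dom B f')" "Cod (prod_cat A B) (f, f') = (Cod A f, Cod B f')"
  "Ide (prod_cat A B) (a, b) = (Ide A a, Ide B b)"
  "Cmp (prod_cat A B) (g, g') (f, f') = (Cmp A g f, Cmp B g' f')"
  by (auto simp: prod_cat_def)

lemma Hom_prod_cat [simp]: "(f, g) \<in> Hom (prod_cat A B) (a, b) (a', b') \<longleftrightarrow> f \<in> Hom A a a' \<and> g \<in> Hom B b b'"
  by (auto simp: Hom_def)

lemma category_op_cat: assumes "category C" shows "category (op_cat C)"
proof -
  interpret category C by fact
  show ?thesis
    by unfold_locales (auto simp: Dom_Obj Cod_Obj Ide_Hom Cmp_Ide_left Cmp_Ide_right intro: Cmp_Hom Cmp_assoc[symmetric])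
qed

lemma category_prod_cat: assumes "category A" "category B" shows "category (prod_cat A B)"
proof -
  interpret A: category A by fact
  interpret B: category B by fact
  show ?thesis
  proof
    fix f a b g c assume "f \<in> Hom (prod_cat A B) a b" "g \<in> Hom (prod_cat A B) b c"
    then show "Cmp (prod_cat A B) g f \<in> Hom (prod_cat A B) a c"
      by (cases f; cases g; cases a; cases b; cases c) (auto intro: A.Cmp_Hom B.Cmp_Hom)
  next
    fix f a b assume "f \<in> Hom (prod_cat A B) a b"
    then show "Cmp (prod_cat A B) f (Ide (prod_cat A B) a) = f"
      "Cmp (prod_cat A B) (Ide (prod_cat A B) b) f = f"
      by (cases f; cases a; cases b; auto intro: A.Cmp_Ide_right B.Cmp_Ide_right A.Cmp_Ide_left B.Cmp_Ide_left)+
  next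
    fix f a b g c h d
    assume "f \<in> Hom (prod_cat A B) a b" "g \<in> Hom (prod_cat A B) b c" "h \<in> Hom (prod_cat A B) c d"
    then show "Cmp (prod_cat A B) h (Cmp (prod_cat A B) g f) = Cmp (prod_cat A B) (Cmp (prod_cat A B) h g) f"
      by (cases f; cases g; cases h; cases a; cases b; cases c; cases d) (auto intro: A.Cmp_assoc B.Cmp_assoc)
  qed (auto simp: A.Dom_Obj A.Cod_Obj B.Dom_Obj B.Cod_Obj A.Ide_Hom B.Ide_Hom)
qed

lemma set_cat_simps [simp]:
  "Obj set_cat = UNIV" "Dom set_cat = sdom" "Cod set_cat = scod"
  "Arr set_cat = {f. smap f \<in> sdom f \<rightarrow>\<^sub>E scod f}"
  "sdom (Ide set_cat X) = X" "scod (Ide set_cat X) = X" "smap (Ide set_cat X) = (\<lambda>x\<in>X. x)"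
  "sdom (Cmp set_cat g f) = sdom f" "scod (Cmp set_cat g f) = scod g"
  "smap (Cmp set_cat g f) = (\<lambda>x\<in>sdom f. smap g (smap f x))"
  by (simp_all add: set_cat_def)

lemma Hom_set_cat: "f \<in> Hom set_cat X Y \<longleftrightarrow> sdom f = X \<and> scod f = Y \<and> smap f \<in> X \<rightarrow>\<^sub>E Y"
  by (auto simp: Hom_def)

lemma sarr_eqI: "f \<in> Hom set_cat X Y \<Longrightarrow> g \<in> Hom set_cat X Y \<Longrightarrow> (\<And>x. x \<in> X \<Longrightarrow> smap f x = smap g x) \<Longrightarrow> f = g"
  by (cases f; cases g) (auto simp: Hom_set_cat intro: PiE_ext)

lemma category_set_cat: "category set_cat"
proof
  fix f :: "'a sarr" and a b assume f: "f \<in> Hom set_cat a b"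
  then show "Cmp set_cat f (Ide set_cat a) = f" "Cmp set_cat (Ide set_cat b) f = f"
    by (auto intro!: sarr_eqI[of _ a b] simp: Hom_set_cat PiE_iff)
next
  fix f g h :: "'a sarr" and a b c d
  assume f: "f \<in> Hom set_cat a b" and g: "g \<in> Hom set_cat b c" and h: "h \<in> Hom set_cat c d"
  then show "Cmp set_cat h (Cmp set_cat g f) = Cmp set_cat (Cmp set_cat h g) f"
    by (intro sarr_eqI[of _ a d]) (auto simp: Hom_set_cat dest!: PiE_mem)
next
  fix f g :: "'a sarr" and a b c 
  assume f: "f \<in> Hom set_cat a b" and g: "g \<in> Hom set_cat b c"
  then show "Cmp set_cat g f \<in> Hom set_cat a c"
    by (auto simp: Hom_set_cat)
qed (auto simp: Hom_set_cat)

lemma (in cat_functor) fob_Obj: "a \<in> Obj (fdom F) \<Longrightarrow> fob F a \<in> Obj (fcod F)"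
  using fob_funcset by auto

lemma (in cat_functor) far_Arr: "f \<in> Arr (fdom F) \<Longrightarrow> far F f \<in> Arr (fcod F)"
  using far_Hom[of f] by (auto simp: Hom_def)

lemma ftor_eqI:
  assumes "cat_functor F" "cat_functor G" "fdom F = fdom G" "fcod F = fcod G"
    "\<And>a. a \<in> Obj (fdom F) \<Longrightarrow> fob F a = fob G a" "\<And>f. f \<in> Arr (fdom F) \<Longrightarrow> far F f = far G f"
  shows "F = G"
proof -
  interpret F: cat_functor F by fact
  interpret G: cat_functor G by fact
  have "fob F = fob G" using F.fob_funcset G.fob_funcset assms
    by (intro PiE_ext[of _ "Obj (fdom F)" "\<lambda>_. Obj (fcod F)"]) auto
  moreover have "far F = far G" using F.far_extensional G.far_extensional assms
    by (intro extensionalityI[of _ "Arr (fdom F)"]) auto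
  ultimately show ?thesis using assms by (cases F; cases G) auto
qed

lemma fid_simps [simp]: "fdom (fid C) = C" "fcod (fid C) = C" "a \<in> Obj C \<Longrightarrow> fob (fid C) a = a"
  "f \<in> Arr C \<Longrightarrow> far (fid C) f = f"
  by (auto simp: fid_def)

lemma functor_fid: assumes "category C" shows "cat_functor (fid C)"
proof -
  interpret category C by fact
  show ?thesis
    apply (rule cat_functor.intro)
    using assms Dom_Obj Cod_Obj Ide_Hom Cmp_Hom
    apply (auto simp: fid_def Hom_def)
    done
qed

lemma fcmp_simps [simp]: "fdom (fcmp G F) = fdom F" "fcod (fcmp G F) = fcod G"
  "a \<in> Obj (fdom F) \<Longrightarrow> fob (fcmp G F) a = fob G (fob F a)"
  "f \<in> Arr (fdom F) \<Longrightarrow> far (fcmp G F) f = far G (far F f)"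
  by (auto simp: fcmp_def)

lemma functor_fcmp: assumes "cat_functor F" "cat_functor G" "fcod F = fdom G" shows "cat_functor (fcmp G F)"
proof -
  interpret F: cat_functor F by fact
  interpret G: cat_functor G by fact
  interpret A: category "fdom F" by (rule F.fdom_category)
  show ?thesis
  proof (rule cat_functor.intro)
    show "fob (fcmp G F) \<in> Obj (fdom (fcmp G F)) \<rightarrow>\<^sub>E Obj (fcod (fcmp G F))"
      using F.fob_Obj G.fob_Obj assms(3) by (auto simp: fcmp_def)
    show "far (fcmp G F) \<in> extensional (Arr (fdom (fcmp G F)))" by (auto simp: fcmp_def)
  next
    fix f a b assume f: "f \<in> Hom (fdom (fcmp G F)) a b"
    then have "far G (far F f) \<in> Hom (fcod G) (fob G (fob F a)) (fob G (fob F b))"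
      using G.far_Hom F.far_Hom assms(3) by simp
    then show "far (fcmp G F) f \<in> Hom (fcod (fcmp G F)) (fob (fcmp G F) a) (fob (fcmp G F) b)"
      using f A.Hom_Obj[of f a b] HomD(1)[of f "fdom F" a b] by simp
  next
    fix a assume "a \<in> Obj (fdom (fcmp G F))"
    then show "far (fcmp G F) (Ide (fdom (fcmp G F)) a) = Ide (fcod (fcmp G F)) (fob (fcmp G F) a)"
      using A.Ide_Hom[of a] F.far_Ide[of a] G.far_Ide[of "fob F a"] F.fob_Obj[of a] assms(3)
      by (simp add: HomD(1)[OF A.Ide_Hom])
  next
    fix f a b g c assume f: "f \<in> Hom (fdom (fcmp G F)) a b" and g: "g \<in> Hom (fdom (fcmp G F)) b c"
    then show "far (fcmp G F) (Cmp (fdom (fcmp G F)) g f) =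
       Cmp (fcod (fcmp G F)) (far (fcmp G F) g) (far (fcmp G F) f)"
      using A.Cmp_Hom[of f a b g c] F.far_Hom[of f a b] F.far_Hom[of g b c] assms(3)
      by (simp add: HomD(1)[of _ "fdom F"] F.far_Cmp[of f a b g c] G.far_Cmp[of "far F f" "fob F a" "fob F b" "far F g" "fob F c"])
  qed (use F.fdom_category G.fcod_category in simp_all)
qed

lemma fop_simps [simp]: "fdom (fop F) = op_cat (fdom F)" "fcod (fop F) = op_cat (fcod F)"
  "fob (fop F) = fob F" "far (fop F) = far F"
  by (auto simp: fop_def)

lemma functor_fop: assumes "cat_functor F" shows "cat_functor (fop F)"
proof -
  interpret F: cat_functor F by fact
  show ?thesis
    by (rule cat_functor.intro) (use F.fob_funcset F.far_extensional in \<open>auto simp: F.fdom_category F.fcod_category category_op_cat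
       F.far_Hom F.far_Ide F.far_Cmp\<close>)
qed

lemma fprod_simps [simp]: "fdom (fprod F G) = prod_cat (fdom F) (fdom G)"
  "fcod (fprod F G) = prod_cat (fcod F) (fcod G)"
  "a \<in> Obj (fdom F) \<Longrightarrow> b \<in> Obj (fdom G) \<Longrightarrow> fob (fprod F G) (a, b) = (fob F a, fob G b)"
  "f \<in> Arr (fdom F) \<Longrightarrow> g \<in> Arr (fdom G) \<Longrightarrow> far (fprod F G) (f, g) = (far F f, far G g)"
  by (auto simp: fprod_def)

lemma functor_fprod: assumes "cat_functor F" "cat_functor G" shows "cat_functor (fprod F G)"
proof -
  interpret F: cat_functor F by fact
  interpret G: cat_functor G by fact
  interpret A: category "fdom F" by (rule F.fdom_category)
  interpret B: category "fdom G" by (rule G.fdom_category)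
  show ?thesis
  proof (rule cat_functor.intro)
    show "fob (fprod F G) \<in> Obj (fdom (fprod F G)) \<rightarrow>\<^sub>E Obj (fcod (fprod F G))"
      using F.fob_Obj G.fob_Obj by (auto simp: fprod_def)
    show "far (fprod F G) \<in> extensional (Arr (fdom (fprod F G)))" by (auto simp: fprod_def)
  next
    fix p a b assume "p \<in> Hom (fdom (fprod F G)) a b"
    then show "far (fprod F G) p \<in> Hom (fcod (fprod F G)) (fob (fprod F G) a) (fob (fprod F G) b)"
      by (cases p; cases a; cases b)
       (auto simp: A.Hom_Obj B.Hom_Obj HomD(1)[of _ "fdom F"] HomD(1)[of _ "fdom G"] F.far_Hom G.far_Hom
         dest: A.Hom_Obj B.Hom_Obj)
  next
    fix a assume "a \<in> Obj (fdom (fprod F G))"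
    then show "far (fprod F G) (Ide (fdom (fprod F G)) a) = Ide (fcod (fprod F G)) (fob (fprod F G) a)"
      by (auto simp: HomD(1)[OF A.Ide_Hom] HomD(1)[OF B.Ide_Hom] F.far_Ide G.far_Ide)
  next
    fix p a b q c assume "p \<in> Hom (fdom (fprod F G)) a b" "q \<in> Hom (fdom (fprod F G)) b c"
    then show "far (fprod F G) (Cmp (fdom (fprod F G)) q p) =
       Cmp (fcod (fprod F G)) (far (fprod F G) q) (far (fprod F G) p)"
      apply (cases p; cases q; cases a; cases b; cases c)
      apply (auto simp: HomD(1)[of _ "fdom F"] HomD(1)[of _ "fdom G"] F.far_Cmp G.far_Cmp)
      apply (subst fprod_simps)
      using A.Cmp_Hom B.Cmp_Hom HomD(1) apply metis
      using A.Cmp_Hom B.Cmp_Hom HomD(1) apply metis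
      apply (auto simp: F.far_Cmp G.far_Cmp)
      done
  qed (use F.fdom_category G.fdom_category F.fcod_category G.fcod_category category_prod_cat in simp_all)
qed

lemma cat_cat_simps [simp]: "Obj cat_cat = {A. category A}" "Arr cat_cat = {F. cat_functor F}"
  "Dom cat_cat = fdom" "Cod cat_cat = fcod" "Ide cat_cat = fid" "Cmp cat_cat = fcmp"
  by (auto simp: cat_cat_def)

lemma fcmp_fid: assumes "cat_functor F" shows "fcmp F (fid (fdom F)) = F" "fcmp (fid (fcod F)) F = F"
proof -
  interpret F: cat_functor F by fact
  show "fcmp F (fid (fdom F)) = F"
    by (rule ftor_eqI) (use assms F.fdom_category F.fcod_category in \<open>auto intro: functor_fcmp functor_fid\<close>)
  show "fcmp (fid (fcod F)) F = F"
    by (rule ftor_eqI) (use assms F.fdom_category F.fcod_category F.fob_Obj F.far_Arr in \<open>auto intro: functor_fcmp functor_fid\<close>)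
qed

lemma fcmp_assoc: assumes "cat_functor F" "cat_functor G" "cat_functor H" "fcod F = fdom G" "fcod G = fdom H"
  shows "fcmp H (fcmp G F) = fcmp (fcmp H G) F"
proof -
  interpret F: cat_functor F by fact
  interpret G: cat_functor G by fact
  interpret H: cat_functor H by fact
  show ?thesis
    by (rule ftor_eqI) (use assms F.fob_Obj F.far_Arr in \<open>auto intro!: functor_fcmp\<close>)
qed

lemma category_cat_cat: "category cat_cat"
  by unfold_locales
   (auto simp: Hom_def cat_functor.fdom_category cat_functor.fcod_category functor_fid functor_fcmp fcmp_fid fcmp_assoc)

abbreviation pset :: "'u prof \<Rightarrow> 'u \<Rightarrow> 'u \<Rightarrow> 'u set" where
  "pset \<Phi> a b \<equiv> fob (pfun \<Phi>) (a, b)"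

abbreviation pact :: "'u prof \<Rightarrow> 'u \<Rightarrow> 'u \<Rightarrow> 'u \<Rightarrow> 'u" where
  "pact \<Phi> \<alpha> \<beta> x \<equiv> smap (far (pfun \<Phi>) (\<alpha>, \<beta>)) x"

lemma pact_in:
  assumes "profunctor \<Phi>" "\<alpha> \<in> Hom (psrc \<Phi>) a' a" "\<beta> \<in> Hom (ptgt \<Phi>) b b'" "x \<in> pset \<Phi> a b"
  shows "pact \<Phi> \<alpha> \<beta> x \<in> pset \<Phi> a' b'"
proof -
  interpret F: cat_functor "pfun \<Phi>" using assms by (simp add: profunctor_def)
  have "far (pfun \<Phi>) (\<alpha>, \<beta>) \<in> Hom set_cat (pset \<Phi> a b) (pset \<Phi> a' b')"
    using F.far_Hom[of "(\<alpha>, \<beta>)" "(a, b)" "(a', b')"] assms by (auto simp: profunctor_def)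
  then show ?thesis using assms by (auto simp: Hom_set_cat)
qed

lemma pact_Ide:
  assumes "profunctor \<Phi>" "a \<in> Obj (psrc \<Phi>)" "b \<in> Obj (ptgt \<Phi>)" "x \<in> pset \<Phi> a b"
  shows "pact \<Phi> (Ide (psrc \<Phi>) a) (Ide (ptgt \<Phi>) b) x = x"
proof -
  interpret F: cat_functor "pfun \<Phi>" using assms by (simp add: profunctor_def)
  show ?thesis using F.far_Ide[of "(a, b)"] assms by (auto simp: profunctor_def)
qed

lemma pact_Cmp:
  assumes "profunctor \<Phi>" "\<alpha> \<in> Hom (psrc \<Phi>) a' a" "\<beta> \<in> Hom (ptgt \<Phi>) b b'"
    "\<alpha>' \<in> Hom (psrc \<Phi>) a'' a'" "\<beta>' \<in> Hom (ptgt \<Phi>) b' b''" "x \<in> pset \<Phi> a b"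
  shows "pact \<Phi> \<alpha>' \<beta>' (pact \<Phi> \<alpha> \<beta> x) = pact \<Phi> (Cmp (psrc \<Phi>) \<alpha> \<alpha>') (Cmp (ptgt \<Phi>) \<beta>' \<beta>) x"
proof -
  interpret F: cat_functor "pfun \<Phi>" using assms by (simp add: profunctor_def)
  have "far (pfun \<Phi>) (\<alpha>, \<beta>) \<in> Hom set_cat (pset \<Phi> a b) (pset \<Phi> a' b')"
    using F.far_Hom[of "(\<alpha>, \<beta>)" "(a, b)" "(a', b')"] assms by (auto simp: profunctor_def)
  then show ?thesis
    using F.far_Cmp[of "(\<alpha>, \<beta>)" "(a, b)" "(a', b')" "(\<alpha>', \<beta>')" "(a'', b'')"] assms
    by (auto simp: profunctor_def Hom_set_cat)
qed

lemma profunctorI: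
  assumes A: "category A" and B: "category B"
    and X: "\<And>a b. a \<in> Obj A \<Longrightarrow> b \<in> Obj B \<Longrightarrow> fob P (a, b) = X a b"
    and P: "fdom P = prod_cat (op_cat A) B" "fcod P = set_cat" "fob P \<in> extensional (Obj A \<times> Obj B)"
      "far P \<in> extensional (Arr A \<times> Arr B)"
    and s: "\<And>\<alpha> \<beta>. \<alpha> \<in> Arr A \<Longrightarrow> \<beta> \<in> Arr B \<Longrightarrow> sdom (far P (\<alpha>, \<beta>)) = X (Cod A \<alpha>) (Dom B \<beta>) \<and> scod (far P (\<alpha>, \<beta>)) = X (Dom A \<alpha>) (Cod B \<beta>)
      \<and> smap (far P (\<alpha>, \<beta>)) \<in> extensional (X (Cod A \<alpha>) (Dom B \<beta>))"
    and i: "\<And>\<alpha> \<beta> a a' b b' x. \<alpha> \<in> Hom A a' a \<Longrightarrow> \<beta> \<in> Hom B b b' \<Longrightarrow> x \<in> X a b \<Longrightarrow> smap (far P (\<alpha>, \<beta>)) x \<in> X a' b'"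
    and ide: "\<And>a b x. a \<in> Obj A \<Longrightarrow> b \<in> Obj B \<Longrightarrow> x \<in> X a b \<Longrightarrow> smap (far P (Ide A a, Ide B b)) x = x"
    and cmp: "\<And>\<alpha> \<beta> \<alpha>' \<beta>' a a' a'' b b' b'' x. \<alpha> \<in> Hom A a' a \<Longrightarrow> \<beta> \<in> Hom B b b' \<Longrightarrow>
      \<alpha>' \<in> Hom A a'' a' \<Longrightarrow> \<beta>' \<in> Hom B b' b'' \<Longrightarrow> x \<in> X a b \<Longrightarrow>
      smap (far P (\<alpha>', \<beta>')) (smap (far P (\<alpha>, \<beta>)) x) = smap (far P (Cmp A \<alpha> \<alpha>', Cmp B \<beta>' \<beta>)) x"
  shows "profunctor \<lparr>psrc = A, ptgt = B, pfun = P\<rparr>"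
proof -
  interpret A: category A by fact
  interpret B: category B by fact
  have H: "far P (\<alpha>, \<beta>) \<in> Hom set_cat (X a b) (X a' b')" if "\<alpha> \<in> Hom A a' a" "\<beta> \<in> Hom B b b'" for \<alpha> \<beta> a a' b b'
    using s[of \<alpha> \<beta>] i[OF that] that by (auto simp: Hom_set_cat HomD PiE_def)
  have "cat_functor P"
  proof (rule cat_functor.intro)
    fix p q r assume "p \<in> Hom (fdom P) q r"
    then show "far P p \<in> Hom (fcod P) (fob P q) (fob P r)"
      using H A.Hom_Obj B.Hom_Obj X by (cases p; cases q; cases r) (auto simp: P; metis)
  next
    fix q assume q: "q \<in> Obj (fdom P)"
    then obtain a b where ab: "q = (a, b)" "a \<in> Obj A" "b \<in> Obj B" by (cases q) (auto simp: P)
    have "far P (Ide A a, Ide B b) \<in> Hom set_cat (X a b) (X a b)" using ab H A.Ide_Hom B.Ide_Hom by auto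
    then have "far P (Ide A a, Ide B b) = Ide set_cat (X a b)"
      by (rule sarr_eqI) (use ab ide in \<open>auto simp: Hom_set_cat\<close>)
    then show "far P (Ide (fdom P) q) = Ide (fcod P) (fob P q)" using ab X by (simp add: P)
  next
    fix p q r p' r' assume "p \<in> Hom (fdom P) q r" "p' \<in> Hom (fdom P) r r'"
    then obtain \<alpha> \<beta> \<alpha>' \<beta>' a a' a'' b b' b'' where
      e: "p = (\<alpha>, \<beta>)" "p' = (\<alpha>', \<beta>')" "q = (a, b)" "r = (a', b')" "r' = (a'', b'')"
      and h: "\<alpha> \<in> Hom A a' a" "\<beta> \<in> Hom B b b'" "\<alpha>' \<in> Hom A a'' a'" "\<beta>' \<in> Hom B b' b''"
      by (cases p; cases p'; cases q; cases r; cases r') (auto simp: P)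
    have "far P (Cmp A \<alpha> \<alpha>', Cmp B \<beta>' \<beta>) \<in> Hom set_cat (X a b) (X a'' b'')"
      using h A.Cmp_Hom B.Cmp_Hom H by blast
    moreover have h1: "far P (\<alpha>, \<beta>) \<in> Hom set_cat (X a b) (X a' b')" "far P (\<alpha>', \<beta>') \<in> Hom set_cat (X a' b') (X a'' b'')"
      using h H by blast+
    moreover have "Cmp set_cat (far P (\<alpha>', \<beta>')) (far P (\<alpha>, \<beta>)) \<in> Hom set_cat (X a b) (X a'' b'')"
      by (rule category.Cmp_Hom[OF category_set_cat h1])
    ultimately have "far P (Cmp A \<alpha> \<alpha>', Cmp B \<beta>' \<beta>) = Cmp set_cat (far P (\<alpha>', \<beta>')) (far P (\<alpha>, \<beta>))"
      using cmp[OF h] by (intro sarr_eqI) (auto simp: Hom_set_cat)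
    then show "far P (Cmp (fdom P) p' p) = Cmp (fcod P) (far P p') (far P p)" by (simp add: P e)
  qed (use P in \<open>auto simp: P A B category_op_cat category_prod_cat category_set_cat PiE_def\<close>)
  then show ?thesis by (simp add: profunctor_def A B P)
qed

abbreviation cmap :: "'u pcell \<Rightarrow> 'u \<Rightarrow> 'u \<Rightarrow> 'u \<Rightarrow> 'u" where
  "cmap \<tau> a b x \<equiv> smap (cnat \<tau> (a, b)) x"

lemma profunctor_cats: assumes "profunctor \<Phi>" shows "category (psrc \<Phi>)" "category (ptgt \<Phi>)"
   "Obj (fdom (pfun \<Phi>)) = Obj (psrc \<Phi>) \<times> Obj (ptgt \<Phi>)"
  using assms by (auto simp: profunctor_def)

lemma cellD:
  assumes "profunctor_cell \<tau>"
  shows "profunctor (cdom \<tau>)" "profunctor (ccod \<tau>)" "cat_functor (csrc \<tau>)" "cat_functor (ctgt \<tau>)"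
    "fdom (csrc \<tau>) = psrc (cdom \<tau>)" "fcod (csrc \<tau>) = psrc (ccod \<tau>)"
    "fdom (ctgt \<tau>) = ptgt (cdom \<tau>)" "fcod (ctgt \<tau>) = ptgt (ccod \<tau>)"
    "cnat \<tau> \<in> extensional (Obj (psrc (cdom \<tau>)) \<times> Obj (ptgt (cdom \<tau>)))"
  using assms by (auto simp: profunctor_cell_def nat_trans_def profunctor_def)

lemma cell_nat_Hom:
  assumes "profunctor_cell \<tau>" "a \<in> Obj (psrc (cdom \<tau>))" "b \<in> Obj (ptgt (cdom \<tau>))"
  shows "cnat \<tau> (a, b) \<in> Hom set_cat (pset (cdom \<tau>) a b) (pset (ccod \<tau>) (fob (csrc \<tau>) a) (fob (ctgt \<tau>) b))"
proof -
  have "nat_trans (pfun (cdom \<tau>)) (fcmp (pfun (ccod \<tau>)) (fprod (fop (csrc \<tau>)) (ctgt \<tau>))) (cnat \<tau>)"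
    using assms by (simp add: profunctor_cell_def)
  then have "\<forall>p\<in>Obj (fdom (pfun (cdom \<tau>))). cnat \<tau> p \<in> Hom (fcod (pfun (cdom \<tau>))) (fob (pfun (cdom \<tau>)) p)
     (fob (fcmp (pfun (ccod \<tau>)) (fprod (fop (csrc \<tau>)) (ctgt \<tau>))) p)"
    unfolding nat_trans_def by blast
  from this[rule_format, of "(a, b)"] show ?thesis using assms cellD[OF assms(1)] by (auto simp: profunctor_def)
qed

lemma cmap_in:
  assumes "profunctor_cell \<tau>" "a \<in> Obj (psrc (cdom \<tau>))" "b \<in> Obj (ptgt (cdom \<tau>))" "x \<in> pset (cdom \<tau>) a b"
  shows "cmap \<tau> a b x \<in> pset (ccod \<tau>) (fob (csrc \<tau>) a) (fob (ctgt \<tau>) b)"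
  using cell_nat_Hom[OF assms(1-3)] assms(4) by (auto simp: Hom_set_cat)

lemma cmap_natural:
  assumes t: "profunctor_cell \<tau>" and h: "\<alpha> \<in> Hom (psrc (cdom \<tau>)) a' a" "\<beta> \<in> Hom (ptgt (cdom \<tau>)) b b'" "x \<in> pset (cdom \<tau>) a b"
  shows "cmap \<tau> a' b' (pact (cdom \<tau>) \<alpha> \<beta> x) = pact (ccod \<tau>) (far (csrc \<tau>) \<alpha>) (far (ctgt \<tau>) \<beta>) (cmap \<tau> a b x)"
proof -
  note c = cellD[OF t]
  interpret A: category "psrc (cdom \<tau>)" using c by (simp add: profunctor_cats)
  interpret B: category "ptgt (cdom \<tau>)" using c by (simp add: profunctor_cats)
  interpret F: cat_functor "pfun (cdom \<tau>)" using c by (simp add: profunctor_def)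
  have d: "fdom (pfun (cdom \<tau>)) = prod_cat (op_cat (psrc (cdom \<tau>))) (ptgt (cdom \<tau>))" "fcod (pfun (cdom \<tau>)) = set_cat"
    using c by (auto simp: profunctor_def)
  have "nat_trans (pfun (cdom \<tau>)) (fcmp (pfun (ccod \<tau>)) (fprod (fop (csrc \<tau>)) (ctgt \<tau>))) (cnat \<tau>)"
    using t by (simp add: profunctor_cell_def)
  then have *: "\<forall>p q. \<forall>f\<in>Hom (fdom (pfun (cdom \<tau>))) p q. Cmp set_cat (cnat \<tau> q) (far (pfun (cdom \<tau>)) f) =
     Cmp set_cat (far (fcmp (pfun (ccod \<tau>)) (fprod (fop (csrc \<tau>)) (ctgt \<tau>))) f) (cnat \<tau> p)"
    by (simp add: nat_trans_def d)
  have e: "Cmp set_cat (cnat \<tau> (a', b')) (far (pfun (cdom \<tau>)) (\<alpha>, \<beta>)) =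
     Cmp set_cat (far (pfun (ccod \<tau>)) (far (csrc \<tau>) \<alpha>, far (ctgt \<tau>) \<beta>)) (cnat \<tau> (a, b))"
    using *[rule_format, of "(\<alpha>, \<beta>)" "(a, b)" "(a', b')"] h by (auto simp: d c HomD)
  have "far (pfun (cdom \<tau>)) (\<alpha>, \<beta>) \<in> Hom set_cat (pset (cdom \<tau>) a b) (pset (cdom \<tau>) a' b')"
    using F.far_Hom[of "(\<alpha>, \<beta>)" "(a, b)" "(a', b')"] h by (auto simp: d)
  moreover have "cnat \<tau> (a, b) \<in> Hom set_cat (pset (cdom \<tau>) a b) (pset (ccod \<tau>) (fob (csrc \<tau>) a) (fob (ctgt \<tau>) b))"
    by (rule cell_nat_Hom[OF t]) (use h A.Hom_Obj B.Hom_Obj in auto)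
  ultimately show ?thesis using arg_cong[OF e, of "\<lambda>f. smap f x"] h by (simp add: Hom_set_cat)
qed

lemma profunctor_cellI:
  assumes P: "profunctor \<Phi>" "profunctor \<Psi>" and F: "cat_functor F" "fdom F = psrc \<Phi>" "fcod F = psrc \<Psi>"
    and G: "cat_functor G" "fdom G = ptgt \<Phi>" "fcod G = ptgt \<Psi>"
    and n: "n \<in> extensional (Obj (psrc \<Phi>) \<times> Obj (ptgt \<Phi>))"
    and s: "\<And>a b. a \<in> Obj (psrc \<Phi>) \<Longrightarrow> b \<in> Obj (ptgt \<Phi>) \<Longrightarrow> sdom (n (a, b)) = pset \<Phi> a b \<and>
       scod (n (a, b)) = pset \<Psi> (fob F a) (fob G b) \<and> smap (n (a, b)) \<in> extensional (pset \<Phi> a b)"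
    and i: "\<And>a b x. a \<in> Obj (psrc \<Phi>) \<Longrightarrow> b \<in> Obj (ptgt \<Phi>) \<Longrightarrow> x \<in> pset \<Phi> a b \<Longrightarrow> smap (n (a, b)) x \<in> pset \<Psi> (fob F a) (fob G b)"
    and nat: "\<And>\<alpha> \<beta> a a' b b' x. \<alpha> \<in> Hom (psrc \<Phi>) a' a \<Longrightarrow> \<beta> \<in> Hom (ptgt \<Phi>) b b' \<Longrightarrow> x \<in> pset \<Phi> a b \<Longrightarrow>
       smap (n (a', b')) (pact \<Phi> \<alpha> \<beta> x) = pact \<Psi> (far F \<alpha>) (far G \<beta>) (smap (n (a, b)) x)"
  shows "profunctor_cell \<lparr>cdom = \<Phi>, ccod = \<Psi>, csrc = F, ctgt = G, cnat = n\<rparr>"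
proof -
  interpret A: category "psrc \<Phi>" using P by (simp add: profunctor_cats)
  interpret B: category "ptgt \<Phi>" using P by (simp add: profunctor_cats)
  interpret X: cat_functor "pfun \<Phi>" using P by (simp add: profunctor_def)
  interpret Y: cat_functor "pfun \<Psi>" using P by (simp add: profunctor_def)
  interpret F: cat_functor F by fact
  interpret G: cat_functor G by fact
  have d: "fdom (pfun \<Phi>) = prod_cat (op_cat (psrc \<Phi>)) (ptgt \<Phi>)" "fcod (pfun \<Phi>) = set_cat"
    "fdom (pfun \<Psi>) = prod_cat (op_cat (psrc \<Psi>)) (ptgt \<Psi>)" "fcod (pfun \<Psi>) = set_cat"
    using P by (auto simp: profunctor_def)
  let ?H = "fcmp (pfun \<Psi>) (fprod (fop F) G)"
  have H: "cat_functor ?H" by (intro functor_fcmp functor_fprod functor_fop) (use P F G d in \<open>auto simp: profunctor_def\<close>)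
  have nH: "n (a, b) \<in> Hom set_cat (pset \<Phi> a b) (pset \<Psi> (fob F a) (fob G b))" if "a \<in> Obj (psrc \<Phi>)" "b \<in> Obj (ptgt \<Phi>)" for a b
    using s[OF that] i[OF that] by (auto simp: Hom_set_cat PiE_def)
  have "nat_trans (pfun \<Phi>) ?H n"
    unfolding nat_trans_def
  proof (intro conjI allI ballI)
    fix p assume "p \<in> Obj (fdom (pfun \<Phi>))"
    then show "n p \<in> Hom (fcod (pfun \<Phi>)) (fob (pfun \<Phi>) p) (fob ?H p)"
      using nH F G by (cases p) (auto simp: d)
  next
    fix p q f assume "f \<in> Hom (fdom (pfun \<Phi>)) p q"
    then obtain \<alpha> \<beta> a a' b b' where e: "f = (\<alpha>, \<beta>)" "p = (a, b)" "q = (a', b')" and h: "\<alpha> \<in> Hom (psrc \<Phi>) a' a" "\<beta> \<in> Hom (ptgt \<Phi>) b b'"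
      by (cases f; cases p; cases q) (auto simp: d)
    have o: "a \<in> Obj (psrc \<Phi>)" "a' \<in> Obj (psrc \<Phi>)" "b \<in> Obj (ptgt \<Phi>)" "b' \<in> Obj (ptgt \<Phi>)"
      using h A.Hom_Obj B.Hom_Obj by auto
    have 1: "far (pfun \<Phi>) (\<alpha>, \<beta>) \<in> Hom set_cat (pset \<Phi> a b) (pset \<Phi> a' b')"
      using X.far_Hom[of "(\<alpha>, \<beta>)" "(a, b)" "(a', b')"] h by (auto simp: d)
    have 2: "far (pfun \<Psi>) (far F \<alpha>, far G \<beta>) \<in> Hom set_cat (pset \<Psi> (fob F a) (fob G b)) (pset \<Psi> (fob F a') (fob G b'))"
      using Y.far_Hom[of "(far F \<alpha>, far G \<beta>)" "(fob F a, fob G b)" "(fob F a', fob G b')"] h F G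
       F.far_Hom[of \<alpha> a' a] G.far_Hom[of \<beta> b b'] by (auto simp: d)
    have "Cmp set_cat (n (a', b')) (far (pfun \<Phi>) (\<alpha>, \<beta>)) = Cmp set_cat (far (pfun \<Psi>) (far F \<alpha>, far G \<beta>)) (n (a, b))"
      by (rule sarr_eqI[OF category.Cmp_Hom[OF category_set_cat 1 nH] category.Cmp_Hom[OF category_set_cat nH 2]])
       (use o nat[OF h] 1 nH[of a b] in \<open>auto simp: Hom_set_cat\<close>)
    then show "Cmp (fcod (pfun \<Phi>)) (n q) (far (pfun \<Phi>) f) = Cmp (fcod (pfun \<Phi>)) (far ?H f) (n p)"
      using h F G by (simp add: d e HomD)
  qed (use X.cat_functor_axioms H n F G in \<open>auto simp: d\<close>)
  then show ?thesis using P F G by (simp add: profunctor_cell_def)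
qed

lemma pcell_eqI:
  assumes "profunctor_cell \<sigma>" "profunctor_cell \<tau>" "cdom \<sigma> = cdom \<tau>" "ccod \<sigma> = ccod \<tau>" "csrc \<sigma> = csrc \<tau>" "ctgt \<sigma> = ctgt \<tau>"
    "\<And>a b x. a \<in> Obj (psrc (cdom \<sigma>)) \<Longrightarrow> b \<in> Obj (ptgt (cdom \<sigma>)) \<Longrightarrow> x \<in> pset (cdom \<sigma>) a b \<Longrightarrow> cmap \<sigma> a b x = cmap \<tau> a b x"
  shows "\<sigma> = \<tau>"
proof -
  have "cnat \<sigma> = cnat \<tau>"
  proof (rule extensionalityI[OF cellD(9)[OF assms(1)]])
    show "cnat \<tau> \<in> extensional (Obj (psrc (cdom \<sigma>)) \<times> Obj (ptgt (cdom \<sigma>)))" using cellD(9)[OF assms(2)] assms by simp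
    fix p assume "p \<in> Obj (psrc (cdom \<sigma>)) \<times> Obj (ptgt (cdom \<sigma>))"
    then obtain a b where p: "p = (a, b)" "a \<in> Obj (psrc (cdom \<sigma>))" "b \<in> Obj (ptgt (cdom \<sigma>))" by auto
    show "cnat \<sigma> p = cnat \<tau> p" unfolding p(1)
      by (rule sarr_eqI[OF cell_nat_Hom[OF assms(1)]]) (use p assms cell_nat_Hom[OF assms(2), of a b] in auto)
  qed
  then show ?thesis using assms by (cases \<sigma>; cases \<tau>) auto
qed

lemma prof_cat_simps [simp]: "Obj prof_cat = {\<Phi>. profunctor \<Phi>}" "Arr prof_cat = {\<tau>. profunctor_cell \<tau>}"
  "Dom prof_cat = cdom" "Cod prof_cat = ccod"
  by (auto simp: prof_cat_def)

lemma Ide_prof_simps [simp]: "cdom (Ide prof_cat \<Phi>) = \<Phi>" "ccod (Ide prof_cat \<Phi>) = \<Phi>"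
  "csrc (Ide prof_cat \<Phi>) = fid (psrc \<Phi>)" "ctgt (Ide prof_cat \<Phi>) = fid (ptgt \<Phi>)"
  by (auto simp: prof_cat_def)

lemma cmap_Ide [simp]: "profunctor \<Phi> \<Longrightarrow> a \<in> Obj (psrc \<Phi>) \<Longrightarrow> b \<in> Obj (ptgt \<Phi>) \<Longrightarrow> x \<in> pset \<Phi> a b \<Longrightarrow>
   cmap (Ide prof_cat \<Phi>) a b x = x"
  by (auto simp: prof_cat_def profunctor_cats)

lemma Cmp_prof_simps [simp]: "cdom (Cmp prof_cat \<sigma> \<tau>) = cdom \<tau>" "ccod (Cmp prof_cat \<sigma> \<tau>) = ccod \<sigma>"
  "csrc (Cmp prof_cat \<sigma> \<tau>) = fcmp (csrc \<sigma>) (csrc \<tau>)" "ctgt (Cmp prof_cat \<sigma> \<tau>) = fcmp (ctgt \<sigma>) (ctgt \<tau>)"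
  by (auto simp: prof_cat_def)

lemma cmap_Cmp [simp]: "profunctor_cell \<tau> \<Longrightarrow> a \<in> Obj (psrc (cdom \<tau>)) \<Longrightarrow> b \<in> Obj (ptgt (cdom \<tau>)) \<Longrightarrow> x \<in> pset (cdom \<tau>) a b \<Longrightarrow>
   cmap (Cmp prof_cat \<sigma> \<tau>) a b x = cmap \<sigma> (fob (csrc \<tau>) a) (fob (ctgt \<tau>) b) (cmap \<tau> a b x)"
  using cell_nat_Hom[of \<tau> a b] by (auto simp: prof_cat_def profunctor_cats cellD Hom_set_cat)

lemma cell_Ide: assumes P: "profunctor \<Phi>" shows "profunctor_cell (Ide prof_cat \<Phi>)"
proof -
  interpret A: category "psrc \<Phi>" using P by (simp add: profunctor_cats)
  interpret B: category "ptgt \<Phi>" using P by (simp add: profunctor_cats)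
  show ?thesis
    unfolding prof_cat_def cat.simps
    apply (rule profunctor_cellI)
    using P A.Hom_Obj B.Hom_Obj pact_in[OF P]
    by (auto simp: profunctor_cats A.Hom_Obj B.Hom_Obj HomD
       intro: functor_fid)
qed

lemma fob_csrc: "profunctor_cell \<tau> \<Longrightarrow> a \<in> Obj (psrc (cdom \<tau>)) \<Longrightarrow> fob (csrc \<tau>) a \<in> Obj (psrc (ccod \<tau>))"
  using cat_functor.fob_Obj[of "csrc \<tau>" a] cellD[of \<tau>] by auto

lemma fob_ctgt: "profunctor_cell \<tau> \<Longrightarrow> a \<in> Obj (ptgt (cdom \<tau>)) \<Longrightarrow> fob (ctgt \<tau>) a \<in> Obj (ptgt (ccod \<tau>))"
  using cat_functor.fob_Obj[of "ctgt \<tau>" a] cellD[of \<tau>] by auto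

lemma far_csrc: "profunctor_cell \<tau> \<Longrightarrow> f \<in> Hom (psrc (cdom \<tau>)) a a' \<Longrightarrow> far (csrc \<tau>) f \<in> Hom (psrc (ccod \<tau>)) (fob (csrc \<tau>) a) (fob (csrc \<tau>) a')"
  using cat_functor.far_Hom[of "csrc \<tau>" f a a'] cellD[of \<tau>] by auto

lemma far_ctgt: "profunctor_cell \<tau> \<Longrightarrow> f \<in> Hom (ptgt (cdom \<tau>)) a a' \<Longrightarrow> far (ctgt \<tau>) f \<in> Hom (ptgt (ccod \<tau>)) (fob (ctgt \<tau>) a) (fob (ctgt \<tau>) a')"
  using cat_functor.far_Hom[of "ctgt \<tau>" f a a'] cellD[of \<tau>] by auto

lemma cell_Cmp: assumes s: "profunctor_cell \<sigma>" and t: "profunctor_cell \<tau>" and e: "cdom \<sigma> = ccod \<tau>"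
  shows "profunctor_cell (Cmp prof_cat \<sigma> \<tau>)"
proof -
  note S = cellD[OF s] and T = cellD[OF t]
  interpret A: category "psrc (cdom \<tau>)" using T by (simp add: profunctor_cats)
  interpret B: category "ptgt (cdom \<tau>)" using T by (simp add: profunctor_cats)
  have c: "smap (cnat (Cmp prof_cat \<sigma> \<tau>) (a, b)) x = cmap \<sigma> (fob (csrc \<tau>) a) (fob (ctgt \<tau>) b) (cmap \<tau> a b x)"
   if "a \<in> Obj (psrc (cdom \<tau>))" "b \<in> Obj (ptgt (cdom \<tau>))" "x \<in> pset (cdom \<tau>) a b" for a b x
    using cmap_Cmp[OF t that] .
  have "profunctor_cell \<lparr>cdom = cdom \<tau>, ccod = ccod \<sigma>, csrc = fcmp (csrc \<sigma>) (csrc \<tau>), ctgt = fcmp (ctgt \<sigma>) (ctgt \<tau>),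
     cnat = cnat (Cmp prof_cat \<sigma> \<tau>)\<rparr>"
  proof (rule profunctor_cellI)
    show "cnat (Cmp prof_cat \<sigma> \<tau>) \<in> extensional (Obj (psrc (cdom \<tau>)) \<times> Obj (ptgt (cdom \<tau>)))"
      using T by (auto simp: prof_cat_def profunctor_cats)
  next
    fix a b assume o: "a \<in> Obj (psrc (cdom \<tau>))" "b \<in> Obj (ptgt (cdom \<tau>))"
    show "sdom (cnat (Cmp prof_cat \<sigma> \<tau>) (a, b)) = pset (cdom \<tau>) a b \<and>
           scod (cnat (Cmp prof_cat \<sigma> \<tau>) (a, b)) = pset (ccod \<sigma>) (fob (fcmp (csrc \<sigma>) (csrc \<tau>)) a) (fob (fcmp (ctgt \<sigma>) (ctgt \<tau>)) b) \<and>
           smap (cnat (Cmp prof_cat \<sigma> \<tau>) (a, b)) \<in> extensional (pset (cdom \<tau>) a b)"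
      using cell_nat_Hom[OF t o] cell_nat_Hom[OF s, of "fob (csrc \<tau>) a" "fob (ctgt \<tau>) b"] fob_csrc[OF t] fob_ctgt[OF t] o T S e
      by (auto simp: prof_cat_def profunctor_cats Hom_set_cat)
  next
    fix a b x assume o: "a \<in> Obj (psrc (cdom \<tau>))" "b \<in> Obj (ptgt (cdom \<tau>))" "x \<in> pset (cdom \<tau>) a b"
    show "cmap (Cmp prof_cat \<sigma> \<tau>) a b x \<in> pset (ccod \<sigma>) (fob (fcmp (csrc \<sigma>) (csrc \<tau>)) a) (fob (fcmp (ctgt \<sigma>) (ctgt \<tau>)) b)"
      using o cmap_in[OF t o] fob_csrc[OF t] fob_ctgt[OF t] e T by (auto simp: c intro!: cmap_in[OF s])
  next
    fix \<alpha> \<beta> a a' b b' x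
    assume h: "\<alpha> \<in> Hom (psrc (cdom \<tau>)) a' a" "\<beta> \<in> Hom (ptgt (cdom \<tau>)) b b'" "x \<in> pset (cdom \<tau>) a b"
    have o: "a \<in> Obj (psrc (cdom \<tau>))" "a' \<in> Obj (psrc (cdom \<tau>))" "b \<in> Obj (ptgt (cdom \<tau>))" "b' \<in> Obj (ptgt (cdom \<tau>))"
      using h A.Hom_Obj B.Hom_Obj by auto
    have "cmap \<sigma> (fob (csrc \<tau>) a') (fob (ctgt \<tau>) b') (pact (cdom \<sigma>) (far (csrc \<tau>) \<alpha>) (far (ctgt \<tau>) \<beta>) (cmap \<tau> a b x)) =
      pact (ccod \<sigma>) (far (csrc \<sigma>) (far (csrc \<tau>) \<alpha>)) (far (ctgt \<sigma>) (far (ctgt \<tau>) \<beta>)) (cmap \<sigma> (fob (csrc \<tau>) a) (fob (ctgt \<tau>) b) (cmap \<tau> a b x))"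
      by (rule cmap_natural[OF s]) (use far_csrc[OF t h(1)] far_ctgt[OF t h(2)] cmap_in[OF t o(1,3) h(3)] e in auto)
    then show "cmap (Cmp prof_cat \<sigma> \<tau>) a' b' (pact (cdom \<tau>) \<alpha> \<beta> x) =
       pact (ccod \<sigma>) (far (fcmp (csrc \<sigma>) (csrc \<tau>)) \<alpha>) (far (fcmp (ctgt \<sigma>) (ctgt \<tau>)) \<beta>) (cmap (Cmp prof_cat \<sigma> \<tau>) a b x)"
      using o h T pact_in[OF T(1) h] by (simp add: c cmap_natural[OF t h] HomD e)
  qed (use S T e in \<open>auto intro!: functor_fcmp\<close>)
  moreover have "\<lparr>cdom = cdom \<tau>, ccod = ccod \<sigma>, csrc = fcmp (csrc \<sigma>) (csrc \<tau>), ctgt = fcmp (ctgt \<sigma>) (ctgt \<tau>),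
     cnat = cnat (Cmp prof_cat \<sigma> \<tau>)\<rparr> = Cmp prof_cat \<sigma> \<tau>" by (simp add: prof_cat_def)
  ultimately show ?thesis by simp
qed

lemma category_prof_cat: "category prof_cat"
proof
  fix \<tau> :: "'u pcell" and \<Phi> \<Psi> assume "\<tau> \<in> Hom prof_cat \<Phi> \<Psi>"
  then have t: "profunctor_cell \<tau>" and e: "cdom \<tau> = \<Phi>" "ccod \<tau> = \<Psi>" by (auto simp: Hom_def)
  note T = cellD[OF t]
  show "Cmp prof_cat \<tau> (Ide prof_cat \<Phi>) = \<tau>"
    by (rule pcell_eqI) (use t T e fcmp_fid[of "csrc \<tau>"] fcmp_fid[of "ctgt \<tau>"] cell_Ide[OF T(1)] in
      \<open>auto intro!: cell_Cmp cell_Ide simp: profunctor_cats\<close>)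
  show "Cmp prof_cat (Ide prof_cat \<Psi>) \<tau> = \<tau>"
    by (rule pcell_eqI) (use t T e fcmp_fid[of "csrc \<tau>"] fcmp_fid[of "ctgt \<tau>"] fob_csrc[OF t] fob_ctgt[OF t] cmap_in[OF t] in
      \<open>auto intro!: cell_Cmp cell_Ide simp: profunctor_cats\<close>)
next
  fix \<tau> \<sigma> \<rho> :: "'u pcell" and \<Phi> \<Psi> X Y assume "\<tau> \<in> Hom prof_cat \<Phi> \<Psi>" "\<sigma> \<in> Hom prof_cat \<Psi> X" "\<rho> \<in> Hom prof_cat X Y"
  then have t: "profunctor_cell \<tau>" "profunctor_cell \<sigma>" "profunctor_cell \<rho>"
    and e: "cdom \<tau> = \<Phi>" "ccod \<tau> = \<Psi>" "cdom \<sigma> = \<Psi>" "ccod \<sigma> = X" "cdom \<rho> = X" "ccod \<rho> = Y" by (auto simp: Hom_def)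
  note T = cellD[OF t(1)] cellD[OF t(2)] cellD[OF t(3)]
  show "Cmp prof_cat \<rho> (Cmp prof_cat \<sigma> \<tau>) = Cmp prof_cat (Cmp prof_cat \<rho> \<sigma>) \<tau>"
    by (rule pcell_eqI) (use t T e fob_csrc[OF t(1)] fob_ctgt[OF t(1)] cmap_in[OF t(1)] cell_Cmp[OF t(2,1)] cell_Cmp[OF t(3,2)] in
      \<open>auto intro!: cell_Cmp fcmp_assoc\<close>)
next
  fix \<tau> \<sigma> :: "'u pcell" and \<Phi> \<Psi> X assume "\<tau> \<in> Hom prof_cat \<Phi> \<Psi>" "\<sigma> \<in> Hom prof_cat \<Psi> X"
  then show "Cmp prof_cat \<sigma> \<tau> \<in> Hom prof_cat \<Phi> X" by (auto simp: Hom_def intro!: cell_Cmp)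
qed (auto simp: Hom_def cellD cell_Ide)

lemma hom_prof_simps [simp]: "psrc (hom_prof A) = A" "ptgt (hom_prof A) = A"
  by (auto simp: hom_prof_def)

lemma pset_hom_prof [simp]: "a \<in> Obj A \<Longrightarrow> b \<in> Obj A \<Longrightarrow> pset (hom_prof A) a b = Hom A a b"
  by (auto simp: hom_prof_def hom_ftor_def)

lemma pact_hom_prof [simp]: "\<alpha> \<in> Hom A a' a \<Longrightarrow> \<beta> \<in> Hom A b b' \<Longrightarrow> h \<in> Hom A a b \<Longrightarrow>
   pact (hom_prof A) \<alpha> \<beta> h = Cmp A \<beta> (Cmp A h \<alpha>)"
  by (auto simp: hom_prof_def hom_ftor_def HomD)

lemma profunctor_hom_prof: assumes A: "category A" shows "profunctor (hom_prof A)"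
proof -
  interpret category A by fact
  show ?thesis
    unfolding hom_prof_def
  proof (rule profunctorI[where X = "Hom A"])
    fix \<alpha> \<beta> a a' b b' x assume h: "\<alpha> \<in> Hom A a' a" "\<beta> \<in> Hom A b b'" "x \<in> Hom A a b"
    show "smap (far (hom_ftor A) (\<alpha>, \<beta>)) x \<in> Hom A a' b'"
      using pact_hom_prof[OF h] Cmp_Hom[OF Cmp_Hom[OF h(1,3)] h(2)] by (simp add: hom_prof_def)
  next
    fix a b x assume h: "a \<in> Obj A" "b \<in> Obj A" "x \<in> Hom A a b"
    show "smap (far (hom_ftor A) (Ide A a, Ide A b)) x = x"
      using pact_hom_prof[OF Ide_Hom Ide_Hom h(3)] h by (simp add: hom_prof_def Cmp_Ide_left Cmp_Ide_right)
  next
    fix \<alpha> \<beta> \<alpha>' \<beta>' a a' a'' b b' b'' x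
    assume h: "\<alpha> \<in> Hom A a' a" "\<beta> \<in> Hom A b b'" "\<alpha>' \<in> Hom A a'' a'" "\<beta>' \<in> Hom A b' b''" "x \<in> Hom A a b"
    have 1: "Cmp A x \<alpha> \<in> Hom A a' b" "Cmp A \<beta> (Cmp A x \<alpha>) \<in> Hom A a' b'" using h Cmp_Hom by blast+
    have 2: "Cmp A \<alpha> \<alpha>' \<in> Hom A a'' a" "Cmp A \<beta>' \<beta> \<in> Hom A b b''" using h Cmp_Hom by blast+
    have "Cmp A \<beta>' (Cmp A (Cmp A \<beta> (Cmp A x \<alpha>)) \<alpha>') = Cmp A (Cmp A \<beta>' \<beta>) (Cmp A x (Cmp A \<alpha> \<alpha>'))"
      using Cmp_assoc[OF h(3) 1(1) h(2)] Cmp_assoc[OF h(3,1,5)] Cmp_assoc[OF Cmp_Hom[OF 2(1) h(5)] h(2,4)] by simp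
    then show "smap (far (hom_ftor A) (\<alpha>', \<beta>')) (smap (far (hom_ftor A) (\<alpha>, \<beta>)) x) = smap (far (hom_ftor A) (Cmp A \<alpha> \<alpha>', Cmp A \<beta>' \<beta>)) x"
      using pact_hom_prof[OF h(1,2,5)] pact_hom_prof[OF h(3,4) 1(2)] pact_hom_prof[OF 2 h(5)] by (simp add: hom_prof_def)
  qed (auto simp: A hom_ftor_def)
qed

lemma inj_code3: "inj (code3 :: 'u::infinite \<times> 'u \<times> 'u \<Rightarrow> 'u)"
proof -
  have "\<exists>p :: 'u \<times> 'u \<Rightarrow> 'u. bij_betw p (UNIV \<times> UNIV) UNIV"
    unfolding card_of_ordIso using infinite_UNIV by (rule card_of_Times_same_infinite)
  then obtain p :: "'u \<times> 'u \<Rightarrow> 'u" where "bij_betw p (UNIV \<times> UNIV) UNIV" by blast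
  then have p: "inj p" by (simp add: bij_betw_def)
  have "inj (\<lambda>(a, b, c). p (a, p (b, c)))"
    by (auto simp: inj_on_def dest!: injD[OF p])
  then show ?thesis unfolding code3_def by (rule someI[of "\<lambda>e. inj e"])
qed

lemma decode3_code3 [simp]: "decode3 (code3 p) = p"
  by (simp add: decode3_def inj_code3)

lemma coend_eq_refl: "(p, p) \<in> coend_eq \<Phi> \<Psi> a c"
  by (simp add: coend_eq_def)

lemma coend_eq_sym: "(p, q) \<in> coend_eq \<Phi> \<Psi> a c \<Longrightarrow> (q, p) \<in> coend_eq \<Phi> \<Psi> a c"
  unfolding coend_eq_def by (metis converse_Un converse_converse rtrancl_converseI sup_commute)

lemma coend_eq_trans: "(p, q) \<in> coend_eq \<Phi> \<Psi> a c \<Longrightarrow> (q, r) \<in> coend_eq \<Phi> \<Psi> a c \<Longrightarrow> (p, r) \<in> coend_eq \<Phi> \<Psi> a c"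
  unfolding coend_eq_def by (rule rtrancl_trans)

lemma tensor_eqI: assumes "(p, q) \<in> coend_eq \<Phi> \<Psi> a c" shows "tensor \<Phi> \<Psi> a c p = tensor \<Phi> \<Psi> a c q"
proof -
  have "(p, r) \<in> coend_eq \<Phi> \<Psi> a c \<longleftrightarrow> (q, r) \<in> coend_eq \<Phi> \<Psi> a c" for r
    using assms coend_eq_sym coend_eq_trans by metis
  then show ?thesis by (simp add: tensor_def)
qed

lemma decode3_tensor: "(p, decode3 (tensor \<Phi> \<Psi> a c p)) \<in> coend_eq \<Phi> \<Psi> a c"
  unfolding tensor_def decode3_code3 by (rule someI, rule coend_eq_refl)

lemma tensor_slide: "\<beta> \<in> Hom (ptgt \<Phi>) b b' \<Longrightarrow> x \<in> pset \<Phi> a b \<Longrightarrow> y \<in> pset \<Psi> b' c \<Longrightarrow>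
   tensor \<Phi> \<Psi> a c (b, x, pact \<Psi> \<beta> (Ide (ptgt \<Psi>) c) y) = tensor \<Phi> \<Psi> a c (b', pact \<Phi> (Ide (psrc \<Phi>) a) \<beta> x, y)"
  by (rule tensor_eqI) (auto simp: coend_eq_def coend_rel_def intro!: r_into_rtrancl)

lemma coend_map:
  assumes "\<And>\<beta> b b' x y. \<beta> \<in> Hom (ptgt \<Phi>) b b' \<Longrightarrow> x \<in> pset \<Phi> a b \<Longrightarrow> y \<in> pset \<Psi> b' c \<Longrightarrow>
      k (b, x, pact \<Psi> \<beta> (Ide (ptgt \<Psi>) c) y) = k (b', pact \<Phi> (Ide (psrc \<Phi>) a) \<beta> x, y)"
  shows "k (decode3 (tensor \<Phi> \<Psi> a c p)) = k p"
proof -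
  have "k q = k p" if "(p, q) \<in> coend_eq \<Phi> \<Psi> a c" for q
    using that unfolding coend_eq_def
  proof induction
    case (step q r)
    then show ?case using assms by (auto simp: coend_rel_def)
  qed simp
  then show ?thesis using decode3_tensor by blast
qed

lemma prof_comp_simps [simp]: "psrc (prof_comp \<Psi> \<Phi>) = psrc \<Phi>" "ptgt (prof_comp \<Psi> \<Phi>) = ptgt \<Psi>"
  by (auto simp: prof_comp_def Let_def)

lemma pset_prof_comp: "a \<in> Obj (psrc \<Phi>) \<Longrightarrow> c \<in> Obj (ptgt \<Psi>) \<Longrightarrow>
    pset (prof_comp \<Psi> \<Phi>) a c = tensor \<Phi> \<Psi> a c ` coend_triples \<Phi> \<Psi> a c"
  by (auto simp: prof_comp_def Let_def)

lemma tensor_in: "a \<in> Obj (psrc \<Phi>) \<Longrightarrow> c \<in> Obj (ptgt \<Psi>) \<Longrightarrow> b \<in> Obj (ptgt \<Phi>) \<Longrightarrow> x \<in> pset \<Phi> a b \<Longrightarrow> y \<in> pset \<Psi> b c \<Longrightarrow>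
   tensor \<Phi> \<Psi> a c (b, x, y) \<in> pset (prof_comp \<Psi> \<Phi>) a c"
  by (auto simp: pset_prof_comp coend_triples_def)

lemma prof_comp_cases:
  assumes "z \<in> pset (prof_comp \<Psi> \<Phi>) a c" "a \<in> Obj (psrc \<Phi>)" "c \<in> Obj (ptgt \<Psi>)"
  obtains b x y where "b \<in> Obj (ptgt \<Phi>)" "x \<in> pset \<Phi> a b" "y \<in> pset \<Psi> b c" "z = tensor \<Phi> \<Psi> a c (b, x, y)"
  using assms by (auto simp: pset_prof_comp coend_triples_def)

definition composable_profs :: "'u prof \<Rightarrow> 'u prof \<Rightarrow> bool" where
  "composable_profs \<Psi> \<Phi> \<longleftrightarrow> profunctor \<Psi> \<and> profunctor \<Phi> \<and> psrc \<Psi> = ptgt \<Phi>"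

lemma act_split:
  assumes P: "profunctor \<Phi>" and h: "\<alpha> \<in> Hom (psrc \<Phi>) a' a" "\<beta> \<in> Hom (ptgt \<Phi>) b b'" "x \<in> pset \<Phi> a b"
  shows "pact \<Phi> \<alpha> (Ide (ptgt \<Phi>) b') (pact \<Phi> (Ide (psrc \<Phi>) a) \<beta> x) = pact \<Phi> \<alpha> \<beta> x" (is ?A)
    "pact \<Phi> (Ide (psrc \<Phi>) a') \<beta> (pact \<Phi> \<alpha> (Ide (ptgt \<Phi>) b) x) = pact \<Phi> \<alpha> \<beta> x" (is ?B)
proof -
  interpret A: category "psrc \<Phi>" using P by (simp add: profunctor_cats)
  interpret B: category "ptgt \<Phi>" using P by (simp add: profunctor_cats)
  have o: "a \<in> Obj (psrc \<Phi>)" "a' \<in> Obj (psrc \<Phi>)" "b \<in> Obj (ptgt \<Phi>)" "b' \<in> Obj (ptgt \<Phi>)"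
    using h A.Hom_Obj B.Hom_Obj by auto
  show ?A using pact_Cmp[OF P A.Ide_Hom[OF o(1)] h(2) h(1) B.Ide_Hom[OF o(4)] h(3)] h
    by (simp add: A.Cmp_Ide_left B.Cmp_Ide_left)
  show ?B using pact_Cmp[OF P h(1) B.Ide_Hom[OF o(3)] A.Ide_Hom[OF o(2)] h(2) h(3)] h
    by (simp add: A.Cmp_Ide_right B.Cmp_Ide_right)
qed

lemma pact_prof_comp:
  assumes c: "composable_profs \<Psi> \<Phi>" and h: "\<alpha> \<in> Hom (psrc \<Phi>) a' a" "\<gamma> \<in> Hom (ptgt \<Psi>) c c'"
    and b: "b \<in> Obj (ptgt \<Phi>)" and xy: "x \<in> pset \<Phi> a b" "y \<in> pset \<Psi> b c"
  shows "pact (prof_comp \<Psi> \<Phi>) \<alpha> \<gamma> (tensor \<Phi> \<Psi> a c (b, x, y)) =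
    tensor \<Phi> \<Psi> a' c' (b, pact \<Phi> \<alpha> (Ide (ptgt \<Phi>) b) x, pact \<Psi> (Ide (psrc \<Psi>) b) \<gamma> y)"
proof -
  have P: "profunctor \<Phi>" "profunctor \<Psi>" and e: "psrc \<Psi> = ptgt \<Phi>" using c by (auto simp: composable_profs_def)
  interpret A: category "psrc \<Phi>" using P by (simp add: profunctor_cats)
  interpret B: category "ptgt \<Phi>" using P by (simp add: profunctor_cats)
  interpret C: category "ptgt \<Psi>" using P by (simp add: profunctor_cats)
  let ?k = "\<lambda>(b, x, y). tensor \<Phi> \<Psi> a' c' (b, pact \<Phi> \<alpha> (Ide (ptgt \<Phi>) b) x, pact \<Psi> (Ide (ptgt \<Phi>) b) \<gamma> y)"
  have "tensor \<Phi> \<Psi> a c (b, x, y) \<in> tensor \<Phi> \<Psi> a c ` coend_triples \<Phi> \<Psi> a c" using xy b by (auto simp: coend_triples_def)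
  then have "pact (prof_comp \<Psi> \<Phi>) \<alpha> \<gamma> (tensor \<Phi> \<Psi> a c (b, x, y)) = ?k (decode3 (tensor \<Phi> \<Psi> a c (b, x, y)))"
    using HomD[OF h(1)] HomD[OF h(2)] by (auto simp: prof_comp_def Let_def)
  also have "\<dots> = ?k (b, x, y)"
  proof (rule coend_map)
    fix \<beta> b b' x y assume k: "\<beta> \<in> Hom (ptgt \<Phi>) b b'" "x \<in> pset \<Phi> a b" "y \<in> pset \<Psi> b' c"
    have o: "b \<in> Obj (ptgt \<Phi>)" "b' \<in> Obj (ptgt \<Phi>)" using k B.Hom_Obj by auto
    have "pact \<Psi> (Ide (ptgt \<Phi>) b) \<gamma> (pact \<Psi> \<beta> (Ide (ptgt \<Psi>) c) y) = pact \<Psi> \<beta> (Ide (ptgt \<Psi>) c') (pact \<Psi> (Ide (ptgt \<Phi>) b') \<gamma> y)"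
      using act_split[OF P(2), of \<beta> b b' \<gamma> c c' y] k h e by simp
    moreover have "pact \<Phi> \<alpha> (Ide (ptgt \<Phi>) b') (pact \<Phi> (Ide (psrc \<Phi>) a) \<beta> x) = pact \<Phi> (Ide (psrc \<Phi>) a') \<beta> (pact \<Phi> \<alpha> (Ide (ptgt \<Phi>) b) x)"
      using act_split[OF P(1), of \<alpha> a' a \<beta> b b' x] k h e by simp
    moreover have "pact \<Phi> \<alpha> (Ide (ptgt \<Phi>) b) x \<in> pset \<Phi> a' b" using pact_in[OF P(1) h(1) B.Ide_Hom[OF o(1)] k(2)] .
    moreover have "pact \<Psi> (Ide (ptgt \<Phi>) b') \<gamma> y \<in> pset \<Psi> b' c'" using pact_in[OF P(2) _ h(2) k(3)] B.Ide_Hom[OF o(2)] e by simp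
    ultimately show "?k (b, x, pact \<Psi> \<beta> (Ide (ptgt \<Psi>) c) y) = ?k (b', pact \<Phi> (Ide (psrc \<Phi>) a) \<beta> x, y)"
      using tensor_slide[OF k(1), of "pact \<Phi> \<alpha> (Ide (ptgt \<Phi>) b) x" a' "pact \<Psi> (Ide (ptgt \<Phi>) b') \<gamma> y" \<Psi> c'] by simp
  qed
  finally show ?thesis by (simp add: e)
qed

lemma profunctor_prof_comp: assumes c: "composable_profs \<Psi> \<Phi>" shows "profunctor (prof_comp \<Psi> \<Phi>)"
proof -
  have P: "profunctor \<Phi>" "profunctor \<Psi>" and e: "psrc \<Psi> = ptgt \<Phi>" using c by (auto simp: composable_profs_def)
  interpret A: category "psrc \<Phi>" using P by (simp add: profunctor_cats)
  interpret B: category "ptgt \<Phi>" using P by (simp add: profunctor_cats)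
  interpret C: category "ptgt \<Psi>" using P by (simp add: profunctor_cats)
  have i: "pact (prof_comp \<Psi> \<Phi>) \<alpha> \<beta> x \<in> pset (prof_comp \<Psi> \<Phi>) a' b'"
    if h: "\<alpha> \<in> Hom (psrc \<Phi>) a' a" "\<beta> \<in> Hom (ptgt \<Psi>) b b'" "x \<in> pset (prof_comp \<Psi> \<Phi>) a b" for \<alpha> \<beta> a a' b b' x
  proof -
    have o: "a \<in> Obj (psrc \<Phi>)" "a' \<in> Obj (psrc \<Phi>)" "b \<in> Obj (ptgt \<Psi>)" "b' \<in> Obj (ptgt \<Psi>)" using h A.Hom_Obj C.Hom_Obj by auto
    obtain d p q where z: "d \<in> Obj (ptgt \<Phi>)" "p \<in> pset \<Phi> a d" "q \<in> pset \<Psi> d b" "x = tensor \<Phi> \<Psi> a b (d, p, q)"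
      using prof_comp_cases[OF h(3) o(1,3)] by metis
    show ?thesis unfolding z(4) pact_prof_comp[OF c h(1,2) z(1-3)]
      by (rule tensor_in) (use o z pact_in[OF P(1) h(1) B.Ide_Hom z(2)] pact_in[OF P(2) _ h(2) z(3)] B.Ide_Hom e in auto)
  qed
  have "profunctor \<lparr>psrc = psrc \<Phi>, ptgt = ptgt \<Psi>, pfun = pfun (prof_comp \<Psi> \<Phi>)\<rparr>"
  proof (rule profunctorI[where X = "pset (prof_comp \<Psi> \<Phi>)"])
    fix \<alpha> \<beta> assume h: "\<alpha> \<in> Arr (psrc \<Phi>)" "\<beta> \<in> Arr (ptgt \<Psi>)"
    show "sdom (far (pfun (prof_comp \<Psi> \<Phi>)) (\<alpha>, \<beta>)) = pset (prof_comp \<Psi> \<Phi>) (Cod (psrc \<Phi>) \<alpha>) (Dom (ptgt \<Psi>) \<beta>) \<and>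
       scod (far (pfun (prof_comp \<Psi> \<Phi>)) (\<alpha>, \<beta>)) = pset (prof_comp \<Psi> \<Phi>) (Dom (psrc \<Phi>) \<alpha>) (Cod (ptgt \<Psi>) \<beta>) \<and>
       smap (far (pfun (prof_comp \<Psi> \<Phi>)) (\<alpha>, \<beta>)) \<in> extensional (pset (prof_comp \<Psi> \<Phi>) (Cod (psrc \<Phi>) \<alpha>) (Dom (ptgt \<Psi>) \<beta>))"
      using h A.Dom_Obj A.Cod_Obj C.Dom_Obj C.Cod_Obj by (auto simp: prof_comp_def Let_def)
  next
    fix a b x assume o: "a \<in> Obj (psrc \<Phi>)" "b \<in> Obj (ptgt \<Psi>)" and x: "x \<in> pset (prof_comp \<Psi> \<Phi>) a b"
    obtain d p q where z: "d \<in> Obj (ptgt \<Phi>)" "p \<in> pset \<Phi> a d" "q \<in> pset \<Psi> d b" "x = tensor \<Phi> \<Psi> a b (d, p, q)"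
      using prof_comp_cases[OF x o] by metis
    show "pact (prof_comp \<Psi> \<Phi>) (Ide (psrc \<Phi>) a) (Ide (ptgt \<Psi>) b) x = x"
      unfolding z(4) using o z pact_prof_comp[OF c A.Ide_Hom C.Ide_Hom z(1-3)] pact_Ide[OF P(1)] pact_Ide[OF P(2)] e by simp
  next
    fix \<alpha> \<beta> \<alpha>' \<beta>' a a' a'' b b' b'' x
    assume h: "\<alpha> \<in> Hom (psrc \<Phi>) a' a" "\<beta> \<in> Hom (ptgt \<Psi>) b b'"
       "\<alpha>' \<in> Hom (psrc \<Phi>) a'' a'" "\<beta>' \<in> Hom (ptgt \<Psi>) b' b''" and x: "x \<in> pset (prof_comp \<Psi> \<Phi>) a b"
    have o: "a \<in> Obj (psrc \<Phi>)" "a' \<in> Obj (psrc \<Phi>)" "b \<in> Obj (ptgt \<Psi>)" "b' \<in> Obj (ptgt \<Psi>)" using h A.Hom_Obj C.Hom_Obj by auto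
    obtain d p q where z: "d \<in> Obj (ptgt \<Phi>)" "p \<in> pset \<Phi> a d" "q \<in> pset \<Psi> d b" "x = tensor \<Phi> \<Psi> a b (d, p, q)"
      using prof_comp_cases[OF x o(1,3)] by metis
    have d: "Ide (ptgt \<Phi>) d \<in> Hom (ptgt \<Phi>) d d" using z B.Ide_Hom by simp
    have 1: "pact \<Phi> \<alpha> (Ide (ptgt \<Phi>) d) p \<in> pset \<Phi> a' d" "pact \<Psi> (Ide (psrc \<Psi>) d) \<beta> q \<in> pset \<Psi> d b'"
      using pact_in[OF P(1) h(1) d z(2)] pact_in[OF P(2) _ h(2) z(3)] e d by auto
    show "pact (prof_comp \<Psi> \<Phi>) \<alpha>' \<beta>' (pact (prof_comp \<Psi> \<Phi>) \<alpha> \<beta> x) =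
       pact (prof_comp \<Psi> \<Phi>) (Cmp (psrc \<Phi>) \<alpha> \<alpha>') (Cmp (ptgt \<Psi>) \<beta>' \<beta>) x"
      unfolding z(4) pact_prof_comp[OF c h(1,2) z(1-3)] pact_prof_comp[OF c h(3,4) z(1) 1]
        pact_prof_comp[OF c A.Cmp_Hom[OF h(3,1)] C.Cmp_Hom[OF h(2,4)] z(1-3)]
      using pact_Cmp[OF P(1) h(1) d h(3) d z(2)] pact_Cmp[OF P(2) _ h(2) _ h(4) z(3), of "Ide (ptgt \<Phi>) d" d "Ide (ptgt \<Phi>) d"] d e
      by (simp add: B.Cmp_Ide_left[OF d])
  next
    fix \<alpha> \<beta> a a' b b' x
    assume "\<alpha> \<in> Hom (psrc \<Phi>) a' a" "\<beta> \<in> Hom (ptgt \<Psi>) b b'" "x \<in> pset (prof_comp \<Psi> \<Phi>) a b"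
    then show "pact (prof_comp \<Psi> \<Phi>) \<alpha> \<beta> x \<in> pset (prof_comp \<Psi> \<Phi>) a' b'" by (rule i)
  qed (use A.category_axioms C.category_axioms in \<open>auto simp: prof_comp_def Let_def\<close>)
  then show ?thesis by (metis prof.surjective old.unit.exhaust prof_comp_simps)
qed

definition composable_cells :: "'u pcell \<Rightarrow> 'u pcell \<Rightarrow> bool" where
  "composable_cells \<sigma> \<tau> \<longleftrightarrow> profunctor_cell \<sigma> \<and> profunctor_cell \<tau> \<and> csrc \<sigma> = ctgt \<tau>"

lemma composable_cellsD:
  assumes "composable_cells \<sigma> \<tau>"
  shows "composable_profs (cdom \<sigma>) (cdom \<tau>)" "composable_profs (ccod \<sigma>) (ccod \<tau>)"
    "profunctor_cell \<sigma>" "profunctor_cell \<tau>" "csrc \<sigma> = ctgt \<tau>" "psrc (cdom \<sigma>) = ptgt (cdom \<tau>)" "psrc (ccod \<sigma>) = ptgt (ccod \<tau>)"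
proof -
  show *: "profunctor_cell \<sigma>" "profunctor_cell \<tau>" "csrc \<sigma> = ctgt \<tau>" using assms by (auto simp: composable_cells_def)
  then show **: "psrc (cdom \<sigma>) = ptgt (cdom \<tau>)" "psrc (ccod \<sigma>) = ptgt (ccod \<tau>)"
    using cellD(5,6)[of \<sigma>] cellD(7,8)[of \<tau>] by auto
  show "composable_profs (cdom \<sigma>) (cdom \<tau>)" "composable_profs (ccod \<sigma>) (ccod \<tau>)"
    using * ** cellD[of \<sigma>] cellD[of \<tau>] by (auto simp: composable_profs_def)
qed

lemma cell_comp_simps [simp]:
  "cdom (cell_comp \<sigma> \<tau>) = prof_comp (cdom \<sigma>) (cdom \<tau>)" "ccod (cell_comp \<sigma> \<tau>) = prof_comp (ccod \<sigma>) (ccod \<tau>)"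
  "csrc (cell_comp \<sigma> \<tau>) = csrc \<tau>" "ctgt (cell_comp \<sigma> \<tau>) = ctgt \<sigma>"
  by (auto simp: cell_comp_def Let_def)

lemma cmap_cell_comp:
  assumes c: "composable_cells \<sigma> \<tau>" and o: "a \<in> Obj (psrc (cdom \<tau>))" "c \<in> Obj (ptgt (cdom \<sigma>))"
    and b: "b \<in> Obj (ptgt (cdom \<tau>))" and xy: "x \<in> pset (cdom \<tau>) a b" "y \<in> pset (cdom \<sigma>) b c"
  shows "cmap (cell_comp \<sigma> \<tau>) a c (tensor (cdom \<tau>) (cdom \<sigma>) a c (b, x, y)) =
     tensor (ccod \<tau>) (ccod \<sigma>) (fob (csrc \<tau>) a) (fob (ctgt \<sigma>) c) (fob (ctgt \<tau>) b, cmap \<tau> a b x, cmap \<sigma> b c y)"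
proof -
  note C = composable_cellsD[OF c]
  have s: "profunctor_cell \<sigma>" and t: "profunctor_cell \<tau>" and e: "csrc \<sigma> = ctgt \<tau>" using c by (auto simp: composable_cells_def)
  note S = cellD[OF s] and T = cellD[OF t]
  interpret A: category "psrc (cdom \<tau>)" using T by (simp add: profunctor_cats)
  interpret B: category "ptgt (cdom \<tau>)" using T by (simp add: profunctor_cats)
  interpret C: category "ptgt (cdom \<sigma>)" using S by (simp add: profunctor_cats)
  interpret F: cat_functor "csrc \<tau>" using T by simp
  interpret H: cat_functor "ctgt \<sigma>" using S by simp
  let ?k = "\<lambda>(b, x, y). tensor (ccod \<tau>) (ccod \<sigma>) (fob (csrc \<tau>) a) (fob (ctgt \<sigma>) c) (fob (ctgt \<tau>) b, cmap \<tau> a b x, cmap \<sigma> b c y)"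
  have P: "Obj (fdom (pfun (prof_comp (cdom \<sigma>) (cdom \<tau>)))) = Obj (psrc (cdom \<tau>)) \<times> Obj (ptgt (cdom \<sigma>))"
    using profunctor_cats(3)[OF profunctor_prof_comp[OF C(1)]] by simp
  have "cmap (cell_comp \<sigma> \<tau>) a c (tensor (cdom \<tau>) (cdom \<sigma>) a c (b, x, y)) = ?k (decode3 (tensor (cdom \<tau>) (cdom \<sigma>) a c (b, x, y)))"
    using tensor_in[OF o b xy] o by (simp add: cell_comp_def Let_def P)
  also have "\<dots> = ?k (b, x, y)"
  proof (rule coend_map)
    fix \<beta> b b' x y assume k: "\<beta> \<in> Hom (ptgt (cdom \<tau>)) b b'" "x \<in> pset (cdom \<tau>) a b" "y \<in> pset (cdom \<sigma>) b' c"
    have ob: "b \<in> Obj (ptgt (cdom \<tau>))" "b' \<in> Obj (ptgt (cdom \<tau>))" using k B.Hom_Obj by auto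
    have 1: "cmap \<sigma> b c (pact (cdom \<sigma>) \<beta> (Ide (ptgt (cdom \<sigma>)) c) y) =
      pact (ccod \<sigma>) (far (ctgt \<tau>) \<beta>) (Ide (ptgt (ccod \<sigma>)) (fob (ctgt \<sigma>) c)) (cmap \<sigma> b' c y)"
      using cmap_natural[OF s, of \<beta> b b' "Ide (ptgt (cdom \<sigma>)) c" c c y] k C.Ide_Hom[OF o(2)] C(5,6) H.far_Ide[of c] o S by simp
    have 2: "cmap \<tau> a b' (pact (cdom \<tau>) (Ide (psrc (cdom \<tau>)) a) \<beta> x) =
      pact (ccod \<tau>) (Ide (psrc (ccod \<tau>)) (fob (csrc \<tau>) a)) (far (ctgt \<tau>) \<beta>) (cmap \<tau> a b x)"
      using cmap_natural[OF t, of "Ide (psrc (cdom \<tau>)) a" a a \<beta> b b' x] k A.Ide_Hom[OF o(1)] F.far_Ide[of a] o T by simp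
    show "?k (b, x, pact (cdom \<sigma>) \<beta> (Ide (ptgt (cdom \<sigma>)) c) y) = ?k (b', pact (cdom \<tau>) (Ide (psrc (cdom \<tau>)) a) \<beta> x, y)"
      using tensor_slide[OF far_ctgt[OF t k(1)], of "cmap \<tau> a b x" "fob (csrc \<tau>) a" "cmap \<sigma> b' c y" "ccod \<sigma>" "fob (ctgt \<sigma>) c"]
       cmap_in[OF t o(1) ob(1) k(2)] cmap_in[OF s _ o(2) k(3)] ob C(5,6) by (simp add: 1 2)
  qed
  finally show ?thesis by simp
qed

lemma cell_cell_comp: assumes c: "composable_cells \<sigma> \<tau>" shows "profunctor_cell (cell_comp \<sigma> \<tau>)"
proof -
  note C = composable_cellsD[OF c]
  have s: "profunctor_cell \<sigma>" and t: "profunctor_cell \<tau>" and e: "csrc \<sigma> = ctgt \<tau>" using c by (auto simp: composable_cells_def)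
  note S = cellD[OF s] and T = cellD[OF t]
  interpret A: category "psrc (cdom \<tau>)" using T by (simp add: profunctor_cats)
  interpret B: category "ptgt (cdom \<tau>)" using T by (simp add: profunctor_cats)
  interpret C: category "ptgt (cdom \<sigma>)" using S by (simp add: profunctor_cats)
  interpret G: cat_functor "ctgt \<tau>" using T by simp
  have P: "Obj (fdom (pfun (prof_comp (cdom \<sigma>) (cdom \<tau>)))) = Obj (psrc (cdom \<tau>)) \<times> Obj (ptgt (cdom \<sigma>))"
    using profunctor_cats(3)[OF profunctor_prof_comp[OF C(1)]] by simp
  have "profunctor_cell \<lparr>cdom = prof_comp (cdom \<sigma>) (cdom \<tau>), ccod = prof_comp (ccod \<sigma>) (ccod \<tau>),
     csrc = csrc \<tau>, ctgt = ctgt \<sigma>, cnat = cnat (cell_comp \<sigma> \<tau>)\<rparr>"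
  proof (rule profunctor_cellI)
    fix a c x assume o: "a \<in> Obj (psrc (prof_comp (cdom \<sigma>) (cdom \<tau>)))" "c \<in> Obj (ptgt (prof_comp (cdom \<sigma>) (cdom \<tau>)))"
      and x: "x \<in> pset (prof_comp (cdom \<sigma>) (cdom \<tau>)) a c"
    then have o': "a \<in> Obj (psrc (cdom \<tau>))" "c \<in> Obj (ptgt (cdom \<sigma>))" by auto
    obtain b p q where z: "b \<in> Obj (ptgt (cdom \<tau>))" "p \<in> pset (cdom \<tau>) a b" "q \<in> pset (cdom \<sigma>) b c"
      "x = tensor (cdom \<tau>) (cdom \<sigma>) a c (b, p, q)" using prof_comp_cases[OF x o'] by metis
    show "cmap (cell_comp \<sigma> \<tau>) a c x \<in> pset (prof_comp (ccod \<sigma>) (ccod \<tau>)) (fob (csrc \<tau>) a) (fob (ctgt \<sigma>) c)"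
      unfolding z(4) cmap_cell_comp[OF c o' z(1-3)]
      by (rule tensor_in) (use o' z(1) fob_csrc[OF t] fob_ctgt[OF s] fob_ctgt[OF t] cmap_in[OF t o'(1) z(1,2)] cmap_in[OF s _ o'(2) z(3)] C in auto)
  next
    fix \<alpha> \<gamma> a a' c c' x
    assume h: "\<alpha> \<in> Hom (psrc (prof_comp (cdom \<sigma>) (cdom \<tau>))) a' a" "\<gamma> \<in> Hom (ptgt (prof_comp (cdom \<sigma>) (cdom \<tau>))) c c'"
      and x: "x \<in> pset (prof_comp (cdom \<sigma>) (cdom \<tau>)) a c"
    then have h': "\<alpha> \<in> Hom (psrc (cdom \<tau>)) a' a" "\<gamma> \<in> Hom (ptgt (cdom \<sigma>)) c c'" by auto
    have o: "a \<in> Obj (psrc (cdom \<tau>))" "c \<in> Obj (ptgt (cdom \<sigma>))" and o': "a' \<in> Obj (psrc (cdom \<tau>))" "c' \<in> Obj (ptgt (cdom \<sigma>))"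
      using h' A.Hom_Obj C.Hom_Obj by auto
    obtain b p q where z: "b \<in> Obj (ptgt (cdom \<tau>))" "p \<in> pset (cdom \<tau>) a b" "q \<in> pset (cdom \<sigma>) b c"
      "x = tensor (cdom \<tau>) (cdom \<sigma>) a c (b, p, q)" using prof_comp_cases[OF x o] by metis
    have b: "Ide (ptgt (cdom \<tau>)) b \<in> Hom (ptgt (cdom \<tau>)) b b" "Ide (ptgt (cdom \<tau>)) b \<in> Hom (psrc (cdom \<sigma>)) b b" 
      using B.Ide_Hom z C by auto
    have b': "b \<in> Obj (psrc (cdom \<sigma>))" using z C by simp
    have 1: "pact (cdom \<tau>) \<alpha> (Ide (ptgt (cdom \<tau>)) b) p \<in> pset (cdom \<tau>) a' b" "pact (cdom \<sigma>) (Ide (ptgt (cdom \<tau>)) b) \<gamma> q \<in> pset (cdom \<sigma>) b c'"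
      using pact_in[OF T(1) h'(1) b(1) z(2)] pact_in[OF S(1) b(2) h'(2) z(3)] by auto
    have 2: "far (ctgt \<tau>) (Ide (ptgt (cdom \<tau>)) b) = Ide (ptgt (ccod \<tau>)) (fob (ctgt \<tau>) b)" using G.far_Ide[of b] z T by simp
    have "cmap (cell_comp \<sigma> \<tau>) a' c' (pact (prof_comp (cdom \<sigma>) (cdom \<tau>)) \<alpha> \<gamma> x) =
      tensor (ccod \<tau>) (ccod \<sigma>) (fob (csrc \<tau>) a') (fob (ctgt \<sigma>) c') (fob (ctgt \<tau>) b,
        pact (ccod \<tau>) (far (csrc \<tau>) \<alpha>) (Ide (ptgt (ccod \<tau>)) (fob (ctgt \<tau>) b)) (cmap \<tau> a b p),
        pact (ccod \<sigma>) (Ide (ptgt (ccod \<tau>)) (fob (ctgt \<tau>) b)) (far (ctgt \<sigma>) \<gamma>) (cmap \<sigma> b c q))"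
      using 1 z cmap_cell_comp[OF c o' z(1) 1] cmap_natural[OF t h'(1) b(1) z(2)] cmap_natural[OF s b(2) h'(2) z(3)]
      by (simp add: pact_prof_comp[OF C(1) h' z(1-3)] C(5,6) 2)
    also have "\<dots> = pact (prof_comp (ccod \<sigma>) (ccod \<tau>)) (far (csrc \<tau>) \<alpha>) (far (ctgt \<sigma>) \<gamma>) (cmap (cell_comp \<sigma> \<tau>) a c x)"
      using pact_prof_comp[OF C(2) far_csrc[OF t h'(1)] far_ctgt[OF s h'(2)] fob_ctgt[OF t z(1)] cmap_in[OF t o(1) z(1,2)], of "cmap \<sigma> b c q"]
        cmap_in[OF s b' o(2) z(3)]
      by (simp add: z(4) cmap_cell_comp[OF c o z(1-3)] C(5,7))
    finally show "cmap (cell_comp \<sigma> \<tau>) a' c' (pact (prof_comp (cdom \<sigma>) (cdom \<tau>)) \<alpha> \<gamma> x) =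
       pact (prof_comp (ccod \<sigma>) (ccod \<tau>)) (far (csrc \<tau>) \<alpha>) (far (ctgt \<sigma>) \<gamma>) (cmap (cell_comp \<sigma> \<tau>) a c x)" .
  qed (use S T C P in \<open>auto intro!: profunctor_prof_comp simp: cell_comp_def Let_def\<close>)
  moreover have "\<lparr>cdom = prof_comp (cdom \<sigma>) (cdom \<tau>), ccod = prof_comp (ccod \<sigma>) (ccod \<tau>),
     csrc = csrc \<tau>, ctgt = ctgt \<sigma>, cnat = cnat (cell_comp \<sigma> \<tau>)\<rparr> = cell_comp \<sigma> \<tau>" by (simp add: cell_comp_def Let_def)
  ultimately show ?thesis by simp
qed

definition globular_map :: "'u prof \<Rightarrow> 'u prof \<Rightarrow> ('u \<Rightarrow> 'u \<Rightarrow> 'u \<Rightarrow> 'u) \<Rightarrow> bool" where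
  "globular_map \<Phi> \<Psi> k \<longleftrightarrow> profunctor \<Phi> \<and> profunctor \<Psi> \<and> psrc \<Psi> = psrc \<Phi> \<and> ptgt \<Psi> = ptgt \<Phi> \<and>
    (\<forall>a\<in>Obj (psrc \<Phi>). \<forall>b\<in>Obj (ptgt \<Phi>). \<forall>x\<in>pset \<Phi> a b. k a b x \<in> pset \<Psi> a b) \<and>
    (\<forall>a a' b b'. \<forall>\<alpha>\<in>Hom (psrc \<Phi>) a' a. \<forall>\<beta>\<in>Hom (ptgt \<Phi>) b b'. \<forall>x\<in>pset \<Phi> a b.
      k a' b' (pact \<Phi> \<alpha> \<beta> x) = pact \<Psi> \<alpha> \<beta> (k a b x))"

lemma globular_cell_simps [simp]: "cdom (globular_cell \<Phi> \<Psi> k) = \<Phi>" "ccod (globular_cell \<Phi> \<Psi> k) = \<Psi>"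
  "csrc (globular_cell \<Phi> \<Psi> k) = fid (psrc \<Phi>)" "ctgt (globular_cell \<Phi> \<Psi> k) = fid (ptgt \<Phi>)"
  by (auto simp: globular_cell_def)

lemma cmap_globular_cell: "profunctor \<Phi> \<Longrightarrow> a \<in> Obj (psrc \<Phi>) \<Longrightarrow> b \<in> Obj (ptgt \<Phi>) \<Longrightarrow> x \<in> pset \<Phi> a b \<Longrightarrow>
   cmap (globular_cell \<Phi> \<Psi> k) a b x = k a b x"
  by (simp add: globular_cell_def profunctor_cats)

lemma cell_globular_cell: assumes g: "globular_map \<Phi> \<Psi> k" shows "profunctor_cell (globular_cell \<Phi> \<Psi> k)"
proof -
  have P: "profunctor \<Phi>" "profunctor \<Psi>" "psrc \<Psi> = psrc \<Phi>" "ptgt \<Psi> = ptgt \<Phi>" using g by (auto simp: globular_map_def)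
  interpret A: category "psrc \<Phi>" using P by (simp add: profunctor_cats)
  interpret B: category "ptgt \<Phi>" using P by (simp add: profunctor_cats)
  show ?thesis
    unfolding globular_cell_def
    by (rule profunctor_cellI)
      (use P g A.Hom_Obj B.Hom_Obj pact_in[OF P(1)] in
      \<open>auto simp: profunctor_cats A.Hom_Obj B.Hom_Obj HomD globular_map_def intro: functor_fid\<close>)
qed

lemma iso_globular_cell:
  assumes g: "globular_map \<Phi> \<Psi> k" and g': "globular_map \<Psi> \<Phi> k'"
    and i: "\<And>a b x. a \<in> Obj (psrc \<Phi>) \<Longrightarrow> b \<in> Obj (ptgt \<Phi>) \<Longrightarrow> x \<in> pset \<Phi> a b \<Longrightarrow> k' a b (k a b x) = x"
    and i': "\<And>a b x. a \<in> Obj (psrc \<Phi>) \<Longrightarrow> b \<in> Obj (ptgt \<Phi>) \<Longrightarrow> x \<in> pset \<Psi> a b \<Longrightarrow> k a b (k' a b x) = x"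
  shows "is_iso prof_cat (globular_cell \<Phi> \<Psi> k)"
proof -
  have P: "profunctor \<Phi>" "profunctor \<Psi>" "psrc \<Psi> = psrc \<Phi>" "ptgt \<Psi> = ptgt \<Phi>" using g by (auto simp: globular_map_def)
  note c = cell_globular_cell[OF g] cell_globular_cell[OF g']
  have f: "fcmp (fid (psrc \<Phi>)) (fid (psrc \<Phi>)) = fid (psrc \<Phi>)" "fcmp (fid (ptgt \<Phi>)) (fid (ptgt \<Phi>)) = fid (ptgt \<Phi>)"
    using fcmp_fid(1)[OF functor_fid] P profunctor_cats by force+
  have m: "a \<in> Obj (psrc \<Phi>) \<Longrightarrow> b \<in> Obj (ptgt \<Phi>) \<Longrightarrow> x \<in> pset \<Phi> a b \<Longrightarrow> k a b x \<in> pset \<Psi> a b"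
    "a \<in> Obj (psrc \<Phi>) \<Longrightarrow> b \<in> Obj (ptgt \<Phi>) \<Longrightarrow> x \<in> pset \<Psi> a b \<Longrightarrow> k' a b x \<in> pset \<Phi> a b" for a b x
    using g g' by (auto simp: globular_map_def)
  have "Cmp prof_cat (globular_cell \<Psi> \<Phi> k') (globular_cell \<Phi> \<Psi> k) = Ide prof_cat \<Phi>"
    by (rule pcell_eqI) (use c P f i m in \<open>auto intro!: cell_Cmp cell_Ide simp: cmap_globular_cell\<close>)
  moreover have "Cmp prof_cat (globular_cell \<Phi> \<Psi> k) (globular_cell \<Psi> \<Phi> k') = Ide prof_cat \<Psi>"
    by (rule pcell_eqI) (use c P f i' m in \<open>auto intro!: cell_Cmp cell_Ide simp: cmap_globular_cell\<close>)
  ultimately show ?thesis using c unfolding is_iso_def inverse_arrows_def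
    by (intro exI[of _ "globular_cell \<Psi> \<Phi> k'"]) (auto simp: Hom_def)
qed

definition asc_inv :: "'u::infinite prof \<Rightarrow> 'u prof \<Rightarrow> 'u prof \<Rightarrow> 'u \<Rightarrow> 'u \<Rightarrow> 'u \<Rightarrow> 'u" where
  "asc_inv X \<Psi> \<Phi> a d z = (case decode3 z of (c, u, v) \<Rightarrow> case decode3 u of (b, x, y) \<Rightarrow>
         tensor \<Phi> (prof_comp X \<Psi>) a d (b, x, tensor \<Psi> X b d (c, y, v)))"

lemma composable_profs_comp:
  assumes "composable_profs X \<Psi>" "composable_profs \<Psi> \<Phi>"
  shows "composable_profs (prof_comp X \<Psi>) \<Phi>" "composable_profs X (prof_comp \<Psi> \<Phi>)"
  using assms profunctor_prof_comp[of X \<Psi>] profunctor_prof_comp[of \<Psi> \<Phi>] by (auto simp: composable_profs_def)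

context
  fixes X \<Psi> \<Phi> :: "'u::infinite prof"
  assumes cc: "composable_profs X \<Psi>" "composable_profs \<Psi> \<Phi>"
begin

interpretation A: category "psrc \<Phi>" using cc by (simp add: composable_profs_def profunctor_cats)
interpretation B: category "ptgt \<Phi>" using cc by (simp add: composable_profs_def profunctor_cats)
interpretation C: category "ptgt \<Psi>" using cc by (simp add: composable_profs_def profunctor_cats)
interpretation D: category "ptgt X" using cc by (simp add: composable_profs_def profunctor_cats)

lemma PP: "profunctor \<Phi>" "profunctor \<Psi>" "profunctor X" "psrc X = ptgt \<Psi>" "psrc \<Psi> = ptgt \<Phi>"
  using cc by (auto simp: composable_profs_def)

lemma asc_map_tensor:
  assumes o: "a \<in> Obj (psrc \<Phi>)" "d \<in> Obj (ptgt X)" and b: "b \<in> Obj (ptgt \<Phi>)" and c: "c \<in> Obj (ptgt \<Psi>)"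
    and x: "x \<in> pset \<Phi> a b" "y \<in> pset \<Psi> b c" "v \<in> pset X c d"
  shows "asc_map X \<Psi> \<Phi> a d (tensor \<Phi> (prof_comp X \<Psi>) a d (b, x, tensor \<Psi> X b d (c, y, v))) =
     tensor (prof_comp \<Psi> \<Phi>) X a d (c, tensor \<Phi> \<Psi> a c (b, x, y), v)"
proof -
  let ?h = "\<lambda>b x. \<lambda>(c, y, v). tensor (prof_comp \<Psi> \<Phi>) X a d (c, tensor \<Phi> \<Psi> a c (b, x, y), v)"
  let ?k = "\<lambda>(b, x, w). ?h b x (decode3 w)"
  have inner: "?h b x (decode3 (tensor \<Psi> X b d p)) = ?h b x p" if x: "x \<in> pset \<Phi> a b" and b: "b \<in> Obj (ptgt \<Phi>)" for b x p
  proof (rule coend_map)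
    fix \<gamma> c c' y v assume k: "\<gamma> \<in> Hom (ptgt \<Psi>) c c'" "y \<in> pset \<Psi> b c" "v \<in> pset X c' d"
    have oc: "c \<in> Obj (ptgt \<Psi>)" "c' \<in> Obj (ptgt \<Psi>)" using k C.Hom_Obj by auto
    have "tensor (prof_comp \<Psi> \<Phi>) X a d (c, tensor \<Phi> \<Psi> a c (b, x, y), pact X \<gamma> (Ide (ptgt X) d) v) =
       tensor (prof_comp \<Psi> \<Phi>) X a d (c', pact (prof_comp \<Psi> \<Phi>) (Ide (psrc \<Phi>) a) \<gamma> (tensor \<Phi> \<Psi> a c (b, x, y)), v)"
      using tensor_slide[of \<gamma> "prof_comp \<Psi> \<Phi>" c c' "tensor \<Phi> \<Psi> a c (b, x, y)" a v X d] k tensor_in[OF o(1) oc(1) b x k(2)] by simp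
    also have "pact (prof_comp \<Psi> \<Phi>) (Ide (psrc \<Phi>) a) \<gamma> (tensor \<Phi> \<Psi> a c (b, x, y)) = tensor \<Phi> \<Psi> a c' (b, x, pact \<Psi> (Ide (psrc \<Psi>) b) \<gamma> y)"
      using pact_prof_comp[OF cc(2) A.Ide_Hom[OF o(1)] k(1) b x k(2)] pact_Ide[OF PP(1) o(1) b x] by simp
    finally show "?h b x (c, y, pact X \<gamma> (Ide (ptgt X) d) v) = ?h b x (c', pact \<Psi> (Ide (psrc \<Psi>) b) \<gamma> y, v)" by simp
  qed
  have "asc_map X \<Psi> \<Phi> a d (tensor \<Phi> (prof_comp X \<Psi>) a d (b, x, tensor \<Psi> X b d (c, y, v))) =
    ?k (decode3 (tensor \<Phi> (prof_comp X \<Psi>) a d (b, x, tensor \<Psi> X b d (c, y, v))))"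
    by (simp add: asc_map_def split: prod.split)
  also have "\<dots> = ?k (b, x, tensor \<Psi> X b d (c, y, v))"
  proof (rule coend_map)
    fix \<beta> b b' x w assume k: "\<beta> \<in> Hom (ptgt \<Phi>) b b'" "x \<in> pset \<Phi> a b" "w \<in> pset (prof_comp X \<Psi>) b' d"
    have ob: "b \<in> Obj (ptgt \<Phi>)" "b' \<in> Obj (ptgt \<Phi>)" using k B.Hom_Obj by auto
    obtain c y v where z: "c \<in> Obj (ptgt \<Psi>)" "y \<in> pset \<Psi> b' c" "v \<in> pset X c d" "w = tensor \<Psi> X b' d (c, y, v)"
      using prof_comp_cases[OF k(3)] o ob PP by metis
    have k': "\<beta> \<in> Hom (psrc \<Psi>) b b'" using k PP by simp
    have w: "pact (prof_comp X \<Psi>) \<beta> (Ide (ptgt X) d) w = tensor \<Psi> X b d (c, pact \<Psi> \<beta> (Ide (ptgt \<Psi>) c) y, v)"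
      unfolding z(4) using pact_prof_comp[OF cc(1) k' D.Ide_Hom[OF o(2)] z(1-3)] pact_Ide[OF PP(3) _ o(2) z(3)] PP z(1) by simp
    have 1: "pact \<Phi> (Ide (psrc \<Phi>) a) \<beta> x \<in> pset \<Phi> a b'" using pact_in[OF PP(1) A.Ide_Hom[OF o(1)] k(1,2)] .
    show "?k (b, x, pact (prof_comp X \<Psi>) \<beta> (Ide (ptgt (prof_comp X \<Psi>)) d) w) = ?k (b', pact \<Phi> (Ide (psrc \<Phi>) a) \<beta> x, w)"
      using inner[OF k(2) ob(1)] inner[OF 1 ob(2)] tensor_slide[OF k(1,2) z(2)] by (simp add: w) (simp add: z)
  qed
  also have "\<dots> = ?h b x (c, y, v)" using inner[OF x(1) b] by simp
  finally show ?thesis by simp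
qed

lemma asc_inv_tensor:
  assumes o: "a \<in> Obj (psrc \<Phi>)" "d \<in> Obj (ptgt X)" and b: "b \<in> Obj (ptgt \<Phi>)" and c: "c \<in> Obj (ptgt \<Psi>)"
    and x: "x \<in> pset \<Phi> a b" "y \<in> pset \<Psi> b c" "v \<in> pset X c d"
  shows "asc_inv X \<Psi> \<Phi> a d (tensor (prof_comp \<Psi> \<Phi>) X a d (c, tensor \<Phi> \<Psi> a c (b, x, y), v)) =
     tensor \<Phi> (prof_comp X \<Psi>) a d (b, x, tensor \<Psi> X b d (c, y, v))"
proof -
  let ?h = "\<lambda>c v. \<lambda>(b, x, y). tensor \<Phi> (prof_comp X \<Psi>) a d (b, x, tensor \<Psi> X b d (c, y, v))"
  let ?k = "\<lambda>(c, u, v). ?h c v (decode3 u)"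
  have inner: "?h c v (decode3 (tensor \<Phi> \<Psi> a c p)) = ?h c v p" if v: "v \<in> pset X c d" and c: "c \<in> Obj (ptgt \<Psi>)" for c v p
  proof (rule coend_map)
    fix \<beta> b b' x y assume k: "\<beta> \<in> Hom (ptgt \<Phi>) b b'" "x \<in> pset \<Phi> a b" "y \<in> pset \<Psi> b' c"
    have ob: "b \<in> Obj (ptgt \<Phi>)" "b' \<in> Obj (ptgt \<Phi>)" using k B.Hom_Obj by auto
    have k': "\<beta> \<in> Hom (psrc \<Psi>) b b'" using k PP by simp
    have "pact (prof_comp X \<Psi>) \<beta> (Ide (ptgt X) d) (tensor \<Psi> X b' d (c, y, v)) = tensor \<Psi> X b d (c, pact \<Psi> \<beta> (Ide (ptgt \<Psi>) c) y, v)"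
      using pact_prof_comp[OF cc(1) k' D.Ide_Hom[OF o(2)] c k(3) v] pact_Ide[OF PP(3) _ o(2) v] PP c by simp
    moreover have "tensor \<Psi> X b' d (c, y, v) \<in> pset (prof_comp X \<Psi>) b' d"
      by (rule tensor_in) (use ob PP o c k v in auto)
    ultimately show "?h c v (b, x, pact \<Psi> \<beta> (Ide (ptgt \<Psi>) c) y) = ?h c v (b', pact \<Phi> (Ide (psrc \<Phi>) a) \<beta> x, y)"
      using tensor_slide[OF k(1,2), of "tensor \<Psi> X b' d (c, y, v)" "prof_comp X \<Psi>" d] by simp
  qed
  have "asc_inv X \<Psi> \<Phi> a d (tensor (prof_comp \<Psi> \<Phi>) X a d (c, tensor \<Phi> \<Psi> a c (b, x, y), v)) =
    ?k (decode3 (tensor (prof_comp \<Psi> \<Phi>) X a d (c, tensor \<Phi> \<Psi> a c (b, x, y), v)))"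
    by (simp add: asc_inv_def split: prod.split)
  also have "\<dots> = ?k (c, tensor \<Phi> \<Psi> a c (b, x, y), v)"
  proof (rule coend_map)
    fix \<gamma> c c' u v assume k: "\<gamma> \<in> Hom (ptgt (prof_comp \<Psi> \<Phi>)) c c'" "u \<in> pset (prof_comp \<Psi> \<Phi>) a c" "v \<in> pset X c' d"
    have g: "\<gamma> \<in> Hom (ptgt \<Psi>) c c'" using k by simp
    have oc: "c \<in> Obj (ptgt \<Psi>)" "c' \<in> Obj (ptgt \<Psi>)" using g C.Hom_Obj by auto
    obtain b x y where z: "b \<in> Obj (ptgt \<Phi>)" "x \<in> pset \<Phi> a b" "y \<in> pset \<Psi> b c" "u = tensor \<Phi> \<Psi> a c (b, x, y)"
      using prof_comp_cases[OF k(2) o(1) oc(1)] by metis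
    have w: "pact (prof_comp \<Psi> \<Phi>) (Ide (psrc \<Phi>) a) \<gamma> u = tensor \<Phi> \<Psi> a c' (b, x, pact \<Psi> (Ide (psrc \<Psi>) b) \<gamma> y)"
      unfolding z(4) using pact_prof_comp[OF cc(2) A.Ide_Hom[OF o(1)] g z(1-3)] pact_Ide[OF PP(1) o(1) z(1,2)] by simp
    have 1: "pact X \<gamma> (Ide (ptgt X) d) v \<in> pset X c d" using pact_in[OF PP(3) _ D.Ide_Hom[OF o(2)] k(3)] g PP by simp
    show "?k (c, u, pact X \<gamma> (Ide (ptgt X) d) v) = ?k (c', pact (prof_comp \<Psi> \<Phi>) (Ide (psrc (prof_comp \<Psi> \<Phi>)) a) \<gamma> u, v)"
      using inner[OF 1 oc(1)] inner[OF k(3) oc(2)] tensor_slide[OF g z(3) k(3)] by (simp add: w) (simp add: z)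
  qed
  also have "\<dots> = ?h c v (b, x, y)" using inner[OF x(3) c] by simp
  finally show ?thesis by simp
qed

lemma left_cases:
  assumes "z \<in> pset (prof_comp (prof_comp X \<Psi>) \<Phi>) a d" "a \<in> Obj (psrc \<Phi>)" "d \<in> Obj (ptgt X)"
  obtains b c x y v where "b \<in> Obj (ptgt \<Phi>)" "c \<in> Obj (ptgt \<Psi>)" "x \<in> pset \<Phi> a b" "y \<in> pset \<Psi> b c" "v \<in> pset X c d"
    "z = tensor \<Phi> (prof_comp X \<Psi>) a d (b, x, tensor \<Psi> X b d (c, y, v))"
proof -
  obtain b x w where 1: "b \<in> Obj (ptgt \<Phi>)" "x \<in> pset \<Phi> a b" "w \<in> pset (prof_comp X \<Psi>) b d" "z = tensor \<Phi> (prof_comp X \<Psi>) a d (b, x, w)"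
    using prof_comp_cases[OF assms(1,2)] assms(3) by auto
  obtain c y v where "c \<in> Obj (ptgt \<Psi>)" "y \<in> pset \<Psi> b c" "v \<in> pset X c d" "w = tensor \<Psi> X b d (c, y, v)"
    using prof_comp_cases[OF 1(3)] assms(3) 1(1) PP by metis
  then show ?thesis using 1 that by blast
qed

lemma right_cases:
  assumes "z \<in> pset (prof_comp X (prof_comp \<Psi> \<Phi>)) a d" "a \<in> Obj (psrc \<Phi>)" "d \<in> Obj (ptgt X)"
  obtains b c x y v where "b \<in> Obj (ptgt \<Phi>)" "c \<in> Obj (ptgt \<Psi>)" "x \<in> pset \<Phi> a b" "y \<in> pset \<Psi> b c" "v \<in> pset X c d"
    "z = tensor (prof_comp \<Psi> \<Phi>) X a d (c, tensor \<Phi> \<Psi> a c (b, x, y), v)"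
proof -
  obtain c u v where 1: "c \<in> Obj (ptgt \<Psi>)" "u \<in> pset (prof_comp \<Psi> \<Phi>) a c" "v \<in> pset X c d" "z = tensor (prof_comp \<Psi> \<Phi>) X a d (c, u, v)"
    using prof_comp_cases[OF assms(1) _ assms(3)] assms(2) by auto
  obtain b x y where "b \<in> Obj (ptgt \<Phi>)" "x \<in> pset \<Phi> a b" "y \<in> pset \<Psi> b c" "u = tensor \<Phi> \<Psi> a c (b, x, y)"
    using prof_comp_cases[OF 1(2) assms(2) 1(1)] by metis
  then show ?thesis using 1 that by blast
qed

lemma left_in:
  assumes o: "a \<in> Obj (psrc \<Phi>)" "d \<in> Obj (ptgt X)" and b: "b \<in> Obj (ptgt \<Phi>)" and c: "c \<in> Obj (ptgt \<Psi>)"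
    and x: "x \<in> pset \<Phi> a b" "y \<in> pset \<Psi> b c" "v \<in> pset X c d"
  shows "tensor \<Psi> X b d (c, y, v) \<in> pset (prof_comp X \<Psi>) b d"
    "tensor \<Phi> (prof_comp X \<Psi>) a d (b, x, tensor \<Psi> X b d (c, y, v)) \<in> pset (prof_comp (prof_comp X \<Psi>) \<Phi>) a d"
proof -
  show *: "tensor \<Psi> X b d (c, y, v) \<in> pset (prof_comp X \<Psi>) b d"
    by (rule tensor_in) (use assms PP in auto)
  show "tensor \<Phi> (prof_comp X \<Psi>) a d (b, x, tensor \<Psi> X b d (c, y, v)) \<in> pset (prof_comp (prof_comp X \<Psi>) \<Phi>) a d"
    by (rule tensor_in) (use assms * in auto)
qed

lemma right_in:
  assumes o: "a \<in> Obj (psrc \<Phi>)" "d \<in> Obj (ptgt X)" and b: "b \<in> Obj (ptgt \<Phi>)" and c: "c \<in> Obj (ptgt \<Psi>)"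
    and x: "x \<in> pset \<Phi> a b" "y \<in> pset \<Psi> b c" "v \<in> pset X c d"
  shows "tensor \<Phi> \<Psi> a c (b, x, y) \<in> pset (prof_comp \<Psi> \<Phi>) a c"
    "tensor (prof_comp \<Psi> \<Phi>) X a d (c, tensor \<Phi> \<Psi> a c (b, x, y), v) \<in> pset (prof_comp X (prof_comp \<Psi> \<Phi>)) a d"
proof -
  show *: "tensor \<Phi> \<Psi> a c (b, x, y) \<in> pset (prof_comp \<Psi> \<Phi>) a c"
    by (rule tensor_in) (use assms PP in auto)
  show "tensor (prof_comp \<Psi> \<Phi>) X a d (c, tensor \<Phi> \<Psi> a c (b, x, y), v) \<in> pset (prof_comp X (prof_comp \<Psi> \<Phi>)) a d"
    by (rule tensor_in) (use assms * in auto)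
qed

lemma pact_left:
  assumes h: "\<alpha> \<in> Hom (psrc \<Phi>) a' a" "\<delta> \<in> Hom (ptgt X) d d'" and b: "b \<in> Obj (ptgt \<Phi>)" and c: "c \<in> Obj (ptgt \<Psi>)"
    and x: "x \<in> pset \<Phi> a b" "y \<in> pset \<Psi> b c" "v \<in> pset X c d"
  shows "pact (prof_comp (prof_comp X \<Psi>) \<Phi>) \<alpha> \<delta> (tensor \<Phi> (prof_comp X \<Psi>) a d (b, x, tensor \<Psi> X b d (c, y, v))) =
    tensor \<Phi> (prof_comp X \<Psi>) a' d' (b, pact \<Phi> \<alpha> (Ide (ptgt \<Phi>) b) x, tensor \<Psi> X b d' (c, y, pact X (Ide (ptgt \<Psi>) c) \<delta> v))"
proof -
  have o: "a \<in> Obj (psrc \<Phi>)" "d \<in> Obj (ptgt X)" using h A.Hom_Obj D.Hom_Obj by auto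
  have "Ide (ptgt \<Phi>) b \<in> Hom (psrc \<Psi>) b b" using B.Ide_Hom[OF b] PP by simp
  then show ?thesis
    using pact_prof_comp[OF composable_profs_comp(1)[OF cc] h(1), of \<delta> d d' b x "tensor \<Psi> X b d (c, y, v)"] h b x left_in[OF o b c x]
    pact_prof_comp[OF cc(1) _ h(2) c x(2,3), of "Ide (ptgt \<Phi>) b" b] pact_Ide[OF PP(2) _ c x(2)] PP by simp
qed

lemma pact_right:
  assumes h: "\<alpha> \<in> Hom (psrc \<Phi>) a' a" "\<delta> \<in> Hom (ptgt X) d d'" and b: "b \<in> Obj (ptgt \<Phi>)" and c: "c \<in> Obj (ptgt \<Psi>)"
    and x: "x \<in> pset \<Phi> a b" "y \<in> pset \<Psi> b c" "v \<in> pset X c d"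
  shows "pact (prof_comp X (prof_comp \<Psi> \<Phi>)) \<alpha> \<delta> (tensor (prof_comp \<Psi> \<Phi>) X a d (c, tensor \<Phi> \<Psi> a c (b, x, y), v)) =
    tensor (prof_comp \<Psi> \<Phi>) X a' d' (c, tensor \<Phi> \<Psi> a' c (b, pact \<Phi> \<alpha> (Ide (ptgt \<Phi>) b) x, y), pact X (Ide (ptgt \<Psi>) c) \<delta> v)"
proof -
  have o: "a \<in> Obj (psrc \<Phi>)" "d \<in> Obj (ptgt X)" using h A.Hom_Obj D.Hom_Obj by auto
  show ?thesis
    using pact_prof_comp[OF composable_profs_comp(2)[OF cc] _ h(2), of \<alpha> a' a c "tensor \<Phi> \<Psi> a c (b, x, y)" v] h c x right_in[OF o b c x]
    pact_prof_comp[OF cc(2) h(1) C.Ide_Hom[OF c] b x(1,2)] pact_Ide[OF PP(2) _ c x(2)] PP b by simp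
qed

lemma asc_globular_map: "globular_map (prof_comp (prof_comp X \<Psi>) \<Phi>) (prof_comp X (prof_comp \<Psi> \<Phi>)) (asc_map X \<Psi> \<Phi>)"
  unfolding globular_map_def
proof (intro conjI ballI allI)
  fix a d z assume "a \<in> Obj (psrc (prof_comp (prof_comp X \<Psi>) \<Phi>))" "d \<in> Obj (ptgt (prof_comp (prof_comp X \<Psi>) \<Phi>))"
    and z: "z \<in> pset (prof_comp (prof_comp X \<Psi>) \<Phi>) a d"
  then have o: "a \<in> Obj (psrc \<Phi>)" "d \<in> Obj (ptgt X)" by auto
  from z o show "asc_map X \<Psi> \<Phi> a d z \<in> pset (prof_comp X (prof_comp \<Psi> \<Phi>)) a d"
    by (rule left_cases) (use o right_in in \<open>simp add: asc_map_tensor\<close>)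
next
  fix a a' d d' \<alpha> \<delta> z
  assume "\<alpha> \<in> Hom (psrc (prof_comp (prof_comp X \<Psi>) \<Phi>)) a' a" "\<delta> \<in> Hom (ptgt (prof_comp (prof_comp X \<Psi>) \<Phi>)) d d'"
    and z: "z \<in> pset (prof_comp (prof_comp X \<Psi>) \<Phi>) a d"
  then have h: "\<alpha> \<in> Hom (psrc \<Phi>) a' a" "\<delta> \<in> Hom (ptgt X) d d'" by auto
  then have o: "a \<in> Obj (psrc \<Phi>)" "d \<in> Obj (ptgt X)" "a' \<in> Obj (psrc \<Phi>)" "d' \<in> Obj (ptgt X)" using A.Hom_Obj D.Hom_Obj by auto
  obtain b c x y v where w: "b \<in> Obj (ptgt \<Phi>)" "c \<in> Obj (ptgt \<Psi>)" "x \<in> pset \<Phi> a b" "y \<in> pset \<Psi> b c" "v \<in> pset X c d"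
    and ze: "z = tensor \<Phi> (prof_comp X \<Psi>) a d (b, x, tensor \<Psi> X b d (c, y, v))"
    using left_cases[OF z o(1,2)] by metis
  have 1: "pact \<Phi> \<alpha> (Ide (ptgt \<Phi>) b) x \<in> pset \<Phi> a' b" using pact_in[OF PP(1) h(1) B.Ide_Hom[OF w(1)] w(3)] .
  have 2: "pact X (Ide (ptgt \<Psi>) c) \<delta> v \<in> pset X c d'" using pact_in[OF PP(3) _ h(2) w(5)] C.Ide_Hom[OF w(2)] PP by simp
  show "asc_map X \<Psi> \<Phi> a' d' (pact (prof_comp (prof_comp X \<Psi>) \<Phi>) \<alpha> \<delta> z) =
     pact (prof_comp X (prof_comp \<Psi> \<Phi>)) \<alpha> \<delta> (asc_map X \<Psi> \<Phi> a d z)"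
    unfolding ze pact_left[OF h w] asc_map_tensor[OF o(3,4) w(1,2) 1 w(4) 2] asc_map_tensor[OF o(1,2) w] pact_right[OF h w] ..
qed (use composable_profs_comp[OF cc] in \<open>auto intro: profunctor_prof_comp\<close>)

lemma asc_inv_globular_map: "globular_map (prof_comp X (prof_comp \<Psi> \<Phi>)) (prof_comp (prof_comp X \<Psi>) \<Phi>) (asc_inv X \<Psi> \<Phi>)"
  unfolding globular_map_def
proof (intro conjI ballI allI)
  fix a d z assume "a \<in> Obj (psrc (prof_comp X (prof_comp \<Psi> \<Phi>)))" "d \<in> Obj (ptgt (prof_comp X (prof_comp \<Psi> \<Phi>)))"
    and z: "z \<in> pset (prof_comp X (prof_comp \<Psi> \<Phi>)) a d"
  then have o: "a \<in> Obj (psrc \<Phi>)" "d \<in> Obj (ptgt X)" by auto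
  from z o show "asc_inv X \<Psi> \<Phi> a d z \<in> pset (prof_comp (prof_comp X \<Psi>) \<Phi>) a d"
    by (rule right_cases) (use o left_in in \<open>simp add: asc_inv_tensor\<close>)
next
  fix a a' d d' \<alpha> \<delta> z
  assume "\<alpha> \<in> Hom (psrc (prof_comp X (prof_comp \<Psi> \<Phi>))) a' a" "\<delta> \<in> Hom (ptgt (prof_comp X (prof_comp \<Psi> \<Phi>))) d d'"
    and z: "z \<in> pset (prof_comp X (prof_comp \<Psi> \<Phi>)) a d"
  then have h: "\<alpha> \<in> Hom (psrc \<Phi>) a' a" "\<delta> \<in> Hom (ptgt X) d d'" by auto
  then have o: "a \<in> Obj (psrc \<Phi>)" "d \<in> Obj (ptgt X)" "a' \<in> Obj (psrc \<Phi>)" "d' \<in> Obj (ptgt X)" using A.Hom_Obj D.Hom_Obj by auto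
  obtain b c x y v where w: "b \<in> Obj (ptgt \<Phi>)" "c \<in> Obj (ptgt \<Psi>)" "x \<in> pset \<Phi> a b" "y \<in> pset \<Psi> b c" "v \<in> pset X c d"
    and ze: "z = tensor (prof_comp \<Psi> \<Phi>) X a d (c, tensor \<Phi> \<Psi> a c (b, x, y), v)"
    using right_cases[OF z o(1,2)] by metis
  have 1: "pact \<Phi> \<alpha> (Ide (ptgt \<Phi>) b) x \<in> pset \<Phi> a' b" using pact_in[OF PP(1) h(1) B.Ide_Hom[OF w(1)] w(3)] .
  have 2: "pact X (Ide (ptgt \<Psi>) c) \<delta> v \<in> pset X c d'" using pact_in[OF PP(3) _ h(2) w(5)] C.Ide_Hom[OF w(2)] PP by simp
  show "asc_inv X \<Psi> \<Phi> a' d' (pact (prof_comp X (prof_comp \<Psi> \<Phi>)) \<alpha> \<delta> z) =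
     pact (prof_comp (prof_comp X \<Psi>) \<Phi>) \<alpha> \<delta> (asc_inv X \<Psi> \<Phi> a d z)"
    unfolding ze pact_right[OF h w] asc_inv_tensor[OF o(3,4) w(1,2) 1 w(4) 2] asc_inv_tensor[OF o(1,2) w] pact_left[OF h w] ..
qed (use composable_profs_comp[OF cc] in \<open>auto intro: profunctor_prof_comp\<close>)

lemma asc_is_iso: "is_iso prof_cat (globular_cell (prof_comp (prof_comp X \<Psi>) \<Phi>) (prof_comp X (prof_comp \<Psi> \<Phi>)) (asc_map X \<Psi> \<Phi>))"
proof (rule iso_globular_cell[OF asc_globular_map asc_inv_globular_map])
  fix a d z assume "a \<in> Obj (psrc (prof_comp (prof_comp X \<Psi>) \<Phi>))" "d \<in> Obj (ptgt (prof_comp (prof_comp X \<Psi>) \<Phi>))"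
    and z: "z \<in> pset (prof_comp (prof_comp X \<Psi>) \<Phi>) a d"
  then have o: "a \<in> Obj (psrc \<Phi>)" "d \<in> Obj (ptgt X)" by auto
  from z o show "asc_inv X \<Psi> \<Phi> a d (asc_map X \<Psi> \<Phi> a d z) = z"
    by (rule left_cases) (use o in \<open>simp add: asc_map_tensor asc_inv_tensor\<close>)
next
  fix a d z assume "a \<in> Obj (psrc (prof_comp (prof_comp X \<Psi>) \<Phi>))" "d \<in> Obj (ptgt (prof_comp (prof_comp X \<Psi>) \<Phi>))"
    and z: "z \<in> pset (prof_comp X (prof_comp \<Psi> \<Phi>)) a d"
  then have o: "a \<in> Obj (psrc \<Phi>)" "d \<in> Obj (ptgt X)" by auto
  from z o show "asc_map X \<Psi> \<Phi> a d (asc_inv X \<Psi> \<Phi> a d z) = z"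
    by (rule right_cases) (use o in \<open>simp add: asc_map_tensor asc_inv_tensor\<close>)
qed

end

context
  fixes \<Phi> :: "'u::infinite prof"
  assumes P: "profunctor \<Phi>"
begin

interpretation A: category "psrc \<Phi>" using P by (simp add: profunctor_cats)
interpretation B: category "ptgt \<Phi>" using P by (simp add: profunctor_cats)

lemma composable_hom: "composable_profs (hom_prof (ptgt \<Phi>)) \<Phi>" "composable_profs \<Phi> (hom_prof (psrc \<Phi>))"
  using P profunctor_hom_prof A.category_axioms B.category_axioms by (auto simp: composable_profs_def)

lemma lun_map_tensor:
  assumes o: "a \<in> Obj (psrc \<Phi>)" and x: "x \<in> pset \<Phi> a b'" and \<beta>: "\<beta> \<in> Hom (ptgt \<Phi>) b' b"
  shows "lun_map \<Phi> a b (tensor \<Phi> (hom_prof (ptgt \<Phi>)) a b (b', x, \<beta>)) = pact \<Phi> (Ide (psrc \<Phi>) a) \<beta> x"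
proof -
  let ?k = "\<lambda>(b', x, \<beta>). pact \<Phi> (Ide (psrc \<Phi>) a) \<beta> x"
  have "?k (decode3 (tensor \<Phi> (hom_prof (ptgt \<Phi>)) a b (b', x, \<beta>))) = ?k (b', x, \<beta>)"
  proof (rule coend_map)
    fix \<gamma> c c' x y assume k: "\<gamma> \<in> Hom (ptgt \<Phi>) c c'" "x \<in> pset \<Phi> a c" "y \<in> pset (hom_prof (ptgt \<Phi>)) c' b"
    have ob: "b \<in> Obj (ptgt \<Phi>)" "c' \<in> Obj (ptgt \<Phi>)" using \<beta> k B.Hom_Obj by auto
    have y: "y \<in> Hom (ptgt \<Phi>) c' b" using k(3) ob by simp
    have 1: "pact (hom_prof (ptgt \<Phi>)) \<gamma> (Ide (ptgt \<Phi>) b) y = Cmp (ptgt \<Phi>) y \<gamma>"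
      using pact_hom_prof[OF k(1) B.Ide_Hom[OF ob(1)] y] B.Cmp_Hom[OF k(1) y] by (simp add: B.Cmp_Ide_left)
    show "?k (c, x, pact (hom_prof (ptgt \<Phi>)) \<gamma> (Ide (ptgt (hom_prof (ptgt \<Phi>))) b) y) = ?k (c', pact \<Phi> (Ide (psrc \<Phi>) a) \<gamma> x, y)"
      using pact_Cmp[OF P A.Ide_Hom[OF o] k(1) A.Ide_Hom[OF o] y k(2)] A.Cmp_Ide_left[OF A.Ide_Hom[OF o]] by (simp add: 1)
  qed
  then show ?thesis by (simp add: lun_map_def)
qed

lemma run_map_tensor:
  assumes o: "b \<in> Obj (ptgt \<Phi>)" and x: "x \<in> pset \<Phi> a' b" and \<alpha>: "\<alpha> \<in> Hom (psrc \<Phi>) a a'"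
  shows "run_map \<Phi> a b (tensor (hom_prof (psrc \<Phi>)) \<Phi> a b (a', \<alpha>, x)) = pact \<Phi> \<alpha> (Ide (ptgt \<Phi>) b) x"
proof -
  let ?k = "\<lambda>(a', \<alpha>, x). pact \<Phi> \<alpha> (Ide (ptgt \<Phi>) b) x"
  have "?k (decode3 (tensor (hom_prof (psrc \<Phi>)) \<Phi> a b (a', \<alpha>, x))) = ?k (a', \<alpha>, x)"
  proof (rule coend_map)
    fix \<gamma> c c' x y assume k: "\<gamma> \<in> Hom (ptgt (hom_prof (psrc \<Phi>))) c c'" "x \<in> pset (hom_prof (psrc \<Phi>)) a c" "y \<in> pset \<Phi> c' b"
    have g: "\<gamma> \<in> Hom (psrc \<Phi>) c c'" using k by simp
    have ob: "a \<in> Obj (psrc \<Phi>)" "c \<in> Obj (psrc \<Phi>)" using \<alpha> g A.Hom_Obj by auto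
    have x: "x \<in> Hom (psrc \<Phi>) a c" using k(2) ob by simp
    have 1: "pact (hom_prof (psrc \<Phi>)) (Ide (psrc \<Phi>) a) \<gamma> x = Cmp (psrc \<Phi>) \<gamma> x"
      using pact_hom_prof[OF A.Ide_Hom[OF ob(1)] g x] x by (simp add: A.Cmp_Ide_right)
    show "?k (c, x, pact \<Phi> \<gamma> (Ide (ptgt \<Phi>) b) y) = ?k (c', pact (hom_prof (psrc \<Phi>)) (Ide (psrc (hom_prof (psrc \<Phi>))) a) \<gamma> x, y)"
      using pact_Cmp[OF P g B.Ide_Hom[OF o] x B.Ide_Hom[OF o] k(3)] B.Cmp_Ide_left[OF B.Ide_Hom[OF o]] by (simp add: 1)
  qed
  then show ?thesis by (simp add: run_map_def)
qed

lemma lun_cases: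
  assumes "z \<in> pset (prof_comp (hom_prof (ptgt \<Phi>)) \<Phi>) a b" "a \<in> Obj (psrc \<Phi>)" "b \<in> Obj (ptgt \<Phi>)"
  obtains b' x \<beta> where "b' \<in> Obj (ptgt \<Phi>)" "x \<in> pset \<Phi> a b'" "\<beta> \<in> Hom (ptgt \<Phi>) b' b" "z = tensor \<Phi> (hom_prof (ptgt \<Phi>)) a b (b', x, \<beta>)"
  using prof_comp_cases[OF assms(1,2)] assms(3) by (metis hom_prof_simps(2) pset_hom_prof)

lemma run_cases:
  assumes "z \<in> pset (prof_comp \<Phi> (hom_prof (psrc \<Phi>))) a b" "a \<in> Obj (psrc \<Phi>)" "b \<in> Obj (ptgt \<Phi>)"
  obtains a' x \<alpha> where "a' \<in> Obj (psrc \<Phi>)" "\<alpha> \<in> Hom (psrc \<Phi>) a a'" "x \<in> pset \<Phi> a' b" "z = tensor (hom_prof (psrc \<Phi>)) \<Phi> a b (a', \<alpha>, x)"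
  using prof_comp_cases[OF assms(1) _ assms(3)] assms(2) by (metis hom_prof_simps pset_hom_prof)

lemma lun_in: "a \<in> Obj (psrc \<Phi>) \<Longrightarrow> x \<in> pset \<Phi> a b' \<Longrightarrow> \<beta> \<in> Hom (ptgt \<Phi>) b' b \<Longrightarrow>
   tensor \<Phi> (hom_prof (ptgt \<Phi>)) a b (b', x, \<beta>) \<in> pset (prof_comp (hom_prof (ptgt \<Phi>)) \<Phi>) a b"
  by (rule tensor_in) (use B.Hom_Obj in auto)

lemma run_in: "b \<in> Obj (ptgt \<Phi>) \<Longrightarrow> x \<in> pset \<Phi> a' b \<Longrightarrow> \<alpha> \<in> Hom (psrc \<Phi>) a a' \<Longrightarrow>
   tensor (hom_prof (psrc \<Phi>)) \<Phi> a b (a', \<alpha>, x) \<in> pset (prof_comp \<Phi> (hom_prof (psrc \<Phi>))) a b"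
  by (rule tensor_in) (use A.Hom_Obj in auto)

lemma lun_normal: "a \<in> Obj (psrc \<Phi>) \<Longrightarrow> x \<in> pset \<Phi> a b' \<Longrightarrow> \<beta> \<in> Hom (ptgt \<Phi>) b' b \<Longrightarrow>
   tensor \<Phi> (hom_prof (ptgt \<Phi>)) a b (b', x, \<beta>) = tensor \<Phi> (hom_prof (ptgt \<Phi>)) a b (b, pact \<Phi> (Ide (psrc \<Phi>) a) \<beta> x, Ide (ptgt \<Phi>) b)"
  using tensor_slide[of \<beta> \<Phi> b' b x a "Ide (ptgt \<Phi>) b" "hom_prof (ptgt \<Phi>)" b] B.Hom_Obj[of \<beta> b' b] B.Ide_Hom[of b]
    pact_hom_prof[of \<beta> "ptgt \<Phi>" b' b "Ide (ptgt \<Phi>) b" b "Ide (ptgt \<Phi>) b"] by (simp add: B.Cmp_Ide_left)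

lemma run_normal: "b \<in> Obj (ptgt \<Phi>) \<Longrightarrow> x \<in> pset \<Phi> a' b \<Longrightarrow> \<alpha> \<in> Hom (psrc \<Phi>) a a' \<Longrightarrow>
   tensor (hom_prof (psrc \<Phi>)) \<Phi> a b (a', \<alpha>, x) = tensor (hom_prof (psrc \<Phi>)) \<Phi> a b (a, Ide (psrc \<Phi>) a, pact \<Phi> \<alpha> (Ide (ptgt \<Phi>) b) x)"
  using tensor_slide[of \<alpha> "hom_prof (psrc \<Phi>)" a a' "Ide (psrc \<Phi>) a" a x \<Phi> b] A.Hom_Obj[of \<alpha> a a'] A.Ide_Hom[of a]
    pact_hom_prof[of "Ide (psrc \<Phi>) a" "psrc \<Phi>" a a \<alpha> a' "Ide (psrc \<Phi>) a"] by (simp add: A.Cmp_Ide_left A.Cmp_Ide_right)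

lemma lun_globular_map: "globular_map (prof_comp (hom_prof (ptgt \<Phi>)) \<Phi>) \<Phi> (lun_map \<Phi>)"
  unfolding globular_map_def
proof (intro conjI ballI allI)
  fix a b z assume "a \<in> Obj (psrc (prof_comp (hom_prof (ptgt \<Phi>)) \<Phi>))" "b \<in> Obj (ptgt (prof_comp (hom_prof (ptgt \<Phi>)) \<Phi>))"
    and z: "z \<in> pset (prof_comp (hom_prof (ptgt \<Phi>)) \<Phi>) a b"
  then have o: "a \<in> Obj (psrc \<Phi>)" "b \<in> Obj (ptgt \<Phi>)" by auto
  from z o show "lun_map \<Phi> a b z \<in> pset \<Phi> a b"
    by (rule lun_cases) (use o pact_in[OF P A.Ide_Hom] in \<open>auto simp: lun_map_tensor\<close>)
next
  fix a a' b b' \<alpha> \<beta> z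
  assume "\<alpha> \<in> Hom (psrc (prof_comp (hom_prof (ptgt \<Phi>)) \<Phi>)) a' a" "\<beta> \<in> Hom (ptgt (prof_comp (hom_prof (ptgt \<Phi>)) \<Phi>)) b b'"
    and z: "z \<in> pset (prof_comp (hom_prof (ptgt \<Phi>)) \<Phi>) a b"
  then have h: "\<alpha> \<in> Hom (psrc \<Phi>) a' a" "\<beta> \<in> Hom (ptgt \<Phi>) b b'" by auto
  then have o: "a \<in> Obj (psrc \<Phi>)" "b \<in> Obj (ptgt \<Phi>)" "a' \<in> Obj (psrc \<Phi>)" "b' \<in> Obj (ptgt \<Phi>)" using A.Hom_Obj B.Hom_Obj by auto
  obtain c x \<gamma> where w: "c \<in> Obj (ptgt \<Phi>)" "x \<in> pset \<Phi> a c" "\<gamma> \<in> Hom (ptgt \<Phi>) c b"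
    and ze: "z = tensor \<Phi> (hom_prof (ptgt \<Phi>)) a b (c, x, \<gamma>)" using lun_cases[OF z o(1,2)] by metis
  note ic = B.Ide_Hom[OF w(1)]
  have g: "\<gamma> \<in> pset (hom_prof (ptgt \<Phi>)) c b" using w o by simp
  have "pact (prof_comp (hom_prof (ptgt \<Phi>)) \<Phi>) \<alpha> \<beta> z = tensor \<Phi> (hom_prof (ptgt \<Phi>)) a' b' (c, pact \<Phi> \<alpha> (Ide (ptgt \<Phi>) c) x, Cmp (ptgt \<Phi>) \<beta> \<gamma>)"
    unfolding ze using pact_prof_comp[OF composable_hom(1) h(1) _ w(1,2) g, of \<beta> b'] h(2) pact_hom_prof[OF ic h(2) w(3)] B.Cmp_Ide_right[OF w(3)] by simp
  moreover have "lun_map \<Phi> a' b' (tensor \<Phi> (hom_prof (ptgt \<Phi>)) a' b' (c, pact \<Phi> \<alpha> (Ide (ptgt \<Phi>) c) x, Cmp (ptgt \<Phi>) \<beta> \<gamma>)) =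
     pact \<Phi> (Ide (psrc \<Phi>) a') (Cmp (ptgt \<Phi>) \<beta> \<gamma>) (pact \<Phi> \<alpha> (Ide (ptgt \<Phi>) c) x)"
    by (rule lun_map_tensor[OF o(3) pact_in[OF P h(1) ic w(2)] B.Cmp_Hom[OF w(3) h(2)]])
  moreover have "\<dots> = pact \<Phi> \<alpha> (Cmp (ptgt \<Phi>) \<beta> \<gamma>) x"
    using act_split(2)[OF P h(1) B.Cmp_Hom[OF w(3) h(2)] w(2)] .
  moreover have "\<dots> = pact \<Phi> \<alpha> \<beta> (lun_map \<Phi> a b z)"
    unfolding ze lun_map_tensor[OF o(1) w(2,3)]
    using pact_Cmp[OF P A.Ide_Hom[OF o(1)] w(3) h w(2)] A.Cmp_Ide_left[OF h(1)] by simp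
  ultimately show "lun_map \<Phi> a' b' (pact (prof_comp (hom_prof (ptgt \<Phi>)) \<Phi>) \<alpha> \<beta> z) = pact \<Phi> \<alpha> \<beta> (lun_map \<Phi> a b z)" by simp
qed (use P composable_hom profunctor_prof_comp in auto)

lemma lun_inv_globular_map:
  "globular_map \<Phi> (prof_comp (hom_prof (ptgt \<Phi>)) \<Phi>) (\<lambda>a b x. tensor \<Phi> (hom_prof (ptgt \<Phi>)) a b (b, x, Ide (ptgt \<Phi>) b))"
  unfolding globular_map_def
proof (intro conjI ballI allI)
  fix a b z assume o: "a \<in> Obj (psrc \<Phi>)" "b \<in> Obj (ptgt \<Phi>)" "z \<in> pset \<Phi> a b"
  then show "tensor \<Phi> (hom_prof (ptgt \<Phi>)) a b (b, z, Ide (ptgt \<Phi>) b) \<in> pset (prof_comp (hom_prof (ptgt \<Phi>)) \<Phi>) a b"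
    using lun_in B.Ide_Hom by auto
next
  fix a a' b b' \<alpha> \<beta> z assume h: "\<alpha> \<in> Hom (psrc \<Phi>) a' a" "\<beta> \<in> Hom (ptgt \<Phi>) b b'" and z: "z \<in> pset \<Phi> a b"
  then have o: "a \<in> Obj (psrc \<Phi>)" "b \<in> Obj (ptgt \<Phi>)" "a' \<in> Obj (psrc \<Phi>)" "b' \<in> Obj (ptgt \<Phi>)" using A.Hom_Obj B.Hom_Obj by auto
  note ib = B.Ide_Hom[OF o(2)]
  have "pact (prof_comp (hom_prof (ptgt \<Phi>)) \<Phi>) \<alpha> \<beta> (tensor \<Phi> (hom_prof (ptgt \<Phi>)) a b (b, z, Ide (ptgt \<Phi>) b)) =
    tensor \<Phi> (hom_prof (ptgt \<Phi>)) a' b' (b, pact \<Phi> \<alpha> (Ide (ptgt \<Phi>) b) z, \<beta>)"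
    using pact_prof_comp[OF composable_hom(1) h(1) _ o(2) z, of \<beta> b b' "Ide (ptgt \<Phi>) b"] h(2) ib o pact_hom_prof[OF ib h(2) ib]
     B.Cmp_Ide_right[OF h(2)] B.Cmp_Ide_right[OF ib] by simp
  also have "\<dots> = tensor \<Phi> (hom_prof (ptgt \<Phi>)) a' b' (b', pact \<Phi> \<alpha> \<beta> z, Ide (ptgt \<Phi>) b')"
    unfolding lun_normal[OF o(3) pact_in[OF P h(1) ib z] h(2)] act_split(2)[OF P h z] ..
  finally show "tensor \<Phi> (hom_prof (ptgt \<Phi>)) a' b' (b', pact \<Phi> \<alpha> \<beta> z, Ide (ptgt \<Phi>) b') =
    pact (prof_comp (hom_prof (ptgt \<Phi>)) \<Phi>) \<alpha> \<beta> (tensor \<Phi> (hom_prof (ptgt \<Phi>)) a b (b, z, Ide (ptgt \<Phi>) b))" ..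
qed (use P composable_hom profunctor_prof_comp in auto)

lemma lun_is_iso: "is_iso prof_cat (globular_cell (prof_comp (hom_prof (ptgt \<Phi>)) \<Phi>) \<Phi> (lun_map \<Phi>))"
proof (rule iso_globular_cell[OF lun_globular_map lun_inv_globular_map])
  fix a b z assume "a \<in> Obj (psrc (prof_comp (hom_prof (ptgt \<Phi>)) \<Phi>))" "b \<in> Obj (ptgt (prof_comp (hom_prof (ptgt \<Phi>)) \<Phi>))"
    and z: "z \<in> pset (prof_comp (hom_prof (ptgt \<Phi>)) \<Phi>) a b"
  then have o: "a \<in> Obj (psrc \<Phi>)" "b \<in> Obj (ptgt \<Phi>)" by auto
  from z o show "tensor \<Phi> (hom_prof (ptgt \<Phi>)) a b (b, lun_map \<Phi> a b z, Ide (ptgt \<Phi>) b) = z"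
    by (rule lun_cases) (use o in \<open>simp add: lun_map_tensor lun_normal[symmetric]\<close>)
next
  fix a b z assume "a \<in> Obj (psrc (prof_comp (hom_prof (ptgt \<Phi>)) \<Phi>))" "b \<in> Obj (ptgt (prof_comp (hom_prof (ptgt \<Phi>)) \<Phi>))"
    and z: "z \<in> pset \<Phi> a b"
  then show "lun_map \<Phi> a b (tensor \<Phi> (hom_prof (ptgt \<Phi>)) a b (b, z, Ide (ptgt \<Phi>) b)) = z"
    using B.Ide_Hom[of b] by (simp add: lun_map_tensor pact_Ide[OF P])
qed

lemma run_globular_map: "globular_map (prof_comp \<Phi> (hom_prof (psrc \<Phi>))) \<Phi> (run_map \<Phi>)"
  unfolding globular_map_def
proof (intro conjI ballI allI)
  fix a b z assume "a \<in> Obj (psrc (prof_comp \<Phi> (hom_prof (psrc \<Phi>))))" "b \<in> Obj (ptgt (prof_comp \<Phi> (hom_prof (psrc \<Phi>))))"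
    and z: "z \<in> pset (prof_comp \<Phi> (hom_prof (psrc \<Phi>))) a b"
  then have o: "a \<in> Obj (psrc \<Phi>)" "b \<in> Obj (ptgt \<Phi>)" by auto
  from z o show "run_map \<Phi> a b z \<in> pset \<Phi> a b"
    by (rule run_cases) (use o pact_in[OF P _ B.Ide_Hom] in \<open>auto simp: run_map_tensor\<close>)
next
  fix a a' b b' \<alpha> \<beta> z
  assume "\<alpha> \<in> Hom (psrc (prof_comp \<Phi> (hom_prof (psrc \<Phi>)))) a' a" "\<beta> \<in> Hom (ptgt (prof_comp \<Phi> (hom_prof (psrc \<Phi>)))) b b'"
    and z: "z \<in> pset (prof_comp \<Phi> (hom_prof (psrc \<Phi>))) a b"
  then have h: "\<alpha> \<in> Hom (psrc \<Phi>) a' a" "\<beta> \<in> Hom (ptgt \<Phi>) b b'" by auto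
  then have o: "a \<in> Obj (psrc \<Phi>)" "b \<in> Obj (ptgt \<Phi>)" "a' \<in> Obj (psrc \<Phi>)" "b' \<in> Obj (ptgt \<Phi>)" using A.Hom_Obj B.Hom_Obj by auto
  obtain c x \<gamma> where w: "c \<in> Obj (psrc \<Phi>)" "\<gamma> \<in> Hom (psrc \<Phi>) a c" "x \<in> pset \<Phi> c b"
    and ze: "z = tensor (hom_prof (psrc \<Phi>)) \<Phi> a b (c, \<gamma>, x)" using run_cases[OF z o(1,2)] by metis
  note ic = A.Ide_Hom[OF w(1)]
  have g: "\<gamma> \<in> pset (hom_prof (psrc \<Phi>)) a c" using w o by simp
  have "pact (prof_comp \<Phi> (hom_prof (psrc \<Phi>))) \<alpha> \<beta> z = tensor (hom_prof (psrc \<Phi>)) \<Phi> a' b' (c, Cmp (psrc \<Phi>) \<gamma> \<alpha>, pact \<Phi> (Ide (psrc \<Phi>) c) \<beta> x)"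
    unfolding ze using pact_prof_comp[OF composable_hom(2) _ h(2) _ g w(3), of \<alpha> a'] h(1) w(1) pact_hom_prof[OF h(1) ic w(2)] B.Cmp_Ide_right
     A.Cmp_Ide_left[OF A.Cmp_Hom[OF h(1) w(2)]] by simp
  moreover have "run_map \<Phi> a' b' (tensor (hom_prof (psrc \<Phi>)) \<Phi> a' b' (c, Cmp (psrc \<Phi>) \<gamma> \<alpha>, pact \<Phi> (Ide (psrc \<Phi>) c) \<beta> x)) =
     pact \<Phi> (Cmp (psrc \<Phi>) \<gamma> \<alpha>) (Ide (ptgt \<Phi>) b') (pact \<Phi> (Ide (psrc \<Phi>) c) \<beta> x)"
    by (rule run_map_tensor[OF o(4) pact_in[OF P ic h(2) w(3)] A.Cmp_Hom[OF h(1) w(2)]])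
  moreover have "\<dots> = pact \<Phi> (Cmp (psrc \<Phi>) \<gamma> \<alpha>) \<beta> x"
    using act_split(1)[OF P A.Cmp_Hom[OF h(1) w(2)] h(2) w(3)] .
  moreover have "\<dots> = pact \<Phi> \<alpha> \<beta> (run_map \<Phi> a b z)"
    unfolding ze run_map_tensor[OF o(2) w(3,2)]
    using pact_Cmp[OF P w(2) B.Ide_Hom[OF o(2)] h w(3)] B.Cmp_Ide_right[OF h(2)] by simp
  ultimately show "run_map \<Phi> a' b' (pact (prof_comp \<Phi> (hom_prof (psrc \<Phi>))) \<alpha> \<beta> z) = pact \<Phi> \<alpha> \<beta> (run_map \<Phi> a b z)" by simp
qed (use P composable_hom profunctor_prof_comp in auto)

lemma run_inv_globular_map:
  "globular_map \<Phi> (prof_comp \<Phi> (hom_prof (psrc \<Phi>))) (\<lambda>a b x. tensor (hom_prof (psrc \<Phi>)) \<Phi> a b (a, Ide (psrc \<Phi>) a, x))"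
  unfolding globular_map_def
proof (intro conjI ballI allI)
  fix a b z assume o: "a \<in> Obj (psrc \<Phi>)" "b \<in> Obj (ptgt \<Phi>)" "z \<in> pset \<Phi> a b"
  then show "tensor (hom_prof (psrc \<Phi>)) \<Phi> a b (a, Ide (psrc \<Phi>) a, z) \<in> pset (prof_comp \<Phi> (hom_prof (psrc \<Phi>))) a b"
    using run_in A.Ide_Hom by auto
next
  fix a a' b b' \<alpha> \<beta> z assume h: "\<alpha> \<in> Hom (psrc \<Phi>) a' a" "\<beta> \<in> Hom (ptgt \<Phi>) b b'" and z: "z \<in> pset \<Phi> a b"
  then have o: "a \<in> Obj (psrc \<Phi>)" "b \<in> Obj (ptgt \<Phi>)" "a' \<in> Obj (psrc \<Phi>)" "b' \<in> Obj (ptgt \<Phi>)" using A.Hom_Obj B.Hom_Obj by auto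
  note ia = A.Ide_Hom[OF o(1)]
  have "pact (prof_comp \<Phi> (hom_prof (psrc \<Phi>))) \<alpha> \<beta> (tensor (hom_prof (psrc \<Phi>)) \<Phi> a b (a, Ide (psrc \<Phi>) a, z)) =
    tensor (hom_prof (psrc \<Phi>)) \<Phi> a' b' (a, \<alpha>, pact \<Phi> (Ide (psrc \<Phi>) a) \<beta> z)"
    using pact_prof_comp[OF composable_hom(2) _ h(2) _ _ z, of \<alpha> a' a "Ide (psrc \<Phi>) a"] h(1) ia o pact_hom_prof[OF h(1) ia ia]
     A.Cmp_Ide_left[OF h(1)] by simp
  also have "\<dots> = tensor (hom_prof (psrc \<Phi>)) \<Phi> a' b' (a', Ide (psrc \<Phi>) a', pact \<Phi> \<alpha> \<beta> z)"
    unfolding run_normal[OF o(4) pact_in[OF P ia h(2) z] h(1)] act_split(1)[OF P h z] ..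
  finally show "tensor (hom_prof (psrc \<Phi>)) \<Phi> a' b' (a', Ide (psrc \<Phi>) a', pact \<Phi> \<alpha> \<beta> z) =
    pact (prof_comp \<Phi> (hom_prof (psrc \<Phi>))) \<alpha> \<beta> (tensor (hom_prof (psrc \<Phi>)) \<Phi> a b (a, Ide (psrc \<Phi>) a, z))" ..
qed (use P composable_hom profunctor_prof_comp in auto)

lemma run_is_iso: "is_iso prof_cat (globular_cell (prof_comp \<Phi> (hom_prof (psrc \<Phi>))) \<Phi> (run_map \<Phi>))"
proof (rule iso_globular_cell[OF run_globular_map run_inv_globular_map])
  fix a b z assume "a \<in> Obj (psrc (prof_comp \<Phi> (hom_prof (psrc \<Phi>))))" "b \<in> Obj (ptgt (prof_comp \<Phi> (hom_prof (psrc \<Phi>))))"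
    and z: "z \<in> pset (prof_comp \<Phi> (hom_prof (psrc \<Phi>))) a b"
  then have o: "a \<in> Obj (psrc \<Phi>)" "b \<in> Obj (ptgt \<Phi>)" by auto
  from z o show "tensor (hom_prof (psrc \<Phi>)) \<Phi> a b (a, Ide (psrc \<Phi>) a, run_map \<Phi> a b z) = z"
    by (rule run_cases) (use o in \<open>simp add: run_map_tensor run_normal[symmetric]\<close>)
next
  fix a b z assume "a \<in> Obj (psrc (prof_comp \<Phi> (hom_prof (psrc \<Phi>))))" "b \<in> Obj (ptgt (prof_comp \<Phi> (hom_prof (psrc \<Phi>))))"
    and z: "z \<in> pset \<Phi> a b"
  then show "run_map \<Phi> a b (tensor (hom_prof (psrc \<Phi>)) \<Phi> a b (a, Ide (psrc \<Phi>) a, z)) = z"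
    using A.Ide_Hom[of a] by (simp add: run_map_tensor pact_Ide[OF P])
qed

end

lemma hom_cell_simps [simp]: "cdom (hom_cell F) = hom_prof (fdom F)" "ccod (hom_cell F) = hom_prof (fcod F)"
  "csrc (hom_cell F) = F" "ctgt (hom_cell F) = F"
  by (auto simp: hom_cell_def)

lemma cmap_hom_cell [simp]: "a \<in> Obj (fdom F) \<Longrightarrow> b \<in> Obj (fdom F) \<Longrightarrow> h \<in> Hom (fdom F) a b \<Longrightarrow> cmap (hom_cell F) a b h = far F h"
  by (simp add: hom_cell_def)

lemma cell_hom_cell: assumes "cat_functor F" shows "profunctor_cell (hom_cell F)"
proof -
  interpret F: cat_functor F by fact
  interpret A: category "fdom F" by (rule F.fdom_category)
  interpret B: category "fcod F" by (rule F.fcod_category)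
  have "profunctor_cell \<lparr>cdom = hom_prof (fdom F), ccod = hom_prof (fcod F), csrc = F, ctgt = F, cnat = cnat (hom_cell F)\<rparr>"
  proof (rule profunctor_cellI)
    fix a b x assume "a \<in> Obj (psrc (hom_prof (fdom F)))" "b \<in> Obj (ptgt (hom_prof (fdom F)))" "x \<in> pset (hom_prof (fdom F)) a b"
    then show "cmap (hom_cell F) a b x \<in> pset (hom_prof (fcod F)) (fob F a) (fob F b)"
      using F.far_Hom[of x a b] F.fob_Obj by simp
  next
    fix \<alpha> \<beta> a a' b b' x assume "\<alpha> \<in> Hom (psrc (hom_prof (fdom F))) a' a" "\<beta> \<in> Hom (ptgt (hom_prof (fdom F))) b b'"
      and x: "x \<in> pset (hom_prof (fdom F)) a b"
    then have h: "\<alpha> \<in> Hom (fdom F) a' a" "\<beta> \<in> Hom (fdom F) b b'" by auto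
    then have o: "a \<in> Obj (fdom F)" "b \<in> Obj (fdom F)" "a' \<in> Obj (fdom F)" "b' \<in> Obj (fdom F)" using A.Hom_Obj by auto
    then have x: "x \<in> Hom (fdom F) a b" using x by simp
    note 1 = A.Cmp_Hom[OF h(1) x] 
    note 2 = A.Cmp_Hom[OF 1 h(2)]
    show "cmap (hom_cell F) a' b' (pact (hom_prof (fdom F)) \<alpha> \<beta> x) = pact (hom_prof (fcod F)) (far F \<alpha>) (far F \<beta>) (cmap (hom_cell F) a b x)"
      using o h x 1 2 F.far_Hom[OF h(1)] F.far_Hom[OF h(2)] F.far_Hom[OF x] F.fob_Obj
      by (simp add: pact_hom_prof[OF h x] pact_hom_prof[OF F.far_Hom[OF h(1)] F.far_Hom[OF h(2)] F.far_Hom[OF x]]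
        F.far_Cmp[OF 1 h(2)] F.far_Cmp[OF h(1) x])
  qed (use assms F.fob_Obj A.category_axioms B.category_axioms in \<open>auto simp: profunctor_hom_prof hom_cell_def\<close>)
  then show ?thesis by (simp add: hom_cell_def)
qed

lemma cell_HomD: assumes "\<tau> \<in> Hom prof_cat \<Phi> \<Psi>" shows "profunctor_cell \<tau>" "cdom \<tau> = \<Phi>" "ccod \<tau> = \<Psi>"
  using assms by (auto simp: Hom_def)

lemma Obj_pairs: "Obj (composable_pairs (Src Cat) (Tgt Cat)) = {(\<Psi>, \<Phi>). composable_profs \<Psi> \<Phi>}"
  by (auto simp: Cat_def Let_def composable_pairs_def composable_profs_def)

lemma Arr_pairs: "Arr (composable_pairs (Src Cat) (Tgt Cat)) = {(\<sigma>, \<tau>). composable_cells \<sigma> \<tau>}"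
  by (auto simp: Cat_def Let_def composable_pairs_def composable_cells_def)

lemma Cat_simps [simp]:
  "Hc Cat = cat_cat" "Vc Cat = prof_cat"
  "fdom (Src Cat) = prof_cat" "fcod (Src Cat) = cat_cat" "fdom (Tgt Cat) = prof_cat" "fcod (Tgt Cat) = cat_cat"
  "fdom (Uni Cat) = cat_cat" "fcod (Uni Cat) = prof_cat"
  "fdom (Vcmp Cat) = composable_pairs (Src Cat) (Tgt Cat)" "fcod (Vcmp Cat) = prof_cat"
  "profunctor \<Phi> \<Longrightarrow> fob (Src Cat) \<Phi> = psrc \<Phi>" "profunctor \<Phi> \<Longrightarrow> fob (Tgt Cat) \<Phi> = ptgt \<Phi>"
  "profunctor_cell \<tau> \<Longrightarrow> far (Src Cat) \<tau> = csrc \<tau>" "profunctor_cell \<tau> \<Longrightarrow> far (Tgt Cat) \<tau> = ctgt \<tau>"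
  "category A \<Longrightarrow> fob (Uni Cat) A = hom_prof A" "cat_functor F \<Longrightarrow> far (Uni Cat) F = hom_cell F"
  "Lun Cat \<Phi> = globular_cell (prof_comp (hom_prof (ptgt \<Phi>)) \<Phi>) \<Phi> (lun_map \<Phi>)"
  "Run Cat \<Phi> = globular_cell (prof_comp \<Phi> (hom_prof (psrc \<Phi>))) \<Phi> (run_map \<Phi>)"
  "Asc Cat X \<Psi> \<Phi> = globular_cell (prof_comp (prof_comp X \<Psi>) \<Phi>) (prof_comp X (prof_comp \<Psi> \<Phi>)) (asc_map X \<Psi> \<Phi>)"
  by (auto simp: Cat_def Let_def)

lemma vcmp_Cat [simp]: "composable_profs \<Psi> \<Phi> \<Longrightarrow> vcmp Cat \<Psi> \<Phi> = prof_comp \<Psi> \<Phi>"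
  using Obj_pairs by (auto simp: Cat_def Let_def)

lemma vcmp2_Cat [simp]: "composable_cells \<sigma> \<tau> \<Longrightarrow> vcmp2 Cat \<sigma> \<tau> = cell_comp \<sigma> \<tau>"
  using Arr_pairs by (auto simp: Cat_def Let_def)

lemma composable_Cat [simp]: "composable Cat \<Psi> \<Phi> \<longleftrightarrow> composable_profs \<Psi> \<Phi>"
  by (auto simp: composable_def composable_profs_def)

lemma composable2_Cat [simp]: "composable2 Cat \<sigma> \<tau> \<longleftrightarrow> composable_cells \<sigma> \<tau>"
  by (auto simp: composable2_def composable_cells_def)

lemma functor_Src_Cat: "cat_functor (Src Cat)"
  by (rule cat_functor.intro)
   (auto simp: category_prof_cat category_cat_cat Hom_def profunctor_cats cellD cell_Ide cell_Cmp,
    auto simp: Cat_def Let_def profunctor_cats split: if_splits)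

lemma functor_Tgt_Cat: "cat_functor (Tgt Cat)"
  by (rule cat_functor.intro)
   (auto simp: category_prof_cat category_cat_cat Hom_def profunctor_cats cellD cell_Ide cell_Cmp,
    auto simp: Cat_def Let_def profunctor_cats split: if_splits)

lemma functor_Uni_Cat: "cat_functor (Uni Cat)"
proof (rule cat_functor.intro)
  show "fob (Uni Cat) \<in> Obj (fdom (Uni Cat)) \<rightarrow>\<^sub>E Obj (fcod (Uni Cat))"
    by (auto simp: Cat_def Let_def profunctor_hom_prof)
  show "far (Uni Cat) \<in> extensional (Arr (fdom (Uni Cat)))"
    by (auto simp: Cat_def Let_def)
next
  fix f a b assume "f \<in> Hom (fdom (Uni Cat)) a b"
  then show "far (Uni Cat) f \<in> Hom (fcod (Uni Cat)) (fob (Uni Cat) a) (fob (Uni Cat) b)"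
    by (auto simp: Hom_def cell_hom_cell cat_functor.fdom_category cat_functor.fcod_category)
next
  fix A :: "('a, 'a) cat" assume "A \<in> Obj (fdom (Uni Cat))"
  then have A: "category A" by simp
  have "hom_cell (fid A) = Ide prof_cat (hom_prof A)"
    by (rule pcell_eqI) (use A in \<open>auto simp: cell_hom_cell functor_fid cell_Ide profunctor_hom_prof HomD\<close>)
  then show "far (Uni Cat) (Ide (fdom (Uni Cat)) A) = Ide (fcod (Uni Cat)) (fob (Uni Cat) A)"
    using A by (simp add: functor_fid)
next
  fix f g :: "('a, 'a, 'a, 'a) ftor" and a b c assume "f \<in> Hom (fdom (Uni Cat)) a b" "g \<in> Hom (fdom (Uni Cat)) b c"
  then have h: "cat_functor f" "cat_functor g" "fcod f = fdom g" by (auto simp: Hom_def)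
  have "hom_cell (fcmp g f) = Cmp prof_cat (hom_cell g) (hom_cell f)"
    by (rule pcell_eqI) (use h in \<open>auto simp: cell_hom_cell functor_fcmp cell_Cmp HomD cat_functor.fob_Obj[OF h(1)]
      cat_functor.far_Hom[OF h(1)] simp flip: h(3)\<close>)
  then show "far (Uni Cat) (Cmp (fdom (Uni Cat)) g f) = Cmp (fcod (Uni Cat)) (far (Uni Cat) g) (far (Uni Cat) f)"
    using h by (simp add: functor_fcmp)
qed (auto simp: category_prof_cat category_cat_cat)

lemma pairs_simps [simp]:
  "Dom (composable_pairs (Src Cat) (Tgt Cat)) (\<sigma>, \<tau>) = (cdom \<sigma>, cdom \<tau>)"
  "Cod (composable_pairs (Src Cat) (Tgt Cat)) (\<sigma>, \<tau>) = (ccod \<sigma>, ccod \<tau>)"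
  "Ide (composable_pairs (Src Cat) (Tgt Cat)) (\<Psi>, \<Phi>) = (Ide prof_cat \<Psi>, Ide prof_cat \<Phi>)"
  "Cmp (composable_pairs (Src Cat) (Tgt Cat)) (\<sigma>, \<tau>) (\<sigma>', \<tau>') = (Cmp prof_cat \<sigma> \<sigma>', Cmp prof_cat \<tau> \<tau>')"
  by (auto simp: composable_pairs_def prod_cat_def)

lemma Hom_pairs [simp]: "(\<sigma>, \<tau>) \<in> Hom (composable_pairs (Src Cat) (Tgt Cat)) (\<Psi>, \<Phi>) (\<Psi>', \<Phi>') \<longleftrightarrow>
  composable_cells \<sigma> \<tau> \<and> cdom \<sigma> = \<Psi> \<and> cdom \<tau> = \<Phi> \<and> ccod \<sigma> = \<Psi>' \<and> ccod \<tau> = \<Phi>'"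
  by (auto simp: Hom_def Arr_pairs)

lemma composable_Ide: "composable_profs \<Psi> \<Phi> \<Longrightarrow> composable_cells (Ide prof_cat \<Psi>) (Ide prof_cat \<Phi>)"
  by (auto simp: composable_profs_def composable_cells_def cell_Ide)

lemma composable_Cmp: "composable_cells \<sigma> \<tau> \<Longrightarrow> composable_cells \<sigma>' \<tau>' \<Longrightarrow> cdom \<sigma>' = ccod \<sigma> \<Longrightarrow> cdom \<tau>' = ccod \<tau> \<Longrightarrow>
  composable_cells (Cmp prof_cat \<sigma>' \<sigma>) (Cmp prof_cat \<tau>' \<tau>)"
  by (auto simp: composable_cells_def cell_Cmp)

lemma cell_unit: "profunctor_cell \<tau> \<Longrightarrow> Cmp prof_cat \<tau> (Ide prof_cat (cdom \<tau>)) = \<tau>"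
  "profunctor_cell \<tau> \<Longrightarrow> Cmp prof_cat (Ide prof_cat (ccod \<tau>)) \<tau> = \<tau>"
  using category.Cmp_Ide_right[OF category_prof_cat, of \<tau> "cdom \<tau>" "ccod \<tau>"]
    category.Cmp_Ide_left[OF category_prof_cat, of \<tau> "cdom \<tau>" "ccod \<tau>"] by (simp_all add: Hom_def)

lemma cell_assoc: "profunctor_cell \<tau> \<Longrightarrow> profunctor_cell \<sigma> \<Longrightarrow> profunctor_cell \<rho> \<Longrightarrow> cdom \<sigma> = ccod \<tau> \<Longrightarrow> cdom \<rho> = ccod \<sigma> \<Longrightarrow>
  Cmp prof_cat \<rho> (Cmp prof_cat \<sigma> \<tau>) = Cmp prof_cat (Cmp prof_cat \<rho> \<sigma>) \<tau>"
  using category.Cmp_assoc[OF category_prof_cat, of \<tau> "cdom \<tau>" "ccod \<tau>" \<sigma> "ccod \<sigma>" \<rho> "ccod \<rho>"] by (simp add: Hom_def)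

lemma category_pairs: "category (composable_pairs (Src Cat) (Tgt Cat))" (is "category ?P")
proof -
  show ?thesis
  proof
    fix f assume "f \<in> Arr ?P"
    then show "Dom ?P f \<in> Obj ?P" "Cod ?P f \<in> Obj ?P" by (auto simp: Arr_pairs Obj_pairs composable_cellsD)
  next
    fix a assume "a \<in> Obj ?P"
    then show "Ide ?P a \<in> Hom ?P a a" by (auto simp: Obj_pairs composable_Ide)
  next
    fix f g a b c assume "f \<in> Hom ?P a b" "g \<in> Hom ?P b c"
    then show "Cmp ?P g f \<in> Hom ?P a c"
      by (cases f; cases g; cases a; cases b; cases c) (auto simp: composable_Cmp)
  next
    fix f a b assume "f \<in> Hom ?P a b"
    then show "Cmp ?P f (Ide ?P a) = f" "Cmp ?P (Ide ?P b) f = f"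
      by (cases f; cases a; cases b; auto simp: composable_cells_def cell_unit)+
  next
    fix f g h a b c d assume "f \<in> Hom ?P a b" "g \<in> Hom ?P b c" "h \<in> Hom ?P c d"
    moreover obtain f1 f2 where f: "f = (f1, f2)" by (cases f)
    moreover obtain g1 g2 where g: "g = (g1, g2)" by (cases g)
    moreover obtain h1 h2 where h: "h = (h1, h2)" by (cases h)
    moreover obtain a1 a2 b1 b2 c1 c2 d1 d2 where "a = (a1, a2)" "b = (b1, b2)" "c = (c1, c2)" "d = (d1, d2)"
      by (cases a; cases b; cases c; cases d)
    ultimately have "profunctor_cell f1" "profunctor_cell f2" "profunctor_cell g1" "profunctor_cell g2" "profunctor_cell h1" "profunctor_cell h2"
      "cdom g1 = ccod f1" "cdom g2 = ccod f2" "cdom h1 = ccod g1" "cdom h2 = ccod g2"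
      by (simp_all add: composable_cells_def)
    then show "Cmp ?P h (Cmp ?P g f) = Cmp ?P (Cmp ?P h g) f"
      unfolding f g h pairs_simps by (simp only: cell_assoc)
  qed
qed

lemma cell_comp_Ide: assumes c: "composable_profs \<Psi> \<Phi>"
  shows "cell_comp (Ide prof_cat \<Psi>) (Ide prof_cat \<Phi>) = Ide prof_cat (prof_comp \<Psi> \<Phi>)"
proof (rule pcell_eqI)
  have P: "profunctor \<Phi>" "profunctor \<Psi>" "psrc \<Psi> = ptgt \<Phi>" using c by (auto simp: composable_profs_def)
  note ci = composable_Ide[OF c]
  note pc = profunctor_prof_comp[OF c]
  show "profunctor_cell (cell_comp (Ide prof_cat \<Psi>) (Ide prof_cat \<Phi>))" by (rule cell_cell_comp[OF ci])
  show "profunctor_cell (Ide prof_cat (prof_comp \<Psi> \<Phi>))" by (rule cell_Ide[OF pc])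
  fix a c z assume "a \<in> Obj (psrc (cdom (cell_comp (Ide prof_cat \<Psi>) (Ide prof_cat \<Phi>))))"
    "c \<in> Obj (ptgt (cdom (cell_comp (Ide prof_cat \<Psi>) (Ide prof_cat \<Phi>))))"
    "z \<in> pset (cdom (cell_comp (Ide prof_cat \<Psi>) (Ide prof_cat \<Phi>))) a c"
  then have o: "a \<in> Obj (psrc \<Phi>)" "c \<in> Obj (ptgt \<Psi>)" and z: "z \<in> pset (prof_comp \<Psi> \<Phi>) a c" by auto
  from z o show "cmap (cell_comp (Ide prof_cat \<Psi>) (Ide prof_cat \<Phi>)) a c z = cmap (Ide prof_cat (prof_comp \<Psi> \<Phi>)) a c z"
  proof (rule prof_comp_cases)
    fix b x y assume w: "b \<in> Obj (ptgt \<Phi>)" "x \<in> pset \<Phi> a b" "y \<in> pset \<Psi> b c" "z = tensor \<Phi> \<Psi> a c (b, x, y)"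
    then show ?thesis
      using cmap_cell_comp[OF ci, of a c b x y] o P z pc by simp
  qed
qed auto

lemma cell_comp_Cmp: assumes c: "composable_cells \<sigma> \<tau>" "composable_cells \<sigma>' \<tau>'" "cdom \<sigma>' = ccod \<sigma>" "cdom \<tau>' = ccod \<tau>"
  shows "cell_comp (Cmp prof_cat \<sigma>' \<sigma>) (Cmp prof_cat \<tau>' \<tau>) = Cmp prof_cat (cell_comp \<sigma>' \<tau>') (cell_comp \<sigma> \<tau>)" (is "?l = ?r")
proof (rule pcell_eqI)
  note cc = composable_Cmp[OF c]
  note C = composable_cellsD[OF c(1)] and C' = composable_cellsD[OF c(2)]
  show "profunctor_cell ?l" by (rule cell_cell_comp[OF cc])
  show "profunctor_cell ?r" by (rule cell_Cmp) (use c cell_cell_comp in auto)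
  fix a d z assume "a \<in> Obj (psrc (cdom ?l))" "d \<in> Obj (ptgt (cdom ?l))" "z \<in> pset (cdom ?l) a d"
  then have o: "a \<in> Obj (psrc (cdom \<tau>))" "d \<in> Obj (ptgt (cdom \<sigma>))" and z: "z \<in> pset (prof_comp (cdom \<sigma>) (cdom \<tau>)) a d" by auto
  from z o show "cmap ?l a d z = cmap ?r a d z"
  proof (rule prof_comp_cases)
    fix b x y assume w: "b \<in> Obj (ptgt (cdom \<tau>))" "x \<in> pset (cdom \<tau>) a b" "y \<in> pset (cdom \<sigma>) b d" "z = tensor (cdom \<tau>) (cdom \<sigma>) a d (b, x, y)"
    have b: "b \<in> Obj (psrc (cdom \<sigma>))" using w C by simp
    have "cmap ?l a d z = tensor (ccod \<tau>') (ccod \<sigma>') (fob (csrc \<tau>') (fob (csrc \<tau>) a)) (fob (ctgt \<sigma>') (fob (ctgt \<sigma>) d))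
       (fob (ctgt \<tau>') (fob (ctgt \<tau>) b), cmap \<tau>' (fob (csrc \<tau>) a) (fob (ctgt \<tau>) b) (cmap \<tau> a b x), cmap \<sigma>' (fob (ctgt \<tau>) b) (fob (ctgt \<sigma>) d) (cmap \<sigma> b d y))"
      using cmap_cell_comp[OF cc, of a d b x y] o w b C cellD[OF C(4)] cellD[OF C(3)] by simp
    also have "\<dots> = cmap (cell_comp \<sigma>' \<tau>') (fob (csrc \<tau>) a) (fob (ctgt \<sigma>) d) (tensor (cdom \<tau>') (cdom \<sigma>') (fob (csrc \<tau>) a) (fob (ctgt \<sigma>) d) (fob (ctgt \<tau>) b, cmap \<tau> a b x, cmap \<sigma> b d y))"
      by (rule cmap_cell_comp[OF c(2), symmetric])
       (use o w b C c fob_csrc[OF C(4)] fob_ctgt[OF C(3)] fob_ctgt[OF C(4)] cmap_in[OF C(4) o(1) w(1,2)] cmap_in[OF C(3) b o(2) w(3)] in auto)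
    also have "\<dots> = cmap (cell_comp \<sigma>' \<tau>') (fob (csrc \<tau>) a) (fob (ctgt \<sigma>) d) (cmap (cell_comp \<sigma> \<tau>) a d z)"
      using cmap_cell_comp[OF c(1) o w(1-3)] c w C by simp
    also have "\<dots> = cmap ?r a d z" using cmap_Cmp[OF cell_cell_comp[OF c(1)], of a d z] o z by simp
    finally show ?thesis .
  qed
qed (use c in auto)

lemma functor_Vcmp_Cat: "cat_functor (Vcmp Cat)"
proof (rule cat_functor.intro)
  show "fob (Vcmp Cat) \<in> Obj (fdom (Vcmp Cat)) \<rightarrow>\<^sub>E Obj (fcod (Vcmp Cat))"
  proof (rule PiE_I)
    fix p assume "p \<in> Obj (fdom (Vcmp Cat))" then show "fob (Vcmp Cat) p \<in> Obj (fcod (Vcmp Cat))"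
      by (auto simp: Obj_pairs profunctor_prof_comp)
  next
    fix p assume "p \<notin> Obj (fdom (Vcmp Cat))" then show "fob (Vcmp Cat) p = undefined"
      by (auto simp: Cat_def Let_def)
  qed
  show "far (Vcmp Cat) \<in> extensional (Arr (fdom (Vcmp Cat)))" by (auto simp: Cat_def Let_def)
next
  fix f a b assume "f \<in> Hom (fdom (Vcmp Cat)) a b"
  then show "far (Vcmp Cat) f \<in> Hom (fcod (Vcmp Cat)) (fob (Vcmp Cat) a) (fob (Vcmp Cat) b)"
    by (cases f; cases a; cases b) (auto simp: composable_cellsD(1,2) intro!: HomI cell_cell_comp)
next
  fix a assume "a \<in> Obj (fdom (Vcmp Cat))"
  then show "far (Vcmp Cat) (Ide (fdom (Vcmp Cat)) a) = Ide (fcod (Vcmp Cat)) (fob (Vcmp Cat) a)"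
    by (auto simp: Obj_pairs composable_Ide cell_comp_Ide)
next
  fix f g a b c assume "f \<in> Hom (fdom (Vcmp Cat)) a b" "g \<in> Hom (fdom (Vcmp Cat)) b c"
  then show "far (Vcmp Cat) (Cmp (fdom (Vcmp Cat)) g f) = Cmp (fcod (Vcmp Cat)) (far (Vcmp Cat) g) (far (Vcmp Cat) f)"
    by (cases f; cases g; cases a; cases b; cases c) (auto simp: composable_Cmp cell_comp_Cmp)
qed (auto simp: category_prof_cat category_pairs)

abbreviation asc_cell :: "'u::infinite prof \<Rightarrow> 'u prof \<Rightarrow> 'u prof \<Rightarrow> 'u pcell" where
  "asc_cell X \<Psi> \<Phi> \<equiv> globular_cell (prof_comp (prof_comp X \<Psi>) \<Phi>) (prof_comp X (prof_comp \<Psi> \<Phi>)) (asc_map X \<Psi> \<Phi>)"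

lemma composable_cells_comp:
  assumes "composable_cells \<rho> \<sigma>" "composable_cells \<sigma> \<tau>"
  shows "composable_cells (cell_comp \<rho> \<sigma>) \<tau>" "composable_cells \<rho> (cell_comp \<sigma> \<tau>)"
  using assms cell_cell_comp[of \<rho> \<sigma>] cell_cell_comp[of \<sigma> \<tau>] by (auto simp: composable_cells_def)

lemma cmap_asc_cell:
  assumes cc: "composable_profs X \<Psi>" "composable_profs \<Psi> \<Phi>"
    and o: "a \<in> Obj (psrc \<Phi>)" "d \<in> Obj (ptgt X)" and b: "b \<in> Obj (ptgt \<Phi>)" and c: "c \<in> Obj (ptgt \<Psi>)"
    and x: "x \<in> pset \<Phi> a b" "y \<in> pset \<Psi> b c" "v \<in> pset X c d"
  shows "cmap (asc_cell X \<Psi> \<Phi>) a d (tensor \<Phi> (prof_comp X \<Psi>) a d (b, x, tensor \<Psi> X b d (c, y, v))) =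
     tensor (prof_comp \<Psi> \<Phi>) X a d (c, tensor \<Phi> \<Psi> a c (b, x, y), v)"
  using cmap_globular_cell[OF profunctor_prof_comp[OF composable_profs_comp(1)[OF cc]], of a d] o
    left_in(2)[OF cc o b c x] asc_map_tensor[OF cc o b c x] by simp

lemma asc_natural:
  assumes cc: "composable_cells \<rho> \<sigma>" "composable_cells \<sigma> \<tau>"
  shows "Cmp prof_cat (asc_cell (ccod \<rho>) (ccod \<sigma>) (ccod \<tau>)) (cell_comp (cell_comp \<rho> \<sigma>) \<tau>) =
    Cmp prof_cat (cell_comp \<rho> (cell_comp \<sigma> \<tau>)) (asc_cell (cdom \<rho>) (cdom \<sigma>) (cdom \<tau>))" (is "?l = ?r")
proof (rule pcell_eqI)
  note R = composable_cellsD[OF cc(1)] and S = composable_cellsD[OF cc(2)]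
  note L = composable_cells_comp(1)[OF cc] and L' = composable_cells_comp(2)[OF cc]
  note d = R(1) S(1) and e = R(2) S(2)
  note gd = cell_globular_cell[OF asc_globular_map[OF d]] and ge = cell_globular_cell[OF asc_globular_map[OF e]]
  show "profunctor_cell ?l" by (rule cell_Cmp) (use ge cell_cell_comp[OF L] in auto)
  show "profunctor_cell ?r" by (rule cell_Cmp) (use gd cell_cell_comp[OF L'] in auto)
  show "csrc ?l = csrc ?r" using cellD[OF S(4)] fcmp_fid[of "csrc \<tau>"] by simp
  show "ctgt ?l = ctgt ?r" using cellD[OF R(3)] fcmp_fid[of "ctgt \<rho>"] by simp
  fix a f z assume "a \<in> Obj (psrc (cdom ?l))" "f \<in> Obj (ptgt (cdom ?l))" "z \<in> pset (cdom ?l) a f"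
  then have o: "a \<in> Obj (psrc (cdom \<tau>))" "f \<in> Obj (ptgt (cdom \<rho>))"
    and z: "z \<in> pset (prof_comp (prof_comp (cdom \<rho>) (cdom \<sigma>)) (cdom \<tau>)) a f" by auto
  from d z o show "cmap ?l a f z = cmap ?r a f z"
  proof (rule left_cases)
    fix b c x y v assume w: "b \<in> Obj (ptgt (cdom \<tau>))" "c \<in> Obj (ptgt (cdom \<sigma>))" "x \<in> pset (cdom \<tau>) a b" "y \<in> pset (cdom \<sigma>) b c" "v \<in> pset (cdom \<rho>) c f"
     and ze: "z = tensor (cdom \<tau>) (prof_comp (cdom \<rho>) (cdom \<sigma>)) a f (b, x, tensor (cdom \<sigma>) (cdom \<rho>) b f (c, y, v))"
    have b: "b \<in> Obj (psrc (cdom \<sigma>))" and c: "c \<in> Obj (psrc (cdom \<rho>))" using w R S by auto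
    note i = cmap_in[OF S(4) o(1) w(1,3)] cmap_in[OF S(3) b w(2,4)] cmap_in[OF R(3) c o(2) w(5)]
    note fo = fob_csrc[OF S(4) o(1)] fob_ctgt[OF R(3) o(2)] fob_ctgt[OF S(4) w(1)] fob_ctgt[OF S(3) w(2)]
    have i': "cmap \<sigma> b c y \<in> pset (ccod \<sigma>) (fob (ctgt \<tau>) b) (fob (ctgt \<sigma>) c)" "cmap \<rho> c f v \<in> pset (ccod \<rho>) (fob (ctgt \<sigma>) c) (fob (ctgt \<rho>) f)"
      using i R(5) S(5) by auto
    have 1: "cmap (cell_comp \<rho> \<sigma>) b f (tensor (cdom \<sigma>) (cdom \<rho>) b f (c, y, v)) =
       tensor (ccod \<sigma>) (ccod \<rho>) (fob (ctgt \<tau>) b) (fob (ctgt \<rho>) f) (fob (ctgt \<sigma>) c, cmap \<sigma> b c y, cmap \<rho> c f v)"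
      using cmap_cell_comp[OF cc(1) b o(2) w(2,4,5)] S(5) by simp
    have 2: "cmap (cell_comp (cell_comp \<rho> \<sigma>) \<tau>) a f z =
       tensor (ccod \<tau>) (prof_comp (ccod \<rho>) (ccod \<sigma>)) (fob (csrc \<tau>) a) (fob (ctgt \<rho>) f) (fob (ctgt \<tau>) b, cmap \<tau> a b x,
         tensor (ccod \<sigma>) (ccod \<rho>) (fob (ctgt \<tau>) b) (fob (ctgt \<rho>) f) (fob (ctgt \<sigma>) c, cmap \<sigma> b c y, cmap \<rho> c f v))"
      using cmap_cell_comp[OF L o(1) _ w(1,3), of f "tensor (cdom \<sigma>) (cdom \<rho>) b f (c, y, v)"] o left_in(1)[OF d o w]
      by (simp add: ze 1)
    have 3: "cmap ?l a f z = tensor (prof_comp (ccod \<sigma>) (ccod \<tau>)) (ccod \<rho>) (fob (csrc \<tau>) a) (fob (ctgt \<rho>) f) (fob (ctgt \<sigma>) c,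
        tensor (ccod \<tau>) (ccod \<sigma>) (fob (csrc \<tau>) a) (fob (ctgt \<sigma>) c) (fob (ctgt \<tau>) b, cmap \<tau> a b x, cmap \<sigma> b c y), cmap \<rho> c f v)"
      using cmap_Cmp[OF cell_cell_comp[OF L], of a f z] o z cmap_asc_cell[OF e fo(1,2,3,4) i(1) i'] by (simp add: 2)
    have 4: "cmap (cell_comp \<sigma> \<tau>) a c (tensor (cdom \<tau>) (cdom \<sigma>) a c (b, x, y)) =
       tensor (ccod \<tau>) (ccod \<sigma>) (fob (csrc \<tau>) a) (fob (ctgt \<sigma>) c) (fob (ctgt \<tau>) b, cmap \<tau> a b x, cmap \<sigma> b c y)"
      by (rule cmap_cell_comp[OF cc(2) o(1) w(2,1,3,4)])
    have "cmap ?r a f z = cmap (cell_comp \<rho> (cell_comp \<sigma> \<tau>)) a f (tensor (prof_comp (cdom \<sigma>) (cdom \<tau>)) (cdom \<rho>) a f (c, tensor (cdom \<tau>) (cdom \<sigma>) a c (b, x, y), v))"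
      using cmap_Cmp[OF gd, of a f z] o z cmap_asc_cell[OF d o w] by (simp add: ze)
    also have "\<dots> = cmap ?l a f z"
      using cmap_cell_comp[OF L' _ o(2), of a c "tensor (cdom \<tau>) (cdom \<sigma>) a c (b, x, y)" v] o w right_in(1)[OF d o w]
      by (simp add: 3 4)
    finally show ?thesis ..
  qed
qed (auto)

lemma lun_natural:
  assumes t: "profunctor_cell \<tau>"
  shows "Cmp prof_cat (globular_cell (prof_comp (hom_prof (ptgt (ccod \<tau>))) (ccod \<tau>)) (ccod \<tau>) (lun_map (ccod \<tau>))) (cell_comp (hom_cell (ctgt \<tau>)) \<tau>)
    = Cmp prof_cat \<tau> (globular_cell (prof_comp (hom_prof (ptgt (cdom \<tau>))) (cdom \<tau>)) (cdom \<tau>) (lun_map (cdom \<tau>)))" (is "?l = ?r")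
proof (rule pcell_eqI)
  note T = cellD[OF t]
  interpret A: category "psrc (cdom \<tau>)" using T profunctor_cats by blast
  interpret F: cat_functor "csrc \<tau>" by (rule T(3))
  have c: "composable_cells (hom_cell (ctgt \<tau>)) \<tau>" using t T by (simp add: composable_cells_def cell_hom_cell)
  note gd = cell_globular_cell[OF lun_globular_map[OF T(1)]] and ge = cell_globular_cell[OF lun_globular_map[OF T(2)]]
  show "profunctor_cell ?l" by (rule cell_Cmp) (use ge cell_cell_comp[OF c] T in auto)
  show "profunctor_cell ?r" by (rule cell_Cmp) (use gd t in auto)
  show "csrc ?l = csrc ?r" using T fcmp_fid[of "csrc \<tau>"] by simp
  show "ctgt ?l = ctgt ?r" using T fcmp_fid[of "ctgt \<tau>"] by simp
  fix a b z assume "a \<in> Obj (psrc (cdom ?l))" "b \<in> Obj (ptgt (cdom ?l))" "z \<in> pset (cdom ?l) a b"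
  then have o: "a \<in> Obj (psrc (cdom \<tau>))" "b \<in> Obj (ptgt (cdom \<tau>))"
    and z: "z \<in> pset (prof_comp (hom_prof (ptgt (cdom \<tau>))) (cdom \<tau>)) a b" using T by auto
  from T(1) z o show "cmap ?l a b z = cmap ?r a b z"
  proof (rule lun_cases)
    fix b' x \<beta> assume w: "b' \<in> Obj (ptgt (cdom \<tau>))" "x \<in> pset (cdom \<tau>) a b'" "\<beta> \<in> Hom (ptgt (cdom \<tau>)) b' b"
      and ze: "z = tensor (cdom \<tau>) (hom_prof (ptgt (cdom \<tau>))) a b (b', x, \<beta>)"
    have 1: "cmap (cell_comp (hom_cell (ctgt \<tau>)) \<tau>) a b z =
       tensor (ccod \<tau>) (hom_prof (ptgt (ccod \<tau>))) (fob (csrc \<tau>) a) (fob (ctgt \<tau>) b) (fob (ctgt \<tau>) b', cmap \<tau> a b' x, far (ctgt \<tau>) \<beta>)"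
      using cmap_cell_comp[OF c o(1) _ w(1,2), of b \<beta>] o w T by (simp add: ze)
    note i = fob_csrc[OF t o(1)] cmap_in[OF t o(1) w(1,2)] far_ctgt[OF t w(3)]
    have "cmap ?l a b z = pact (ccod \<tau>) (Ide (psrc (ccod \<tau>)) (fob (csrc \<tau>) a)) (far (ctgt \<tau>) \<beta>) (cmap \<tau> a b' x)"
      using cmap_Cmp[OF cell_cell_comp[OF c], of a b z] o z T 
        cmap_globular_cell[OF profunctor_prof_comp[OF composable_hom(1)[OF T(2)]], of "fob (csrc \<tau>) a" "fob (ctgt \<tau>) b"]
        lun_in[OF T(2) i] lun_map_tensor[OF T(2) i] fob_csrc[OF t] fob_ctgt[OF t] by (simp add: 1)
    also have "\<dots> = cmap \<tau> a b (pact (cdom \<tau>) (Ide (psrc (cdom \<tau>)) a) \<beta> x)"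
      using cmap_natural[OF t A.Ide_Hom[OF o(1)] w(3,2)] F.far_Ide[of a] o T by simp
    also have "\<dots> = cmap ?r a b z"
      using cmap_Cmp[OF gd, of a b z] o z lun_map_tensor[OF T(1) o(1) w(2,3)]
       cmap_globular_cell[OF profunctor_prof_comp[OF composable_hom(1)[OF T(1)]], of a b z] by (simp add: ze)
    finally show ?thesis .
  qed
qed (use cellD[OF t] in auto)

lemma run_natural:
  assumes t: "profunctor_cell \<tau>"
  shows "Cmp prof_cat (globular_cell (prof_comp (ccod \<tau>) (hom_prof (psrc (ccod \<tau>)))) (ccod \<tau>) (run_map (ccod \<tau>))) (cell_comp \<tau> (hom_cell (csrc \<tau>)))
    = Cmp prof_cat \<tau> (globular_cell (prof_comp (cdom \<tau>) (hom_prof (psrc (cdom \<tau>)))) (cdom \<tau>) (run_map (cdom \<tau>)))" (is "?l = ?r")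
proof (rule pcell_eqI)
  note T = cellD[OF t]
  interpret B: category "ptgt (cdom \<tau>)" using T profunctor_cats by blast
  interpret G: cat_functor "ctgt \<tau>" by (rule T(4))
  have c: "composable_cells \<tau> (hom_cell (csrc \<tau>))" using t T by (simp add: composable_cells_def cell_hom_cell)
  note gd = cell_globular_cell[OF run_globular_map[OF T(1)]] and ge = cell_globular_cell[OF run_globular_map[OF T(2)]]
  show "profunctor_cell ?l" by (rule cell_Cmp) (use ge cell_cell_comp[OF c] T in auto)
  show "profunctor_cell ?r" by (rule cell_Cmp) (use gd t in auto)
  show "csrc ?l = csrc ?r" using T fcmp_fid[of "csrc \<tau>"] by simp
  show "ctgt ?l = ctgt ?r" using T fcmp_fid[of "ctgt \<tau>"] by simp
  fix a b z assume "a \<in> Obj (psrc (cdom ?l))" "b \<in> Obj (ptgt (cdom ?l))" "z \<in> pset (cdom ?l) a b"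
  then have o: "a \<in> Obj (psrc (cdom \<tau>))" "b \<in> Obj (ptgt (cdom \<tau>))"
    and z: "z \<in> pset (prof_comp (cdom \<tau>) (hom_prof (psrc (cdom \<tau>)))) a b" using T by auto
  from T(1) z o show "cmap ?l a b z = cmap ?r a b z"
  proof (rule run_cases)
    fix a' x \<alpha> assume w: "a' \<in> Obj (psrc (cdom \<tau>))" "\<alpha> \<in> Hom (psrc (cdom \<tau>)) a a'" "x \<in> pset (cdom \<tau>) a' b"
      and ze: "z = tensor (hom_prof (psrc (cdom \<tau>))) (cdom \<tau>) a b (a', \<alpha>, x)"
    have 1: "cmap (cell_comp \<tau> (hom_cell (csrc \<tau>))) a b z =
       tensor (hom_prof (psrc (ccod \<tau>))) (ccod \<tau>) (fob (csrc \<tau>) a) (fob (ctgt \<tau>) b) (fob (csrc \<tau>) a', far (csrc \<tau>) \<alpha>, cmap \<tau> a' b x)"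
      using cmap_cell_comp[OF c _ o(2), of a a' \<alpha> x] o w T by (simp add: ze)
    note i = fob_ctgt[OF t o(2)] cmap_in[OF t w(1) o(2) w(3)] far_csrc[OF t w(2)]
    have "cmap ?l a b z = pact (ccod \<tau>) (far (csrc \<tau>) \<alpha>) (Ide (ptgt (ccod \<tau>)) (fob (ctgt \<tau>) b)) (cmap \<tau> a' b x)"
      using cmap_Cmp[OF cell_cell_comp[OF c], of a b z] o z T 
        cmap_globular_cell[OF profunctor_prof_comp[OF composable_hom(2)[OF T(2)]], of "fob (csrc \<tau>) a" "fob (ctgt \<tau>) b"]
        run_in[OF T(2) i] run_map_tensor[OF T(2) i] fob_csrc[OF t] fob_ctgt[OF t] by (simp add: 1)
    also have "\<dots> = cmap \<tau> a b (pact (cdom \<tau>) \<alpha> (Ide (ptgt (cdom \<tau>)) b) x)"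
      using cmap_natural[OF t w(2) B.Ide_Hom[OF o(2)] w(3)] G.far_Ide[of b] o T by simp
    also have "\<dots> = cmap ?r a b z"
      using cmap_Cmp[OF gd, of a b z] o z run_map_tensor[OF T(1) o(2) w(3,2)]
       cmap_globular_cell[OF profunctor_prof_comp[OF composable_hom(2)[OF T(1)]], of a b z] by (simp add: ze)
    finally show ?thesis .
  qed
qed (use cellD[OF t] in auto)

lemma triangle_Cat:
  assumes c: "composable_profs \<Psi> \<Phi>"
  shows "Cmp prof_cat (cell_comp (Ide prof_cat \<Psi>) (globular_cell (prof_comp (hom_prof (ptgt \<Phi>)) \<Phi>) \<Phi> (lun_map \<Phi>)))
      (asc_cell \<Psi> (hom_prof (psrc \<Psi>)) \<Phi>) =
    cell_comp (globular_cell (prof_comp \<Psi> (hom_prof (psrc \<Psi>))) \<Psi> (run_map \<Psi>)) (Ide prof_cat \<Phi>)" (is "Cmp prof_cat (cell_comp ?ip ?lu) ?as = cell_comp ?ru ?if")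
proof (rule pcell_eqI)
  have P: "profunctor \<Phi>" "profunctor \<Psi>" and e: "psrc \<Psi> = ptgt \<Phi>" using c by (auto simp: composable_profs_def)
  interpret B: category "ptgt \<Phi>" using P profunctor_cats by blast
  have d: "composable_profs \<Psi> (hom_prof (psrc \<Psi>))" "composable_profs (hom_prof (psrc \<Psi>)) \<Phi>"
    using composable_hom(2)[OF P(2)] composable_hom(1)[OF P(1)] e by auto
  note lu = cell_globular_cell[OF lun_globular_map[OF P(1)]] and ru = cell_globular_cell[OF run_globular_map[OF P(2)]]
    and as = cell_globular_cell[OF asc_globular_map[OF d]]
  have c1: "composable_cells ?ip ?lu" using lu cell_Ide[OF P(2)] e by (auto simp: composable_cells_def)
  have c2: "composable_cells ?ru ?if" using ru cell_Ide[OF P(1)] e by (auto simp: composable_cells_def)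
  show "profunctor_cell (Cmp prof_cat (cell_comp ?ip ?lu) ?as)" by (rule cell_Cmp) (use as cell_cell_comp[OF c1] e in auto)
  show "profunctor_cell (cell_comp ?ru ?if)" by (rule cell_cell_comp[OF c2])
  show "csrc (Cmp prof_cat (cell_comp ?ip ?lu) ?as) = csrc (cell_comp ?ru ?if)" 
    using fcmp_fid(1)[OF functor_fid[OF profunctor_cats(1)[OF P(1)]]] by simp
  show "ctgt (Cmp prof_cat (cell_comp ?ip ?lu) ?as) = ctgt (cell_comp ?ru ?if)" 
    using fcmp_fid(1)[OF functor_fid[OF profunctor_cats(2)[OF P(2)]]] by simp
  fix a f z assume "a \<in> Obj (psrc (cdom (Cmp prof_cat (cell_comp ?ip ?lu) ?as)))" "f \<in> Obj (ptgt (cdom (Cmp prof_cat (cell_comp ?ip ?lu) ?as)))"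
    "z \<in> pset (cdom (Cmp prof_cat (cell_comp ?ip ?lu) ?as)) a f"
  then have o: "a \<in> Obj (psrc \<Phi>)" "f \<in> Obj (ptgt \<Psi>)" and z: "z \<in> pset (prof_comp (prof_comp \<Psi> (hom_prof (psrc \<Psi>))) \<Phi>) a f" by auto
  from d z o show "cmap (Cmp prof_cat (cell_comp ?ip ?lu) ?as) a f z = cmap (cell_comp ?ru ?if) a f z"
  proof (rule left_cases)
    fix b c x y v assume w: "b \<in> Obj (ptgt \<Phi>)" "c \<in> Obj (ptgt (hom_prof (psrc \<Psi>)))" "x \<in> pset \<Phi> a b" "y \<in> pset (hom_prof (psrc \<Psi>)) b c" "v \<in> pset \<Psi> c f"
     and ze: "z = tensor \<Phi> (prof_comp \<Psi> (hom_prof (psrc \<Psi>))) a f (b, x, tensor (hom_prof (psrc \<Psi>)) \<Psi> b f (c, y, v))"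
    have c: "c \<in> Obj (ptgt \<Phi>)" and y: "y \<in> Hom (ptgt \<Phi>) b c" using w e by auto
    have 1: "cmap ?lu a c (tensor \<Phi> (hom_prof (psrc \<Psi>)) a c (b, x, y)) = pact \<Phi> (Ide (psrc \<Phi>) a) y x"
      using cmap_globular_cell[OF profunctor_prof_comp[OF composable_hom(1)[OF P(1)]], of a c] o c lun_in[OF P(1) o(1) w(3) y] lun_map_tensor[OF P(1) o(1) w(3) y] e by simp
    have y': "y \<in> Hom (psrc \<Psi>) b c" and b: "b \<in> Obj (psrc \<Psi>)" using y w e by auto
    have 2: "cmap ?ru b f (tensor (hom_prof (psrc \<Psi>)) \<Psi> b f (c, y, v)) = pact \<Psi> y (Ide (ptgt \<Psi>) f) v"
      using cmap_globular_cell[OF profunctor_prof_comp[OF composable_hom(2)[OF P(2)]], of b f] o b run_in[OF P(2) o(2) w(5) y'] run_map_tensor[OF P(2) o(2) w(5) y'] by simp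
    have "cmap (Cmp prof_cat (cell_comp ?ip ?lu) ?as) a f z = cmap (cell_comp ?ip ?lu) a f (tensor (prof_comp (hom_prof (psrc \<Psi>)) \<Phi>) \<Psi> a f (c, tensor \<Phi> (hom_prof (psrc \<Psi>)) a c (b, x, y), v))"
      using cmap_Cmp[OF as, of a f z] o z cmap_asc_cell[OF d o w] by (simp add: ze)
    also have "\<dots> = tensor \<Phi> \<Psi> a f (c, pact \<Phi> (Ide (psrc \<Phi>) a) y x, v)"
      using cmap_cell_comp[OF c1, of a f c "tensor \<Phi> (hom_prof (psrc \<Psi>)) a c (b, x, y)" v] o c w lun_in[OF P(1) o(1) w(3) y] P
      by (simp add: e 1[unfolded e])
    also have "\<dots> = tensor \<Phi> \<Psi> a f (b, x, pact \<Psi> y (Ide (ptgt \<Psi>) f) v)"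
      by (rule tensor_slide[symmetric, OF y w(3,5)])
    also have "\<dots> = cmap (cell_comp ?ru ?if) a f z"
      using cmap_cell_comp[OF c2, of a f b x "tensor (hom_prof (psrc \<Psi>)) \<Psi> b f (c, y, v)"] o w run_in[OF P(2) o(2) w(5) y'] P
      by (simp add: ze 2)
    finally show ?thesis .
  qed
qed (use assms in \<open>auto simp: composable_profs_def\<close>)

lemma pentagon_Cat:
  assumes c: "composable_profs Y X" "composable_profs X \<Psi>" "composable_profs \<Psi> \<Phi>"
  shows "Cmp prof_cat (asc_cell Y X (prof_comp \<Psi> \<Phi>)) (asc_cell (prof_comp Y X) \<Psi> \<Phi>) =
    Cmp prof_cat (cell_comp (Ide prof_cat Y) (asc_cell X \<Psi> \<Phi>))
      (Cmp prof_cat (asc_cell Y (prof_comp X \<Psi>) \<Phi>) (cell_comp (asc_cell Y X \<Psi>) (Ide prof_cat \<Phi>)))" (is "?l = Cmp prof_cat ?r3 (Cmp prof_cat ?r2 ?r1)")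
proof (rule pcell_eqI)
  have P: "profunctor \<Phi>" "profunctor \<Psi>" "profunctor X" "profunctor Y" and e: "psrc \<Psi> = ptgt \<Phi>" "psrc X = ptgt \<Psi>" "psrc Y = ptgt X"
    using c by (auto simp: composable_profs_def)
  note YX = composable_profs_comp[OF c(1,2)] and XP = composable_profs_comp[OF c(2,3)]
  note l1 = cell_globular_cell[OF asc_globular_map[OF YX(1) c(3)]] and l2 = cell_globular_cell[OF asc_globular_map[OF c(1) XP(2)]]
    and m = cell_globular_cell[OF asc_globular_map[OF YX(2) XP(1)]]
    and n1 = cell_globular_cell[OF asc_globular_map[OF c(1,2)]] and n2 = cell_globular_cell[OF asc_globular_map[OF c(2,3)]]
  have c1: "composable_cells (asc_cell Y X \<Psi>) (Ide prof_cat \<Phi>)" using n1 cell_Ide[OF P(1)] e by (auto simp: composable_cells_def)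
  have c3: "composable_cells (Ide prof_cat Y) (asc_cell X \<Psi> \<Phi>)" using n2 cell_Ide[OF P(4)] e by (auto simp: composable_cells_def)
  show L: "profunctor_cell ?l" by (rule cell_Cmp) (use l1 l2 in auto)
  have R21: "profunctor_cell (Cmp prof_cat ?r2 ?r1)" by (rule cell_Cmp) (use m cell_cell_comp[OF c1] in auto)
  show "profunctor_cell (Cmp prof_cat ?r3 (Cmp prof_cat ?r2 ?r1))" by (rule cell_Cmp) (use R21 cell_cell_comp[OF c3] in auto)
  show "csrc ?l = csrc (Cmp prof_cat ?r3 (Cmp prof_cat ?r2 ?r1))" 
    using fcmp_fid(1)[OF functor_fid[OF profunctor_cats(1)[OF P(1)]]] by simp
  show "ctgt ?l = ctgt (Cmp prof_cat ?r3 (Cmp prof_cat ?r2 ?r1))" 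
    using fcmp_fid(1)[OF functor_fid[OF profunctor_cats(2)[OF P(4)]]] by simp
  fix a f z assume "a \<in> Obj (psrc (cdom ?l))" "f \<in> Obj (ptgt (cdom ?l))" "z \<in> pset (cdom ?l) a f"
  then have o: "a \<in> Obj (psrc \<Phi>)" "f \<in> Obj (ptgt Y)" and z: "z \<in> pset (prof_comp (prof_comp (prof_comp Y X) \<Psi>) \<Phi>) a f" by auto
  have o': "f \<in> Obj (ptgt (prof_comp Y X))" using o by simp
  obtain b c x y v where w: "b \<in> Obj (ptgt \<Phi>)" "c \<in> Obj (ptgt \<Psi>)" "x \<in> pset \<Phi> a b" "y \<in> pset \<Psi> b c" "v \<in> pset (prof_comp Y X) c f"
     and ze: "z = tensor \<Phi> (prof_comp (prof_comp Y X) \<Psi>) a f (b, x, tensor \<Psi> (prof_comp Y X) b f (c, y, v))"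
    using left_cases[OF YX(1) c(3) z o(1) o'] by metis
  have oc: "c \<in> Obj (psrc X)" and ob: "b \<in> Obj (psrc \<Psi>)" using w e by auto
  obtain d u t where w': "d \<in> Obj (ptgt X)" "u \<in> pset X c d" "t \<in> pset Y d f" and ve: "v = tensor X Y c f (d, u, t)"
    using prof_comp_cases[OF w(5) oc o(2)] by metis
  note x1 = right_in(1)[OF c(2,3) o(1) w'(1) w(1-4) w'(2)]
  have "cmap ?l a f z = cmap (asc_cell Y X (prof_comp \<Psi> \<Phi>)) a f (tensor (prof_comp \<Psi> \<Phi>) (prof_comp Y X) a f (c, tensor \<Phi> \<Psi> a c (b, x, y), v))"
    using cmap_Cmp[OF l1, of a f z] o z cmap_asc_cell[OF YX(1) c(3) o(1) o' w] by (simp add: ze)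
  also have "\<dots> = tensor (prof_comp X (prof_comp \<Psi> \<Phi>)) Y a f (d, tensor (prof_comp \<Psi> \<Phi>) X a d (c, tensor \<Phi> \<Psi> a c (b, x, y), u), t)"
    unfolding ve by (rule cmap_asc_cell[OF c(1) XP(2)]) (use o w w' x1 in auto)
  finally have l: "cmap ?l a f z = tensor (prof_comp X (prof_comp \<Psi> \<Phi>)) Y a f (d, tensor (prof_comp \<Psi> \<Phi>) X a d (c, tensor \<Phi> \<Psi> a c (b, x, y), u), t)" .
  have 1: "cmap (asc_cell Y X \<Psi>) b f (tensor \<Psi> (prof_comp Y X) b f (c, y, v)) = tensor (prof_comp X \<Psi>) Y b f (d, tensor \<Psi> X b d (c, y, u), t)"
    unfolding ve by (rule cmap_asc_cell[OF c(1,2) ob o(2) w(2) w'(1) w(4) w'(2,3)])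
  have 2: "tensor \<Psi> (prof_comp Y X) b f (c, y, v) \<in> pset (prof_comp (prof_comp Y X) \<Psi>) b f"
    using left_in(1)[OF YX(1) c(3) o(1) o' w] .
  have r1: "cmap ?r1 a f z = tensor \<Phi> (prof_comp Y (prof_comp X \<Psi>)) a f (b, x, tensor (prof_comp X \<Psi>) Y b f (d, tensor \<Psi> X b d (c, y, u), t))"
    using cmap_cell_comp[OF c1, of a f b x "tensor \<Psi> (prof_comp Y X) b f (c, y, v)"] o w 2 P by (simp add: ze 1)
  note x2 = left_in(1)[OF c(2,3) o(1) w'(1) w(1-4) w'(2)]
  have r2: "cmap ?r2 a f (cmap ?r1 a f z) = tensor (prof_comp (prof_comp X \<Psi>) \<Phi>) Y a f (d, tensor \<Phi> (prof_comp X \<Psi>) a d (b, x, tensor \<Psi> X b d (c, y, u)), t)"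
    unfolding r1 by (rule cmap_asc_cell[OF YX(2) XP(1)]) (use o w w' x2 in auto)
  have r3: "cmap ?r3 a f (cmap ?r2 a f (cmap ?r1 a f z)) = cmap ?l a f z"
    unfolding r2 l
    using cmap_cell_comp[OF c3, of a f d "tensor \<Phi> (prof_comp X \<Psi>) a d (b, x, tensor \<Psi> X b d (c, y, u))" t]
     o w' left_in(2)[OF c(2,3) o(1) w'(1) w(1-4) w'(2)] cmap_asc_cell[OF c(2,3) o(1) w'(1) w(1-4) w'(2)] P e by simp
  show "cmap ?l a f z = cmap (Cmp prof_cat ?r3 (Cmp prof_cat ?r2 ?r1)) a f z"
    using cmap_Cmp[OF R21, of a f z] cmap_Cmp[OF cell_cell_comp[OF c1], of a f z] o z r3 by simp
qed auto

lemma globular_CatI: "globular_map \<Phi> \<Psi> k \<Longrightarrow> globular Cat \<Phi> \<Psi> (globular_cell \<Phi> \<Psi> k)"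
  using cell_globular_cell[of \<Phi> \<Psi> k] by (auto simp: globular_def Hom_def globular_map_def)

lemma double_category_Cat: "double_category Cat"
proof (rule double_category.intro)
  show "fcmp (Src Cat) (Uni Cat) = fid (Hc Cat)"
    by (rule ftor_eqI) (auto simp: functor_Src_Cat functor_Uni_Cat functor_fcmp functor_fid category_cat_cat profunctor_hom_prof cell_hom_cell)
  show "fcmp (Tgt Cat) (Uni Cat) = fid (Hc Cat)"
    by (rule ftor_eqI) (auto simp: functor_Tgt_Cat functor_Uni_Cat functor_fcmp functor_fid category_cat_cat profunctor_hom_prof cell_hom_cell)
next
  fix w v u :: "'a prof" assume "composable Cat w v" "composable Cat v u"
  then have c: "composable_profs w v" "composable_profs v u" by auto
  show "globular Cat (vcmp Cat (vcmp Cat w v) u) (vcmp Cat w (vcmp Cat v u)) (Asc Cat w v u)"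
    using c composable_profs_comp[OF c] globular_CatI[OF asc_globular_map[OF c]] by simp
  show "is_iso (Vc Cat) (Asc Cat w v u)" using asc_is_iso[OF c] by simp
next
  fix \<gamma> \<beta> \<alpha> :: "'a pcell" and w w' v v' u u'
  assume "composable2 Cat \<gamma> \<beta>" "composable2 Cat \<beta> \<alpha>" "\<gamma> \<in> Hom (Vc Cat) w w'" "\<beta> \<in> Hom (Vc Cat) v v'" "\<alpha> \<in> Hom (Vc Cat) u u'"
  then show "Cmp (Vc Cat) (Asc Cat w' v' u') (vcmp2 Cat (vcmp2 Cat \<gamma> \<beta>) \<alpha>) = Cmp (Vc Cat) (vcmp2 Cat \<gamma> (vcmp2 Cat \<beta> \<alpha>)) (Asc Cat w v u)"
    using asc_natural[of \<gamma> \<beta> \<alpha>] composable_cells_comp[of \<gamma> \<beta> \<alpha>] by (simp add: Hom_def)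
next
  fix v :: "'a prof" assume "v \<in> Obj (Vc Cat)"
  then have P: "profunctor v" by simp
  note k = profunctor_cats[OF P] composable_hom[OF P]
  show "globular Cat (vcmp Cat (fob (Uni Cat) (fob (Tgt Cat) v)) v) v (Lun Cat v)"
    using P k globular_CatI[OF lun_globular_map[OF P]] by simp
  show "is_iso (Vc Cat) (Lun Cat v)" using lun_is_iso[OF P] by simp
  show "globular Cat (vcmp Cat v (fob (Uni Cat) (fob (Src Cat) v))) v (Run Cat v)"
    using P k globular_CatI[OF run_globular_map[OF P]] by simp
  show "is_iso (Vc Cat) (Run Cat v)" using run_is_iso[OF P] by simp
next
  fix \<alpha> :: "'a pcell" and v v' assume "\<alpha> \<in> Hom (Vc Cat) v v'"
  then have t: "profunctor_cell \<alpha>" "v = cdom \<alpha>" "v' = ccod \<alpha>" by (auto dest: cell_HomD)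
  note T = cellD[OF t(1)]
  have "composable_cells (hom_cell (ctgt \<alpha>)) \<alpha>" "composable_cells \<alpha> (hom_cell (csrc \<alpha>))"
    using t T by (auto simp: composable_cells_def cell_hom_cell)
  then show "Cmp (Vc Cat) (Lun Cat v') (vcmp2 Cat (far (Uni Cat) (far (Tgt Cat) \<alpha>)) \<alpha>) = Cmp (Vc Cat) \<alpha> (Lun Cat v)"
    "Cmp (Vc Cat) (Run Cat v') (vcmp2 Cat \<alpha> (far (Uni Cat) (far (Src Cat) \<alpha>))) = Cmp (Vc Cat) \<alpha> (Run Cat v)"
    using t T lun_natural[OF t(1)] run_natural[OF t(1)] by simp_all
next
  fix x w v u :: "'a prof" assume "composable Cat x w" "composable Cat w v" "composable Cat v u"
  then have c: "composable_profs x w" "composable_profs w v" "composable_profs v u" by auto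
  have P: "profunctor x" "profunctor u" and e: "psrc v = ptgt u" "psrc x = ptgt w" using c by (auto simp: composable_profs_def)
  have "composable_cells (Ide prof_cat x) (asc_cell w v u)" "composable_cells (asc_cell x w v) (Ide prof_cat u)"
    using cell_globular_cell[OF asc_globular_map[OF c(1,2)]] cell_globular_cell[OF asc_globular_map[OF c(2,3)]] P cell_Ide e
    by (auto simp: composable_cells_def)
  then show "Cmp (Vc Cat) (Asc Cat x w (vcmp Cat v u)) (Asc Cat (vcmp Cat x w) v u) =
      Cmp (Vc Cat) (vcmp2 Cat (Ide (Vc Cat) x) (Asc Cat w v u))
        (Cmp (Vc Cat) (Asc Cat x (vcmp Cat w v) u) (vcmp2 Cat (Asc Cat x w v) (Ide (Vc Cat) u)))"
    using c pentagon_Cat[OF c] by simp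
next
  fix w v :: "'a prof" assume "composable Cat w v"
  then have c: "composable_profs w v" by simp
  have P: "profunctor w" "profunctor v" and e: "psrc w = ptgt v" using c by (auto simp: composable_profs_def)
  have "composable_cells (Ide prof_cat w) (Lun Cat v)" "composable_cells (Run Cat w) (Ide prof_cat v)"
    using cell_globular_cell[OF lun_globular_map[OF P(2)]] cell_globular_cell[OF run_globular_map[OF P(1)]] P cell_Ide e
    by (auto simp: composable_cells_def)
  then show "Cmp (Vc Cat) (vcmp2 Cat (Ide (Vc Cat) w) (Lun Cat v)) (Asc Cat w (fob (Uni Cat) (fob (Src Cat) w)) v) =
      vcmp2 Cat (Run Cat w) (Ide (Vc Cat) v)"
    using P profunctor_cats[OF P(1)] triangle_Cat[OF c] by simp
qed (auto simp: functor_Src_Cat functor_Tgt_Cat functor_Uni_Cat functor_Vcmp_Cat composable_profs_def profunctor_prof_comp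
   cell_cell_comp composable_cellsD)

locale square_class = category C for C :: "('o, 'a) cat" +
  fixes Q :: "'a square \<Rightarrow> bool"
  assumes Q_comm: "Q q \<Longrightarrow> commutative_square C q"
    and Q_hid: "f \<in> Arr C \<Longrightarrow> Q \<lparr>Left = f, Right = f, Top = Ide C (Dom C f), Bottom = Ide C (Cod C f)\<rparr>"
    and Q_vid: "h \<in> Arr C \<Longrightarrow> Q \<lparr>Left = Ide C (Dom C h), Right = Ide C (Cod C h), Top = h, Bottom = h\<rparr>"
    and Q_hcomp: "Q p \<Longrightarrow> Q q \<Longrightarrow> Right p = Left q \<Longrightarrow>
      Q \<lparr>Left = Left p, Right = Right q, Top = Cmp C (Top q) (Top p), Bottom = Cmp C (Bottom q) (Bottom p)\<rparr>"
    and Q_vcomp: "Q p \<Longrightarrow> Q q \<Longrightarrow> Bottom p = Top q \<Longrightarrow>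
      Q \<lparr>Left = Cmp C (Left q) (Left p), Right = Cmp C (Right q) (Right p), Top = Top p, Bottom = Bottom q\<rparr>"
begin

lemma Q_D:
  assumes "Q q"
  shows "Left q \<in> Arr C" "Right q \<in> Arr C" "Top q \<in> Arr C" "Bottom q \<in> Arr C"
    "Dom C (Top q) = Dom C (Left q)" "Cod C (Top q) = Dom C (Right q)"
    "Dom C (Bottom q) = Cod C (Left q)" "Cod C (Bottom q) = Cod C (Right q)"
    "Cmp C (Right q) (Top q) = Cmp C (Bottom q) (Left q)"
  using Q_comm[OF assms] by (auto simp: commutative_square_def Hom_def)

lemma Cmp_Arr: "f \<in> Arr C \<Longrightarrow> g \<in> Arr C \<Longrightarrow> Cod C f = Dom C g \<Longrightarrow> Cmp C g f \<in> Arr C \<and> Dom C (Cmp C g f) = Dom C f \<and> Cod C (Cmp C g f) = Cod C g"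
  using Cmp_Hom[of f "Dom C f" "Cod C f" g "Cod C g"] by (auto simp: Hom_def)

lemma Ide_Arr: "a \<in> Obj C \<Longrightarrow> Ide C a \<in> Arr C \<and> Dom C (Ide C a) = a \<and> Cod C (Ide C a) = a"
  using Ide_Hom by (auto simp: Hom_def)

lemma unit_Arr: "f \<in> Arr C \<Longrightarrow> Cmp C f (Ide C (Dom C f)) = f" "f \<in> Arr C \<Longrightarrow> Cmp C (Ide C (Cod C f)) f = f"
  using Cmp_Ide_right[of f "Dom C f" "Cod C f"] Cmp_Ide_left[of f "Dom C f" "Cod C f"] by (auto simp: Hom_def)

lemma assoc_Arr: "f \<in> Arr C \<Longrightarrow> g \<in> Arr C \<Longrightarrow> h \<in> Arr C \<Longrightarrow> Cod C f = Dom C g \<Longrightarrow> Cod C g = Dom C h \<Longrightarrow>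
   Cmp C h (Cmp C g f) = Cmp C (Cmp C h g) f"
  using Cmp_assoc[of f "Dom C f" "Cod C f" g "Cod C g" h "Cod C h"] by (auto simp: Hom_def)

lemmas arr_simps = Cmp_Arr Ide_Arr unit_Arr assoc_Arr Dom_Obj Cod_Obj

lemma sq_cat_simps [simp]: "Obj (square_cat C Q) = Arr C" "Arr (square_cat C Q) = {q. Q q}" "Dom (square_cat C Q) = Left"
  "Cod (square_cat C Q) = Right"
  "Ide (square_cat C Q) f = \<lparr>Left = f, Right = f, Top = Ide C (Dom C f), Bottom = Ide C (Cod C f)\<rparr>"
  "Cmp (square_cat C Q) q p = \<lparr>Left = Left p, Right = Right q, Top = Cmp C (Top q) (Top p), Bottom = Cmp C (Bottom q) (Bottom p)\<rparr>"
  by (auto simp: square_cat_def)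

lemma category_square_cat: "category (square_cat C Q)"
proof
  fix f a b assume "f \<in> Hom (square_cat C Q) a b"
  then have q: "Q f" and e: "Left f = a" "Right f = b" by (auto simp: Hom_def)
  note d = Q_D[OF q]
  have u: "Cmp C (Top f) (Ide C (Dom C a)) = Top f" "Cmp C (Bottom f) (Ide C (Cod C a)) = Bottom f"
    "Cmp C (Ide C (Dom C b)) (Top f) = Top f" "Cmp C (Ide C (Cod C b)) (Bottom f) = Bottom f"
    using unit_Arr[OF d(3)] unit_Arr[OF d(4)] d e by simp_all
  show "Cmp (square_cat C Q) f (Ide (square_cat C Q) a) = f" "Cmp (square_cat C Q) (Ide (square_cat C Q) b) f = f"
    using u e by (cases f; simp)+
next
  fix f g h a b c d assume "f \<in> Hom (square_cat C Q) a b" "g \<in> Hom (square_cat C Q) b c" "h \<in> Hom (square_cat C Q) c d"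
  then have q: "Q f" "Q g" "Q h" "Right f = Left g" "Right g = Left h" by (auto simp: Hom_def)
  show "Cmp (square_cat C Q) h (Cmp (square_cat C Q) g f) = Cmp (square_cat C Q) (Cmp (square_cat C Q) h g) f"
    using q Q_D[OF q(1)] Q_D[OF q(2)] Q_D[OF q(3)] by (simp add: assoc_Arr)
qed (auto simp: Hom_def Q_D Q_hid Q_hcomp)

lemma DD_simps [simp]:
  "Hc (square_dbl C Q) = C" "Vc (square_dbl C Q) = square_cat C Q" "fdom (Src (square_dbl C Q)) = square_cat C Q" "fcod (Src (square_dbl C Q)) = C" "fdom (Tgt (square_dbl C Q)) = square_cat C Q" "fcod (Tgt (square_dbl C Q)) = C"
  "fdom (Uni (square_dbl C Q)) = C" "fcod (Uni (square_dbl C Q)) = square_cat C Q" "fcod (Vcmp (square_dbl C Q)) = square_cat C Q" "fdom (Vcmp (square_dbl C Q)) = composable_pairs (Src (square_dbl C Q)) (Tgt (square_dbl C Q))"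
  "f \<in> Arr C \<Longrightarrow> fob (Src (square_dbl C Q)) f = Dom C f" "f \<in> Arr C \<Longrightarrow> fob (Tgt (square_dbl C Q)) f = Cod C f"
  "Q q \<Longrightarrow> far (Src (square_dbl C Q)) q = Top q" "Q q \<Longrightarrow> far (Tgt (square_dbl C Q)) q = Bottom q"
  "a \<in> Obj C \<Longrightarrow> fob (Uni (square_dbl C Q)) a = Ide C a"
  "h \<in> Arr C \<Longrightarrow> far (Uni (square_dbl C Q)) h = \<lparr>Left = Ide C (Dom C h), Right = Ide C (Cod C h), Top = h, Bottom = h\<rparr>"
  "Asc (square_dbl C Q) h g f = Ide (square_cat C Q) (Cmp C h (Cmp C g f))" "Lun (square_dbl C Q) = Ide (square_cat C Q)" "Run (square_dbl C Q) = Ide (square_cat C Q)"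
  by (auto simp: square_dbl_def Let_def)

lemma composable_DD [simp]: "composable (square_dbl C Q) g f \<longleftrightarrow> f \<in> Arr C \<and> g \<in> Arr C \<and> Dom C g = Cod C f"
  by (auto simp: composable_def)

lemma composable2_DD [simp]: "composable2 (square_dbl C Q) q p \<longleftrightarrow> Q p \<and> Q q \<and> Top q = Bottom p"
  by (auto simp: composable2_def)

lemma Obj_pairs_DD: "Obj (composable_pairs (Src (square_dbl C Q)) (Tgt (square_dbl C Q))) = {(g, f). composable (square_dbl C Q) g f}"
  by (auto simp: composable_pairs_def)

lemma Arr_pairs_DD: "Arr (composable_pairs (Src (square_dbl C Q)) (Tgt (square_dbl C Q))) = {(q, p). composable2 (square_dbl C Q) q p}"
  by (auto simp: composable_pairs_def)

lemma vcmp_DD [simp]: assumes "composable (square_dbl C Q) g f" shows "vcmp (square_dbl C Q) g f = Cmp C g f"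
proof -
  have "f \<in> Arr C" "g \<in> Arr C" "Dom C g = Cod C f" using assms by simp_all
  then show ?thesis by (simp add: square_dbl_def Let_def composable_pairs_def)
qed

lemma vcmp2_DD [simp]: assumes "composable2 (square_dbl C Q) q p"
  shows "vcmp2 (square_dbl C Q) q p = \<lparr>Left = Cmp C (Left q) (Left p), Right = Cmp C (Right q) (Right p), Top = Top p, Bottom = Bottom q\<rparr>"
proof -
  have "Q p" "Q q" "Top q = Bottom p" using assms by simp_all
  then show ?thesis by (simp add: square_dbl_def Let_def composable_pairs_def)
qed

lemma vcmp2_Ide:
  assumes c: "composable (square_dbl C Q) g f"
  shows "vcmp2 (square_dbl C Q) (Ide (square_cat C Q) g) (Ide (square_cat C Q) f) = Ide (square_cat C Q) (Cmp C g f)"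
proof -
  have h: "f \<in> Arr C" "g \<in> Arr C" "Dom C g = Cod C f" using c by simp_all
  then have "composable2 (square_dbl C Q) (Ide (square_cat C Q) g) (Ide (square_cat C Q) f)"
    using Q_hid[OF h(1)] Q_hid[OF h(2)] by simp
  then show ?thesis using h by (simp add: Cmp_Arr)
qed

lemma pairs_DD [simp]:
  "Dom (composable_pairs (Src (square_dbl C Q)) (Tgt (square_dbl C Q))) (q, p) = (Left q, Left p)"
  "Cod (composable_pairs (Src (square_dbl C Q)) (Tgt (square_dbl C Q))) (q, p) = (Right q, Right p)"
  "Ide (composable_pairs (Src (square_dbl C Q)) (Tgt (square_dbl C Q))) (g, f) = (Ide (square_cat C Q) g, Ide (square_cat C Q) f)"
  "Cmp (composable_pairs (Src (square_dbl C Q)) (Tgt (square_dbl C Q))) (q, p) (q', p') = (Cmp (square_cat C Q) q q', Cmp (square_cat C Q) p p')"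
  by (auto simp: composable_pairs_def prod_cat_def square_cat_def)

lemma Hom_pairs_DD [simp]: "(q, p) \<in> Hom (composable_pairs (Src (square_dbl C Q)) (Tgt (square_dbl C Q))) (g, f) (g', f') \<longleftrightarrow>
  composable2 (square_dbl C Q) q p \<and> Left q = g \<and> Left p = f \<and> Right q = g' \<and> Right p = f'"
  by (auto simp: Hom_def Arr_pairs_DD)

lemma category_pairs_DD: "category (composable_pairs (Src (square_dbl C Q)) (Tgt (square_dbl C Q)))" (is "category ?P")
proof
  interpret V: category "square_cat C Q" by (rule category_square_cat)
  {
    fix f assume "f \<in> Arr ?P"
    then obtain q p where f: "f = (q, p)" and h: "Q p" "Q q" "Top q = Bottom p" by (auto simp: Arr_pairs_DD)
    show "Dom ?P f \<in> Obj ?P" "Cod ?P f \<in> Obj ?P"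
      using Q_D[OF h(1)] Q_D[OF h(2)] h by (auto simp: f Obj_pairs_DD)
  next
    fix a assume o: "a \<in> Obj ?P"
    show "Ide ?P a \<in> Hom ?P a a"
    proof -
      from o obtain g f where a: "a = (g, f)" "composable (square_dbl C Q) g f" by (auto simp: Obj_pairs_DD)
      then show ?thesis using Q_hid[of f] Q_hid[of g] by simp
    qed
  next
    fix f g a b c assume "f \<in> Hom ?P a b" "g \<in> Hom ?P b c"
    moreover obtain q p where f: "f = (q, p)" by (cases f)
    moreover obtain q' p' where g: "g = (q', p')" by (cases g)
    moreover obtain a1 a2 b1 b2 c1 c2 where "a = (a1, a2)" "b = (b1, b2)" "c = (c1, c2)" by (cases a; cases b; cases c)
    ultimately show "Cmp ?P g f \<in> Hom ?P a c"
      using Q_hcomp[of q q'] Q_hcomp[of p p'] by simp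
  next
    fix f a b assume "f \<in> Hom ?P a b"
    moreover obtain f1 f2 where f: "f = (f1, f2)" by (cases f)
    moreover obtain a1 a2 b1 b2 where ab: "a = (a1, a2)" "b = (b1, b2)" by (cases a; cases b)
    ultimately have h: "f1 \<in> Hom (square_cat C Q) a1 b1" "f2 \<in> Hom (square_cat C Q) a2 b2" by (auto simp: Hom_def Arr_pairs_DD)
    show "Cmp ?P f (Ide ?P a) = f" "Cmp ?P (Ide ?P b) f = f"
      unfolding f ab pairs_DD using V.Cmp_Ide_right h V.Cmp_Ide_left by (simp_all only: )
  next
    fix f g k a b c d assume "f \<in> Hom ?P a b" "g \<in> Hom ?P b c" "k \<in> Hom ?P c d"
    moreover obtain f1 f2 where f: "f = (f1, f2)" by (cases f)
    moreover obtain g1 g2 where g: "g = (g1, g2)" by (cases g)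
    moreover obtain h1 h2 where k: "k = (h1, h2)" by (cases k)
    moreover obtain a1 a2 b1 b2 c1 c2 d1 d2 where "a = (a1, a2)" "b = (b1, b2)" "c = (c1, c2)" "d = (d1, d2)"
      by (cases a; cases b; cases c; cases d)
    ultimately have h: "f1 \<in> Hom (square_cat C Q) a1 b1" "f2 \<in> Hom (square_cat C Q) a2 b2" "g1 \<in> Hom (square_cat C Q) b1 c1" "g2 \<in> Hom (square_cat C Q) b2 c2"
      "h1 \<in> Hom (square_cat C Q) c1 d1" "h2 \<in> Hom (square_cat C Q) c2 d2" by (auto simp: Hom_def Arr_pairs_DD)
    show "Cmp ?P k (Cmp ?P g f) = Cmp ?P (Cmp ?P k g) f"
      unfolding f g k pairs_DD using V.Cmp_assoc[OF h(1,3,5)] V.Cmp_assoc[OF h(2,4,6)] by (simp only: )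
  }
qed

lemma sq_Ide_unit:
  assumes "Q q" shows "Cmp (square_cat C Q) q (Ide (square_cat C Q) (Left q)) = q" "Cmp (square_cat C Q) (Ide (square_cat C Q) (Right q)) q = q"
  using category.Cmp_Ide_right[OF category_square_cat, of q "Left q" "Right q"]
    category.Cmp_Ide_left[OF category_square_cat, of q "Left q" "Right q"] assms by (auto simp: Hom_def)

lemma functor_Src_DD: "cat_functor (Src (square_dbl C Q))" 
  by (rule cat_functor.intro)
   (auto simp: category_square_cat category_axioms Hom_def arr_simps Q_D Q_hid Q_hcomp, auto simp: square_dbl_def Let_def Dom_Obj split: if_splits)

lemma functor_Tgt_DD: "cat_functor (Tgt (square_dbl C Q))" 
  by (rule cat_functor.intro)
   (auto simp: category_square_cat category_axioms Hom_def arr_simps Q_D Q_hid Q_hcomp, auto simp: square_dbl_def Let_def Cod_Obj split: if_splits)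

lemma functor_Uni_DD: "cat_functor (Uni (square_dbl C Q))" 
proof (rule cat_functor.intro)
  fix f g a b c assume "f \<in> Hom (fdom (Uni (square_dbl C Q))) a b" "g \<in> Hom (fdom (Uni (square_dbl C Q))) b c"
  then have h: "f \<in> Arr C" "g \<in> Arr C" "Dom C f = a" "Cod C f = b" "Dom C g = b" "Cod C g = c" by (auto simp: Hom_def)
  have "Cmp C (Ide C b) (Ide C b) = Ide C b" "Cmp C (Ide C a) (Ide C a) = Ide C a" using unit_Arr Ide_Arr Dom_Obj h by metis+
  then show "far (Uni (square_dbl C Q)) (Cmp (fdom (Uni (square_dbl C Q))) g f) = Cmp (fcod (Uni (square_dbl C Q))) (far (Uni (square_dbl C Q)) g) (far (Uni (square_dbl C Q)) f)"
    using h Cmp_Arr[of f g] by simp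
next
  show "far (Uni (square_dbl C Q)) \<in> extensional (Arr (fdom (Uni (square_dbl C Q))))" by (auto simp: square_dbl_def Let_def)
  show "fob (Uni (square_dbl C Q)) \<in> Obj (fdom (Uni (square_dbl C Q))) \<rightarrow>\<^sub>E Obj (fcod (Uni (square_dbl C Q)))" by (auto simp: square_dbl_def Let_def Ide_Arr)
qed (auto simp: category_square_cat category_axioms Hom_def Ide_Arr Q_vid Dom_Obj Cod_Obj)

lemma functor_Vcmp_DD: "cat_functor (Vcmp (square_dbl C Q))" 
proof (rule cat_functor.intro)
  show "fob (Vcmp (square_dbl C Q)) \<in> Obj (fdom (Vcmp (square_dbl C Q))) \<rightarrow>\<^sub>E Obj (fcod (Vcmp (square_dbl C Q)))"
  proof (rule PiE_I)
    fix p assume "p \<in> Obj (fdom (Vcmp (square_dbl C Q)))" then show "fob (Vcmp (square_dbl C Q)) p \<in> Obj (fcod (Vcmp (square_dbl C Q)))"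
      by (auto simp: Obj_pairs_DD Cmp_Arr)
  next
    fix p assume "p \<notin> Obj (fdom (Vcmp (square_dbl C Q)))" then show "fob (Vcmp (square_dbl C Q)) p = undefined"
      by (auto simp: square_dbl_def Let_def)
  qed
  show "far (Vcmp (square_dbl C Q)) \<in> extensional (Arr (fdom (Vcmp (square_dbl C Q))))" by (auto simp: square_dbl_def Let_def)
next
  fix f a b assume h: "f \<in> Hom (fdom (Vcmp (square_dbl C Q))) a b"
  obtain q p where f: "f = (q, p)" by (cases f)
  obtain a1 a2 b1 b2 where ab: "a = (a1, a2)" "b = (b1, b2)" by (cases a; cases b)
  have k: "Q p" "Q q" "Top q = Bottom p" "Left q = a1" "Left p = a2" "Right q = b1" "Right p = b2" using h by (auto simp: f ab)
  have "a2 \<in> Arr C" "a1 \<in> Arr C" "Dom C a1 = Cod C a2" "b2 \<in> Arr C" "b1 \<in> Arr C" "Dom C b1 = Cod C b2"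
    using k Q_D[OF k(1)] Q_D[OF k(2)] by metis+
  then show "far (Vcmp (square_dbl C Q)) f \<in> Hom (fcod (Vcmp (square_dbl C Q))) (fob (Vcmp (square_dbl C Q)) a) (fob (Vcmp (square_dbl C Q)) b)"
    using k Q_vcomp[OF k(1,2)] by (simp add: f ab Hom_def)
next
  fix a assume "a \<in> Obj (fdom (Vcmp (square_dbl C Q)))"
  then obtain g f where a: "a = (g, f)" and c: "composable (square_dbl C Q) g f" by (auto simp: Obj_pairs_DD)
  show "far (Vcmp (square_dbl C Q)) (Ide (fdom (Vcmp (square_dbl C Q))) a) = Ide (fcod (Vcmp (square_dbl C Q))) (fob (Vcmp (square_dbl C Q)) a)"
    unfolding a DD_simps pairs_DD vcmp2_Ide[OF c] vcmp_DD[OF c] ..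
next
  fix f g a b c assume fg: "f \<in> Hom (fdom (Vcmp (square_dbl C Q))) a b" "g \<in> Hom (fdom (Vcmp (square_dbl C Q))) b c"
  obtain q p where f: "f = (q, p)" by (cases f)
  obtain q' p' where g: "g = (q', p')" by (cases g)
  obtain a1 a2 b1 b2 c1 c2 where ab: "a = (a1, a2)" "b = (b1, b2)" "c = (c1, c2)" by (cases a; cases b; cases c)
  have k: "Q p" "Q q" "Top q = Bottom p" "Q p'" "Q q'" "Top q' = Bottom p'" "Left q' = Right q" "Left p' = Right p"
    using fg by (auto simp: f g ab)
  have "Q (Cmp (square_cat C Q) q' q)" "Q (Cmp (square_cat C Q) p' p)" using k Q_hcomp[of q q'] Q_hcomp[of p p'] by simp_all
  then show "far (Vcmp (square_dbl C Q)) (Cmp (fdom (Vcmp (square_dbl C Q))) g f) = Cmp (fcod (Vcmp (square_dbl C Q))) (far (Vcmp (square_dbl C Q)) g) (far (Vcmp (square_dbl C Q)) f)"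
    using k by (simp add: f g)
qed (auto simp: category_square_cat category_pairs_DD)

lemma sq_iso_Ide: "f \<in> Arr C \<Longrightarrow> is_iso (square_cat C Q) (Ide (square_cat C Q) f)"
  using sq_Ide_unit[OF Q_hid, of f] Q_hid[of f] unfolding is_iso_def inverse_arrows_def
  by (intro exI[of _ "Ide (square_cat C Q) f"]) (auto simp: Hom_def)

lemma sq_globular_Ide: "f \<in> Arr C \<Longrightarrow> globular (square_dbl C Q) f f (Ide (square_cat C Q) f)"
  by (auto simp: globular_def Hom_def Q_hid)

lemma double_category_square_dbl: "double_category (square_dbl C Q)"
proof (rule double_category.intro)
  show "fcmp (Src (square_dbl C Q)) (Uni (square_dbl C Q)) = fid (Hc (square_dbl C Q))"
    by (rule ftor_eqI) (auto simp: functor_Src_DD functor_Uni_DD functor_fcmp functor_fid category_axioms Ide_Arr Q_vid)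
  show "fcmp (Tgt (square_dbl C Q)) (Uni (square_dbl C Q)) = fid (Hc (square_dbl C Q))"
    by (rule ftor_eqI) (auto simp: functor_Tgt_DD functor_Uni_DD functor_fcmp functor_fid category_axioms Ide_Arr Q_vid)
next
  fix w v u assume "composable (square_dbl C Q) w v" "composable (square_dbl C Q) v u"
  then show "globular (square_dbl C Q) (vcmp (square_dbl C Q) (vcmp (square_dbl C Q) w v) u) (vcmp (square_dbl C Q) w (vcmp (square_dbl C Q) v u)) (Asc (square_dbl C Q) w v u)"
    "is_iso (Vc (square_dbl C Q)) (Asc (square_dbl C Q) w v u)"
    using sq_globular_Ide[of "Cmp C w (Cmp C v u)"] sq_iso_Ide[of "Cmp C w (Cmp C v u)"] by (auto simp: Cmp_Arr assoc_Arr simp del: sq_cat_simps(5))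
next
  fix \<gamma> \<beta> \<alpha> w w' v v' u u'
  assume "composable2 (square_dbl C Q) \<gamma> \<beta>" "composable2 (square_dbl C Q) \<beta> \<alpha>" "\<gamma> \<in> Hom (Vc (square_dbl C Q)) w w'" "\<beta> \<in> Hom (Vc (square_dbl C Q)) v v'" "\<alpha> \<in> Hom (Vc (square_dbl C Q)) u u'"
  then have k: "Q \<gamma>" "Q \<beta>" "Q \<alpha>" "Top \<gamma> = Bottom \<beta>" "Top \<beta> = Bottom \<alpha>" "Left \<gamma> = w" "Right \<gamma> = w'" "Left \<beta> = v" "Right \<beta> = v'" "Left \<alpha> = u" "Right \<alpha> = u'"
    by (auto simp: Hom_def)
  have o: "u \<in> Arr C" "v \<in> Arr C" "w \<in> Arr C" "Cod C u = Dom C v" "Cod C v = Dom C w" "u' \<in> Arr C" "v' \<in> Arr C" "w' \<in> Arr C" "Cod C u' = Dom C v'" "Cod C v' = Dom C w'"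
    using k Q_D[OF k(1)] Q_D[OF k(2)] Q_D[OF k(3)] by metis+
  let ?x = "vcmp2 (square_dbl C Q) \<gamma> (vcmp2 (square_dbl C Q) \<beta> \<alpha>)"
  note 1 = Q_vcomp[OF k(3,2)] and 2 = Q_vcomp[OF k(2,1)]
  have x: "Q ?x" "Left ?x = Cmp C w (Cmp C v u)" "Right ?x = Cmp C w' (Cmp C v' u')" using 1 k Q_vcomp[OF 1 k(1)] by simp_all
  have "vcmp2 (square_dbl C Q) (vcmp2 (square_dbl C Q) \<gamma> \<beta>) \<alpha> = ?x" using k 1 2 o by (simp add: assoc_Arr)
  then show "Cmp (Vc (square_dbl C Q)) (Asc (square_dbl C Q) w' v' u') (vcmp2 (square_dbl C Q) (vcmp2 (square_dbl C Q) \<gamma> \<beta>) \<alpha>) = Cmp (Vc (square_dbl C Q)) ?x (Asc (square_dbl C Q) w v u)"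
    using sq_Ide_unit[OF x(1)] x by (simp del: sq_cat_simps(5,6) vcmp2_DD)
next
  fix v assume "v \<in> Obj (Vc (square_dbl C Q))"
  then have v: "v \<in> Arr C" by simp
  show "globular (square_dbl C Q) (vcmp (square_dbl C Q) (fob (Uni (square_dbl C Q)) (fob (Tgt (square_dbl C Q)) v)) v) v (Lun (square_dbl C Q) v)"
    "is_iso (Vc (square_dbl C Q)) (Lun (square_dbl C Q) v)"
    "globular (square_dbl C Q) (vcmp (square_dbl C Q) v (fob (Uni (square_dbl C Q)) (fob (Src (square_dbl C Q)) v))) v (Run (square_dbl C Q) v)"
    "is_iso (Vc (square_dbl C Q)) (Run (square_dbl C Q) v)"
    using v sq_globular_Ide[OF v] sq_iso_Ide[OF v] by (simp_all add: arr_simps del: sq_cat_simps(5))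
next
  fix \<alpha> v v' assume "\<alpha> \<in> Hom (Vc (square_dbl C Q)) v v'"
  then have k: "Q \<alpha>" "Left \<alpha> = v" "Right \<alpha> = v'" by (auto simp: Hom_def)
  note d = Q_D[OF k(1)]
  have "vcmp2 (square_dbl C Q) (far (Uni (square_dbl C Q)) (far (Tgt (square_dbl C Q)) \<alpha>)) \<alpha> = \<alpha>" "vcmp2 (square_dbl C Q) \<alpha> (far (Uni (square_dbl C Q)) (far (Src (square_dbl C Q)) \<alpha>)) = \<alpha>"
    using k d Q_vid[of "Top \<alpha>"] Q_vid[of "Bottom \<alpha>"] by (simp_all add: unit_Arr)
  then show "Cmp (Vc (square_dbl C Q)) (Lun (square_dbl C Q) v') (vcmp2 (square_dbl C Q) (far (Uni (square_dbl C Q)) (far (Tgt (square_dbl C Q)) \<alpha>)) \<alpha>) = Cmp (Vc (square_dbl C Q)) \<alpha> (Lun (square_dbl C Q) v)"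
    "Cmp (Vc (square_dbl C Q)) (Run (square_dbl C Q) v') (vcmp2 (square_dbl C Q) \<alpha> (far (Uni (square_dbl C Q)) (far (Src (square_dbl C Q)) \<alpha>))) = Cmp (Vc (square_dbl C Q)) \<alpha> (Run (square_dbl C Q) v)"
    using sq_Ide_unit[OF k(1)] k by (simp_all del: sq_cat_simps(5,6))
next
  fix x w v u assume c: "composable (square_dbl C Q) x w" "composable (square_dbl C Q) w v" "composable (square_dbl C Q) v u"
  let ?f = "Cmp C x (Cmp C w (Cmp C v u))"
  have f: "?f \<in> Arr C" using c by (simp add: Cmp_Arr)
  let ?i = "Ide (square_cat C Q) ?f"
  have "Asc (square_dbl C Q) x w (vcmp (square_dbl C Q) v u) = ?i" "Asc (square_dbl C Q) (vcmp (square_dbl C Q) x w) v u = ?i" "Asc (square_dbl C Q) x (vcmp (square_dbl C Q) w v) u = ?i"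
    using c by (simp_all add: Cmp_Arr assoc_Arr del: sq_cat_simps)
  moreover have "vcmp2 (square_dbl C Q) (Ide (Vc (square_dbl C Q)) x) (Asc (square_dbl C Q) w v u) = ?i" "vcmp2 (square_dbl C Q) (Asc (square_dbl C Q) x w v) (Ide (Vc (square_dbl C Q)) u) = ?i"
    using c vcmp2_Ide[of x "Cmp C w (Cmp C v u)"] vcmp2_Ide[of "Cmp C x (Cmp C w v)" u]
    by (simp_all add: Cmp_Arr assoc_Arr del: sq_cat_simps vcmp2_DD)
  moreover have "Cmp (square_cat C Q) ?i ?i = ?i" using sq_Ide_unit[OF Q_hid[OF f]] by simp
  ultimately show "Cmp (Vc (square_dbl C Q)) (Asc (square_dbl C Q) x w (vcmp (square_dbl C Q) v u)) (Asc (square_dbl C Q) (vcmp (square_dbl C Q) x w) v u) =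
      Cmp (Vc (square_dbl C Q)) (vcmp2 (square_dbl C Q) (Ide (Vc (square_dbl C Q)) x) (Asc (square_dbl C Q) w v u))
        (Cmp (Vc (square_dbl C Q)) (Asc (square_dbl C Q) x (vcmp (square_dbl C Q) w v) u) (vcmp2 (square_dbl C Q) (Asc (square_dbl C Q) x w v) (Ide (Vc (square_dbl C Q)) u)))" by (simp only: DD_simps(2))
next
  fix w v assume c: "composable (square_dbl C Q) w v"
  let ?i = "Ide (square_cat C Q) (Cmp C w v)"
  have f: "Cmp C w v \<in> Arr C" using c by (simp add: Cmp_Arr)
  have "vcmp2 (square_dbl C Q) (Ide (Vc (square_dbl C Q)) w) (Lun (square_dbl C Q) v) = ?i" "vcmp2 (square_dbl C Q) (Run (square_dbl C Q) w) (Ide (Vc (square_dbl C Q)) v) = ?i"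
    using vcmp2_Ide[OF c] by (simp_all del: sq_cat_simps vcmp2_DD)
  moreover have "Asc (square_dbl C Q) w (fob (Uni (square_dbl C Q)) (fob (Src (square_dbl C Q)) w)) v = ?i"
    using c by (simp add: arr_simps del: sq_cat_simps)
  moreover have "Cmp (square_cat C Q) ?i ?i = ?i" using sq_Ide_unit[OF Q_hid[OF f]] by simp
  ultimately show "Cmp (Vc (square_dbl C Q)) (vcmp2 (square_dbl C Q) (Ide (Vc (square_dbl C Q)) w) (Lun (square_dbl C Q) v)) (Asc (square_dbl C Q) w (fob (Uni (square_dbl C Q)) (fob (Src (square_dbl C Q)) w)) v) =
      vcmp2 (square_dbl C Q) (Run (square_dbl C Q) w) (Ide (Vc (square_dbl C Q)) v)" by (simp only: DD_simps(2))
next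
  fix \<beta> \<alpha> assume c: "composable2 (square_dbl C Q) \<beta> \<alpha>"
  then show "far (Src (square_dbl C Q)) (vcmp2 (square_dbl C Q) \<beta> \<alpha>) = far (Src (square_dbl C Q)) \<alpha>" "far (Tgt (square_dbl C Q)) (vcmp2 (square_dbl C Q) \<beta> \<alpha>) = far (Tgt (square_dbl C Q)) \<beta>"
    using Q_vcomp[of \<alpha> \<beta>] by simp_all
qed (auto simp: functor_Src_DD functor_Tgt_DD functor_Uni_DD functor_Vcmp_DD Cmp_Arr)

end

lemma commutative_squareD:
  assumes "commutative_square C q"
  shows "Left q \<in> Arr C" "Right q \<in> Arr C" "Top q \<in> Hom C (Dom C (Left q)) (Dom C (Right q))" 
    "Bottom q \<in> Hom C (Cod C (Left q)) (Cod C (Right q))"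
    "Left q \<in> Hom C (Dom C (Left q)) (Cod C (Left q))" "Right q \<in> Hom C (Dom C (Right q)) (Cod C (Right q))"
    "Cmp C (Right q) (Top q) = Cmp C (Bottom q) (Left q)"
  using assms by (auto simp: commutative_square_def Hom_def)

lemma square_class_commutative: assumes "category C" shows "square_class C (commutative_square C)"
proof -
  interpret category C by fact
  show ?thesis
  proof
    fix f assume f: "f \<in> Arr C"
    then have fH: "f \<in> Hom C (Dom C f) (Cod C f)" by (simp add: Hom_def)
    note ia = Ide_Hom[OF Dom_Obj[OF f]] and ib = Ide_Hom[OF Cod_Obj[OF f]]
    show "commutative_square C \<lparr>Left = f, Right = f, Top = Ide C (Dom C f), Bottom = Ide C (Cod C f)\<rparr>"
      "commutative_square C \<lparr>Left = Ide C (Dom C f), Right = Ide C (Cod C f), Top = f, Bottom = f\<rparr>"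
      using f fH ia ib HomD[OF ia] HomD[OF ib] Cmp_Ide_left[OF fH] Cmp_Ide_right[OF fH]
      by (simp_all add: commutative_square_def)
  next
    fix p q assume p: "commutative_square C p" and q: "commutative_square C q" and e: "Right p = Left q"
    note P = commutative_squareD[OF p] and Q = commutative_squareD[OF q]
    have t: "Top q \<in> Hom C (Dom C (Right p)) (Dom C (Right q))" "Bottom q \<in> Hom C (Cod C (Right p)) (Cod C (Right q))" using Q e by simp_all
    have "Cmp C (Right q) (Cmp C (Top q) (Top p)) = Cmp C (Cmp C (Bottom q) (Bottom p)) (Left p)"
      using Cmp_assoc[OF P(3) t(1) Q(6)] Cmp_assoc[OF P(3) P(6) t(2)] Cmp_assoc[OF P(5) P(4) t(2)] P(7) Q(7) e by simp
    then show "commutative_square C \<lparr>Left = Left p, Right = Right q, Top = Cmp C (Top q) (Top p), Bottom = Cmp C (Bottom q) (Bottom p)\<rparr>"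
      using P Q Cmp_Hom[OF P(3) t(1)] Cmp_Hom[OF P(4) t(2)] by (simp add: commutative_square_def)
  next
    fix p q assume p: "commutative_square C p" and q: "commutative_square C q" and e: "Bottom p = Top q"
    note P = commutative_squareD[OF p] and Q = commutative_squareD[OF q]
    have d: "Dom C (Left q) = Cod C (Left p)" "Dom C (Right q) = Cod C (Right p)" using HomD[OF P(4)] HomD[OF Q(3)] e by auto
    note Q5 = Q(5)[unfolded d] and Q6 = Q(6)[unfolded d]
    have "Cmp C (Cmp C (Right q) (Right p)) (Top p) = Cmp C (Bottom q) (Cmp C (Left q) (Left p))"
      using Cmp_assoc[OF P(3) P(6) Q6] Cmp_assoc[OF P(5) Q5 Q(4)] Cmp_assoc[OF P(5) P(4) Q6] P(7) Q(7) e by simp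
    then show "commutative_square C \<lparr>Left = Cmp C (Left q) (Left p), Right = Cmp C (Right q) (Right p), Top = Top p, Bottom = Bottom q\<rparr>"
      using P Q HomD[OF Cmp_Hom[OF P(5) Q5]] HomD[OF Cmp_Hom[OF P(6) Q6]] by (simp add: commutative_square_def)
  qed
qed

lemma pullback_squareI:
  assumes "commutative_square C q"
    "\<And>W x y. W \<in> Obj C \<Longrightarrow> x \<in> Hom C W (Dom C (Right q)) \<Longrightarrow> y \<in> Hom C W (Cod C (Left q)) \<Longrightarrow> Cmp C (Right q) x = Cmp C (Bottom q) y \<Longrightarrow>
       \<exists>u. u \<in> Hom C W (Dom C (Left q)) \<and> Cmp C (Top q) u = x \<and> Cmp C (Left q) u = y"
    "\<And>W u u'. u \<in> Hom C W (Dom C (Left q)) \<Longrightarrow> u' \<in> Hom C W (Dom C (Left q)) \<Longrightarrow> Cmp C (Top q) u = Cmp C (Top q) u' \<Longrightarrow> Cmp C (Left q) u = Cmp C (Left q) u' \<Longrightarrow> u = u'"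
  shows "pullback_square C q"
  unfolding pullback_square_def using assms by (intro conjI ballI impI ex_ex1I) auto

lemma pullback_squareD:
  assumes "category C" "pullback_square C q"
  shows "commutative_square C q"
    "x \<in> Hom C W (Dom C (Right q)) \<Longrightarrow> y \<in> Hom C W (Cod C (Left q)) \<Longrightarrow> Cmp C (Right q) x = Cmp C (Bottom q) y \<Longrightarrow>
       \<exists>u. u \<in> Hom C W (Dom C (Left q)) \<and> Cmp C (Top q) u = x \<and> Cmp C (Left q) u = y"
    "u \<in> Hom C W (Dom C (Left q)) \<Longrightarrow> u' \<in> Hom C W (Dom C (Left q)) \<Longrightarrow> Cmp C (Top q) u = Cmp C (Top q) u' \<Longrightarrow> Cmp C (Left q) u = Cmp C (Left q) u' \<Longrightarrow> u = u'"
proof -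
  interpret category C by fact
  show c: "commutative_square C q" using assms by (simp add: pullback_square_def)
  note Q = commutative_squareD[OF c]
  show "x \<in> Hom C W (Dom C (Right q)) \<Longrightarrow> y \<in> Hom C W (Cod C (Left q)) \<Longrightarrow> Cmp C (Right q) x = Cmp C (Bottom q) y \<Longrightarrow>
       \<exists>u. u \<in> Hom C W (Dom C (Left q)) \<and> Cmp C (Top q) u = x \<and> Cmp C (Left q) u = y"
    using assms(2) Hom_Obj(1)[of x W] unfolding pullback_square_def by blast
  assume u: "u \<in> Hom C W (Dom C (Left q))" "u' \<in> Hom C W (Dom C (Left q))" "Cmp C (Top q) u = Cmp C (Top q) u'" "Cmp C (Left q) u = Cmp C (Left q) u'"
  have "Cmp C (Right q) (Cmp C (Top q) u) = Cmp C (Bottom q) (Cmp C (Left q) u)"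
    using Cmp_assoc[OF u(1) Q(3,6)] Cmp_assoc[OF u(1) Q(5,4)] Q(7) by simp
  then have "\<exists>!z. z \<in> Hom C W (Dom C (Left q)) \<and> Cmp C (Top q) z = Cmp C (Top q) u \<and> Cmp C (Left q) z = Cmp C (Left q) u"
    using assms(2) Hom_Obj(1)[OF u(1)] Cmp_Hom[OF u(1) Q(3)] Cmp_Hom[OF u(1) Q(5)] unfolding pullback_square_def by blast
  then show "u = u'" using u by auto
qed

lemma square_class_pullback: assumes C: "category C" shows "square_class C (pullback_square C)"
proof -
  interpret category C by fact
  interpret K: square_class C "commutative_square C" by (rule square_class_commutative[OF C])
  show ?thesis
  proof
    fix f assume f: "f \<in> Arr C"
    then have fH: "f \<in> Hom C (Dom C f) (Cod C f)" by (simp add: Hom_def)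
    show "pullback_square C \<lparr>Left = f, Right = f, Top = Ide C (Dom C f), Bottom = Ide C (Cod C f)\<rparr>"
      by (rule pullback_squareI[OF K.Q_hid[OF f]]) (auto simp: Cmp_Ide_left)
    show "pullback_square C \<lparr>Left = Ide C (Dom C f), Right = Ide C (Cod C f), Top = f, Bottom = f\<rparr>"
      using HomD[OF Ide_Hom[OF Dom_Obj[OF f]]] HomD[OF Ide_Hom[OF Cod_Obj[OF f]]]
      by (intro pullback_squareI[OF K.Q_vid[OF f]]) (auto simp: Cmp_Ide_left)
  next
    fix p q assume p: "pullback_square C p" and q: "pullback_square C q" and e: "Right p = Left q"
    note P = commutative_squareD[OF pullback_squareD(1)[OF C p]] and Q = commutative_squareD[OF pullback_squareD(1)[OF C q]]
    note pb = pullback_squareD(2,3)[OF C p] and qb = pullback_squareD(2,3)[OF C q]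
    have t: "Top q \<in> Hom C (Dom C (Right p)) (Dom C (Right q))" "Bottom q \<in> Hom C (Cod C (Right p)) (Cod C (Right q))" using Q e by simp_all
    show "pullback_square C \<lparr>Left = Left p, Right = Right q, Top = Cmp C (Top q) (Top p), Bottom = Cmp C (Bottom q) (Bottom p)\<rparr>"
    proof (rule pullback_squareI[OF K.Q_hcomp[OF pullback_squareD(1)[OF C p] pullback_squareD(1)[OF C q] e]], unfold square.simps)
      fix W x y assume x: "x \<in> Hom C W (Dom C (Right q))" and y: "y \<in> Hom C W (Cod C (Left p))"
        and xy: "Cmp C (Right q) x = Cmp C (Cmp C (Bottom q) (Bottom p)) y"
      have y': "Cmp C (Bottom p) y \<in> Hom C W (Cod C (Left q))" using Cmp_Hom[OF y P(4)] e by simp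
      obtain v where v: "v \<in> Hom C W (Dom C (Left q))" "Cmp C (Top q) v = x" "Cmp C (Left q) v = Cmp C (Bottom p) y"
        using qb(1)[OF x y'] xy Cmp_assoc[OF y P(4) t(2)] by auto
      obtain u where u: "u \<in> Hom C W (Dom C (Left p))" "Cmp C (Top p) u = v" "Cmp C (Left p) u = y"
        using pb(1)[of v W y] v y e by auto
      show "\<exists>u. u \<in> Hom C W (Dom C (Left p)) \<and> Cmp C (Cmp C (Top q) (Top p)) u = x \<and> Cmp C (Left p) u = y"
        using u v Cmp_assoc[OF u(1) P(3) t(1)] by auto
    next
      fix W u u' assume u: "u \<in> Hom C W (Dom C (Left p))" "u' \<in> Hom C W (Dom C (Left p))"
        and e1: "Cmp C (Cmp C (Top q) (Top p)) u = Cmp C (Cmp C (Top q) (Top p)) u'" and e2: "Cmp C (Left p) u = Cmp C (Left p) u'"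
      have "Cmp C (Right p) (Cmp C (Top p) u) = Cmp C (Right p) (Cmp C (Top p) u')"
        using Cmp_assoc[OF u(1) P(3,6)] Cmp_assoc[OF u(2) P(3,6)] Cmp_assoc[OF u(1) P(5,4)] Cmp_assoc[OF u(2) P(5,4)] P(7) e2 by simp
      moreover have "Cmp C (Top q) (Cmp C (Top p) u) = Cmp C (Top q) (Cmp C (Top p) u')"
        using Cmp_assoc[OF u(1) P(3) t(1)] Cmp_assoc[OF u(2) P(3) t(1)] e1 by simp
      ultimately have "Cmp C (Top p) u = Cmp C (Top p) u'"
        using qb(2)[of "Cmp C (Top p) u" W "Cmp C (Top p) u'"] Cmp_Hom[OF u(1) P(3)] Cmp_Hom[OF u(2) P(3)] e by simp
      then show "u = u'" using pb(2)[OF u] e2 by simp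
    qed
  next
    fix p q assume p: "pullback_square C p" and q: "pullback_square C q" and e: "Bottom p = Top q"
    note P = commutative_squareD[OF pullback_squareD(1)[OF C p]] and Q = commutative_squareD[OF pullback_squareD(1)[OF C q]]
    note pb = pullback_squareD(2,3)[OF C p] and qb = pullback_squareD(2,3)[OF C q]
    have d: "Dom C (Left q) = Cod C (Left p)" "Dom C (Right q) = Cod C (Right p)" using HomD[OF P(4)] HomD[OF Q(3)] e by auto
    note Q5 = Q(5)[unfolded d] and Q6 = Q(6)[unfolded d]
    have D: "Dom C (Cmp C (Left q) (Left p)) = Dom C (Left p)" "Cod C (Cmp C (Left q) (Left p)) = Cod C (Left q)"
      "Dom C (Cmp C (Right q) (Right p)) = Dom C (Right p)"
      using HomD[OF Cmp_Hom[OF P(5) Q5]] HomD[OF Cmp_Hom[OF P(6) Q6]] by auto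
    show "pullback_square C \<lparr>Left = Cmp C (Left q) (Left p), Right = Cmp C (Right q) (Right p), Top = Top p, Bottom = Bottom q\<rparr>"
    proof (rule pullback_squareI[OF K.Q_vcomp[OF pullback_squareD(1)[OF C p] pullback_squareD(1)[OF C q] e]], unfold square.simps D)
      fix W x y assume x: "x \<in> Hom C W (Dom C (Right p))" and y: "y \<in> Hom C W (Cod C (Left q))"
        and xy: "Cmp C (Cmp C (Right q) (Right p)) x = Cmp C (Bottom q) y"
      have x': "Cmp C (Right p) x \<in> Hom C W (Dom C (Right q))" using Cmp_Hom[OF x P(6)] d by simp
      obtain v where v: "v \<in> Hom C W (Dom C (Left q))" "Cmp C (Top q) v = Cmp C (Right p) x" "Cmp C (Left q) v = y"
        using qb(1)[OF x' y] xy Cmp_assoc[OF x P(6) Q6] by auto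
      obtain u where u: "u \<in> Hom C W (Dom C (Left p))" "Cmp C (Top p) u = x" "Cmp C (Left p) u = v"
        using pb(1)[of x W v] v x e d by auto
      show "\<exists>u. u \<in> Hom C W (Dom C (Left p)) \<and> Cmp C (Top p) u = x \<and> Cmp C (Cmp C (Left q) (Left p)) u = y"
        using u v Cmp_assoc[OF u(1) P(5) Q5] by auto
    next
      fix W u u' assume u: "u \<in> Hom C W (Dom C (Left p))" "u' \<in> Hom C W (Dom C (Left p))"
        and e1: "Cmp C (Top p) u = Cmp C (Top p) u'" and e2: "Cmp C (Cmp C (Left q) (Left p)) u = Cmp C (Cmp C (Left q) (Left p)) u'"
      have "Cmp C (Bottom p) (Cmp C (Left p) u) = Cmp C (Bottom p) (Cmp C (Left p) u')"
        using Cmp_assoc[OF u(1) P(3,6)] Cmp_assoc[OF u(2) P(3,6)] Cmp_assoc[OF u(1) P(5,4)] Cmp_assoc[OF u(2) P(5,4)] P(7) e1 by simp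
      moreover have "Cmp C (Left q) (Cmp C (Left p) u) = Cmp C (Left q) (Cmp C (Left p) u')"
        using Cmp_assoc[OF u(1) P(5) Q5] Cmp_assoc[OF u(2) P(5) Q5] e2 by simp
      ultimately have "Cmp C (Left p) u = Cmp C (Left p) u'"
        using qb(2)[of "Cmp C (Left p) u" W "Cmp C (Left p) u'"] Cmp_Hom[OF u(1) P(5)] Cmp_Hom[OF u(2) P(5)] e d by simp
      then show "u = u'" using pb(2)[OF u] e1 by simp
    qed
  qed (auto simp: pullback_square_def)
qed

lemma double_category_Sq: "category S \<Longrightarrow> double_category (Sq S)"
  unfolding Sq_def by (intro square_class.double_category_square_dbl square_class_commutative)

lemma double_category_Pb: "category C \<Longrightarrow> double_category (Pb C)"
  unfolding Pb_def by (intro square_class.double_category_square_dbl square_class_pullback)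

context category begin

lemma inverse_unique: "inverse_arrows C f g \<Longrightarrow> inverse_arrows C f g' \<Longrightarrow> g = g'"
proof -
  assume a: "inverse_arrows C f g" "inverse_arrows C f g'"
  have f: "f \<in> Hom C (Dom C f) (Cod C f)" and g: "g \<in> Hom C (Cod C f) (Dom C f)" "g' \<in> Hom C (Cod C f) (Dom C f)"
    and e: "Cmp C g f = Ide C (Dom C f)" "Cmp C f g' = Ide C (Cod C f)" using a by (auto simp: inverse_arrows_def Hom_def)
  have "g = Cmp C g (Cmp C f g')" using g e Cmp_Ide_right by simp
  also have "\<dots> = g'" using Cmp_assoc[OF g(2) f g(1)] e Cmp_Ide_left[OF g(2)] by simp
  finally show ?thesis .
qed

lemma inverse_arrow_eqI: "inverse_arrows C f g \<Longrightarrow> inverse_arrow C f = g"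
  unfolding inverse_arrow_def using inverse_unique by blast

lemma inverse_arrow: "is_iso C f \<Longrightarrow> inverse_arrows C f (inverse_arrow C f)"
  unfolding is_iso_def using inverse_arrow_eqI by metis

lemma inverse_arrowD:
  assumes "is_iso C f" "f \<in> Hom C a b"
  shows "inverse_arrow C f \<in> Hom C b a" "Cmp C (inverse_arrow C f) f = Ide C a" "Cmp C f (inverse_arrow C f) = Ide C b"
  using inverse_arrow[OF assms(1)] assms(2) by (auto simp: inverse_arrows_def Hom_def)

lemma inverse_arrow_eqI': "f \<in> Hom C a b \<Longrightarrow> g \<in> Hom C b a \<Longrightarrow> Cmp C g f = Ide C a \<Longrightarrow> Cmp C f g = Ide C b \<Longrightarrow> is_iso C f \<and> inverse_arrow C f = g"
  using inverse_arrow_eqI[of f g] by (auto simp: inverse_arrows_def Hom_def is_iso_def)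

lemma inverse_Cmp:
  assumes f: "is_iso C f" "f \<in> Hom C a b" and g: "is_iso C g" "g \<in> Hom C b c"
  shows "is_iso C (Cmp C g f)" "inverse_arrow C (Cmp C g f) = Cmp C (inverse_arrow C f) (inverse_arrow C g)"
proof -
  note F = inverse_arrowD[OF f] and G = inverse_arrowD[OF g]
  note gf = Cmp_Hom[OF f(2) g(2)] and fg = Cmp_Hom[OF G(1) F(1)]
  have "Cmp C (Cmp C (inverse_arrow C f) (inverse_arrow C g)) (Cmp C g f) = Ide C a"
    using Cmp_assoc[OF gf G(1) F(1)] Cmp_assoc[OF f(2) g(2) G(1)] F G Cmp_Ide_left[OF f(2)] by simp
  moreover have "Cmp C (Cmp C g f) (Cmp C (inverse_arrow C f) (inverse_arrow C g)) = Ide C c"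
    using Cmp_assoc[OF fg f(2) g(2)] Cmp_assoc[OF G(1) F(1) f(2)] F G Cmp_Ide_left[OF G(1)] by simp
  ultimately show "is_iso C (Cmp C g f)" "inverse_arrow C (Cmp C g f) = Cmp C (inverse_arrow C f) (inverse_arrow C g)"
    using inverse_arrow_eqI'[OF gf fg] by auto
qed

lemma inverse_square:
  assumes f: "is_iso C f" "f \<in> Hom C a b" and g: "is_iso C g" "g \<in> Hom C a' b'"
    and x: "x \<in> Hom C a a'" and y: "y \<in> Hom C b b'" and e: "Cmp C g x = Cmp C y f"
  shows "Cmp C x (inverse_arrow C f) = Cmp C (inverse_arrow C g) y"
proof -
  note F = inverse_arrowD[OF f] and G = inverse_arrowD[OF g]
  have "Cmp C x (inverse_arrow C f) = Cmp C (Cmp C (inverse_arrow C g) (Cmp C g x)) (inverse_arrow C f)"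
    using Cmp_assoc[OF x g(2) G(1)] G Cmp_Ide_left[OF x] by simp
  also have "\<dots> = Cmp C (inverse_arrow C g) y"
    unfolding e using Cmp_assoc[OF F(1) Cmp_Hom[OF f(2) y] G(1)] Cmp_assoc[OF F(1) f(2) y] F Cmp_Ide_right[OF y] by simp
  finally show ?thesis .
qed

lemma Ide_iso: "a \<in> Obj C \<Longrightarrow> is_iso C (Ide C a) \<and> inverse_arrow C (Ide C a) = Ide C a"
  using inverse_arrow_eqI'[OF Ide_Hom Ide_Hom] Cmp_Ide_left[OF Ide_Hom] by simp

end

lemma functor_inverse:
  assumes "cat_functor F" "is_iso (fdom F) f" "f \<in> Arr (fdom F)"
  shows "is_iso (fcod F) (far F f) \<and> inverse_arrow (fcod F) (far F f) = far F (inverse_arrow (fdom F) f)"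
proof -
  interpret F: cat_functor F by fact
  interpret A: category "fdom F" by (rule F.fdom_category)
  interpret B: category "fcod F" by (rule F.fcod_category)
  let ?a = "Dom (fdom F) f" let ?b = "Cod (fdom F) f"
  have f: "f \<in> Hom (fdom F) ?a ?b" using assms by (simp add: Hom_def)
  note I = A.inverse_arrowD[OF assms(2) f]
  show ?thesis
    by (rule B.inverse_arrow_eqI'[OF F.far_Hom[OF f] F.far_Hom[OF I(1)]])
      (use F.far_Cmp[OF f I(1)] F.far_Cmp[OF I(1) f] I F.far_Ide A.Hom_Obj[OF f] in auto)
qed

lemma is_iso_op_cat: "category C \<Longrightarrow> is_iso C f \<Longrightarrow> is_iso (op_cat C) (inverse_arrow C f)"
proof -
  assume C: "category C" and f: "is_iso C f"
  interpret category C by fact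
  have "inverse_arrows C f (inverse_arrow C f)" by (rule inverse_arrow[OF f])
  then show ?thesis unfolding is_iso_def by (intro exI[of _ f]) (auto simp: inverse_arrows_def Hom_def)
qed

context double_category begin

interpretation V: category "Vc D" using cat_functor.fdom_category[OF Src_functor(1)] Src_functor by simp
interpretation H: category "Hc D" using cat_functor.fcod_category[OF Src_functor(1)] Src_functor by simp
interpretation s: cat_functor "Src D" by (rule Src_functor)
interpretation t: cat_functor "Tgt D" by (rule Tgt_functor)

lemma composable_pairs_op: "composable_pairs (fop (Src D)) (fop (Tgt D)) = op_cat (composable_pairs (Src D) (Tgt D))"
  by (auto simp: composable_pairs_def op_cat_def prod_cat_def fun_eq_iff)

lemma inv_globular:
  assumes g: "globular D v w \<alpha>" and i: "is_iso (Vc D) \<alpha>"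
  shows "inverse_arrow (Vc D) \<alpha> \<in> Hom (Vc D) w v" "far (Src D) (inverse_arrow (Vc D) \<alpha>) = Ide (Hc D) (fob (Src D) v)"
    "far (Tgt D) (inverse_arrow (Vc D) \<alpha>) = Ide (Hc D) (fob (Tgt D) v)" "fob (Src D) w = fob (Src D) v" "fob (Tgt D) w = fob (Tgt D) v"
    "is_iso (Vc D) (inverse_arrow (Vc D) \<alpha>)"
proof -
  have a: "\<alpha> \<in> Hom (Vc D) v w" and s: "far (Src D) \<alpha> = Ide (Hc D) (fob (Src D) v)" and t: "far (Tgt D) \<alpha> = Ide (Hc D) (fob (Tgt D) v)"
    using g by (auto simp: globular_def)
  note I = V.inverse_arrowD[OF i a]
  show "inverse_arrow (Vc D) \<alpha> \<in> Hom (Vc D) w v" by (rule I)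
  have v: "v \<in> Obj (Vc D)" "w \<in> Obj (Vc D)" using V.Hom_Obj[OF a] .
  have o: "fob (Src D) v \<in> Obj (Hc D)" "fob (Tgt D) v \<in> Obj (Hc D)" using s.fob_Obj t.fob_Obj v Src_functor Tgt_functor by auto
  show "far (Src D) (inverse_arrow (Vc D) \<alpha>) = Ide (Hc D) (fob (Src D) v)" "far (Tgt D) (inverse_arrow (Vc D) \<alpha>) = Ide (Hc D) (fob (Tgt D) v)"
    using functor_inverse[OF Src_functor(1), of \<alpha>] functor_inverse[OF Tgt_functor(1), of \<alpha>] i HomD[OF a] s t H.Ide_iso o
      Src_functor Tgt_functor by auto
  show "fob (Src D) w = fob (Src D) v" "fob (Tgt D) w = fob (Tgt D) v"
    using s.far_Hom[of \<alpha> v w] t.far_Hom[of \<alpha> v w] a s t H.Ide_Hom[OF o(1)] H.Ide_Hom[OF o(2)] Src_functor Tgt_functor by (auto simp: Hom_def)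
  show "is_iso (Vc D) (inverse_arrow (Vc D) \<alpha>)" using V.inverse_arrow_eqI'[OF I(1) a] I by auto
qed

lemma composable_op: "composable (op_dbl D) w v \<longleftrightarrow> composable D w v"
  by (simp add: composable_def op_dbl_def)

lemma composable2_op: "composable2 (op_dbl D) w v \<longleftrightarrow> composable2 D w v"
  by (simp add: composable2_def op_dbl_def)

lemma globular_op: "globular D v w \<alpha> \<Longrightarrow> is_iso (Vc D) \<alpha> \<Longrightarrow> globular (op_dbl D) v w (inverse_arrow (Vc D) \<alpha>)"
  using inv_globular[of v w \<alpha>] by (simp add: globular_def op_dbl_def)

lemma vcmp2_Hom: "composable2 D \<beta> \<alpha> \<Longrightarrow> \<beta> \<in> Hom (Vc D) w w' \<Longrightarrow> \<alpha> \<in> Hom (Vc D) v v' \<Longrightarrow> vcmp2 D \<beta> \<alpha> \<in> Hom (Vc D) (vcmp D w v) (vcmp D w' v')"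
  using cat_functor.far_Hom[OF Vcmp_functor(1), of "(\<beta>, \<alpha>)" "(w, v)" "(w', v')"] Vcmp_functor Src_functor
  by (auto simp: composable_pairs_def Hom_def composable2_def prod_cat_def)

lemma iso_pair:
  assumes c: "composable2 D \<beta> \<alpha>" and i: "is_iso (Vc D) \<beta>" "is_iso (Vc D) \<alpha>"
  shows "is_iso (Vc D) (vcmp2 D \<beta> \<alpha>)" "inverse_arrow (Vc D) (vcmp2 D \<beta> \<alpha>) = vcmp2 D (inverse_arrow (Vc D) \<beta>) (inverse_arrow (Vc D) \<alpha>)"
    "composable2 D (inverse_arrow (Vc D) \<beta>) (inverse_arrow (Vc D) \<alpha>)"
proof -
  let ?P = "composable_pairs (Src D) (Tgt D)"
  interpret P: category ?P using cat_functor.fdom_category[OF Vcmp_functor(1)] Vcmp_functor by simp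
  have ba: "\<beta> \<in> Hom (Vc D) (Dom (Vc D) \<beta>) (Cod (Vc D) \<beta>)" "\<alpha> \<in> Hom (Vc D) (Dom (Vc D) \<alpha>) (Cod (Vc D) \<alpha>)" and e: "far (Src D) \<beta> = far (Tgt D) \<alpha>"
    using c by (auto simp: composable2_def Hom_def)
  note B = V.inverse_arrowD[OF i(1) ba(1)] and A = V.inverse_arrowD[OF i(2) ba(2)]
  have e': "far (Src D) (inverse_arrow (Vc D) \<beta>) = far (Tgt D) (inverse_arrow (Vc D) \<alpha>)"
    using functor_inverse[OF Src_functor(1), of \<beta>] functor_inverse[OF Tgt_functor(1), of \<alpha>] i HomD(1)[OF ba(1)] HomD(1)[OF ba(2)] e Src_functor Tgt_functor
    by simp
  show "composable2 D (inverse_arrow (Vc D) \<beta>) (inverse_arrow (Vc D) \<alpha>)" using e' HomD(1)[OF A(1)] HomD(1)[OF B(1)] by (simp add: composable2_def)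
  have 1: "(\<beta>, \<alpha>) \<in> Hom ?P (Dom (Vc D) \<beta>, Dom (Vc D) \<alpha>) (Cod (Vc D) \<beta>, Cod (Vc D) \<alpha>)" and 2: "(inverse_arrow (Vc D) \<beta>, inverse_arrow (Vc D) \<alpha>) \<in> Hom ?P (Cod (Vc D) \<beta>, Cod (Vc D) \<alpha>) (Dom (Vc D) \<beta>, Dom (Vc D) \<alpha>)"
    using ba e e' A(1) B(1) Src_functor by (auto simp: Hom_def composable_pairs_def prod_cat_def)
  have *: "is_iso ?P (\<beta>, \<alpha>) \<and> inverse_arrow ?P (\<beta>, \<alpha>) = (inverse_arrow (Vc D) \<beta>, inverse_arrow (Vc D) \<alpha>)"
    by (rule P.inverse_arrow_eqI'[OF 1 2]) (use A B Src_functor in \<open>auto simp: composable_pairs_def prod_cat_def\<close>)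
  show "is_iso (Vc D) (vcmp2 D \<beta> \<alpha>)" "inverse_arrow (Vc D) (vcmp2 D \<beta> \<alpha>) = vcmp2 D (inverse_arrow (Vc D) \<beta>) (inverse_arrow (Vc D) \<alpha>)"
    using functor_inverse[OF Vcmp_functor(1), of "(\<beta>, \<alpha>)"] * Vcmp_functor HomD(1)[OF 1] by auto
qed

lemma op_dbl_simps: "Hc (op_dbl D) = op_cat (Hc D)" "Vc (op_dbl D) = op_cat (Vc D)" "Src (op_dbl D) = fop (Src D)" "Tgt (op_dbl D) = fop (Tgt D)"
  "Uni (op_dbl D) = fop (Uni D)" "Vcmp (op_dbl D) = fop (Vcmp D)" "Asc (op_dbl D) w v u = inverse_arrow (Vc D) (Asc D w v u)"
  "Lun (op_dbl D) v = inverse_arrow (Vc D) (Lun D v)" "Run (op_dbl D) v = inverse_arrow (Vc D) (Run D v)"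
  by (simp_all add: op_dbl_def)

lemma composable_vcmp:
  assumes "composable D w v" "composable D v u" shows "composable D (vcmp D w v) u" "composable D w (vcmp D v u)"
proof -
  have "vcmp D w v \<in> Obj (Vc D)" "vcmp D v u \<in> Obj (Vc D)"
    using cat_functor.fob_Obj[OF Vcmp_functor(1), of "(w, v)"] cat_functor.fob_Obj[OF Vcmp_functor(1), of "(v, u)"] assms Vcmp_functor Src_functor
    by (auto simp: composable_pairs_def composable_def)
  then show "composable D (vcmp D w v) u" "composable D w (vcmp D v u)"
    using assms Src_vcmp Tgt_vcmp by (auto simp: composable_def)
qed

lemma uni_composable: assumes "v \<in> Obj (Vc D)"
  shows "composable D (fob (Uni D) (fob (Tgt D) v)) v" "composable D v (fob (Uni D) (fob (Src D) v))"
proof -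
  have o: "fob (Tgt D) v \<in> Obj (Hc D)" "fob (Src D) v \<in> Obj (Hc D)" using s.fob_Obj t.fob_Obj assms Src_functor Tgt_functor by auto
  have "fob (fcmp (Src D) (Uni D)) (fob (Tgt D) v) = fob (Tgt D) v" "fob (fcmp (Tgt D) (Uni D)) (fob (Src D) v) = fob (Src D) v"
    unfolding Src_Uni Tgt_Uni using o by simp_all
  then show "composable D (fob (Uni D) (fob (Tgt D) v)) v" "composable D v (fob (Uni D) (fob (Src D) v))"
    using assms cat_functor.fob_Obj[OF Uni_functor(1)] o Uni_functor by (auto simp: composable_def)
qed

lemma uni_composable2: assumes "\<alpha> \<in> Arr (Vc D)"
  shows "composable2 D (far (Uni D) (far (Tgt D) \<alpha>)) \<alpha>" "composable2 D \<alpha> (far (Uni D) (far (Src D) \<alpha>))"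
proof -
  have o: "far (Tgt D) \<alpha> \<in> Arr (Hc D)" "far (Src D) \<alpha> \<in> Arr (Hc D)" using s.far_Arr t.far_Arr assms Src_functor Tgt_functor by auto
  have "far (fcmp (Src D) (Uni D)) (far (Tgt D) \<alpha>) = far (Tgt D) \<alpha>" "far (fcmp (Tgt D) (Uni D)) (far (Src D) \<alpha>) = far (Src D) \<alpha>"
    unfolding Src_Uni Tgt_Uni using o by simp_all
  then show "composable2 D (far (Uni D) (far (Tgt D) \<alpha>)) \<alpha>" "composable2 D \<alpha> (far (Uni D) (far (Src D) \<alpha>))"
    using assms cat_functor.far_Arr[OF Uni_functor(1)] o Uni_functor by (auto simp: composable2_def)
qed

lemma fob_Ide: "v \<in> Obj (Vc D) \<Longrightarrow> far (Src D) (Ide (Vc D) v) = Ide (Hc D) (fob (Src D) v)" "v \<in> Obj (Vc D) \<Longrightarrow> far (Tgt D) (Ide (Vc D) v) = Ide (Hc D) (fob (Tgt D) v)"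
  using s.far_Ide[of v] t.far_Ide[of v] Src_functor Tgt_functor by auto

lemma double_category_op: "double_category (op_dbl D)"
proof (rule double_category.intro, unfold op_dbl_simps composable_op composable2_op fop_simps op_cat_simps)
  show "fcmp (fop (Src D)) (fop (Uni D)) = fid (op_cat (Hc D))"
    using arg_cong[OF Src_Uni, of fop] Uni_functor by (simp add: fop_def fcmp_def fid_def)
  show "fcmp (fop (Tgt D)) (fop (Uni D)) = fid (op_cat (Hc D))"
    using arg_cong[OF Tgt_Uni, of fop] Uni_functor by (simp add: fop_def fcmp_def fid_def)
next
  fix w v u assume c: "composable D w v" "composable D v u"
  show "globular (op_dbl D) (vcmp D (vcmp D w v) u) (vcmp D w (vcmp D v u)) (inverse_arrow (Vc D) (Asc D w v u))"
    by (rule globular_op[OF Asc_globular[OF c] Asc_iso[OF c]])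
  show "is_iso (op_cat (Vc D)) (inverse_arrow (Vc D) (Asc D w v u))" by (rule is_iso_op_cat[OF V.category_axioms Asc_iso[OF c]])
next
  fix \<gamma> \<beta> \<alpha> w w' v v' u u'
  assume c: "composable2 D \<gamma> \<beta>" "composable2 D \<beta> \<alpha>" and h: "\<gamma> \<in> Hom (Vc D) w' w" "\<beta> \<in> Hom (Vc D) v' v" "\<alpha> \<in> Hom (Vc D) u' u"
  have d: "composable D w v" "composable D v u" "composable D w' v'" "composable D v' u'"
    using c V.Hom_Obj[OF h(1)] V.Hom_Obj[OF h(2)] V.Hom_Obj[OF h(3)] s.far_Hom[of \<gamma> w' w] s.far_Hom[of \<beta> v' v] t.far_Hom[of \<beta> v' v] t.far_Hom[of \<alpha> u' u] h Src_functor Tgt_functor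
    by (auto simp: composable_def composable2_def Hom_def)
  have c': "composable2 D (vcmp2 D \<gamma> \<beta>) \<alpha>" "composable2 D \<gamma> (vcmp2 D \<beta> \<alpha>)"
    using c HomD(1)[OF vcmp2_Hom[OF c(1) h(1,2)]] HomD(1)[OF vcmp2_Hom[OF c(2) h(2,3)]] Src_vcmp2[OF c(1)] Tgt_vcmp2[OF c(2)]
    by (auto simp: composable2_def)
  note A = Asc_globular[OF d(1,2)] and A' = Asc_globular[OF d(3,4)]
  show "Cmp (Vc D) (vcmp2 D (vcmp2 D \<gamma> \<beta>) \<alpha>) (inverse_arrow (Vc D) (Asc D w' v' u')) = Cmp (Vc D) (inverse_arrow (Vc D) (Asc D w v u)) (vcmp2 D \<gamma> (vcmp2 D \<beta> \<alpha>))"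
    by (rule V.inverse_square[OF Asc_iso[OF d(3,4)] _ Asc_iso[OF d(1,2)] _ vcmp2_Hom[OF c'(1) vcmp2_Hom[OF c(1) h(1,2)] h(3)]
      vcmp2_Hom[OF c'(2) h(1) vcmp2_Hom[OF c(2) h(2,3)]] Asc_natural[OF c h]])
      (use A A' in \<open>auto simp: globular_def\<close>)
next
  fix v assume v: "v \<in> Obj (Vc D)"
  show "globular (op_dbl D) (vcmp D (fob (Uni D) (fob (Tgt D) v)) v) v (inverse_arrow (Vc D) (Lun D v))"
    by (rule globular_op[OF Lun_globular[OF v] Lun_iso[OF v]])
  show "is_iso (op_cat (Vc D)) (inverse_arrow (Vc D) (Lun D v))" by (rule is_iso_op_cat[OF V.category_axioms Lun_iso[OF v]])
  show "globular (op_dbl D) (vcmp D v (fob (Uni D) (fob (Src D) v))) v (inverse_arrow (Vc D) (Run D v))"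
    by (rule globular_op[OF Run_globular[OF v] Run_iso[OF v]])
  show "is_iso (op_cat (Vc D)) (inverse_arrow (Vc D) (Run D v))" by (rule is_iso_op_cat[OF V.category_axioms Run_iso[OF v]])
next
  fix \<alpha> v v' assume h: "\<alpha> \<in> Hom (Vc D) v' v"
  note c = uni_composable2[OF HomD(1)[OF h]] and v = V.Hom_Obj[OF h]
  have u: "far (Uni D) (far (Tgt D) \<alpha>) \<in> Hom (Vc D) (fob (Uni D) (fob (Tgt D) v')) (fob (Uni D) (fob (Tgt D) v))"
    "far (Uni D) (far (Src D) \<alpha>) \<in> Hom (Vc D) (fob (Uni D) (fob (Src D) v')) (fob (Uni D) (fob (Src D) v))"
    using cat_functor.far_Hom[OF Uni_functor(1)] s.far_Hom t.far_Hom h Src_functor Tgt_functor Uni_functor by auto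
  show "Cmp (Vc D) (vcmp2 D (far (Uni D) (far (Tgt D) \<alpha>)) \<alpha>) (inverse_arrow (Vc D) (Lun D v')) = Cmp (Vc D) (inverse_arrow (Vc D) (Lun D v)) \<alpha>"
    by (rule V.inverse_square[OF Lun_iso[OF v(1)] _ Lun_iso[OF v(2)] _ vcmp2_Hom[OF c(1) u(1) h] h Lun_natural[OF h]])
      (use Lun_globular[OF v(1)] Lun_globular[OF v(2)] in \<open>auto simp: globular_def\<close>)
  show "Cmp (Vc D) (vcmp2 D \<alpha> (far (Uni D) (far (Src D) \<alpha>))) (inverse_arrow (Vc D) (Run D v')) = Cmp (Vc D) (inverse_arrow (Vc D) (Run D v)) \<alpha>"
    by (rule V.inverse_square[OF Run_iso[OF v(1)] _ Run_iso[OF v(2)] _ vcmp2_Hom[OF c(2) h u(2)] h Run_natural[OF h]])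
      (use Run_globular[OF v(1)] Run_globular[OF v(2)] in \<open>auto simp: globular_def\<close>)
next
  fix x w v u assume c: "composable D x w" "composable D w v" "composable D v u"
  note d = composable_vcmp[OF c(1,2)] composable_vcmp[OF c(2,3)]
  have o: "x \<in> Obj (Vc D)" "u \<in> Obj (Vc D)" using c by (auto simp: composable_def)
  let ?H = "\<lambda>\<alpha>. globular D"
  note a1 = Asc_iso[OF d(1) c(3)] and a2 = Asc_iso[OF c(1) d(4)] and b1 = Asc_iso[OF c(1,2)] and b2 = Asc_iso[OF d(2,3)] and b3 = Asc_iso[OF c(2,3)]
  note h1 = Asc_globular[OF d(1) c(3)] and h2 = Asc_globular[OF c(1) d(4)] and k1 = Asc_globular[OF c(1,2)] and k2 = Asc_globular[OF d(2,3)] and k3 = Asc_globular[OF c(2,3)]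
  have ix: "is_iso (Vc D) (Ide (Vc D) x)" "inverse_arrow (Vc D) (Ide (Vc D) x) = Ide (Vc D) x" and iu: "is_iso (Vc D) (Ide (Vc D) u)" "inverse_arrow (Vc D) (Ide (Vc D) u) = Ide (Vc D) u"
    using V.Ide_iso o by auto
  have c1: "composable2 D (Ide (Vc D) x) (Asc D w v u)"
    using k3 o HomD(1)[OF V.Ide_Hom[OF o(1)]] Tgt_vcmp[OF d(3)] Tgt_vcmp[OF c(2)] c(1) by (auto simp: composable2_def globular_def fob_Ide composable_def dest: HomD)
  have c2: "composable2 D (Asc D x w v) (Ide (Vc D) u)"
    using k1 o HomD(1)[OF V.Ide_Hom[OF o(2)]] Src_vcmp[OF d(1)] Src_vcmp[OF c(2)] c(3) by (auto simp: composable2_def globular_def fob_Ide composable_def dest: HomD)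
  note p1 = iso_pair[OF c1 ix(1) b3] and p2 = iso_pair[OF c2 b1 iu(1)]
  have X1: "Asc D (vcmp D x w) v u \<in> Hom (Vc D) (vcmp D (vcmp D (vcmp D x w) v) u) (vcmp D (vcmp D x w) (vcmp D v u))"
    and X2: "Asc D x w (vcmp D v u) \<in> Hom (Vc D) (vcmp D (vcmp D x w) (vcmp D v u)) (vcmp D x (vcmp D w (vcmp D v u)))"
    and Y2: "Asc D x (vcmp D w v) u \<in> Hom (Vc D) (vcmp D (vcmp D x (vcmp D w v)) u) (vcmp D x (vcmp D (vcmp D w v) u))"
    using h1 h2 k2 by (auto simp: globular_def)
  have Y1: "vcmp2 D (Asc D x w v) (Ide (Vc D) u) \<in> Hom (Vc D) (vcmp D (vcmp D (vcmp D x w) v) u) (vcmp D (vcmp D x (vcmp D w v)) u)"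
    by (rule vcmp2_Hom[OF c2]) (use k1 V.Ide_Hom o in \<open>auto simp: globular_def\<close>)
  have Y3: "vcmp2 D (Ide (Vc D) x) (Asc D w v u) \<in> Hom (Vc D) (vcmp D x (vcmp D (vcmp D w v) u)) (vcmp D x (vcmp D w (vcmp D v u)))"
    by (rule vcmp2_Hom[OF c1]) (use k3 V.Ide_Hom o in \<open>auto simp: globular_def\<close>)
  have L: "inverse_arrow (Vc D) (Cmp (Vc D) (Asc D x w (vcmp D v u)) (Asc D (vcmp D x w) v u)) =
    Cmp (Vc D) (inverse_arrow (Vc D) (Asc D (vcmp D x w) v u)) (inverse_arrow (Vc D) (Asc D x w (vcmp D v u)))"
    by (rule V.inverse_Cmp(2)[OF a1 X1 a2 X2])
  note R1 = V.inverse_Cmp[OF p2(1) Y1 b2 Y2]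
  note R = V.inverse_Cmp(2)[OF R1(1) V.Cmp_Hom[OF Y1 Y2] p1(1) Y3]
  show "Cmp (Vc D) (inverse_arrow (Vc D) (Asc D (vcmp D x w) v u)) (inverse_arrow (Vc D) (Asc D x w (vcmp D v u))) =
      Cmp (Vc D) (Cmp (Vc D) (vcmp2 D (inverse_arrow (Vc D) (Asc D x w v)) (Ide (Vc D) u)) (inverse_arrow (Vc D) (Asc D x (vcmp D w v) u)))
        (vcmp2 D (Ide (Vc D) x) (inverse_arrow (Vc D) (Asc D w v u)))"
    using L R R1(2) p1(2) p2(2) ix iu pentagon[OF c] by simp
next
  fix w v assume c: "composable D w v"
  have o: "w \<in> Obj (Vc D)" "v \<in> Obj (Vc D)" and e: "fob (Src D) w = fob (Tgt D) v" using c by (auto simp: composable_def)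
  let ?U = "fob (Uni D) (fob (Src D) w)"
  have d: "composable D w ?U" "composable D ?U v" using uni_composable[OF o(1)] uni_composable[OF o(2)] e by auto
  note lg = Lun_globular[OF o(2)] and rg = Run_globular[OF o(1)] and ag = Asc_globular[OF d]
  have iw: "is_iso (Vc D) (Ide (Vc D) w)" "inverse_arrow (Vc D) (Ide (Vc D) w) = Ide (Vc D) w" and iv: "is_iso (Vc D) (Ide (Vc D) v)" "inverse_arrow (Vc D) (Ide (Vc D) v) = Ide (Vc D) v"
    using V.Ide_iso o by auto
  have c1: "composable2 D (Ide (Vc D) w) (Lun D v)"
    using lg o HomD(1)[OF V.Ide_Hom[OF o(1)]] Tgt_vcmp[OF d(2)] e Tgt_vcmp[OF uni_composable(1)[OF o(2)]] d(1)
    by (auto simp: composable2_def globular_def fob_Ide composable_def dest: HomD)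
  have c2: "composable2 D (Run D w) (Ide (Vc D) v)"
    using rg o HomD(1)[OF V.Ide_Hom[OF o(2)]] Src_vcmp[OF d(1)] d(2)
    by (auto simp: composable2_def globular_def fob_Ide composable_def dest: HomD)
  note p1 = iso_pair[OF c1 iw(1) Lun_iso[OF o(2)]] and p2 = iso_pair[OF c2 Run_iso[OF o(1)] iv(1)]
  have X: "Asc D w ?U v \<in> Hom (Vc D) (vcmp D (vcmp D w ?U) v) (vcmp D w (vcmp D ?U v))" using ag by (auto simp: globular_def)
  have Y: "vcmp2 D (Ide (Vc D) w) (Lun D v) \<in> Hom (Vc D) (vcmp D w (vcmp D ?U v)) (vcmp D w v)"
    by (rule vcmp2_Hom[OF c1]) (use lg e V.Ide_Hom o in \<open>auto simp: globular_def\<close>)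
  show "Cmp (Vc D) (inverse_arrow (Vc D) (Asc D w ?U v)) (vcmp2 D (Ide (Vc D) w) (inverse_arrow (Vc D) (Lun D v))) = vcmp2 D (inverse_arrow (Vc D) (Run D w)) (Ide (Vc D) v)"
    using V.inverse_Cmp(2)[OF Asc_iso[OF d] X p1(1) Y] triangle[OF c] p1(2) p2(2) iw iv by simp
qed (use Src_functor Tgt_functor Uni_functor Vcmp_functor in \<open>auto intro: functor_fop simp: composable_pairs_op Src_vcmp Tgt_vcmp Src_vcmp2 Tgt_vcmp2\<close>)

end

end

theory Submission
  imports Defs
begin

text \<open>Taking isomorphism classes is a functor from categories to sets, and on a representable profunctor
  it acts by the representing functor. That this turns \<open>M\<close> into a strict functor to commutative
  squares rests on universal elements: they determine \<open>f\<^sub>!\<close> up to isomorphism, compose under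
  composition of profunctors, and are transported along the invertible comparison cells, whence
  \<open>(gf)\<^sub>! \<cong> g\<^sub>! f\<^sub>!\<close>. Commutativity of the squares is the Beck-Chevalley condition.

  Taking isomorphism classes preserves arbitrary products: objects and isomorphisms of a product of
  categories are families, as one sees by mapping into it from the terminal category and from the
  free isomorphism. Products of profunctors reduce to this, since they are products on sources and
  on targets.\<close>

section \<open>Isomorphism classes\<close>

text \<open>A double functor into \<open>Cat\<close> composes vertical arrows only up to comparison
  cells, whereas the result has to satisfy its laws on the nose. The gap is bridged by the fact that
  \<open>iso_classes_map\<close> sees a functor only through the isomorphism types of its values:
  two functors become equal on classes as soon as they agree up to isomorphism at each object, with
  no naturality. This is why universal elements, one for each object of the source, replace natural
  isomorphisms between representing functors; a composite of representing functors is never shown to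
  represent anything. On the product side no product of categories is constructed. The cone in
  \<open>cat_cat\<close> is arbitrary and known only through its universal property against
  categories carried by \<open>'u\<close>, so the test categories have to be built inside
  \<open>'u\<close>, whose infinity supplies codes for their arrows. Classes are subsets of
  \<open>'u\<close>; hence the new double functor takes its values in sets over
  \<open>'u set\<close>.\<close>

lemma isomorphicI:
  "f \<in> Hom C a b \<Longrightarrow> g \<in> Hom C b a \<Longrightarrow> Cmp C g f = Ide C a \<Longrightarrow> Cmp C f g = Ide C b \<Longrightarrow> isomorphic C a b"
  unfolding isomorphic_def is_iso_def inverse_arrows_def by (auto simp: Hom_def)

lemma (in category) isomorphicE:
  assumes "isomorphic C a b"
  obtains f g where "f \<in> Hom C a b" "g \<in> Hom C b a" "Cmp C g f = Ide C a" "Cmp C f g = Ide C b"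
  using assms inverse_arrowD unfolding isomorphic_def by metis

lemma (in category) isomorphic_refl: "a \<in> Obj C \<Longrightarrow> isomorphic C a a"
  using Ide_iso Ide_Hom unfolding isomorphic_def by blast

lemma (in category) isomorphic_sym: "isomorphic C a b \<Longrightarrow> isomorphic C b a"
  by (erule isomorphicE) (rule isomorphicI)

lemma (in category) isomorphic_trans: "isomorphic C a b \<Longrightarrow> isomorphic C b c \<Longrightarrow> isomorphic C a c"
  unfolding isomorphic_def using Cmp_Hom inverse_Cmp(1) by blast

lemma (in category) iso_class_eq_iff:
  assumes "a \<in> Obj C" "b \<in> Obj C"
  shows "iso_class C a = iso_class C b \<longleftrightarrow> isomorphic C a b"
  using assms isomorphic_refl isomorphic_sym isomorphic_trans unfolding iso_class_def by blast

lemma (in cat_functor) isomorphic_fob: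
  assumes "isomorphic (fdom F) a b" shows "isomorphic (fcod F) (fob F a) (fob F b)"
proof -
  interpret A: category "fdom F" by (rule fdom_category)
  from assms obtain f g where *: "f \<in> Hom (fdom F) a b" "g \<in> Hom (fdom F) b a"
    "Cmp (fdom F) g f = Ide (fdom F) a" "Cmp (fdom F) f g = Ide (fdom F) b"
    by (rule A.isomorphicE)
  show ?thesis
    by (rule isomorphicI[OF far_Hom[OF *(1)] far_Hom[OF *(2)]])
      (use * A.Hom_Obj[OF *(1)] in \<open>simp_all flip: far_Cmp far_Ide\<close>)
qed

lemma iso_classes_map_simps [simp]:
  "sdom (iso_classes_map F) = iso_classes (fdom F)" "scod (iso_classes_map F) = iso_classes (fcod F)"
  by (simp_all add: iso_classes_map_def)

text \<open>Functors preserve isomorphy, so all sets in the union defining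
  \<open>iso_classes_map\<close> coincide; the union is not empty because an object lies in its own
  class.\<close>

lemma smap_iso_classes_map:
  assumes F: "cat_functor F" and a: "a \<in> Obj (fdom F)"
  shows "smap (iso_classes_map F) (iso_class (fdom F) a) = iso_class (fcod F) (fob F a)"
proof -
  interpret F: cat_functor F by fact
  interpret A: category "fdom F" by (rule F.fdom_category)
  interpret B: category "fcod F" by (rule F.fcod_category)
  have "a \<in> iso_class (fdom F) a" using a A.isomorphic_refl by (simp add: iso_class_def)
  moreover have "iso_class (fcod F) (fob F x) = iso_class (fcod F) (fob F a)" if "x \<in> iso_class (fdom F) a" for x
    using that a F.fob_Obj F.isomorphic_fob A.isomorphic_sym by (subst B.iso_class_eq_iff) (auto simp: iso_class_def)
  ultimately have "(\<Union>x\<in>iso_class (fdom F) a. iso_class (fcod F) (fob F x)) = iso_class (fcod F) (fob F a)" by blast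
  then show ?thesis using a by (simp add: iso_classes_map_def iso_classes_def)
qed

lemma iso_classes_map_Hom:
  assumes F: "cat_functor F"
  shows "iso_classes_map F \<in> Hom set_cat (iso_classes (fdom F)) (iso_classes (fcod F))"
proof -
  have "smap (iso_classes_map F) \<in> extensional (iso_classes (fdom F))" by (simp add: iso_classes_map_def)
  then show ?thesis using smap_iso_classes_map[OF F] cat_functor.fob_Obj[OF F]
    by (auto simp: Hom_set_cat PiE_def iso_classes_def)
qed

text \<open>The isomorphisms are chosen separately for each object and need not be natural. Every
  later equality between maps of classes that does not come from functoriality goes through this
  rule.\<close>

lemma iso_classes_map_eqI:
  assumes F: "cat_functor F" and G: "cat_functor G" and e: "fdom F = fdom G" "fcod F = fcod G"
    and i: "\<And>a. a \<in> Obj (fdom F) \<Longrightarrow> isomorphic (fcod F) (fob F a) (fob G a)"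
  shows "iso_classes_map F = iso_classes_map G"
proof (rule sarr_eqI)
  interpret F: cat_functor F by fact
  interpret G: cat_functor G by fact
  interpret B: category "fcod F" by (rule F.fcod_category)
  show "iso_classes_map F \<in> Hom set_cat (iso_classes (fdom F)) (iso_classes (fcod F))" by (rule iso_classes_map_Hom[OF F.cat_functor_axioms])
  show "iso_classes_map G \<in> Hom set_cat (iso_classes (fdom F)) (iso_classes (fcod F))"
    using iso_classes_map_Hom[OF G.cat_functor_axioms] e by simp
  fix c assume "c \<in> iso_classes (fdom F)"
  then obtain a where "a \<in> Obj (fdom F)" "c = iso_class (fdom F) a" by (auto simp: iso_classes_def)
  then show "smap (iso_classes_map F) c = smap (iso_classes_map G) c"
    using smap_iso_classes_map[OF F.cat_functor_axioms, of a] smap_iso_classes_map[OF G.cat_functor_axioms, of a] F.fob_Obj[of a] G.fob_Obj[of a] i[of a] e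
      B.iso_class_eq_iff[of "fob F a" "fob G a"] by simp
qed

lemma iso_classes_map_fid:
  assumes "category A" shows "iso_classes_map (fid A) = Ide set_cat (iso_classes A)"
proof (rule sarr_eqI)
  interpret F: cat_functor "fid A" using assms by (rule functor_fid)
  show "iso_classes_map (fid A) \<in> Hom set_cat (iso_classes A) (iso_classes A)" using iso_classes_map_Hom[OF F.cat_functor_axioms] by simp
  show "Ide set_cat (iso_classes A) \<in> Hom set_cat (iso_classes A) (iso_classes A)" by (simp add: Hom_set_cat)
  fix c assume "c \<in> iso_classes A"
  then show "smap (iso_classes_map (fid A)) c = smap (Ide set_cat (iso_classes A)) c"
    using smap_iso_classes_map[OF F.cat_functor_axioms] by (auto simp: iso_classes_def)
qed

lemma iso_classes_map_fcmp:
  assumes F: "cat_functor F" and G: "cat_functor G" and e: "fcod F = fdom G"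
  shows "iso_classes_map (fcmp G F) = Cmp set_cat (iso_classes_map G) (iso_classes_map F)"
proof (rule sarr_eqI)
  interpret F: cat_functor F by fact
  interpret G: cat_functor G by fact
  interpret GF: cat_functor "fcmp G F" using assms by (intro functor_fcmp)
  show "iso_classes_map (fcmp G F) \<in> Hom set_cat (iso_classes (fdom F)) (iso_classes (fcod G))"
    using iso_classes_map_Hom[OF GF.cat_functor_axioms] by simp
  show "Cmp set_cat (iso_classes_map G) (iso_classes_map F) \<in> Hom set_cat (iso_classes (fdom F)) (iso_classes (fcod G))"
    using category.Cmp_Hom[OF category_set_cat iso_classes_map_Hom[OF F.cat_functor_axioms], of "iso_classes_map G" "iso_classes (fcod G)"]
      iso_classes_map_Hom[OF G.cat_functor_axioms] e by simp
  fix c assume "c \<in> iso_classes (fdom F)"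
  then obtain a where a: "a \<in> Obj (fdom F)" "c = iso_class (fdom F) a" "c \<in> iso_classes (fdom F)" by (auto simp: iso_classes_def)
  then show "smap (iso_classes_map (fcmp G F)) c = smap (Cmp set_cat (iso_classes_map G) (iso_classes_map F)) c"
    using smap_iso_classes_map[OF GF.cat_functor_axioms, of a] smap_iso_classes_map[OF F.cat_functor_axioms, of a] smap_iso_classes_map[OF G.cat_functor_axioms, of "fob F a"] F.fob_Obj[of a] e
    by simp
qed

text \<open>Packaged as a functor on \<open>cat_cat\<close> so that the horizontal part of the new
  double functor is simply its composite with \<open>hfun M\<close>.\<close>

definition iso_classes_ftor :: "(('u, 'u) cat, ('u, 'u, 'u, 'u) ftor, 'u set set, 'u set sarr) ftor" where
  "iso_classes_ftor = \<lparr>fdom = cat_cat, fcod = set_cat, fob = restrict iso_classes (Obj cat_cat),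
     far = restrict iso_classes_map (Arr cat_cat)\<rparr>"

lemma iso_classes_ftor_simps [simp]:
  "fdom iso_classes_ftor = cat_cat" "fcod iso_classes_ftor = set_cat"
  "category A \<Longrightarrow> fob iso_classes_ftor A = iso_classes A"
  "cat_functor F \<Longrightarrow> far iso_classes_ftor F = iso_classes_map F"
  by (simp_all add: iso_classes_ftor_def)

lemma functor_iso_classes: "cat_functor iso_classes_ftor"
proof (rule cat_functor.intro)
  fix F :: "('a, 'a, 'a, 'a) ftor" and A B assume "F \<in> Hom (fdom iso_classes_ftor) A B"
  then show "far iso_classes_ftor F \<in> Hom (fcod iso_classes_ftor) (fob iso_classes_ftor A) (fob iso_classes_ftor B)"
    using iso_classes_map_Hom[of F] by (auto simp: Hom_def cat_functor.fdom_category cat_functor.fcod_category)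
next
  fix F G :: "('a, 'a, 'a, 'a) ftor" and A B C
  assume "F \<in> Hom (fdom iso_classes_ftor) A B" "G \<in> Hom (fdom iso_classes_ftor) B C"
  then show "far iso_classes_ftor (Cmp (fdom iso_classes_ftor) G F) =
      Cmp (fcod iso_classes_ftor) (far iso_classes_ftor G) (far iso_classes_ftor F)"
    by (auto simp: Hom_def functor_fcmp iso_classes_map_fcmp)
qed (auto simp: category_cat_cat category_set_cat functor_fid iso_classes_map_fid, auto simp: iso_classes_ftor_def)


section \<open>Products of categories\<close>

text \<open>The unique arrow from \<open>a\<close> to \<open>b\<close> is encoded as \<open>code3 (a, b, a)\<close>, the third entry being a
  dummy. The category is initial, terminal or the free isomorphism when \<open>S\<close> has no, one or two
  elements.\<close>

definition chaotic :: "'u::infinite set \<Rightarrow> ('u, 'u) cat" where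
  "chaotic S = \<lparr>Obj = S, Arr = {code3 (a, b, a) | a b. a \<in> S \<and> b \<in> S},
     Dom = (\<lambda>f. fst (decode3 f)), Cod = (\<lambda>f. fst (snd (decode3 f))),
     Ide = (\<lambda>a. code3 (a, a, a)),
     Cmp = (\<lambda>g f. code3 (fst (decode3 f), fst (snd (decode3 g)), fst (decode3 f)))\<rparr>"

lemma chaotic_simps [simp]: "Obj (chaotic S) = S" "Ide (chaotic S) a = code3 (a, a, a)"
  "Cmp (chaotic S) (code3 (b, c, b')) (code3 (a, b'', a')) = code3 (a, c, a)"
  by (simp_all add: chaotic_def)

lemma Hom_chaotic: "f \<in> Hom (chaotic S) a b \<longleftrightarrow> a \<in> S \<and> b \<in> S \<and> f = code3 (a, b, a)"
  by (auto simp: Hom_def chaotic_def)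

lemma Arr_chaotic: "f \<in> Arr (chaotic S) \<longleftrightarrow> (\<exists>a\<in>S. \<exists>b\<in>S. f = code3 (a, b, a))"
  by (auto simp: chaotic_def)

lemma category_chaotic: "category (chaotic S)"
  by (rule category.intro) (auto simp: Hom_chaotic, auto simp: chaotic_def)

text \<open>A functor out of a chaotic category is a family of objects \<open>x a\<close> with a
  compatible family of isomorphisms \<open>h a b\<close>; the endpoints \<open>a\<close> and
  \<open>b\<close> are decoded from the arrow.\<close>

definition chaotic_ftor :: "'u::infinite set \<Rightarrow> ('p, 'b) cat \<Rightarrow> ('u \<Rightarrow> 'p) \<Rightarrow> ('u \<Rightarrow> 'u \<Rightarrow> 'b) \<Rightarrow> ('u, 'u, 'p, 'b) ftor" where
  "chaotic_ftor S A x h = \<lparr>fdom = chaotic S, fcod = A, fob = restrict x S,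
     far = (\<lambda>f\<in>Arr (chaotic S). h (fst (decode3 f)) (fst (snd (decode3 f))))\<rparr>"

lemma chaotic_ftor_simps [simp]:
  "fdom (chaotic_ftor S A x h) = chaotic S" "fcod (chaotic_ftor S A x h) = A"
  "a \<in> S \<Longrightarrow> fob (chaotic_ftor S A x h) a = x a"
  "a \<in> S \<Longrightarrow> b \<in> S \<Longrightarrow> far (chaotic_ftor S A x h) (code3 (a, b, a)) = h a b"
  by (auto simp: chaotic_ftor_def Arr_chaotic)

lemma functor_chaotic_ftor:
  assumes A: "category A" and x: "\<And>a. a \<in> S \<Longrightarrow> x a \<in> Obj A"
    and h: "\<And>a b. a \<in> S \<Longrightarrow> b \<in> S \<Longrightarrow> h a b \<in> Hom A (x a) (x b)"
    and h_Ide: "\<And>a. a \<in> S \<Longrightarrow> h a a = Ide A (x a)"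
    and h_Cmp: "\<And>a b c. a \<in> S \<Longrightarrow> b \<in> S \<Longrightarrow> c \<in> S \<Longrightarrow> Cmp A (h b c) (h a b) = h a c"
  shows "cat_functor (chaotic_ftor S A x h)"
  by (rule cat_functor.intro)
    (auto simp: category_chaotic assms Hom_chaotic, auto simp: chaotic_ftor_def x)

text \<open>Unique existence is split into existence of the induced arrow and joint cancellability
  of the projections. \<open>C\<close> is not assumed to be a category, so the last rule has to be
  told that the composites with \<open>u\<close> form a cone.\<close>

lemma is_productD:
  assumes "is_product C I X P \<pi>"
  shows "P \<in> Obj C" "i \<in> I \<Longrightarrow> X i \<in> Obj C" "i \<in> I \<Longrightarrow> \<pi> i \<in> Hom C P (X i)"
    "Q \<in> Obj C \<Longrightarrow> (\<And>i. i \<in> I \<Longrightarrow> q i \<in> Hom C Q (X i)) \<Longrightarrow> \<exists>u. u \<in> Hom C Q P \<and> (\<forall>i\<in>I. Cmp C (\<pi> i) u = q i)"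
    "Q \<in> Obj C \<Longrightarrow> (\<And>i. i \<in> I \<Longrightarrow> Cmp C (\<pi> i) u \<in> Hom C Q (X i)) \<Longrightarrow> u \<in> Hom C Q P \<Longrightarrow> v \<in> Hom C Q P \<Longrightarrow>
      (\<And>i. i \<in> I \<Longrightarrow> Cmp C (\<pi> i) u = Cmp C (\<pi> i) v) \<Longrightarrow> u = v"
proof -
  show "P \<in> Obj C" "i \<in> I \<Longrightarrow> X i \<in> Obj C" "i \<in> I \<Longrightarrow> \<pi> i \<in> Hom C P (X i)"
    using assms by (auto simp: is_product_def)
  have *: "\<exists>!u. u \<in> Hom C Q P \<and> (\<forall>i\<in>I. Cmp C (\<pi> i) u = q i)"
    if "Q \<in> Obj C" "\<forall>i\<in>I. q i \<in> Hom C Q (X i)" for Q q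
    using assms that unfolding is_product_def by blast
  show "\<exists>u. u \<in> Hom C Q P \<and> (\<forall>i\<in>I. Cmp C (\<pi> i) u = q i)"
    if "Q \<in> Obj C" "\<And>i. i \<in> I \<Longrightarrow> q i \<in> Hom C Q (X i)"
    using *[of Q q] that by blast
  show "u = v" if "Q \<in> Obj C" "\<And>i. i \<in> I \<Longrightarrow> Cmp C (\<pi> i) u \<in> Hom C Q (X i)" "u \<in> Hom C Q P" "v \<in> Hom C Q P"
    "\<And>i. i \<in> I \<Longrightarrow> Cmp C (\<pi> i) u = Cmp C (\<pi> i) v"
  proof -
    have "\<exists>!w. w \<in> Hom C Q P \<and> (\<forall>i\<in>I. Cmp C (\<pi> i) w = Cmp C (\<pi> i) u)" using that(2) by (intro *[OF that(1)]) blast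
    moreover have "u \<in> Hom C Q P \<and> (\<forall>i\<in>I. Cmp C (\<pi> i) u = Cmp C (\<pi> i) u)"
      "v \<in> Hom C Q P \<and> (\<forall>i\<in>I. Cmp C (\<pi> i) v = Cmp C (\<pi> i) u)" using that(3-5) by simp_all
    ultimately show ?thesis by blast
  qed
qed

lemma is_productI:
  assumes "P \<in> Obj C" "\<And>i. i \<in> I \<Longrightarrow> X i \<in> Obj C" "\<And>i. i \<in> I \<Longrightarrow> \<pi> i \<in> Hom C P (X i)"
    "\<And>Q q. Q \<in> Obj C \<Longrightarrow> (\<And>i. i \<in> I \<Longrightarrow> q i \<in> Hom C Q (X i)) \<Longrightarrow> \<exists>u. u \<in> Hom C Q P \<and> (\<forall>i\<in>I. Cmp C (\<pi> i) u = q i)"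
    "\<And>Q u v. Q \<in> Obj C \<Longrightarrow> u \<in> Hom C Q P \<Longrightarrow> v \<in> Hom C Q P \<Longrightarrow>
      (\<And>i. i \<in> I \<Longrightarrow> Cmp C (\<pi> i) u = Cmp C (\<pi> i) v) \<Longrightarrow> u = v"
  shows "is_product C I X P \<pi>"
  unfolding is_product_def
proof (intro conjI ballI allI impI)
  fix Q q assume "Q \<in> Obj C" "\<forall>i\<in>I. q i \<in> Hom C Q (X i)"
  with assms(4)[of Q q] obtain u where u: "u \<in> Hom C Q P \<and> (\<forall>i\<in>I. Cmp C (\<pi> i) u = q i)" by auto
  then show "\<exists>!u. u \<in> Hom C Q P \<and> (\<forall>i\<in>I. Cmp C (\<pi> i) u = q i)"
    by (rule ex1I) (use assms(5)[OF \<open>Q \<in> Obj C\<close>] u in auto)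
qed (use assms in auto)

lemma is_product_cong:
  assumes "is_product C I X P \<pi>" "\<And>i. i \<in> I \<Longrightarrow> X i = X' i" "P = P'" "\<And>i. i \<in> I \<Longrightarrow> \<pi> i = \<pi>' i"
  shows "is_product C I X' P' \<pi>'"
  using assms unfolding is_product_def by (simp cong: ball_cong)

text \<open>Objects are functors from the terminal category \<open>chaotic {s}\<close>, so the
  family \<open>x\<close> is a cone over it and the induced functor picks the object of
  \<open>P\<close>. The element \<open>s\<close> is arbitrary.\<close>

lemma product_Obj_ex:
  fixes A :: "'i \<Rightarrow> ('u::infinite, 'u) cat"
  assumes p: "is_product cat_cat I A P \<pi>" and x: "\<And>i. i \<in> I \<Longrightarrow> x i \<in> Obj (A i)"
  shows "\<exists>p\<in>Obj P. \<forall>i\<in>I. fob (\<pi> i) p = x i"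
proof -
  note P = is_productD[OF p]
  fix s :: 'u
  let ?F = "\<lambda>i. chaotic_ftor {s} (A i) (\<lambda>_. x i) (\<lambda>_ _. Ide (A i) (x i))"
  have F: "?F i \<in> Hom cat_cat (chaotic {s}) (A i)" if "i \<in> I" for i
  proof -
    interpret category "A i" using P(2)[OF that] by simp
    have "cat_functor (?F i)"
      using x[OF that] by (intro functor_chaotic_ftor) (auto simp: category_axioms Ide_Hom Cmp_Ide_left[OF Ide_Hom])
    then show ?thesis by (simp add: Hom_def)
  qed
  from P(4)[of "chaotic {s}" ?F, OF _ F] obtain U where U: "U \<in> Hom cat_cat (chaotic {s}) P"
    "\<And>i. i \<in> I \<Longrightarrow> fcmp (\<pi> i) U = ?F i"
    by (auto simp: category_chaotic)
  have "fob U s \<in> Obj P" using U cat_functor.fob_Obj[of U s] by (auto simp: Hom_def)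
  moreover have "fob (\<pi> i) (fob U s) = x i" if "i \<in> I" for i
    using arg_cong[OF U(2)[OF that], of "\<lambda>F. fob F s"] U(1) by (simp add: Hom_def)
  ultimately show ?thesis by blast
qed

text \<open>The functors from the terminal category that pick \<open>p\<close> and \<open>q\<close>
  agree after every projection, so the uniqueness half of the universal property identifies
  them.\<close>

lemma product_Obj_eqI:
  fixes A :: "'i \<Rightarrow> ('u::infinite, 'u) cat"
  assumes p: "is_product cat_cat I A P \<pi>" and pq: "p \<in> Obj P" "q \<in> Obj P"
    and e: "\<And>i. i \<in> I \<Longrightarrow> fob (\<pi> i) p = fob (\<pi> i) q"
  shows "p = q"
proof -
  note P = is_productD[OF p]
  fix s :: 'u
  let ?F = "\<lambda>p. chaotic_ftor {s} P (\<lambda>_. p) (\<lambda>_ _. Ide P p)"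
  interpret P: category P using P(1) by simp
  have F: "?F p \<in> Hom cat_cat (chaotic {s}) P" if "p \<in> Obj P" for p
    using that by (auto simp: Hom_def intro!: functor_chaotic_ftor P.category_axioms)
      (auto intro: P.Cmp_Ide_left[OF P.Ide_Hom] HomD[OF P.Ide_Hom])
  have "?F p = ?F q"
  proof (rule P(5)[where Q = "chaotic {s}"])
    fix i assume i: "i \<in> I"
    note pi = P(3)[OF i]
    show "Cmp cat_cat (\<pi> i) (?F p) \<in> Hom cat_cat (chaotic {s}) (A i)"
      by (rule category.Cmp_Hom[OF category_cat_cat F[OF pq(1)] pi])
    interpret pi: cat_functor "\<pi> i" using pi by (simp add: Hom_def)
    have "fdom (\<pi> i) = P" using pi by (simp add: Hom_def)
    then show "Cmp cat_cat (\<pi> i) (?F p) = Cmp cat_cat (\<pi> i) (?F q)"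
      using F[OF pq(1)] F[OF pq(2)] e[OF i] pi.far_Ide pq
      by (intro ftor_eqI) (auto simp: Hom_def Arr_chaotic pi.cat_functor_axioms intro!: functor_fcmp)
  qed (use F pq in \<open>auto simp: category_chaotic\<close>)
  from arg_cong[OF this, of "\<lambda>F. fob F s"] show ?thesis by simp
qed

text \<open>An isomorphism in each factor is a functor from the free isomorphism on \<open>s\<close>
  and \<open>t\<close>. These functors form a cone; the induced functor \<open>U\<close> into
  \<open>P\<close> carries the isomorphism between \<open>s\<close> and \<open>t\<close> to one
  between \<open>p\<close> and \<open>q\<close>.\<close>

lemma product_isomorphic:
  fixes A :: "'i \<Rightarrow> ('u::infinite, 'u) cat"
  assumes p: "is_product cat_cat I A P \<pi>" and pq: "p \<in> Obj P" "q \<in> Obj P"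
    and e: "\<And>i. i \<in> I \<Longrightarrow> isomorphic (A i) (fob (\<pi> i) p) (fob (\<pi> i) q)"
  shows "isomorphic P p q"
proof -
  note P = is_productD[OF p]
  obtain s t :: 'u where st: "s \<noteq> t"
    using infinite_arbitrarily_large[OF infinite_UNIV, of 2] by (auto simp: card_2_iff)
  have "\<exists>f g. f \<in> Hom (A i) (fob (\<pi> i) p) (fob (\<pi> i) q) \<and> g \<in> Hom (A i) (fob (\<pi> i) q) (fob (\<pi> i) p) \<and>
      Cmp (A i) g f = Ide (A i) (fob (\<pi> i) p) \<and> Cmp (A i) f g = Ide (A i) (fob (\<pi> i) q)" if "i \<in> I" for i
    using category.isomorphicE[OF _ e[OF that]] P(2)[OF that] by (simp; metis)
  \<comment> \<open>Simultaneous choice of an isomorphism and its inverse for every index; the index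
    set may be infinite.\<close>
  then obtain f g where f: "\<And>i. i \<in> I \<Longrightarrow> f i \<in> Hom (A i) (fob (\<pi> i) p) (fob (\<pi> i) q)"
    and g: "\<And>i. i \<in> I \<Longrightarrow> g i \<in> Hom (A i) (fob (\<pi> i) q) (fob (\<pi> i) p)"
    and gf: "\<And>i. i \<in> I \<Longrightarrow> Cmp (A i) (g i) (f i) = Ide (A i) (fob (\<pi> i) p)"
    and fg: "\<And>i. i \<in> I \<Longrightarrow> Cmp (A i) (f i) (g i) = Ide (A i) (fob (\<pi> i) q)" by metis
  let ?S = "chaotic {s, t}"
  let ?x = "\<lambda>i a. if a = s then fob (\<pi> i) p else fob (\<pi> i) q"
  let ?h = "\<lambda>i a b. if a = b then Ide (A i) (?x i a) else if a = s then f i else g i"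
  let ?F = "\<lambda>i. chaotic_ftor {s, t} (A i) (?x i) (?h i)"
  have F: "?F i \<in> Hom cat_cat ?S (A i)" if i: "i \<in> I" for i
  proof -
    interpret category "A i" using P(2)[OF i] by simp
    interpret pi: cat_functor "\<pi> i" using P(3)[OF i] by (simp add: Hom_def)
    have o: "fob (\<pi> i) p \<in> Obj (A i)" "fob (\<pi> i) q \<in> Obj (A i)" using Hom_Obj[OF f[OF i]] by auto
    have "cat_functor (?F i)"
      using o f[OF i] g[OF i] gf[OF i] fg[OF i] st Cmp_Ide_left[OF f[OF i]] Cmp_Ide_left[OF g[OF i]]
        Cmp_Ide_right[OF f[OF i]] Cmp_Ide_right[OF g[OF i]] Cmp_Ide_left[OF Ide_Hom[OF o(1)]] Cmp_Ide_left[OF Ide_Hom[OF o(2)]]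
      by (intro functor_chaotic_ftor) (auto simp: category_axioms Ide_Hom)
    then show ?thesis by (simp add: Hom_def)
  qed
  from P(4)[of ?S ?F, OF _ F] obtain U where U: "U \<in> Hom cat_cat ?S P" "\<And>i. i \<in> I \<Longrightarrow> fcmp (\<pi> i) U = ?F i"
    by (auto simp: category_chaotic)
  interpret U: cat_functor U using U by (simp add: Hom_def)
  have d: "fdom U = ?S" "fcod U = P" using U(1) by (auto simp: Hom_def)
  have o: "fob U s \<in> Obj P" "fob U t \<in> Obj P" using U.fob_Obj d by auto
  \<comment> \<open>\<open>U\<close> comes from existence alone, so its endpoints are known only
    through their projections; uniqueness on objects identifies them with \<open>p\<close> and
    \<open>q\<close>.\<close>
  have "fob U s = p"
    by (rule product_Obj_eqI[OF p o(1) pq(1)])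
      (use arg_cong[OF U(2), of _ "\<lambda>F. fob F s"] st d in auto)
  moreover have "fob U t = q"
    by (rule product_Obj_eqI[OF p o(2) pq(2)])
      (use arg_cong[OF U(2), of _ "\<lambda>F. fob F t"] st d in auto)
  moreover have "isomorphic ?S s t"
    by (rule isomorphicI[of "code3 (s, t, s)" _ _ _ "code3 (t, s, t)"]) (auto simp: Hom_chaotic)
  ultimately show ?thesis using U.isomorphic_fob[of s t] d by simp
qed

section \<open>Products of sets, and of sets of isomorphism classes\<close>

lemma is_product_set_catI:
  assumes \<pi>: "\<And>i. i \<in> I \<Longrightarrow> \<pi> i \<in> Hom set_cat P (X i)"
    and ex: "\<And>x. (\<And>i. i \<in> I \<Longrightarrow> x i \<in> X i) \<Longrightarrow> \<exists>p\<in>P. \<forall>i\<in>I. smap (\<pi> i) p = x i"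
    and un: "\<And>p q. p \<in> P \<Longrightarrow> q \<in> P \<Longrightarrow> (\<And>i. i \<in> I \<Longrightarrow> smap (\<pi> i) p = smap (\<pi> i) q) \<Longrightarrow> p = q"
  shows "is_product set_cat I X P \<pi>"
proof (rule is_productI)
  fix Q q assume q: "\<And>i. i \<in> I \<Longrightarrow> q i \<in> Hom set_cat Q (X i)"
  have "\<exists>p\<in>P. \<forall>i\<in>I. smap (\<pi> i) p = smap (q i) y" if "y \<in> Q" for y
    using q that by (intro ex) (auto simp: Hom_set_cat)
  then obtain u where u: "\<And>y. y \<in> Q \<Longrightarrow> u y \<in> P \<and> (\<forall>i\<in>I. smap (\<pi> i) (u y) = smap (q i) y)" by metis
  let ?u = "\<lparr>sdom = Q, scod = P, smap = restrict u Q\<rparr>"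
  have h: "?u \<in> Hom set_cat Q P" using u by (auto simp: Hom_set_cat)
  have "Cmp set_cat (\<pi> i) ?u = q i" if i: "i \<in> I" for i
    by (rule sarr_eqI[OF category.Cmp_Hom[OF category_set_cat h \<pi>[OF i]] q[OF i]]) (use u i in auto)
  with h show "\<exists>u. u \<in> Hom set_cat Q P \<and> (\<forall>i\<in>I. Cmp set_cat (\<pi> i) u = q i)" by blast
next
  fix Q u v assume uv: "u \<in> Hom set_cat Q P" "v \<in> Hom set_cat Q P"
    and e: "\<And>i. i \<in> I \<Longrightarrow> Cmp set_cat (\<pi> i) u = Cmp set_cat (\<pi> i) v"
  show "u = v"
  proof (rule sarr_eqI[OF uv])
    fix y assume y: "y \<in> Q"
    have "smap u y \<in> P" "smap v y \<in> P" using uv y by (auto simp: Hom_set_cat)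
    moreover have "smap (\<pi> i) (smap u y) = smap (\<pi> i) (smap v y)" if "i \<in> I" for i
      using arg_cong[OF e[OF that], of "\<lambda>f. smap f y"] uv y by (simp add: Hom_set_cat)
    ultimately show "smap u y = smap v y" by (rule un)
  qed
qed (use \<pi> in auto)

text \<open>A family of classes is lifted by choosing a representative in every factor and applying
  \<open>product_Obj_ex\<close>. Two classes with equal projections have factorwise isomorphic
  representatives, and \<open>product_isomorphic\<close> makes these isomorphic in
  \<open>P\<close>.\<close>

lemma product_iso_classes:
  fixes A :: "'i \<Rightarrow> ('u::infinite, 'u) cat"
  assumes p: "is_product cat_cat I A P \<pi>"
  shows "is_product set_cat I (\<lambda>i. iso_classes (A i)) (iso_classes P) (\<lambda>i. iso_classes_map (\<pi> i))"
proof (rule is_product_set_catI)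
  note P = is_productD[OF p]
  have c: "category (A i)" "cat_functor (\<pi> i)" "fdom (\<pi> i) = P" "fcod (\<pi> i) = A i" if "i \<in> I" for i
    using P(2,3)[OF that] by (auto simp: Hom_def)
  show "iso_classes_map (\<pi> i) \<in> Hom set_cat (iso_classes P) (iso_classes (A i))" if "i \<in> I" for i
    using iso_classes_map_Hom[OF c(2)[OF that]] c[OF that] by simp
  have m: "smap (iso_classes_map (\<pi> i)) (iso_class P a) = iso_class (A i) (fob (\<pi> i) a)" "fob (\<pi> i) a \<in> Obj (A i)"
    if "i \<in> I" "a \<in> Obj P" for i a
    using smap_iso_classes_map[OF c(2)[OF that(1)], of a] cat_functor.fob_Obj[OF c(2)[OF that(1)], of a]
      c(3,4)[OF that(1)] that(2) by simp_all
  show "\<exists>p\<in>iso_classes P. \<forall>i\<in>I. smap (iso_classes_map (\<pi> i)) p = k i" if k: "\<And>i. i \<in> I \<Longrightarrow> k i \<in> iso_classes (A i)" for k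
  proof -
    have "\<exists>a. a \<in> Obj (A i) \<and> k i = iso_class (A i) a" if "i \<in> I" for i
      using k[OF that] by (auto simp: iso_classes_def)
    then obtain x where x: "\<And>i. i \<in> I \<Longrightarrow> x i \<in> Obj (A i) \<and> k i = iso_class (A i) (x i)" by metis
    from product_Obj_ex[OF p, of x] x obtain a where "a \<in> Obj P" "\<forall>i\<in>I. fob (\<pi> i) a = x i" by blast
    then show ?thesis using m x by (intro bexI[of _ "iso_class P a"]) (auto simp: iso_classes_def)
  qed
  fix k l assume "k \<in> iso_classes P" "l \<in> iso_classes P" and e: "\<And>i. i \<in> I \<Longrightarrow> smap (iso_classes_map (\<pi> i)) k = smap (iso_classes_map (\<pi> i)) l"
  then obtain a b where ab: "a \<in> Obj P" "b \<in> Obj P" "k = iso_class P a" "l = iso_class P b" by (auto simp: iso_classes_def)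
  have "isomorphic P a b"
  proof (rule product_isomorphic[OF p ab(1,2)])
    fix i assume i: "i \<in> I"
    have "iso_class (A i) (fob (\<pi> i) a) = iso_class (A i) (fob (\<pi> i) b)" using e[OF i] m(1)[OF i] ab by simp
    then show "isomorphic (A i) (fob (\<pi> i) a) (fob (\<pi> i) b)"
      using category.iso_class_eq_iff[OF c(1)[OF i] m(2)[OF i ab(1)] m(2)[OF i ab(2)]] by simp
  qed
  then show "k = l" using ab category.iso_class_eq_iff[of P a b] P(1) by simp
qed


section \<open>Products of profunctors\<close>

text \<open>Cells out of the profunctor with empty values are arbitrary pairs of functors. Hence products
  of profunctors are mapped to products of categories by source and target.\<close>

definition empty_prof :: "('u, 'u) cat \<Rightarrow> ('u, 'u) cat \<Rightarrow> 'u prof" where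
  "empty_prof A B = \<lparr>psrc = A, ptgt = B, pfun = \<lparr>fdom = prod_cat (op_cat A) B, fcod = set_cat,
     fob = (\<lambda>p\<in>Obj A \<times> Obj B. {}), far = (\<lambda>p\<in>Arr A \<times> Arr B. Ide set_cat {})\<rparr>\<rparr>"

lemma empty_prof_simps [simp]: "psrc (empty_prof A B) = A" "ptgt (empty_prof A B) = B"
  "a \<in> Obj A \<Longrightarrow> b \<in> Obj B \<Longrightarrow> pset (empty_prof A B) a b = {}"
  by (simp_all add: empty_prof_def)

lemma profunctor_empty_prof: "category A \<Longrightarrow> category B \<Longrightarrow> profunctor (empty_prof A B)"
  unfolding empty_prof_def by (rule profunctorI[where X = "\<lambda>_ _. {}"]) auto

definition empty_cell :: "'u prof \<Rightarrow> ('u, 'u, 'u, 'u) ftor \<Rightarrow> ('u, 'u, 'u, 'u) ftor \<Rightarrow> 'u pcell" where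
  "empty_cell \<Phi> F G = \<lparr>cdom = empty_prof (fdom F) (fdom G), ccod = \<Phi>, csrc = F, ctgt = G,
     cnat = (\<lambda>(a, b)\<in>Obj (fdom F) \<times> Obj (fdom G).
       \<lparr>sdom = {}, scod = pset \<Phi> (fob F a) (fob G b), smap = (\<lambda>x\<in>{}. undefined)\<rparr>)\<rparr>"

lemma empty_cell_simps [simp]: "cdom (empty_cell \<Phi> F G) = empty_prof (fdom F) (fdom G)"
  "ccod (empty_cell \<Phi> F G) = \<Phi>" "csrc (empty_cell \<Phi> F G) = F" "ctgt (empty_cell \<Phi> F G) = G"
  by (simp_all add: empty_cell_def)

lemma cell_empty_cell:
  assumes "profunctor \<Phi>" "F \<in> Hom cat_cat A (psrc \<Phi>)" "G \<in> Hom cat_cat B (ptgt \<Phi>)"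
  shows "empty_cell \<Phi> F G \<in> Hom prof_cat (empty_prof A B) \<Phi>"
proof -
  have d: "cat_functor F" "fdom F = A" "fcod F = psrc \<Phi>" "cat_functor G" "fdom G = B" "fcod G = ptgt \<Phi>"
    using assms(2,3) by (auto simp: Hom_def)
  have cc: "category A" "category B" using cat_functor.fdom_category d by auto
  interpret A: category A by fact
  interpret B: category B by fact
  have "profunctor_cell (empty_cell \<Phi> F G)"
    unfolding empty_cell_def
    by (rule profunctor_cellI) (use assms(1) d cc A.Hom_Obj B.Hom_Obj in \<open>auto simp: profunctor_empty_prof\<close>)
  then show ?thesis using d by (simp add: Hom_def)
qed

text \<open>The source has no elements on which the components could differ.\<close>

lemma empty_cell_eqI:
  assumes "\<sigma> \<in> Hom prof_cat (empty_prof A B) \<Phi>" "\<tau> \<in> Hom prof_cat (empty_prof A B) \<Phi>" "csrc \<sigma> = csrc \<tau>" "ctgt \<sigma> = ctgt \<tau>"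
  shows "\<sigma> = \<tau>"
  by (rule pcell_eqI) (use assms in \<open>auto simp: Hom_def\<close>)

lemma csrc_ctgt_Hom:
  assumes "\<tau> \<in> Hom prof_cat \<Phi> \<Psi>"
  shows "csrc \<tau> \<in> Hom cat_cat (psrc \<Phi>) (psrc \<Psi>)" "ctgt \<tau> \<in> Hom cat_cat (ptgt \<Phi>) (ptgt \<Psi>)"
  using cell_HomD[OF assms] cellD[of \<tau>] by (auto simp: Hom_def)

lemma product_prof_ftors_ex:
  assumes p: "is_product prof_cat I \<Phi> P \<pi>" and AB: "category A" "category B"
    and F: "\<And>i. i \<in> I \<Longrightarrow> F i \<in> Hom cat_cat A (psrc (\<Phi> i))"
    and G: "\<And>i. i \<in> I \<Longrightarrow> G i \<in> Hom cat_cat B (ptgt (\<Phi> i))"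
  shows "\<exists>U V. U \<in> Hom cat_cat A (psrc P) \<and> V \<in> Hom cat_cat B (ptgt P) \<and>
    (\<forall>i\<in>I. fcmp (csrc (\<pi> i)) U = F i \<and> fcmp (ctgt (\<pi> i)) V = G i)"
proof -
  note P = is_productD[OF p]
  have "empty_cell (\<Phi> i) (F i) (G i) \<in> Hom prof_cat (empty_prof A B) (\<Phi> i)" if "i \<in> I" for i
    using P(2)[OF that] by (intro cell_empty_cell F G that) simp
  from P(4)[OF _ this] obtain w where w: "w \<in> Hom prof_cat (empty_prof A B) P"
    "\<And>i. i \<in> I \<Longrightarrow> Cmp prof_cat (\<pi> i) w = empty_cell (\<Phi> i) (F i) (G i)"
    using AB by (auto simp: profunctor_empty_prof)
  have "csrc w \<in> Hom cat_cat A (psrc P)" "ctgt w \<in> Hom cat_cat B (ptgt P)" using csrc_ctgt_Hom[OF w(1)] by simp_all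
  moreover have "\<forall>i\<in>I. fcmp (csrc (\<pi> i)) (csrc w) = F i \<and> fcmp (ctgt (\<pi> i)) (ctgt w) = G i"
    using arg_cong[OF w(2), of _ csrc] arg_cong[OF w(2), of _ ctgt] by simp
  ultimately show ?thesis by blast
qed

lemma product_prof_ftors_eqI:
  assumes p: "is_product prof_cat I \<Phi> P \<pi>"
    and U: "U \<in> Hom cat_cat A (psrc P)" "U' \<in> Hom cat_cat A (psrc P)" "\<And>i. i \<in> I \<Longrightarrow> fcmp (csrc (\<pi> i)) U = fcmp (csrc (\<pi> i)) U'"
    and V: "V \<in> Hom cat_cat B (ptgt P)" "V' \<in> Hom cat_cat B (ptgt P)" "\<And>i. i \<in> I \<Longrightarrow> fcmp (ctgt (\<pi> i)) V = fcmp (ctgt (\<pi> i)) V'"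
  shows "U = U' \<and> V = V'"
proof -
  note P = is_productD[OF p]
  have PP: "profunctor P" using P(1) by simp
  note c = cell_empty_cell[OF PP U(1) V(1)] and c' = cell_empty_cell[OF PP U(2) V(2)]
  have o: "empty_prof A B \<in> Obj prof_cat" using category.Hom_Obj(1)[OF category_prof_cat c] .
  have h: "Cmp prof_cat (\<pi> i) (empty_cell P U V) \<in> Hom prof_cat (empty_prof A B) (\<Phi> i)" if "i \<in> I" for i
    by (rule category.Cmp_Hom[OF category_prof_cat c P(3)[OF that]])
  have "empty_cell P U V = empty_cell P U' V'"
  proof (rule P(5)[OF o h c c'])
    fix i assume i: "i \<in> I"
    show "Cmp prof_cat (\<pi> i) (empty_cell P U V) = Cmp prof_cat (\<pi> i) (empty_cell P U' V')"
      by (rule empty_cell_eqI[OF h[OF i] category.Cmp_Hom[OF category_prof_cat c' P(3)[OF i]]])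
        (simp_all add: U(3)[OF i] V(3)[OF i])
  qed
  then show ?thesis by (metis empty_cell_simps(3,4))
qed

text \<open>Testing against empty profunctors yields functors on sources and on targets
  simultaneously. To isolate one side, the test category on the other side is taken to be the empty
  category, which maps to every category, so that a cone on that side is always available.\<close>

lemma product_psrc_ptgt:
  fixes \<Phi> :: "'i \<Rightarrow> 'u::infinite prof"
  assumes p: "is_product prof_cat I \<Phi> P \<pi>"
  shows "is_product cat_cat I (\<lambda>i. psrc (\<Phi> i)) (psrc P) (\<lambda>i. csrc (\<pi> i))"
    "is_product cat_cat I (\<lambda>i. ptgt (\<Phi> i)) (ptgt P) (\<lambda>i. ctgt (\<pi> i))"
proof -
  note P = is_productD[OF p]
  let ?E = "chaotic {} :: ('u, 'u) cat"
  \<comment> \<open>With an empty set of objects the object and arrow maps are never evaluated, so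
    \<open>undefined\<close> serves for both.\<close>
  let ?z = "\<lambda>A :: ('u, 'u) cat. chaotic_ftor ({} :: 'u set) A undefined undefined"
  have z: "?z A \<in> Hom cat_cat ?E A" if "category A" for A :: "('u, 'u) cat"
    using functor_chaotic_ftor[OF that, of "{}"] by (simp add: Hom_def)
  have z': "fcmp F (?z A) = ?z B" if "F \<in> Hom cat_cat A B" for F :: "('u, 'u, 'u, 'u) ftor" and A B
    using that z[of A] z[of B] category.Hom_Obj[OF category_cat_cat that]
    by (intro ftor_eqI functor_fcmp) (auto simp: Hom_def Arr_chaotic)
  have c: "category (psrc P)" "category (ptgt P)" using P(1) by (auto simp: profunctor_cats)
  have ci: "category (psrc (\<Phi> i))" "category (ptgt (\<Phi> i))" if "i \<in> I" for i
    using P(2)[OF that] by (auto simp: profunctor_cats)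
  note h = csrc_ctgt_Hom[OF P(3)]
  show "is_product cat_cat I (\<lambda>i. psrc (\<Phi> i)) (psrc P) (\<lambda>i. csrc (\<pi> i))"
  proof (rule is_productI)
    fix A F assume A: "A \<in> Obj cat_cat" and F: "\<And>i. i \<in> I \<Longrightarrow> F i \<in> Hom cat_cat A (psrc (\<Phi> i))"
    show "\<exists>U. U \<in> Hom cat_cat A (psrc P) \<and> (\<forall>i\<in>I. Cmp cat_cat (csrc (\<pi> i)) U = F i)"
      using product_prof_ftors_ex[where F = F and G = "\<lambda>i. ?z (ptgt (\<Phi> i))", OF p _ category_chaotic F z] A ci by auto
  next
    fix A U V assume "U \<in> Hom cat_cat A (psrc P)" "V \<in> Hom cat_cat A (psrc P)"
      "\<And>i. i \<in> I \<Longrightarrow> Cmp cat_cat (csrc (\<pi> i)) U = Cmp cat_cat (csrc (\<pi> i)) V"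
    then show "U = V" using product_prof_ftors_eqI[OF p _ _ _ z[OF c(2)] z[OF c(2)], of U A V] by simp
  qed (use c ci h in auto)
  show "is_product cat_cat I (\<lambda>i. ptgt (\<Phi> i)) (ptgt P) (\<lambda>i. ctgt (\<pi> i))"
  proof (rule is_productI)
    fix A F assume A: "A \<in> Obj cat_cat" and F: "\<And>i. i \<in> I \<Longrightarrow> F i \<in> Hom cat_cat A (ptgt (\<Phi> i))"
    show "\<exists>U. U \<in> Hom cat_cat A (ptgt P) \<and> (\<forall>i\<in>I. Cmp cat_cat (ctgt (\<pi> i)) U = F i)"
      using product_prof_ftors_ex[where F = "\<lambda>i. ?z (psrc (\<Phi> i))" and G = F, OF p category_chaotic _ z F] A ci by auto
  next
    fix A U V assume "U \<in> Hom cat_cat A (ptgt P)" "V \<in> Hom cat_cat A (ptgt P)"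
      "\<And>i. i \<in> I \<Longrightarrow> Cmp cat_cat (ctgt (\<pi> i)) U = Cmp cat_cat (ctgt (\<pi> i)) V"
    then show "U = V" using product_prof_ftors_eqI[OF p z[OF c(1)] z[OF c(1)], of U A V] by simp
  qed (use c ci h in auto)
qed


section \<open>Universal elements of profunctors\<close>

text \<open>By the Yoneda lemma \<open>e\<close> exhibits \<open>b\<close> as a representing object
  of \<Phi>(a, -). Naturality of the bijection in \<open>c\<close> is implicit in the action of
  \<open>h\<close> on \<open>e\<close>, so no natural transformation has to be carried
  along.\<close>

definition universal_element :: "'u prof \<Rightarrow> 'u \<Rightarrow> 'u \<Rightarrow> 'u \<Rightarrow> bool" where
  "universal_element \<Phi> a b e \<longleftrightarrow> a \<in> Obj (psrc \<Phi>) \<and> b \<in> Obj (ptgt \<Phi>) \<and> e \<in> pset \<Phi> a b \<and>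
     (\<forall>c\<in>Obj (ptgt \<Phi>). bij_betw (\<lambda>h. pact \<Phi> (Ide (psrc \<Phi>) a) h e) (Hom (ptgt \<Phi>) b c) (pset \<Phi> a c))"

lemma universal_elementD:
  assumes "universal_element \<Phi> a b e"
  shows "a \<in> Obj (psrc \<Phi>)" "b \<in> Obj (ptgt \<Phi>)" "e \<in> pset \<Phi> a b"
    "c \<in> Obj (ptgt \<Phi>) \<Longrightarrow> x \<in> pset \<Phi> a c \<Longrightarrow> \<exists>h\<in>Hom (ptgt \<Phi>) b c. pact \<Phi> (Ide (psrc \<Phi>) a) h e = x"
    "c \<in> Obj (ptgt \<Phi>) \<Longrightarrow> h \<in> Hom (ptgt \<Phi>) b c \<Longrightarrow> h' \<in> Hom (ptgt \<Phi>) b c \<Longrightarrow>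
      pact \<Phi> (Ide (psrc \<Phi>) a) h e = pact \<Phi> (Ide (psrc \<Phi>) a) h' e \<Longrightarrow> h = h'"
proof -
  have *: "bij_betw (\<lambda>h. pact \<Phi> (Ide (psrc \<Phi>) a) h e) (Hom (ptgt \<Phi>) b c) (pset \<Phi> a c)" if "c \<in> Obj (ptgt \<Phi>)" for c
    using assms that by (simp add: universal_element_def)
  show "c \<in> Obj (ptgt \<Phi>) \<Longrightarrow> x \<in> pset \<Phi> a c \<Longrightarrow> \<exists>h\<in>Hom (ptgt \<Phi>) b c. pact \<Phi> (Ide (psrc \<Phi>) a) h e = x"
    using bij_betw_imp_surj_on[OF *] by (metis (no_types, lifting) imageE)
  show "c \<in> Obj (ptgt \<Phi>) \<Longrightarrow> h \<in> Hom (ptgt \<Phi>) b c \<Longrightarrow> h' \<in> Hom (ptgt \<Phi>) b c \<Longrightarrow>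
      pact \<Phi> (Ide (psrc \<Phi>) a) h e = pact \<Phi> (Ide (psrc \<Phi>) a) h' e \<Longrightarrow> h = h'"
    using inj_onD[OF bij_betw_imp_inj_on[OF *]] by blast
qed (use assms in \<open>auto simp: universal_element_def\<close>)

lemma universal_elementI:
  assumes P: "profunctor \<Phi>" and o: "a \<in> Obj (psrc \<Phi>)" "b \<in> Obj (ptgt \<Phi>)" "e \<in> pset \<Phi> a b"
    and ex: "\<And>c x. c \<in> Obj (ptgt \<Phi>) \<Longrightarrow> x \<in> pset \<Phi> a c \<Longrightarrow> \<exists>h\<in>Hom (ptgt \<Phi>) b c. pact \<Phi> (Ide (psrc \<Phi>) a) h e = x"
    and un: "\<And>c h h'. c \<in> Obj (ptgt \<Phi>) \<Longrightarrow> h \<in> Hom (ptgt \<Phi>) b c \<Longrightarrow> h' \<in> Hom (ptgt \<Phi>) b c \<Longrightarrow>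
      pact \<Phi> (Ide (psrc \<Phi>) a) h e = pact \<Phi> (Ide (psrc \<Phi>) a) h' e \<Longrightarrow> h = h'"
  shows "universal_element \<Phi> a b e"
proof -
  have "Ide (psrc \<Phi>) a \<in> Hom (psrc \<Phi>) a a" using category.Ide_Hom[OF profunctor_cats(1)[OF P] o(1)] .
  note m = pact_in[OF P this _ o(3)]
  have "bij_betw (\<lambda>h. pact \<Phi> (Ide (psrc \<Phi>) a) h e) (Hom (ptgt \<Phi>) b c) (pset \<Phi> a c)" if c: "c \<in> Obj (ptgt \<Phi>)" for c
  proof (rule bij_betwI')
    show "pact \<Phi> (Ide (psrc \<Phi>) a) h e = pact \<Phi> (Ide (psrc \<Phi>) a) h' e \<longleftrightarrow> h = h'"
      if "h \<in> Hom (ptgt \<Phi>) b c" "h' \<in> Hom (ptgt \<Phi>) b c" for h h'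
      using un[OF c that] by blast
    show "\<exists>h\<in>Hom (ptgt \<Phi>) b c. x = pact \<Phi> (Ide (psrc \<Phi>) a) h e" if "x \<in> pset \<Phi> a c" for x
      using ex[OF c that] by metis
  qed (rule m)
  with o show ?thesis by (simp add: universal_element_def)
qed

text \<open>Each of \<open>e\<close> and \<open>e'\<close> factors through the other; the composite
  factorisations fix \<open>e\<close> and \<open>e'\<close>, hence are identities by
  uniqueness.\<close>

lemma universal_element_isomorphic:
  assumes P: "profunctor \<Phi>" and u: "universal_element \<Phi> a b e" and u': "universal_element \<Phi> a b' e'"
  shows "isomorphic (ptgt \<Phi>) b b'"
proof -
  interpret A: category "psrc \<Phi>" using P by (simp add: profunctor_cats)
  interpret B: category "ptgt \<Phi>" using P by (simp add: profunctor_cats)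
  note U = universal_elementD[OF u] and U' = universal_elementD[OF u']
  let ?a = "pact \<Phi> (Ide (psrc \<Phi>) a)"
  note ia = A.Ide_Hom[OF U(1)]
  obtain f where f: "f \<in> Hom (ptgt \<Phi>) b b'" "?a f e = e'" using U(4)[OF U'(2,3)] by blast
  obtain g where g: "g \<in> Hom (ptgt \<Phi>) b' b" "?a g e' = e" using U'(4)[OF U(2,3)] by blast
  have "?a (Cmp (ptgt \<Phi>) g f) e = ?a (Ide (ptgt \<Phi>) b) e"
    using pact_Cmp[OF P ia f(1) ia g(1) U(3)] pact_Ide[OF P U(1,2,3)] f g A.Cmp_Ide_left[OF ia] by simp
  moreover have "?a (Cmp (ptgt \<Phi>) f g) e' = ?a (Ide (ptgt \<Phi>) b') e'"
    using pact_Cmp[OF P ia g(1) ia f(1) U'(3)] pact_Ide[OF P U'(1,2,3)] f g A.Cmp_Ide_left[OF ia] by simp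
  ultimately show ?thesis
    using isomorphicI[OF f(1) g(1)] U(5)[OF U(2) B.Cmp_Hom[OF f(1) g(1)] B.Ide_Hom[OF U(2)]]
      U'(5)[OF U'(2) B.Cmp_Hom[OF g(1) f(1)] B.Ide_Hom[OF U'(2)]] by blast
qed

text \<open>The action of \<open>h\<close> on the identity of \<open>a\<close> is \<open>h\<close>
  itself.\<close>

lemma universal_element_hom_prof:
  assumes A: "category A" and a: "a \<in> Obj A"
  shows "universal_element (hom_prof A) a a (Ide A a)"
proof -
  interpret category A by fact
  have e: "pact (hom_prof A) (Ide A a) h (Ide A a) = h" if "h \<in> Hom A a c" for h c
    using that pact_hom_prof[OF Ide_Hom[OF a] that Ide_Hom[OF a]]
    by (simp add: Cmp_Ide_left[OF Ide_Hom[OF a]] Cmp_Ide_right)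
  show ?thesis
    by (rule universal_elementI[OF profunctor_hom_prof[OF A]]) (use a e Ide_Hom in auto)
qed

text \<open>A globular isomorphism is a bijection from \<Phi>(a, c) to \<Psi>(a, c) for every
  \<open>c\<close> and commutes with the action of \<open>h\<close>, so it carries one universal
  element to another.\<close>

lemma universal_element_iso:
  assumes t: "\<tau> \<in> Hom prof_cat \<Phi> \<Psi>" "csrc \<tau> = fid (psrc \<Phi>)" "ctgt \<tau> = fid (ptgt \<Phi>)" and i: "is_iso prof_cat \<tau>"
    and u: "universal_element \<Phi> a b e"
  shows "universal_element \<Psi> a b (cmap \<tau> a b e)"
proof -
  note U = universal_elementD[OF u]
  define \<sigma> where "\<sigma> = inverse_arrow prof_cat \<tau>"
  note S = category.inverse_arrowD[OF category_prof_cat i t(1), folded \<sigma>_def]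
  note T = cell_HomD[OF t(1)] and S' = cell_HomD[OF S(1)]
  have P: "profunctor \<Phi>" "profunctor \<Psi>" using T cellD[of \<tau>] by auto
  have e: "psrc \<Psi> = psrc \<Phi>" "ptgt \<Psi> = ptgt \<Phi>" using csrc_ctgt_Hom[OF t(1)] t(2,3) by (auto simp: Hom_def)
  \<comment> \<open>Invertibility in \<open>prof_cat\<close> does not say that the inverse is
    globular too; comparing the frames in \<tau> \<sigma> = id shows it.\<close>
  have cs: "csrc \<sigma> = fid (psrc \<Phi>)" "ctgt \<sigma> = fid (ptgt \<Phi>)"
    using arg_cong[OF S(3), of csrc] arg_cong[OF S(3), of ctgt] t(2,3) e fcmp_fid(2)[OF cellD(3)[OF S'(1)]] fcmp_fid(2)[OF cellD(4)[OF S'(1)]]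
      cellD[OF S'(1)] S' by auto
  interpret A: category "psrc \<Phi>" using P by (simp add: profunctor_cats)
  interpret B: category "ptgt \<Phi>" using P by (simp add: profunctor_cats)
  have st: "cmap \<sigma> a c (cmap \<tau> a c x) = x" if "c \<in> Obj (ptgt \<Phi>)" "x \<in> pset \<Phi> a c" for c x
    using arg_cong[OF S(2), of "\<lambda>\<rho>. cmap \<rho> a c x"] that U(1) T t P by simp
  have ts: "cmap \<tau> a c (cmap \<sigma> a c x) = x" if "c \<in> Obj (ptgt \<Phi>)" "x \<in> pset \<Psi> a c" for c x
    using arg_cong[OF S(3), of "\<lambda>\<rho>. cmap \<rho> a c x"] that U(1) S' cs P e by simp
  have tin: "cmap \<tau> a c x \<in> pset \<Psi> a c" if "c \<in> Obj (ptgt \<Phi>)" "x \<in> pset \<Phi> a c" for c x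
    using cmap_in[OF T(1), of a c x] that U(1) T t by simp
  have sin: "cmap \<sigma> a c x \<in> pset \<Phi> a c" if "c \<in> Obj (ptgt \<Phi>)" "x \<in> pset \<Psi> a c" for c x
    using cmap_in[OF S'(1), of a c x] that U(1) S' cs e by simp
  have n: "pact \<Psi> (Ide (psrc \<Phi>) a) h (cmap \<tau> a b e) = cmap \<tau> a c (pact \<Phi> (Ide (psrc \<Phi>) a) h e)"
    if "h \<in> Hom (ptgt \<Phi>) b c" for h c
    using cmap_natural[OF T(1), of "Ide (psrc \<Phi>) a" a a h b c e] T t U(1,3) that A.Ide_Hom HomD(1)[OF that] HomD(1)[OF A.Ide_Hom]
    by simp
  show ?thesis
  proof (rule universal_elementI[OF P(2)], unfold e)
    fix c x assume c: "c \<in> Obj (ptgt \<Phi>)" and x: "x \<in> pset \<Psi> a c"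
    then obtain h where h: "h \<in> Hom (ptgt \<Phi>) b c" "pact \<Phi> (Ide (psrc \<Phi>) a) h e = cmap \<sigma> a c x"
      using U(4)[OF c sin[OF c x]] by blast
    then show "\<exists>h\<in>Hom (ptgt \<Phi>) b c. pact \<Psi> (Ide (psrc \<Phi>) a) h (cmap \<tau> a b e) = x"
      using n[OF h(1)] ts[OF c x] by (intro bexI[of _ h]) simp_all
  next
    fix c h h' assume c: "c \<in> Obj (ptgt \<Phi>)" and h: "h \<in> Hom (ptgt \<Phi>) b c" "h' \<in> Hom (ptgt \<Phi>) b c"
      and q: "pact \<Psi> (Ide (psrc \<Phi>) a) h (cmap \<tau> a b e) = pact \<Psi> (Ide (psrc \<Phi>) a) h' (cmap \<tau> a b e)"
    have "pact \<Phi> (Ide (psrc \<Phi>) a) h e \<in> pset \<Phi> a c" "pact \<Phi> (Ide (psrc \<Phi>) a) h' e \<in> pset \<Phi> a c"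
      using pact_in[OF P(1) A.Ide_Hom[OF U(1)] _ U(3)] h by auto
    then have "pact \<Phi> (Ide (psrc \<Phi>) a) h e = pact \<Phi> (Ide (psrc \<Phi>) a) h' e"
      using q n[OF h(1)] n[OF h(2)] st[OF c] by metis
    then show "h = h'" by (rule U(5)[OF c h])
  qed (use U tin in auto)
qed

text \<open>An element of \<open>\<Phi>(a, b')\<close> is \<open>\<Phi>(a, h) e\<close> for a unique \<open>h\<close>, so that the coend over \<open>b'\<close> of
  \<open>\<Phi>(a, b') \<times> \<Psi>(b', d)\<close> is \<open>\<Psi>(b, d)\<close> by the co-Yoneda lemma.\<close>

lemma universal_element_prof_comp:
  assumes c: "composable_profs \<Psi> \<Phi>" and u: "universal_element \<Phi> a b e" and u': "universal_element \<Psi> b c e'"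
  shows "universal_element (prof_comp \<Psi> \<Phi>) a c (tensor \<Phi> \<Psi> a c (b, e, e'))"
proof -
  have P: "profunctor \<Phi>" "profunctor \<Psi>" and q: "psrc \<Psi> = ptgt \<Phi>" using c by (auto simp: composable_profs_def)
  interpret A: category "psrc \<Phi>" using P by (simp add: profunctor_cats)
  interpret B: category "ptgt \<Phi>" using P by (simp add: profunctor_cats)
  interpret C: category "ptgt \<Psi>" using P by (simp add: profunctor_cats)
  note U = universal_elementD[OF u] and U' = universal_elementD[OF u']
  note ia = A.Ide_Hom[OF U(1)] and ib = B.Ide_Hom[OF U(2)]
  let ?e = "\<lambda>h. pact \<Phi> (Ide (psrc \<Phi>) a) h e"
  have act: "pact (prof_comp \<Psi> \<Phi>) (Ide (psrc \<Phi>) a) h (tensor \<Phi> \<Psi> a c (b, e, e')) =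
      tensor \<Phi> \<Psi> a d (b, e, pact \<Psi> (Ide (psrc \<Psi>) b) h e')" if "h \<in> Hom (ptgt \<Psi>) c d" for h d
    using pact_prof_comp[OF assms(1) ia that U(2,3) U'(3)] pact_Ide[OF P(1) U(1-3)] by simp
  show ?thesis
  proof (rule universal_elementI[OF profunctor_prof_comp[OF assms(1)]], unfold prof_comp_simps)
    fix d z assume d: "d \<in> Obj (ptgt \<Psi>)" and z: "z \<in> pset (prof_comp \<Psi> \<Phi>) a d"
    from z U(1) d obtain b' x y where t: "b' \<in> Obj (ptgt \<Phi>)" "x \<in> pset \<Phi> a b'" "y \<in> pset \<Psi> b' d" "z = tensor \<Phi> \<Psi> a d (b', x, y)"
      by (rule prof_comp_cases)
    obtain h where h: "h \<in> Hom (ptgt \<Phi>) b b'" "?e h = x" using U(4)[OF t(1,2)] by blast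
    have "pact \<Psi> h (Ide (ptgt \<Psi>) d) y \<in> pset \<Psi> b d" using pact_in[OF P(2) _ C.Ide_Hom[OF d] t(3)] h q by simp
    then obtain k where k: "k \<in> Hom (ptgt \<Psi>) c d" "pact \<Psi> (Ide (psrc \<Psi>) b) k e' = pact \<Psi> h (Ide (ptgt \<Psi>) d) y"
      using U'(4)[OF d] by blast
    \<comment> \<open>Since \<open>x\<close> is the action of \<open>h\<close> on \<open>e\<close>,
      sliding \<open>h\<close> to the other factor turns any triple into an equivalent one beginning
      with \<open>b\<close> and \<open>e\<close>.\<close>
    have "tensor \<Phi> \<Psi> a d (b, e, pact \<Psi> h (Ide (ptgt \<Psi>) d) y) = z"
      using tensor_slide[OF h(1) U(3) t(3)] h(2) t(4) by simp
    then show "\<exists>h\<in>Hom (ptgt \<Psi>) c d. pact (prof_comp \<Psi> \<Phi>) (Ide (psrc \<Phi>) a) h (tensor \<Phi> \<Psi> a c (b, e, e')) = z"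
      using act[OF k(1)] k by auto
  next
    fix d h h' assume d: "d \<in> Obj (ptgt \<Psi>)" and h: "h \<in> Hom (ptgt \<Psi>) c d" "h' \<in> Hom (ptgt \<Psi>) c d"
      and eq: "pact (prof_comp \<Psi> \<Phi>) (Ide (psrc \<Phi>) a) h (tensor \<Phi> \<Psi> a c (b, e, e')) =
        pact (prof_comp \<Psi> \<Phi>) (Ide (psrc \<Phi>) a) h' (tensor \<Phi> \<Psi> a c (b, e, e'))"
    \<comment> \<open>\<open>r\<close> inverts the action on \<open>e\<close>. It gives the
      co-Yoneda map \<open>?k\<close> from triples to \<Psi>(b, d), which is invariant under sliding
      and so can be read off from a class. Applied to both sides of \<open>eq\<close>, it recovers
      the actions of \<open>h\<close> and \<open>h'\<close> on \<open>e'\<close>.\<close>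
    define r where "r b' x = (THE g. g \<in> Hom (ptgt \<Phi>) b b' \<and> ?e g = x)" for b' x
    have r: "r b' (?e g) = g" if "g \<in> Hom (ptgt \<Phi>) b b'" for b' g
      unfolding r_def using that U(5)[OF B.Hom_Obj(2)[OF that]] by (intro the_equality) auto
    let ?k = "\<lambda>(b', x, y). pact \<Psi> (r b' x) (Ide (ptgt \<Psi>) d) y"
    have k: "?k (decode3 (tensor \<Phi> \<Psi> a d p)) = ?k p" for p
    proof (rule coend_map)
      fix \<beta> b1 b2 x y assume h: "\<beta> \<in> Hom (ptgt \<Phi>) b1 b2" "x \<in> pset \<Phi> a b1" "y \<in> pset \<Psi> b2 d"
      obtain g where g: "g \<in> Hom (ptgt \<Phi>) b b1" "x = ?e g" using U(4)[OF B.Hom_Obj(1)[OF h(1)] h(2)] by blast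
      have "pact \<Phi> (Ide (psrc \<Phi>) a) \<beta> x = ?e (Cmp (ptgt \<Phi>) \<beta> g)"
        using pact_Cmp[OF P(1) ia g(1) ia h(1) U(3)] A.Cmp_Ide_left[OF ia] g by simp
      moreover have "pact \<Psi> g (Ide (ptgt \<Psi>) d) (pact \<Psi> \<beta> (Ide (ptgt \<Psi>) d) y) = pact \<Psi> (Cmp (ptgt \<Phi>) \<beta> g) (Ide (ptgt \<Psi>) d) y"
        using pact_Cmp[OF P(2) _ C.Ide_Hom[OF d] _ C.Ide_Hom[OF d] h(3), of \<beta> b1 g b] h g C.Cmp_Ide_left[OF C.Ide_Hom[OF d]] q by simp
      ultimately show "?k (b1, x, pact \<Psi> \<beta> (Ide (ptgt \<Psi>) d) y) = ?k (b2, pact \<Phi> (Ide (psrc \<Phi>) a) \<beta> x, y)"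
        using r[OF g(1)] r[OF B.Cmp_Hom[OF g(1) h(1)]] g(2) by simp
    qed
    have "?k (b, e, pact \<Psi> (Ide (psrc \<Psi>) b) g e') = pact \<Psi> (Ide (psrc \<Psi>) b) g e'" if "g \<in> Hom (ptgt \<Psi>) c d" for g
    proof -
      have "pact \<Psi> (Ide (psrc \<Psi>) b) g e' \<in> pset \<Psi> b d" using pact_in[OF P(2) _ that U'(3)] ib q by simp
      moreover have "r b e = Ide (ptgt \<Phi>) b" using r[OF ib] pact_Ide[OF P(1) U(1-3)] by simp
      ultimately show ?thesis using pact_Ide[OF P(2) U'(1) d] q by simp
    qed
    with h have "pact \<Psi> (Ide (psrc \<Psi>) b) h e' = pact \<Psi> (Ide (psrc \<Psi>) b) h' e'"
      using arg_cong[OF eq, of "\<lambda>z. ?k (decode3 z)"] unfolding act[OF h(1)] act[OF h(2)] k by simp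
    then show "h = h'" by (rule U'(5)[OF d h])
  qed (use U U' tensor_in in auto)
qed

text \<open>The Yoneda argument with the first variable held at \<open>a\<close>: the representing
  isomorphism restricts to one from \<Phi>(a, -) to the hom functor of \<open>fob F a\<close>, and
  the universal element corresponds to the identity.\<close>

lemma represents_universal_element:
  assumes P: "profunctor \<Phi>" and F: "represents F \<Phi>" and a: "a \<in> Obj (psrc \<Phi>)"
  shows "\<exists>e. universal_element \<Phi> a (fob F a) e"
proof -
  have d: "cat_functor F" "fdom F = psrc \<Phi>" "fcod F = ptgt \<Phi>" "fdom (pfun \<Phi>) = prod_cat (op_cat (psrc \<Phi>)) (ptgt \<Phi>)"
    "fcod (pfun \<Phi>) = set_cat"
    using F P by (auto simp: represents_def profunctor_def)
  interpret F: cat_functor F by fact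
  interpret A: category "psrc \<Phi>" using P by (simp add: profunctor_cats)
  interpret B: category "ptgt \<Phi>" using P by (simp add: profunctor_cats)
  from F obtain \<tau> where t: "nat_trans (pfun \<Phi>) (represented_ftor F) \<tau>"
    "\<And>p. p \<in> Obj (fdom (pfun \<Phi>)) \<Longrightarrow> is_iso (fcod (pfun \<Phi>)) (\<tau> p)"
    unfolding represents_def naturally_isomorphic_def by blast
  let ?b = "fob F a" and ?i = "Ide (psrc \<Phi>) a"
  have b: "?b \<in> Obj (ptgt \<Phi>)" using F.fob_Obj a d by simp
  note ia = A.Ide_Hom[OF a] and ib = B.Ide_Hom[OF b]
  have Fo: "fob (represented_ftor F) (a, c) = Hom (ptgt \<Phi>) ?b c" if "c \<in> Obj (ptgt \<Phi>)" for c
    using that a b d by (simp add: represented_ftor_def hom_ftor_def)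
  have H: "\<tau> (a, c) \<in> Hom set_cat (pset \<Phi> a c) (Hom (ptgt \<Phi>) ?b c)" if "c \<in> Obj (ptgt \<Phi>)" for c
    unfolding Fo[OF that, symmetric] using t(1) that a d unfolding nat_trans_def by auto
  have n: "smap (\<tau> (a, c')) (pact \<Phi> ?i h x) = Cmp (ptgt \<Phi>) h (smap (\<tau> (a, c)) x)"
    if h: "h \<in> Hom (ptgt \<Phi>) c c'" and x: "x \<in> pset \<Phi> a c" for h c c' x
  proof -
    have o: "c \<in> Obj (ptgt \<Phi>)" "c' \<in> Obj (ptgt \<Phi>)" using B.Hom_Obj[OF h] by auto
    have "(?i, h) \<in> Hom (fdom (pfun \<Phi>)) (a, c) (a, c')" using ia h d by simp
    then have e: "Cmp set_cat (\<tau> (a, c')) (far (pfun \<Phi>) (?i, h)) = Cmp set_cat (far (represented_ftor F) (?i, h)) (\<tau> (a, c))"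
      using t(1) unfolding nat_trans_def d(5) by blast
    have "far (pfun \<Phi>) (?i, h) \<in> Hom set_cat (pset \<Phi> a c) (pset \<Phi> a c')"
      using P cat_functor.far_Hom[of "pfun \<Phi>" "(?i, h)" "(a, c)" "(a, c')"] d ia h by (simp add: profunctor_def)
    moreover have "smap (\<tau> (a, c)) x \<in> Hom (ptgt \<Phi>) ?b c" using H[OF o(1)] x by (auto simp: Hom_set_cat)
    moreover have "smap (far (represented_ftor F) (?i, h)) y = Cmp (ptgt \<Phi>) h y" if "y \<in> Hom (ptgt \<Phi>) ?b c" for y
      using HomD[OF ia] HomD[OF ib] HomD[OF h] F.far_Ide[of a] a d that B.Cmp_Ide_right[OF that]
      by (simp add: represented_ftor_def hom_ftor_def)
    ultimately show ?thesis using arg_cong[OF e, of "\<lambda>f. smap f x"] x H[OF o(1)] by (simp add: Hom_set_cat)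
  qed
  have bij: "bij_betw (smap (\<tau> (a, c))) (pset \<Phi> a c) (Hom (ptgt \<Phi>) ?b c)" if c: "c \<in> Obj (ptgt \<Phi>)" for c
  proof -
    have "is_iso set_cat (\<tau> (a, c))" using t(2)[of "(a, c)"] c a d by simp
    note I = category.inverse_arrowD[OF category_set_cat this H[OF c]]
    show ?thesis
    proof (rule bij_betw_byWitness[of _ "smap (inverse_arrow set_cat (\<tau> (a, c)))"])
      show "\<forall>x\<in>pset \<Phi> a c. smap (inverse_arrow set_cat (\<tau> (a, c))) (smap (\<tau> (a, c)) x) = x"
      proof
        fix x assume "x \<in> pset \<Phi> a c"
        then show "smap (inverse_arrow set_cat (\<tau> (a, c))) (smap (\<tau> (a, c)) x) = x"
          using arg_cong[OF I(2), of "\<lambda>f. smap f x"] H[OF c] by (simp add: Hom_set_cat)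
      qed
      show "\<forall>x\<in>Hom (ptgt \<Phi>) ?b c. smap (\<tau> (a, c)) (smap (inverse_arrow set_cat (\<tau> (a, c))) x) = x"
      proof
        fix x assume "x \<in> Hom (ptgt \<Phi>) ?b c"
        then show "smap (\<tau> (a, c)) (smap (inverse_arrow set_cat (\<tau> (a, c))) x) = x"
          using arg_cong[OF I(3), of "\<lambda>f. smap f x"] I(1) by (simp add: Hom_set_cat)
      qed
    qed (use H[OF c] I(1) in \<open>auto simp: Hom_set_cat\<close>)
  qed
  from bij_betw_imp_surj_on[OF bij[OF b]] ib obtain e where e: "e \<in> pset \<Phi> a ?b" "smap (\<tau> (a, ?b)) e = Ide (ptgt \<Phi>) ?b"
    by (metis (no_types, lifting) imageE)
  \<comment> \<open>By naturality the action on \<open>e\<close> is a right inverse of the bijection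
    given by \<tau>, hence its inverse.\<close>
  have te: "smap (\<tau> (a, c)) (pact \<Phi> ?i h e) = h" if "h \<in> Hom (ptgt \<Phi>) ?b c" for h c
    using n[OF that e(1)] e(2) B.Cmp_Ide_right[OF that] by simp
  have "universal_element \<Phi> a ?b e"
  proof (rule universal_elementI[OF P a b e(1)])
    fix c x assume c: "c \<in> Obj (ptgt \<Phi>)" and x: "x \<in> pset \<Phi> a c"
    let ?h = "smap (\<tau> (a, c)) x"
    have h: "?h \<in> Hom (ptgt \<Phi>) ?b c" using bij_betwE[OF bij[OF c]] x by blast
    have "pact \<Phi> ?i ?h e = x"
      by (rule inj_onD[OF bij_betw_imp_inj_on[OF bij[OF c]] te[OF h] pact_in[OF P ia h e(1)] x])
    with h show "\<exists>h\<in>Hom (ptgt \<Phi>) ?b c. pact \<Phi> ?i h e = x" by blast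
  qed (metis te)
  then show ?thesis by blast
qed


section \<open>Isomorphism classes and representing functors\<close>

lemma iso_classes_map_represents_eq:
  assumes P: "profunctor \<Phi>" and F: "represents F \<Phi>" and G: "represents G \<Phi>"
  shows "iso_classes_map F = iso_classes_map G"
proof (rule iso_classes_map_eqI)
  fix a assume "a \<in> Obj (fdom F)"
  then have a: "a \<in> Obj (psrc \<Phi>)" using F by (simp add: represents_def)
  show "isomorphic (fcod F) (fob F a) (fob G a)"
    using represents_universal_element[OF P F a] represents_universal_element[OF P G a]
      universal_element_isomorphic[OF P] F by (auto simp: represents_def)
qed (use F G in \<open>auto simp: represents_def\<close>)

text \<open>This is the unit law: by normality the profunctor of an identity is a hom profunctor.
  Its representing functor fixes every object up to isomorphism, because the identities are
  universal elements.\<close>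

lemma iso_classes_map_represents_hom_prof:
  assumes A: "category A" and F: "represents F (hom_prof A)"
  shows "iso_classes_map F = Ide set_cat (iso_classes A)"
proof -
  have d: "cat_functor F" "fdom F = A" "fcod F = A" using F by (auto simp: represents_def)
  have "iso_classes_map F = iso_classes_map (fid A)"
  proof (rule iso_classes_map_eqI)
    fix a assume "a \<in> Obj (fdom F)"
    then have a: "a \<in> Obj (psrc (hom_prof A))" "a \<in> Obj A" using d by simp_all
    show "isomorphic (fcod F) (fob F a) (fob (fid A) a)"
      using represents_universal_element[OF profunctor_hom_prof[OF A] F a(1)] universal_element_hom_prof[OF A a(2)]
        universal_element_isomorphic[OF profunctor_hom_prof[OF A]] d a by auto
  qed (use d functor_fid[OF A] in auto)
  then show ?thesis by (simp add: iso_classes_map_fid[OF A])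
qed

text \<open>This is the composition law, with \<tau> a comparison cell. Universal elements of \<Phi>
  at \<open>a\<close> and of \<Psi> at \<open>fob F a\<close> combine to one of the composite, and
  \<tau> moves it to \<open>X\<close>, where \<open>K\<close> provides another one at
  \<open>a\<close>. Hence \<open>K\<close> and the composite of \<open>F\<close> and
  \<open>G\<close> agree up to isomorphism at every object.\<close>

lemma iso_classes_map_represents_prof_comp:
  assumes c: "composable_profs \<Psi> \<Phi>" and F: "represents F \<Phi>" and G: "represents G \<Psi>" and K: "represents K X"
    and g: "globular Cat (prof_comp \<Psi> \<Phi>) X \<tau>" and i: "is_iso prof_cat \<tau>"
  shows "iso_classes_map K = Cmp set_cat (iso_classes_map G) (iso_classes_map F)"
proof -
  have P: "profunctor \<Phi>" "profunctor \<Psi>" "psrc \<Psi> = ptgt \<Phi>" using c by (auto simp: composable_profs_def)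
  note PC = profunctor_prof_comp[OF c]
  have d: "cat_functor F" "fdom F = psrc \<Phi>" "fcod F = ptgt \<Phi>" "cat_functor G" "fdom G = psrc \<Psi>" "fcod G = ptgt \<Psi>"
    "cat_functor K" "fdom K = psrc X" "fcod K = ptgt X"
    using F G K by (auto simp: represents_def)
  have t: "\<tau> \<in> Hom prof_cat (prof_comp \<Psi> \<Phi>) X" using g by (simp add: globular_def)
  note T = cell_HomD[OF t]
  have s: "csrc \<tau> = fid (psrc (prof_comp \<Psi> \<Phi>))" "ctgt \<tau> = fid (ptgt (prof_comp \<Psi> \<Phi>))"
    using g T(1) PC by (auto simp: globular_def)
  have X: "profunctor X" "psrc X = psrc \<Phi>" "ptgt X = ptgt \<Psi>" using cellD[OF T(1)] csrc_ctgt_Hom[OF t] s T by (auto simp: Hom_def)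
  have "iso_classes_map K = iso_classes_map (fcmp G F)"
  proof (rule iso_classes_map_eqI)
    fix a assume "a \<in> Obj (fdom K)"
    then have a: "a \<in> Obj (psrc \<Phi>)" "a \<in> Obj (psrc X)" "fob F a \<in> Obj (psrc \<Psi>)"
      using d X P cat_functor.fob_Obj[OF d(1), of a] by auto
    obtain e e' where "universal_element \<Phi> a (fob F a) e" "universal_element \<Psi> (fob F a) (fob G (fob F a)) e'"
      using represents_universal_element[OF P(1) F a(1)] represents_universal_element[OF P(2) G a(3)] by blast
    from universal_element_iso[OF t s i universal_element_prof_comp[OF c this]]
    have "\<exists>e. universal_element X a (fob G (fob F a)) e" by blast
    then show "isomorphic (fcod K) (fob K a) (fob (fcmp G F) a)"
      using represents_universal_element[OF X(1) K a(2)] universal_element_isomorphic[OF X(1)] d a by auto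
  qed (use d P X functor_fcmp[OF d(1,4)] in auto)
  then show ?thesis using iso_classes_map_fcmp[OF d(1,4)] d P by simp
qed


section \<open>Functors to double categories of squares\<close>

text \<open>The category of commutative squares is the arrow category of \<open>S\<close>, where
  products are computed separately on domains and on codomains.\<close>

lemma is_product_square_cat:
  assumes S: "category S" and f: "f \<in> Arr S"
    and \<pi>: "\<And>i. i \<in> I \<Longrightarrow> \<pi> i \<in> Hom (square_cat S (commutative_square S)) f (X i)"
    and top: "is_product S I (\<lambda>i. Dom S (X i)) (Dom S f) (\<lambda>i. Top (\<pi> i))"
    and bot: "is_product S I (\<lambda>i. Cod S (X i)) (Cod S f) (\<lambda>i. Bottom (\<pi> i))"
  shows "is_product (square_cat S (commutative_square S)) I X f \<pi>"
proof -
  interpret S: category S by fact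
  interpret Q: square_class S "commutative_square S" by (rule square_class_commutative[OF S])
  note T = is_productD[OF top] and B = is_productD[OF bot]
  have fH: "f \<in> Hom S (Dom S f) (Cod S f)" using f by (simp add: Hom_def)
  have p: "commutative_square S (\<pi> i)" "Left (\<pi> i) = f" "Right (\<pi> i) = X i" if "i \<in> I" for i
    using \<pi>[OF that] by (auto simp: Hom_def)
  show ?thesis
  proof (rule is_productI)
    show "X i \<in> Obj (square_cat S (commutative_square S))" if "i \<in> I" for i
      using commutative_squareD(2)[OF p(1)[OF that]] p(3)[OF that] by simp
  next
    fix g q assume "g \<in> Obj (square_cat S (commutative_square S))"
      and q: "\<And>i. i \<in> I \<Longrightarrow> q i \<in> Hom (square_cat S (commutative_square S)) g (X i)"
    then have g: "g \<in> Arr S" and gH: "g \<in> Hom S (Dom S g) (Cod S g)" by (auto simp: Hom_def)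
    have q': "commutative_square S (q i)" "Left (q i) = g" "Right (q i) = X i" if "i \<in> I" for i
      using q[OF that] by (auto simp: Hom_def)
    have "Top (q i) \<in> Hom S (Dom S g) (Dom S (X i))" "Bottom (q i) \<in> Hom S (Cod S g) (Cod S (X i))" if "i \<in> I" for i
      using commutative_squareD(3,4)[OF q'(1)[OF that]] q'[OF that] by simp_all
    then obtain u v where u: "u \<in> Hom S (Dom S g) (Dom S f)" "\<And>i. i \<in> I \<Longrightarrow> Cmp S (Top (\<pi> i)) u = Top (q i)"
      and v: "v \<in> Hom S (Cod S g) (Cod S f)" "\<And>i. i \<in> I \<Longrightarrow> Cmp S (Bottom (\<pi> i)) v = Bottom (q i)"
      using T(4)[OF S.Dom_Obj[OF g], of "\<lambda>i. Top (q i)"] B(4)[OF S.Cod_Obj[OF g], of "\<lambda>i. Bottom (q i)"] by blast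
    \<comment> \<open>The two induced arrows form a square with \<open>f\<close> and
      \<open>g\<close>: both composites end in the product of the codomains, so they may be compared
      after each projection.\<close>
    have "Cmp S f u = Cmp S v g"
    proof (rule B(5)[OF S.Dom_Obj[OF g] _ S.Cmp_Hom[OF u(1) fH] S.Cmp_Hom[OF gH v(1)]])
      fix i assume i: "i \<in> I"
      show "Cmp S (Bottom (\<pi> i)) (Cmp S f u) \<in> Hom S (Dom S g) (Cod S (X i))"
        by (rule S.Cmp_Hom[OF S.Cmp_Hom[OF u(1) fH] B(3)[OF i]])
      have X: "X i \<in> Hom S (Dom S (X i)) (Cod S (X i))" using commutative_squareD(6)[OF p(1)[OF i]] p(3)[OF i] by simp
      show "Cmp S (Bottom (\<pi> i)) (Cmp S f u) = Cmp S (Bottom (\<pi> i)) (Cmp S v g)"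
        using S.Cmp_assoc[OF u(1) fH B(3)[OF i]] S.Cmp_assoc[OF u(1) T(3)[OF i] X] S.Cmp_assoc[OF gH v(1) B(3)[OF i]]
          commutative_squareD(7)[OF p(1)[OF i]] commutative_squareD(7)[OF q'(1)[OF i]] p[OF i] q'[OF i] u(2)[OF i] v(2)[OF i]
        by simp
    qed
    then have w: "\<lparr>Left = g, Right = f, Top = u, Bottom = v\<rparr> \<in> Hom (square_cat S (commutative_square S)) g f"
      using f g u(1) v(1) by (simp add: Hom_def commutative_square_def)
    have "Cmp (square_cat S (commutative_square S)) (\<pi> i) \<lparr>Left = g, Right = f, Top = u, Bottom = v\<rparr> = q i" if "i \<in> I" for i
      using u(2)[OF that] v(2)[OF that] p[OF that] q'[OF that] by (cases "q i") simp
    with w show "\<exists>u. u \<in> Hom (square_cat S (commutative_square S)) g f \<and>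
        (\<forall>i\<in>I. Cmp (square_cat S (commutative_square S)) (\<pi> i) u = q i)" by blast
  next
    fix g u v assume uv: "u \<in> Hom (square_cat S (commutative_square S)) g f" "v \<in> Hom (square_cat S (commutative_square S)) g f"
      and e: "\<And>i. i \<in> I \<Longrightarrow> Cmp (square_cat S (commutative_square S)) (\<pi> i) u = Cmp (square_cat S (commutative_square S)) (\<pi> i) v"
    have c: "commutative_square S u" "commutative_square S v" and d: "Left u = g" "Right u = f" "Left v = g" "Right v = f"
      using uv by (auto simp: Hom_def)
    note U = commutative_squareD[OF c(1), unfolded d] and V = commutative_squareD[OF c(2), unfolded d]
    have "Top u = Top v"
      by (rule T(5)[OF S.Dom_Obj[OF U(1)] S.Cmp_Hom[OF U(3) T(3)] U(3) V(3)]) (use e in simp_all)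
    moreover have "Bottom u = Bottom v"
      by (rule B(5)[OF S.Cod_Obj[OF U(1)] S.Cmp_Hom[OF U(4) B(3)] U(4) V(4)]) (use e in simp_all)
    ultimately show "u = v" using d by (cases u; cases v) simp
  qed (use f \<pi> in auto)
qed

text \<open>Both double categories of squares are strict and a square is determined by its four
  sides. With identity comparison cells, naturality and coherence therefore reduce to equalities
  between sides, all of which follow from functoriality of \<open>H\<close> and strict preservation
  of vertical composites and identities.\<close>

lemma strict_functor_to_Sq:
  assumes C: "category C" and S: "category S"
    and H: "cat_functor H" "fdom H = op_cat C" "fcod H = S"
    and V: "cat_functor V" "fdom V = op_cat (square_cat C (pullback_square C))" "fcod V = square_cat S (commutative_square S)"
    and Dom_V: "\<And>f. f \<in> Arr C \<Longrightarrow> Dom S (fob V f) = fob H (Dom C f)"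
    and Cod_V: "\<And>f. f \<in> Arr C \<Longrightarrow> Cod S (fob V f) = fob H (Cod C f)"
    and Top_V: "\<And>q. pullback_square C q \<Longrightarrow> Top (far V q) = far H (Top q)"
    and Bottom_V: "\<And>q. pullback_square C q \<Longrightarrow> Bottom (far V q) = far H (Bottom q)"
    and V_Ide: "\<And>a. a \<in> Obj C \<Longrightarrow> fob V (Ide C a) = Ide S (fob H a)"
    and V_Cmp: "\<And>f g. f \<in> Arr C \<Longrightarrow> g \<in> Arr C \<Longrightarrow> Dom C g = Cod C f \<Longrightarrow> fob V (Cmp C g f) = Cmp S (fob V g) (fob V f)"
  shows "lax_double_functor (op_dbl (Pb C)) (Sq S) \<lparr>hfun = H, vfun = V,
     lcmp = (\<lambda>g f. Ide (square_cat S (commutative_square S)) (fob V (Cmp C g f))),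
     luni = (\<lambda>a. Ide (square_cat S (commutative_square S)) (fob V (Ide C a)))\<rparr>"
proof -
  let ?p = "pullback_square C" and ?c = "commutative_square S"
  interpret P: square_class C ?p by (rule square_class_pullback[OF C])
  interpret Q: square_class S ?c by (rule square_class_commutative[OF S])
  interpret D: double_category "square_dbl C ?p" by (rule P.double_category_square_dbl)
  interpret E: double_category "square_dbl S ?c" by (rule Q.double_category_square_dbl)
  interpret SC: category "square_cat C ?p" by (rule P.category_square_cat)
  interpret SS: category "square_cat S ?c" by (rule Q.category_square_cat)
  interpret H: cat_functor H by fact
  interpret V: cat_functor V by fact
  have VA: "fob V f \<in> Arr S" if "f \<in> Arr C" for f using V.fob_Obj[of f] that V by simp
  \<comment> \<open>The horizontal opposite exchanges the left and right sides of a square but keeps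
    the vertical direction.\<close>
  have VQ: "?c (far V q)" "Left (far V q) = fob V (Right q)" "Right (far V q) = fob V (Left q)" if "?p q" for q
    using V.far_Hom[of q "Right q" "Left q"] that V by (auto simp: Hom_def)
  have HA: "far H h \<in> Hom S (fob H (Cod C h)) (fob H (Dom C h))" if "h \<in> Arr C" for h
    using H.far_Hom[of h "Cod C h" "Dom C h"] that H by (simp add: Hom_def)
  have HO: "fob H a \<in> Obj S" if "a \<in> Obj C" for a using H.fob_Obj[of a] that H by simp
  have VCmp: "composable (square_dbl S ?c) (fob V g) (fob V f)" "vcmp (square_dbl S ?c) (fob V g) (fob V f) = fob V (Cmp C g f)"
    "Cmp C g f \<in> Arr C" if "f \<in> Arr C" "g \<in> Arr C" "Dom C g = Cod C f" for f g
    using that VA V_Cmp Dom_V Cod_V P.Cmp_Arr[of f g] by simp_all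
  have Ide2: "vcmp2 (square_dbl S ?c) (Ide (square_cat S ?c) (fob V g)) (Ide (square_cat S ?c) (fob V f)) = Ide (square_cat S ?c) (fob V (Cmp C g f))"
    if "f \<in> Arr C" "g \<in> Arr C" "Dom C g = Cod C f" for f g
    using Q.vcmp2_Ide[OF VCmp(1)[OF that]] V_Cmp[OF that] by (simp del: Q.sq_cat_simps(5))
  have Ide_unit: "Cmp (square_cat S ?c) (Ide (square_cat S ?c) f) (Ide (square_cat S ?c) f) = Ide (square_cat S ?c) f" if "f \<in> Arr S" for f
    using SS.Cmp_Ide_left[OF SS.Ide_Hom, of f] that by (simp del: Q.sq_cat_simps(5,6))
  \<comment> \<open>The structure cells of the opposite double category are inverses of those of
    \<open>Pb C\<close>, which are identities.\<close>
  have inv_Ide: "inverse_arrow (square_cat C ?p) (Ide (square_cat C ?p) f) = Ide (square_cat C ?p) f" if "f \<in> Arr C" for f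
    using SC.Ide_iso[of f] that by (simp del: P.sq_cat_simps(5))
  have far_V_Ide: "far V (Ide (square_cat C ?p) f) = Ide (square_cat S ?c) (fob V f)" if "f \<in> Arr C" for f
    using V.far_Ide[of f] that V by (simp del: P.sq_cat_simps(5) Q.sq_cat_simps(5))
  note D_simps = D.op_dbl_simps D.composable_op D.composable2_op
  note ids = P.sq_cat_simps(5) Q.sq_cat_simps(5)
  show ?thesis
    unfolding Pb_def Sq_def
  proof (rule lax_double_functor.intro[OF D.double_category_op E.double_category_axioms], rule lax_double_functor_axioms.intro,
      unfold lax.simps D_simps)
    show "fcmp (Src (square_dbl S ?c)) V = fcmp H (fop (Src (square_dbl C ?p)))"
      by (rule ftor_eqI) (simp_all add: H V VA VQ Q.functor_Src_DD P.functor_Src_DD Dom_V Top_V functor_fcmp functor_fop)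
    show "fcmp (Tgt (square_dbl S ?c)) V = fcmp H (fop (Tgt (square_dbl C ?p)))"
      by (rule ftor_eqI) (simp_all add: H V VA VQ Q.functor_Tgt_DD P.functor_Tgt_DD Cod_V Bottom_V functor_fcmp functor_fop)
  next
    fix g f assume "composable (square_dbl C ?p) g f"
    then have c: "f \<in> Arr C" "g \<in> Arr C" "Dom C g = Cod C f" by simp_all
    show "globular (square_dbl S ?c) (vcmp (square_dbl S ?c) (fob V g) (fob V f)) (fob V (fob (fop (Vcmp (square_dbl C ?p))) (g, f)))
       (Ide (square_cat S ?c) (fob V (Cmp C g f)))"
      using c VCmp[OF c] Q.sq_globular_Ide VA by (simp del: ids)
  next
    fix \<beta> \<alpha> g g' f f' assume "composable2 (square_dbl C ?p) \<beta> \<alpha>"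
      and h: "\<beta> \<in> Hom (op_cat (Vc (square_dbl C ?p))) g g'" "\<alpha> \<in> Hom (op_cat (Vc (square_dbl C ?p))) f f'"
    then have k: "?p \<alpha>" "?p \<beta>" "Top \<beta> = Bottom \<alpha>" and lr: "Right \<beta> = g" "Left \<beta> = g'" "Right \<alpha> = f" "Left \<alpha> = f'"
      by (auto simp: Hom_def)
    \<comment> \<open>The vertical pasting of \<alpha> above \<beta>, written with the sides as they
      are named in the opposite category.\<close>
    let ?\<gamma> = "\<lparr>Left = Cmp C g' f', Right = Cmp C g f, Top = Top \<alpha>, Bottom = Bottom \<beta>\<rparr>"
    have \<gamma>: "?p ?\<gamma>" using P.Q_vcomp[OF k(1,2)] k(3) lr by simp
    have d: "f \<in> Arr C" "g \<in> Arr C" "Dom C g = Cod C f" "f' \<in> Arr C" "g' \<in> Arr C" "Dom C g' = Cod C f'"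
      using P.Q_D[OF k(1)] P.Q_D[OF k(2)] k(3) lr by metis+
    have "composable2 (square_dbl S ?c) (far V \<beta>) (far V \<alpha>)"
      using VQ[OF k(1)] VQ[OF k(2)] Top_V[OF k(2)] Bottom_V[OF k(1)] k(3) by simp
    then have "vcmp2 (square_dbl S ?c) (far V \<beta>) (far V \<alpha>) = far V ?\<gamma>"
      using VQ[OF k(1)] VQ[OF k(2)] VQ[OF \<gamma>] Top_V[OF k(1)] Bottom_V[OF k(2)] Top_V[OF \<gamma>] Bottom_V[OF \<gamma>] lr
        V_Cmp[OF d(1-3)] V_Cmp[OF d(4-6)] by (cases "far V ?\<gamma>") simp
    moreover have "vcmp2 (square_dbl C ?p) \<beta> \<alpha> = ?\<gamma>" using k lr by simp
    ultimately show "Cmp (Vc (square_dbl S ?c)) (Ide (square_cat S ?c) (fob V (Cmp C g' f'))) (vcmp2 (square_dbl S ?c) (far V \<beta>) (far V \<alpha>)) =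
      Cmp (Vc (square_dbl S ?c)) (far V (far (fop (Vcmp (square_dbl C ?p))) (\<beta>, \<alpha>))) (Ide (square_cat S ?c) (fob V (Cmp C g f)))"
      using Q.sq_Ide_unit[OF VQ(1)[OF \<gamma>]] VQ[OF \<gamma>] by (simp del: ids Q.sq_cat_simps(6))
  next
    fix a assume "a \<in> Obj (op_cat (Hc (square_dbl C ?p)))"
    then have a: "a \<in> Obj C" by simp
    show "globular (square_dbl S ?c) (fob (Uni (square_dbl S ?c)) (fob H a)) (fob V (fob (fop (Uni (square_dbl C ?p))) a))
       (Ide (square_cat S ?c) (fob V (Ide C a)))"
      using a HO[OF a] V_Ide[OF a] Q.Ide_Arr[OF HO[OF a]] Q.sq_globular_Ide[of "Ide S (fob H a)"] by (simp del: ids)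
  next
    fix h a b assume "h \<in> Hom (op_cat (Hc (square_dbl C ?p))) a b"
    then have h: "h \<in> Arr C" "Dom C h = b" "Cod C h = a" "a \<in> Obj C" "b \<in> Obj C" by (auto simp: Hom_def P.Dom_Obj P.Cod_Obj)
    let ?h = "\<lparr>Left = Ide C b, Right = Ide C a, Top = h, Bottom = h\<rparr>"
    have q: "?p ?h" using P.Q_vid[OF h(1)] h by simp
    have "far H h \<in> Hom S (fob H a) (fob H b)" using HA[OF h(1)] h by simp
    note hh = HomD[OF this]
    have "far (Uni (square_dbl S ?c)) (far H h) = far V ?h"
      using hh VQ[OF q] Top_V[OF q] Bottom_V[OF q] V_Ide h by (cases "far V ?h") simp
    then show "Cmp (Vc (square_dbl S ?c)) (Ide (square_cat S ?c) (fob V (Ide C b))) (far (Uni (square_dbl S ?c)) (far H h)) =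
      Cmp (Vc (square_dbl S ?c)) (far V (far (fop (Uni (square_dbl C ?p))) h)) (Ide (square_cat S ?c) (fob V (Ide C a)))"
      using Q.sq_Ide_unit[OF VQ(1)[OF q]] VQ[OF q] h by (simp del: ids Q.sq_cat_simps(6))
  next
    fix h g f assume "composable (square_dbl C ?p) h g" "composable (square_dbl C ?p) g f"
    then have c: "f \<in> Arr C" "g \<in> Arr C" "h \<in> Arr C" "Dom C g = Cod C f" "Dom C h = Cod C g" by simp_all
    have k: "Cmp C g f \<in> Arr C" "Dom C (Cmp C g f) = Dom C f" "Cod C (Cmp C g f) = Cod C g" 
       "Cmp C h g \<in> Arr C" "Dom C (Cmp C h g) = Dom C g" "Cod C (Cmp C h g) = Cod C h" "Cmp C h (Cmp C g f) \<in> Arr C"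
       "Cmp C (Cmp C h g) f = Cmp C h (Cmp C g f)"
      using P.Cmp_Arr[of f g] P.Cmp_Arr[of g h] P.Cmp_Arr[of "Cmp C g f" h] P.assoc_Arr[of f g h] c by auto
    have VV: "Cmp S (fob V h) (Cmp S (fob V g) (fob V f)) = fob V (Cmp C h (Cmp C g f))"
      using V_Cmp k c by simp
    show "Cmp (Vc (square_dbl S ?c)) (far V (inverse_arrow (Vc (square_dbl C ?p)) (Asc (square_dbl C ?p) h g f)))
        (Cmp (Vc (square_dbl S ?c)) (Ide (square_cat S ?c) (fob V (Cmp C (fob (fop (Vcmp (square_dbl C ?p))) (h, g)) f)))
          (vcmp2 (square_dbl S ?c) (Ide (square_cat S ?c) (fob V (Cmp C h g))) (Ide (Vc (square_dbl S ?c)) (fob V f)))) =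
      Cmp (Vc (square_dbl S ?c)) (Ide (square_cat S ?c) (fob V (Cmp C h (fob (fop (Vcmp (square_dbl C ?p))) (g, f)))))
        (Cmp (Vc (square_dbl S ?c)) (vcmp2 (square_dbl S ?c) (Ide (Vc (square_dbl S ?c)) (fob V h)) (Ide (square_cat S ?c) (fob V (Cmp C g f))))
          (Asc (square_dbl S ?c) (fob V h) (fob V g) (fob V f)))"
      using c k by (simp add: inv_Ide far_V_Ide Ide2 VA Ide_unit VV del: ids Q.sq_cat_simps(6))
  next
    fix f assume "f \<in> Obj (op_cat (Vc (square_dbl C ?p)))"
    then have f: "f \<in> Arr C" "Dom C f \<in> Obj C" "Cod C f \<in> Obj C" by (simp_all add: P.Dom_Obj P.Cod_Obj)
    note i = P.Ide_Arr[OF f(2)] P.Ide_Arr[OF f(3)]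
    show "Cmp (Vc (square_dbl S ?c)) (far V (inverse_arrow (Vc (square_dbl C ?p)) (Lun (square_dbl C ?p) f)))
        (Cmp (Vc (square_dbl S ?c)) (Ide (square_cat S ?c) (fob V (Cmp C (fob (fop (Uni (square_dbl C ?p))) (fob (fop (Tgt (square_dbl C ?p))) f)) f)))
          (vcmp2 (square_dbl S ?c) (Ide (square_cat S ?c) (fob V (Ide C (fob (fop (Tgt (square_dbl C ?p))) f)))) (Ide (Vc (square_dbl S ?c)) (fob V f)))) =
      Lun (square_dbl S ?c) (fob V f)"
      using f i by (simp add: inv_Ide far_V_Ide Ide2 VA Ide_unit P.unit_Arr del: ids Q.sq_cat_simps(6))
    show "Cmp (Vc (square_dbl S ?c)) (far V (inverse_arrow (Vc (square_dbl C ?p)) (Run (square_dbl C ?p) f)))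
        (Cmp (Vc (square_dbl S ?c)) (Ide (square_cat S ?c) (fob V (Cmp C f (fob (fop (Uni (square_dbl C ?p))) (fob (fop (Src (square_dbl C ?p))) f)))))
          (vcmp2 (square_dbl S ?c) (Ide (Vc (square_dbl S ?c)) (fob V f)) (Ide (square_cat S ?c) (fob V (Ide C (fob (fop (Src (square_dbl C ?p))) f)))))) =
      Run (square_dbl S ?c) (fob V f)"
      using f i by (simp add: inv_Ide far_V_Ide Ide2 VA Ide_unit P.unit_Arr del: ids Q.sq_cat_simps(6))
  qed (simp_all add: H V)
qed

section \<open>The DF monoid of isomorphism classes\<close>

theorem proposition8:
  fixes C :: "('o, 'a) cat" and M :: "('o, 'a, 'u::infinite) cat_lax"
  assumes "extensive C" and "has_pullbacks C"
    and "DF_monoidal_category TYPE('i) C M"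
    and "invertible_comparisons (op_dbl (Pb C)) Cat M"
  shows "\<exists>N :: ('o, 'a, 'u set set, 'u set sarr) sq_lax.
    DF_monoid TYPE('i) C set_cat N \<and>
    (\<forall>I \<in> Obj C. fob (hfun N) I = iso_classes (fob (hfun M) I)) \<and>
    (\<forall>f \<in> Arr C. far (hfun N) f = iso_classes_map (far (hfun M) f)) \<and>
    (\<forall>f \<in> Arr C. \<forall>F. represents F (fob (vfun M) f) \<longrightarrow> fob (vfun N) f = iso_classes_map F)"
proof -
  let ?p = "pullback_square C" and ?S = "set_cat :: ('u set set, 'u set sarr) cat"
  let ?c = "commutative_square ?S"
  have C: "category C" using assms(1) by (simp add: extensive_def)
  interpret P: square_class C ?p by (rule square_class_pullback[OF C])
  interpret Q: square_class ?S ?c by (rule square_class_commutative[OF category_set_cat])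
  interpret D: double_category "square_dbl C ?p" by (rule P.double_category_square_dbl)
  have M: "lax_double_functor (op_dbl (Pb C)) Cat M" and normal: "normal_lax (op_dbl (Pb C)) Cat M"
    and prods: "preserves_products TYPE('i) (hfun M)" "preserves_products TYPE('i) (vfun M)"
    and rep: "\<And>f. f \<in> Arr C \<Longrightarrow> \<exists>F. represents F (fob (vfun M) f)"
    using assms(3) by (auto simp: DF_monoidal_category_def DF_operad_def product_preserving_def)
  have BC: "naturally_isomorphic (fcmp F (far (hfun M) (Top q))) (fcmp (far (hfun M) (Bottom q)) G)"
    if "?p q" "represents F (fob (vfun M) (Left q))" "represents G (fob (vfun M) (Right q))" for q F G
    using assms(3) that by (cases q) (simp add: DF_monoidal_category_def)
  interpret M: lax_double_functor "op_dbl (Pb C)" Cat M by (rule M)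
  note Pb_simps = Pb_def D.op_dbl_simps D.composable_op D.composable2_op
  have h: "cat_functor (hfun M)" "fdom (hfun M) = op_cat C" "fcod (hfun M) = cat_cat"
    using M.hfun_functor by (simp_all add: Pb_simps)
  have v: "cat_functor (vfun M)" "fdom (vfun M) = op_cat (square_cat C ?p)" "fcod (vfun M) = prof_cat"
    using M.vfun_functor by (simp_all add: Pb_simps)
  interpret h: cat_functor "hfun M" by (rule h)
  interpret v: cat_functor "vfun M" by (rule v)
  let ?h = "far (hfun M)" and ?M = "fob (hfun M)" and ?\<Phi> = "fob (vfun M)"
  have hA: "?h f \<in> Hom cat_cat (?M (Cod C f)) (?M (Dom C f))" if "f \<in> Arr C" for f
    using h.far_Hom[of f "Cod C f" "Dom C f"] that h by (simp add: Hom_def)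
  have hO: "category (?M a)" if "a \<in> Obj C" for a using h.fob_Obj[of a] that h by simp
  have \<Phi>: "profunctor (?\<Phi> f)" if "f \<in> Arr C" for f using v.fob_Obj[of f] that v by simp
  have vA: "far (vfun M) q \<in> Hom prof_cat (?\<Phi> (Right q)) (?\<Phi> (Left q))" if "?p q" for q :: "'a square"
    using v.far_Hom[of q "Right q" "Left q"] that v by (simp add: Hom_def)
  have src: "psrc (?\<Phi> f) = ?M (Dom C f)" "ptgt (?\<Phi> f) = ?M (Cod C f)" if "f \<in> Arr C" for f
    using arg_cong[OF M.Src_vfun, of "\<lambda>F. fob F f"] arg_cong[OF M.Tgt_vfun, of "\<lambda>F. fob F f"] that \<Phi>[OF that] v
    by (simp_all add: Pb_simps)
  have csrc: "csrc (far (vfun M) q) = ?h (Top q)" "ctgt (far (vfun M) q) = ?h (Bottom q)" if "?p q" for q :: "'a square"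
    using arg_cong[OF M.Src_vfun, of "\<lambda>F. far F q"] arg_cong[OF M.Tgt_vfun, of "\<lambda>F. far F q"] that cell_HomD(1)[OF vA[OF that]] v
    by (simp_all add: Pb_simps)
  \<comment> \<open>A representing functor is unique only up to isomorphism; the next fact shows
    that the map of classes does not depend on the one selected.\<close>
  define V where "V f = iso_classes_map (SOME F. represents F (?\<Phi> f))" for f
  have V: "V f = iso_classes_map F" if "f \<in> Arr C" "represents F (?\<Phi> f)" for f F
    unfolding V_def by (rule iso_classes_map_represents_eq[OF \<Phi>[OF that(1)] someI that(2)]) (rule that(2))
  have V_Hom: "V f \<in> Hom ?S (iso_classes (?M (Dom C f))) (iso_classes (?M (Cod C f)))" if f: "f \<in> Arr C" for f
  proof -
    obtain F where F: "represents F (?\<Phi> f)" using rep[OF f] by blast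
    then show ?thesis using iso_classes_map_Hom[of F] V[OF f F] src[OF f] by (simp add: represents_def)
  qed
  define Vq where "Vq q = \<lparr>Left = V (Right q), Right = V (Left q), Top = iso_classes_map (?h (Top q)), Bottom = iso_classes_map (?h (Bottom q))\<rparr>" for q :: "'a square"
  have Vq: "?c (Vq q)" if q: "?p q" for q :: "'a square"
  proof -
    note d = P.Q_D[OF q]
    obtain F G where F: "represents F (?\<Phi> (Left q))" and G: "represents G (?\<Phi> (Right q))"
      using rep[OF d(1)] rep[OF d(2)] by blast
    note VF = V[OF d(1) F] and VG = V[OF d(2) G]
    have F': "cat_functor F" "fdom F = ?M (Dom C (Left q))" "fcod F = ?M (Cod C (Left q))"
      and G': "cat_functor G" "fdom G = ?M (Dom C (Right q))" "fcod G = ?M (Cod C (Right q))"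
      using F G src[OF d(1)] src[OF d(2)] by (auto simp: represents_def)
    have t: "cat_functor (?h (Top q))" "fdom (?h (Top q)) = ?M (Dom C (Right q))" "fcod (?h (Top q)) = ?M (Dom C (Left q))"
      and b: "cat_functor (?h (Bottom q))" "fdom (?h (Bottom q)) = ?M (Cod C (Right q))" "fcod (?h (Bottom q)) = ?M (Cod C (Left q))"
      using hA[OF d(3)] hA[OF d(4)] d(5-8) by (auto simp: Hom_def)
    from BC[OF q F G] obtain \<tau> where n: "nat_trans (fcmp F (?h (Top q))) (fcmp (?h (Bottom q)) G) \<tau>"
      and i: "\<And>a. a \<in> Obj (fdom (fcmp F (?h (Top q)))) \<Longrightarrow> is_iso (fcod (fcmp F (?h (Top q)))) (\<tau> a)"
      unfolding naturally_isomorphic_def by blast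
    \<comment> \<open>Of the Beck-Chevalley isomorphism only its components are retained.\<close>
    have "iso_classes_map (fcmp F (?h (Top q))) = iso_classes_map (fcmp (?h (Bottom q)) G)"
    proof (rule iso_classes_map_eqI)
      fix a assume a: "a \<in> Obj (fdom (fcmp F (?h (Top q))))"
      then show "isomorphic (fcod (fcmp F (?h (Top q)))) (fob (fcmp F (?h (Top q))) a) (fob (fcmp (?h (Bottom q)) G) a)"
        using n i[OF a] unfolding nat_trans_def isomorphic_def by blast
    qed (use n in \<open>auto simp: nat_trans_def\<close>)
    then have "Cmp ?S (V (Left q)) (iso_classes_map (?h (Top q))) = Cmp ?S (iso_classes_map (?h (Bottom q))) (V (Right q))"
      using iso_classes_map_fcmp[OF t(1) F'(1)] iso_classes_map_fcmp[OF G'(1) b(1)] F' G' t b by (simp add: VF VG)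
    then show ?thesis
      using V_Hom[OF d(1)] V_Hom[OF d(2)] iso_classes_map_Hom[OF t(1)] iso_classes_map_Hom[OF b(1)] t b
      unfolding commutative_square_def Vq_def by (auto simp: Hom_set_cat)
  qed
  define H where "H = fcmp iso_classes_ftor (hfun M)"
  \<comment> \<open>The restrictions provide the extensionality that \<open>cat_functor\<close>
    demands outside the domain.\<close>
  define W where "W = \<lparr>fdom = op_cat (square_cat C ?p), fcod = square_cat ?S ?c, fob = restrict V (Arr C), far = restrict Vq {q. ?p q}\<rparr>"
  have H: "cat_functor H" "fdom H = op_cat C" "fcod H = ?S"
    using functor_fcmp[OF h(1) functor_iso_classes] h by (simp_all add: H_def)
  have H_fob: "fob H a = iso_classes (?M a)" if "a \<in> Obj C" for a using that h hO by (simp add: H_def)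
  have H_far: "far H f = iso_classes_map (?h f)" if "f \<in> Arr C" for f using that h hA[OF that] by (simp add: H_def Hom_def)
  have W_simps: "fdom W = op_cat (square_cat C ?p)" "fcod W = square_cat ?S ?c" "f \<in> Arr C \<Longrightarrow> fob W f = V f" "?p q \<Longrightarrow> far W q = Vq q" for f q
    by (simp_all add: W_def)
  have hCmp: "iso_classes_map (?h (Cmp C g f)) = Cmp ?S (iso_classes_map (?h f)) (iso_classes_map (?h g))"
    if "f \<in> Arr C" "g \<in> Arr C" "Cod C f = Dom C g" for f g
    using cat_functor.far_Cmp[OF H(1), of g "Cod C g" "Dom C g" f "Dom C f"] that H P.Cmp_Arr[of f g] by (simp add: Hom_def H_far)
  have hIde: "iso_classes_map (?h (Ide C a)) = Ide ?S (iso_classes (?M a))" if "a \<in> Obj C" for a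
    using cat_functor.far_Ide[OF H(1), of a] that H P.Ide_Arr[OF that] by (simp add: H_far H_fob)
  have W: "cat_functor W"
  proof (rule cat_functor.intro)
    show "category (fdom W)" "category (fcod W)"
      by (simp_all add: W_def category_op_cat P.category_square_cat Q.category_square_cat)
    show "fob W \<in> Obj (fdom W) \<rightarrow>\<^sub>E Obj (fcod W)" using HomD(1)[OF V_Hom] by (auto simp: W_def simp del: set_cat_simps(4))
    show "far W \<in> extensional (Arr (fdom W))" by (simp add: W_def)
  next
    fix q f g assume "q \<in> Hom (fdom W) f g"
    then have q: "?p q" "Right q = f" "Left q = g" by (auto simp: W_def Hom_def)
    then show "far W q \<in> Hom (fcod W) (fob W f) (fob W g)"
      using Vq[OF q(1)] P.Q_D[OF q(1)] by (simp add: W_simps Hom_def Vq_def)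
  next
    fix f assume "f \<in> Obj (fdom W)"
    then have f: "f \<in> Arr C" by (simp add: W_simps)
    have "?p (Ide (square_cat C ?p) f)" using P.Q_hid[OF f] by simp
    then show "far W (Ide (fdom W) f) = Ide (fcod W) (fob W f)"
      using f V_Hom[OF f] P.Dom_Obj[OF f] P.Cod_Obj[OF f] by (simp add: W_simps Vq_def hIde Hom_def)
  next
    fix q r f g k assume "q \<in> Hom (fdom W) f g" "r \<in> Hom (fdom W) g k"
    then have q: "?p q" "?p r" "Left q = Right r" by (auto simp: W_simps Hom_def)
    have "?p (Cmp (square_cat C ?p) q r)" using P.Q_hcomp[OF q(2,1)] q(3) by simp
    then show "far W (Cmp (fdom W) r q) = Cmp (fcod W) (far W r) (far W q)"
      using q P.Q_D[OF q(1)] P.Q_D[OF q(2)] by (simp add: W_simps Vq_def hCmp)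
  qed
  have V_Ide: "V (Ide C a) = Ide ?S (iso_classes (?M a))" if a: "a \<in> Obj C" for a
  proof -
    have A: "Ide C a \<in> Arr C" using P.Ide_Arr[OF a] by simp
    obtain F where F: "represents F (?\<Phi> (Ide C a))" using rep[OF A] by blast
    have "?\<Phi> (Ide C a) = hom_prof (?M a)" using normal a hO[OF a] by (simp add: normal_lax_def Pb_simps)
    then show ?thesis using V[OF A F] iso_classes_map_represents_hom_prof[OF hO[OF a], of F] F by simp
  qed
  have V_Cmp: "V (Cmp C g f) = Cmp ?S (V g) (V f)" if f: "f \<in> Arr C" "g \<in> Arr C" "Dom C g = Cod C f" for f g
  proof -
    have gf: "Cmp C g f \<in> Arr C" using P.Cmp_Arr[of f g] f by simp
    obtain F G K where r: "represents F (?\<Phi> f)" "represents G (?\<Phi> g)" "represents K (?\<Phi> (Cmp C g f))"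
      using rep[OF f(1)] rep[OF f(2)] rep[OF gf] by blast
    have c: "composable_profs (?\<Phi> g) (?\<Phi> f)" using \<Phi> f src by (simp add: composable_profs_def)
    have k: "composable (op_dbl (Pb C)) g f" using f by (simp add: Pb_simps)
    have g: "globular Cat (prof_comp (?\<Phi> g) (?\<Phi> f)) (?\<Phi> (Cmp C g f)) (lcmp M g f)"
      using M.lcmp_globular[OF k] c f by (simp add: Pb_simps)
    have "is_iso prof_cat (lcmp M g f)" using assms(4) k by (simp add: invertible_comparisons_def)
    from iso_classes_map_represents_prof_comp[OF c r g this] show ?thesis using V f gf r by simp
  qed
  let ?N = "\<lparr>hfun = H, vfun = W, lcmp = (\<lambda>g f. Ide (square_cat ?S ?c) (fob W (Cmp C g f))),
     luni = (\<lambda>a. Ide (square_cat ?S ?c) (fob W (Ide C a)))\<rparr>"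
  have "lax_double_functor (op_dbl (Pb C)) (Sq ?S) ?N"
  proof (rule strict_functor_to_Sq[OF C category_set_cat H W W_simps(1,2)])
    fix f assume f: "f \<in> Arr C"
    show "Dom ?S (fob W f) = fob H (Dom C f)" "Cod ?S (fob W f) = fob H (Cod C f)"
      using V_Hom[OF f] f P.Dom_Obj[OF f] P.Cod_Obj[OF f] by (simp_all add: W_simps H_fob Hom_def)
  next
    fix q assume q: "?p q"
    show "Top (far W q) = far H (Top q)" "Bottom (far W q) = far H (Bottom q)"
      using q P.Q_D[OF q] by (simp_all add: W_simps Vq_def H_far)
  next
    fix a assume a: "a \<in> Obj C"
    then show "fob W (Ide C a) = Ide ?S (fob H a)" using P.Ide_Arr[OF a] by (simp add: W_simps H_fob V_Ide)
  next
    fix f g assume f: "f \<in> Arr C" "g \<in> Arr C" "Dom C g = Cod C f"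
    then show "fob W (Cmp C g f) = Cmp ?S (fob W g) (fob W f)" using P.Cmp_Arr[of f g] V_Cmp[OF f] by (simp add: W_simps)
  qed
  moreover have "preserves_products TYPE('i) H"
    unfolding preserves_products_def
  proof (intro allI impI)
    fix I :: "'i set" and X P \<pi> assume p: "is_product (fdom H) I X P \<pi>"
    \<comment> \<open>A product in the opposite of \<open>C\<close> is a sum in \<open>C\<close>.
      \<open>M\<close> already turns it into a product of categories, and it remains to pass to
      classes.\<close>
    have "is_product (fdom (hfun M)) I X P \<pi>" using p h H by simp
    then have "is_product cat_cat I (\<lambda>i. ?M (X i)) (?M P) (\<lambda>i. ?h (\<pi> i))"
      using prods(1) h(3) unfolding preserves_products_def by metis
    from product_iso_classes[OF this]
    show "is_product (fcod H) I (\<lambda>i. fob H (X i)) (fob H P) (\<lambda>i. far H (\<pi> i))"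
      unfolding H(3) by (rule is_product_cong) (use is_productD(1-3)[OF p] H in \<open>simp_all add: H_fob H_far Hom_def\<close>)
  qed
  moreover have "preserves_products TYPE('i) W"
    unfolding preserves_products_def
  proof (intro allI impI)
    fix I :: "'i set" and X P \<pi> assume p: "is_product (fdom W) I X P \<pi>"
    have PA: "P \<in> Arr C" and XA: "\<And>i. i \<in> I \<Longrightarrow> X i \<in> Arr C"
      and \<pi>: "\<And>i. i \<in> I \<Longrightarrow> ?p (\<pi> i) \<and> Left (\<pi> i) = X i \<and> Right (\<pi> i) = P"
      using is_productD(1-3)[OF p] by (auto simp: W_simps Hom_def)
    have "is_product (fdom (vfun M)) I X P \<pi>" using p v by (simp add: W_simps)
    then have "is_product prof_cat I (\<lambda>i. ?\<Phi> (X i)) (?\<Phi> P) (\<lambda>i. far (vfun M) (\<pi> i))"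
      using prods(2) v(3) unfolding preserves_products_def by metis
    \<comment> \<open>Of the product of profunctors only its sources and targets are kept. The maps
      of classes induced by the representing functors need no comparison with the product: a product
      of arrows of sets is decided on domains and codomains.\<close>
    note st = product_psrc_ptgt[OF this, THEN product_iso_classes]
    have d: "sdom (V f) = iso_classes (?M (Dom C f))" "scod (V f) = iso_classes (?M (Cod C f))" if "f \<in> Arr C" for f
      using V_Hom[OF that] by (simp_all add: Hom_set_cat)
    show "is_product (fcod W) I (\<lambda>i. fob W (X i)) (fob W P) (\<lambda>i. far W (\<pi> i))"
      unfolding W_simps(2)
    proof (rule is_product_square_cat[OF category_set_cat])
      show "fob W P \<in> Arr ?S" using HomD(1)[OF V_Hom[OF PA]] PA by (simp add: W_simps del: set_cat_simps(4))
      show "far W (\<pi> i) \<in> Hom (square_cat ?S ?c) (fob W P) (fob W (X i))" if "i \<in> I" for i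
        using \<pi>[OF that] Vq[of "\<pi> i"] PA XA[OF that] by (simp add: W_simps Hom_def Vq_def)
      show "is_product ?S I (\<lambda>i. Dom ?S (fob W (X i))) (Dom ?S (fob W P)) (\<lambda>i. Top (far W (\<pi> i)))"
        by (rule is_product_cong[OF st(1)]) (use \<pi> XA PA d src csrc in \<open>simp_all add: W_simps Vq_def\<close>)
      show "is_product ?S I (\<lambda>i. Cod ?S (fob W (X i))) (Cod ?S (fob W P)) (\<lambda>i. Bottom (far W (\<pi> i)))"
        by (rule is_product_cong[OF st(2)]) (use \<pi> XA PA d src csrc in \<open>simp_all add: W_simps Vq_def\<close>)
    qed
  qed
  ultimately have "DF_monoid TYPE('i) C ?S ?N" by (simp add: DF_monoid_def product_preserving_def)
  moreover have "\<forall>f \<in> Arr C. \<forall>F. represents F (?\<Phi> f) \<longrightarrow> fob (vfun ?N) f = iso_classes_map F"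
    using V by (simp add: W_simps)
  ultimately show ?thesis using H_fob H_far by (intro exI[of _ ?N]) simp
qed

end
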